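(* Let $z_1<\dots<z_p$ be real numbers, $p\ge2$, and $\alpha_1,\dots,\alpha_p,\gamma$ complex numbers with positive real parts. Then, with the rows and columns indexed by $\mathcal Z_n^{p-1}$ in the same order, $$\det\Big[\int_{\mathbb U_{\mathbf l}}\Phi(t,z)\,\omega_{\mathbf m}(t,z)\Big]_{\mathbf l,\mathbf m\in\mathcal Z_n^{p-1}} =\prod_{s=0}^{n-1}\Big[\frac{\Gamma((s+1)\gamma)^{p-1}}{\Gamma(\gamma)^{p-1}}\frac{\Gamma(1+\alpha_p+s\gamma)\prod_{j=1}^{p-1}\Gamma(\alpha_j+s\gamma)}{\Gamma(1+\sum_{j=1}^p\alpha_j+(2n-2-s)\gamma)}\Big]^{\binom{p+n-s-3}{p-2}}$$ $$\times\exp\Big(i\pi\binom{p+n-2}{p-1}\sum_{s=1}^p(s-1)\alpha_s\Big)\prod_{1\le a<b\le p}(z_b-z_a)^{(\alpha_a+\alpha_b)\binom{p+n-2}{p-1}+2\gamma\binom{p+n-2}{p}}.$$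
   Context: For $t\in\mathbb R^n$, $$\Phi(t,z)=\prod_{s=1}^p\prod_{i=1}^n(t_i-z_s)^{\alpha_s}\prod_{1\le i<j\le n}(t_j-t_i)^{2\gamma},$$ where every power $x^{\alpha_s}$ and $x^{2\gamma}$ uses the branch with $-\pi/2<\arg x<3\pi/2$. $\mathcal Z_n^p=\{\mathbf l=(l_1,\dots,l_p)\in\mathbb Z^p: l_i\ge0,\ l_1+\dots+l_p=n\}$. Set $\mathbf l^s=l_1+\dots+l_s$ and $\mathbf l^0=0$, and $\Gamma_{\mathbf m,s}=\{\mathbf m^{s-1}+1,\dots,\mathbf m^s\}$. For $\mathbf m\in\mathcal Z_n^p$, $$\omega_{\mathbf m}=\Big(\sum_{\sigma\in S_n}\prod_{s=1}^p\frac{1}{m_s!}\prod_{j\in\Gamma_{\mathbf m,s}}\frac{1}{t_{\sigma_j}-z_s}\Big)dt_1\wedge\dots\wedge dt_n,$$ and $\mathbf m\in\mathcal Z_n^{p-1}$ is identified with $(\mathbf m,0)\in\mathcal Z_n^p$. For $\mathbf l\in\mathcal Z_n^{p-1}$, $$\mathbb U_{\mathbf l}=\{t\in\mathbb R^n: z_s\le t_{\mathbf l^{s-1}+1}\le\dots\le t_{\mathbf l^s}\le z_{s+1}\text{ for }s=1,\dots,p-1\},$$ with the standard orientation of $\mathbb R^n$. *)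

theory Defs
  imports "HOL-Analysis.Analysis"
begin

text \<open>Branch of the logarithm with argument in the open interval (-pi/2, 3pi/2).\<close>
definition br_log :: "complex \<Rightarrow> complex" where
  "br_log x = (if Im (Ln x) \<le> - pi / 2 then Ln x + 2 * pi * \<i> else Ln x)"

text \<open>Power x^a using that branch (value at x = 0 irrelevant; set to 0).\<close>
definition br_pow :: "complex \<Rightarrow> complex \<Rightarrow> complex" where
  "br_pow x a = (if x = 0 then 0 else exp (a * br_log x))"

definition Zset :: "nat \<Rightarrow> nat \<Rightarrow> (nat \<Rightarrow> nat) set" where
  "Zset n k = {l. (\<forall>i. i \<notin> {1..k} \<longrightarrow> l i = 0) \<and> (\<Sum>i=1..k. l i) = n}"

definition psum :: "(nat \<Rightarrow> nat) \<Rightarrow> nat \<Rightarrow> nat" where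
  "psum l s = (\<Sum>i=1..s. l i)"

definition Gam :: "(nat \<Rightarrow> nat) \<Rightarrow> nat \<Rightarrow> nat set" where
  "Gam m s = {psum m (s - 1) + 1 .. psum m s}"

definition Phi :: "nat \<Rightarrow> nat \<Rightarrow> (nat \<Rightarrow> real) \<Rightarrow> (nat \<Rightarrow> complex) \<Rightarrow> complex
    \<Rightarrow> (nat \<Rightarrow> real) \<Rightarrow> complex" where
  "Phi n p z \<alpha> \<gamma> t =
     (\<Prod>s=1..p. \<Prod>i=1..n. br_pow (complex_of_real (t i - z s)) (\<alpha> s)) *
     (\<Prod>i=1..n. \<Prod>j\<in>{i<..n}. br_pow (complex_of_real (t j - t i)) (2 * \<gamma>))"

text \<open>Coefficient of omega_m with respect to dt_1 \<and> ... \<and> dt_n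
  (m in Z_n^{p-1} is identified with (m,0) in Z_n^p).\<close>
definition omega :: "nat \<Rightarrow> nat \<Rightarrow> (nat \<Rightarrow> real) \<Rightarrow> (nat \<Rightarrow> nat) \<Rightarrow> (nat \<Rightarrow> real) \<Rightarrow> complex" where
  "omega n p z m t =
     (\<Sum>\<sigma> | \<sigma> permutes {1..n}.
        \<Prod>s=1..p. (1 / of_nat (fact (m s))) *
          (\<Prod>j\<in>Gam m s. 1 / complex_of_real (t (\<sigma> j) - z s)))"

definition Uset :: "nat \<Rightarrow> nat \<Rightarrow> (nat \<Rightarrow> real) \<Rightarrow> (nat \<Rightarrow> nat) \<Rightarrow> (nat \<Rightarrow> real) set" where
  "Uset n p z l = {t. \<forall>s\<in>{1..p-1}.
      (\<forall>j\<in>Gam l s. z s \<le> t j \<and> t j \<le> z (s + 1)) \<and>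
      (\<forall>j\<in>{psum l (s - 1) + 1 ..< psum l s}. t j \<le> t (j + 1))}"

abbreviation Rn :: "nat \<Rightarrow> (nat \<Rightarrow> real) measure" where
  "Rn n \<equiv> PiM {1..n} (\<lambda>_. lborel)"

text \<open>Determinant of a square matrix indexed by a finite set S (Leibniz formula);
  independent of the chosen ordering of S.\<close>
definition det_on :: "'i set \<Rightarrow> ('i \<Rightarrow> 'i \<Rightarrow> 'a::comm_ring_1) \<Rightarrow> 'a" where
  "det_on S M = (\<Sum>\<pi> | \<pi> permutes S. of_int (sign \<pi>) * (\<Prod>i\<in>S. M i (\<pi> i)))"

end

theory Submission
  imports Defs "HOL-Real_Asymp.Real_Asymp"
begin

text \<open>On \<open>Uset l\<close> the phase of \<open>Phi\<close> is constant, so each row reduces to an integral of the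
  positive-type weight \<open>Psi\<close> built from the powers of absolute values. Put \<open>c\<^sub>s = z\<^sub>p - z\<^sub>s\<close>,
  \<open>f\<^sub>s = 1 / (t - z\<^sub>s)\<close>, \<open>g\<^sub>s = c\<^sub>s f\<^sub>s\<close> and \<open>h\<^sub>s = (z\<^sub>p - t) f\<^sub>s = g\<^sub>s - 1\<close>. Replacing \<open>\<alpha>\<^sub>p\<close> by
  \<open>\<alpha>\<^sub>p + 1\<close> replaces symmetric products of the \<open>f\<^sub>s\<close> by symmetric products of the \<open>h\<^sub>s\<close>. With
  \<open>u\<^sub>s = g\<^sub>s - g\<^sub>1 = h\<^sub>s - h\<^sub>1\<close>, the products of \<open>h\<^sub>1\<close> and the \<open>u\<^sub>s\<close> are expressed through products of
  \<open>g\<^sub>1\<close> and the \<open>u\<^sub>s\<close> by the integration by parts that comes from differentiating \<open>(t\<^sub>i - z\<^sub>p) Psi\<close>,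
  and the transition matrix is triangular in the number of factors with index 1. This gives the
  determinant for \<open>\<alpha>\<^sub>p + 1\<close> as an explicit multiple of the determinant for \<open>\<alpha>\<^sub>p\<close>.

  Iterating \<open>K\<close> times and letting \<open>K\<close> tend to infinity, the substitution \<open>t\<^sub>i = z\<^sub>s + c\<^sub>s y\<^sub>i / K\<close>
  makes the rescaled matrix converge to a diagonal one, whose entries are products of
  Laguerre--Selberg integrals \<open>Laguerre\<close>. For two points this expresses Selberg's integral
  \<open>Selberg n a b\<close> through \<open>Laguerre n a\<close>; its symmetry in \<open>a\<close> and \<open>b\<close> determines the dependence of
  \<open>Laguerre n a\<close> on \<open>a\<close>, and the translation \<open>y\<^sub>i = y\<^sub>1 + w\<^sub>i\<close> yields
  \<open>Laguerre n 1 = Laguerre (n - 1) (1 + 2 \<gamma>) / n\<close>, which fixes the constant by induction on \<open>n\<close>.\<close>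

section \<open>Determinants indexed by a finite set\<close>

lemma det_on_cong:
  assumes "\<And>i j. i \<in> S \<Longrightarrow> j \<in> S \<Longrightarrow> M i j = N i j"
  shows "det_on S M = det_on S N"
  unfolding det_on_def
  by (intro sum.cong refl arg_cong2[where f="(*)"] prod.cong assms) (auto simp: permutes_in_image)

lemma det_on_scale:
  "det_on S (\<lambda>i j. r i * M i j * c j) = (\<Prod>i\<in>S. r i) * (\<Prod>i\<in>S. c i) * det_on S M"
proof -
  have "(\<Prod>i\<in>S. c (\<pi> i)) = (\<Prod>i\<in>S. c i)" if "\<pi> permutes S" for \<pi>
    using prod.permute[OF that, of c] by (simp add: o_def)
  then show ?thesis unfolding det_on_def
    by (simp add: prod.distrib sum_distrib_left mult_ac)
qed

lemma det_on_permute_rows: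
  assumes "finite S" "\<tau> permutes S"
  shows "det_on S (\<lambda>i j. M (\<tau> i) j) = of_int (sign \<tau>) * det_on S M"
proof -
  have "det_on S (\<lambda>i j. M (\<tau> i) j)
      = (\<Sum>\<pi> | \<pi> permutes S. of_int (sign (\<pi> \<circ> \<tau>)) * (\<Prod>i\<in>S. M (\<tau> i) ((\<pi> \<circ> \<tau>) i)))"
    unfolding det_on_def by (rule sum_permutations_compose_right[OF assms(2)])
  also have "\<dots> = (\<Sum>\<pi> | \<pi> permutes S. of_int (sign \<tau>) * (of_int (sign \<pi>) * (\<Prod>i\<in>S. M i (\<pi> i))))"
  proof (intro sum.cong refl)
    fix \<pi> assume "\<pi> \<in> {\<pi>. \<pi> permutes S}"
    then have \<pi>: "\<pi> permutes S" by simp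
    have "(\<Prod>i\<in>S. M (\<tau> i) ((\<pi> \<circ> \<tau>) i)) = (\<Prod>i\<in>S. M i (\<pi> i))"
      using prod.permute[OF assms(2), of "\<lambda>i. M i (\<pi> i)"] by (simp add: o_def)
    moreover have "sign (\<pi> \<circ> \<tau>) = sign \<pi> * sign \<tau>"
      using assms \<pi> by (intro sign_compose permutes_imp_permutation) auto
    ultimately show "of_int (sign (\<pi> \<circ> \<tau>)) * (\<Prod>i\<in>S. M (\<tau> i) ((\<pi> \<circ> \<tau>) i))
        = of_int (sign \<tau>) * (of_int (sign \<pi>) * (\<Prod>i\<in>S. M i (\<pi> i)))" by simp
  qed
  finally show ?thesis by (simp add: det_on_def sum_distrib_left)
qed

lemma det_on_equal_rows:
  fixes M :: "'i \<Rightarrow> 'i \<Rightarrow> 'a :: {idom, ring_char_0}"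
  assumes "finite S" "a \<in> S" "b \<in> S" "a \<noteq> b" "\<And>j. j \<in> S \<Longrightarrow> M a j = M b j"
  shows "det_on S M = 0"
proof -
  let ?\<tau> = "Transposition.transpose a b"
  have \<tau>: "?\<tau> permutes S" using assms by (simp add: permutes_swap_id)
  have "det_on S M = det_on S (\<lambda>i j. M (?\<tau> i) j)"
    by (rule det_on_cong) (auto simp: Transposition.transpose_def assms(5))
  also have "\<dots> = - det_on S M"
    using det_on_permute_rows[OF assms(1) \<tau>, of M] assms(4) by (simp add: sign_swap_id)
  finally have "det_on S M + det_on S M = 0" by (simp only: eq_neg_iff_add_eq_0)
  then have "2 * det_on S M = 0" by (simp only: mult_2)
  then show ?thesis by simp
qed

lemma sum_inj_PiE_eq_sum_permutes:
  assumes S: "finite S"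
  shows "(\<Sum>f | f \<in> S \<rightarrow>\<^sub>E S \<and> inj_on f S. F (restrict_id f S)) = (\<Sum>\<pi> | \<pi> permutes S. F \<pi>)"
proof (rule sum.reindex_bij_witness[where i="\<lambda>\<pi>. restrict \<pi> S" and j="\<lambda>f. restrict_id f S"])
  fix f assume f: "f \<in> {f. f \<in> S \<rightarrow>\<^sub>E S \<and> inj_on f S}"
  show "restrict (restrict_id f S) S = f"
    using f by (auto simp: PiE_def extensional_def fun_eq_iff)
  have "bij_betw f S S" using f endo_inj_surj[OF S, of f] by (auto simp: bij_betw_def)
  then show "restrict_id f S \<in> {\<pi>. \<pi> permutes S}" by (simp add: permutes_restrict_id)
next
  fix \<pi> assume "\<pi> \<in> {\<pi>. \<pi> permutes S}"
  then have \<pi>: "\<pi> permutes S" by simp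
  show "restrict_id (restrict \<pi> S) S = \<pi>" using \<pi> by (auto simp: fun_eq_iff restrict_id_def permutes_def)
  show "restrict \<pi> S \<in> {f. f \<in> S \<rightarrow>\<^sub>E S \<and> inj_on f S}"
    using \<pi> by (auto simp: permutes_in_image permutes_inj_on inj_on_restrict_eq)
qed simp

lemma det_on_mult:
  fixes A B :: "'i \<Rightarrow> 'i \<Rightarrow> 'a :: {idom, ring_char_0}"
  assumes S: "finite S"
  shows "det_on S (\<lambda>i j. \<Sum>k\<in>S. A i k * B k j) = det_on S A * det_on S B"
proof -
  let ?term = "\<lambda>f. (\<Prod>i\<in>S. A i (f i)) * det_on S (\<lambda>i j. B (f i) j)"
  have "det_on S (\<lambda>i j. \<Sum>k\<in>S. A i k * B k j)
     = (\<Sum>\<pi> | \<pi> permutes S. of_int (sign \<pi>) * (\<Sum>f\<in>S \<rightarrow>\<^sub>E S. \<Prod>i\<in>S. A i (f i) * B (f i) (\<pi> i)))"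
    unfolding det_on_def by (simp add: prod_sum_PiE[OF S] S)
  also have "\<dots> = (\<Sum>f\<in>S \<rightarrow>\<^sub>E S. ?term f)"
    unfolding det_on_def sum_distrib_left by (subst sum.swap) (simp add: prod.distrib mult_ac)
  also have "\<dots> = (\<Sum>f | f \<in> S \<rightarrow>\<^sub>E S \<and> inj_on f S. ?term f)"
  proof (rule sum.mono_neutral_right)
    show "finite (S \<rightarrow>\<^sub>E S)" using S by (simp add: finite_PiE)
    show "\<forall>f\<in>(S \<rightarrow>\<^sub>E S) - {f. f \<in> S \<rightarrow>\<^sub>E S \<and> inj_on f S}. ?term f = 0"
    proof
      fix f assume "f \<in> (S \<rightarrow>\<^sub>E S) - {f. f \<in> S \<rightarrow>\<^sub>E S \<and> inj_on f S}"
      then obtain a b where "a \<in> S" "b \<in> S" "a \<noteq> b" "f a = f b" by (auto simp: inj_on_def)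
      then have "det_on S (\<lambda>i j. B (f i) j) = 0"
        by (intro det_on_equal_rows[OF S, of a b]) auto
      then show "?term f = 0" by simp
    qed
  qed auto
  also have "\<dots> = (\<Sum>f | f \<in> S \<rightarrow>\<^sub>E S \<and> inj_on f S. ?term (restrict_id f S))"
    by (intro sum.cong refl arg_cong2[where f="(*)"] prod.cong det_on_cong) auto
  also have "\<dots> = (\<Sum>\<pi> | \<pi> permutes S. ?term \<pi>)" by (rule sum_inj_PiE_eq_sum_permutes[OF S])
  also have "\<dots> = (\<Sum>\<pi> | \<pi> permutes S. (\<Prod>i\<in>S. A i (\<pi> i)) * (of_int (sign \<pi>) * det_on S B))"
    by (intro sum.cong refl) (simp add: det_on_permute_rows[OF S])
  also have "\<dots> = det_on S A * det_on S B"
    by (simp add: det_on_def[of S A] sum_distrib_left mult_ac)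
  finally show ?thesis .
qed

lemma det_on_triangular:
  fixes rank :: "'i \<Rightarrow> nat"
  assumes S: "finite S"
    and upper: "\<And>i j. i \<in> S \<Longrightarrow> j \<in> S \<Longrightarrow> i \<noteq> j \<Longrightarrow> \<not> rank i < rank j \<Longrightarrow> M i j = 0"
  shows "det_on S M = (\<Prod>i\<in>S. M i i)"
proof -
  have "(\<Prod>i\<in>S. M i (\<pi> i)) = 0" if \<pi>: "\<pi> permutes S" and "\<pi> \<noteq> id" for \<pi>
  proof (rule ccontr)
    assume "(\<Prod>i\<in>S. M i (\<pi> i)) \<noteq> 0"
    then have nonzero: "M i (\<pi> i) \<noteq> 0" if "i \<in> S" for i
      using prod_zero[OF S, of "\<lambda>i. M i (\<pi> i)"] that by metis
    have rank_less: "rank i < rank (\<pi> i)" if "i \<in> S" "\<pi> i \<noteq> i" for i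
      using upper[of i "\<pi> i"] nonzero[OF that(1)] that \<pi> by (auto simp: permutes_in_image)
    obtain a where a: "\<pi> a \<noteq> a" using \<open>\<pi> \<noteq> id\<close> by (auto simp: fun_eq_iff)
    then have "a \<in> S" using \<pi> by (meson permutes_not_in)
    then have "(\<Sum>i\<in>S. rank i) < (\<Sum>i\<in>S. rank (\<pi> i))"
      using S rank_less[OF _ a] rank_less
      by (intro sum_strict_mono_ex1) (auto, metis le_less)
    moreover have "(\<Sum>i\<in>S. rank (\<pi> i)) = (\<Sum>i\<in>S. rank i)"
      using sum.permute[OF \<pi>, of rank] by (simp add: o_def)
    ultimately show False by simp
  qed
  then have "det_on S M = (\<Sum>\<pi>\<in>{id}. of_int (sign \<pi>) * (\<Prod>i\<in>S. M i (\<pi> i)))"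
    unfolding det_on_def
    by (intro sum.mono_neutral_right) (auto simp: S permutes_id finite_permutations)
  then show ?thesis by (simp add: sign_id)
qed

lemma tendsto_det_on:
  fixes M :: "'k \<Rightarrow> 'i \<Rightarrow> 'i \<Rightarrow> 'a :: real_normed_field"
  assumes "\<And>i j. i \<in> S \<Longrightarrow> j \<in> S \<Longrightarrow> ((\<lambda>k. M k i j) \<longlongrightarrow> N i j) F"
  shows "((\<lambda>k. det_on S (M k)) \<longlongrightarrow> det_on S N) F"
  unfolding det_on_def
  by (intro tendsto_sum tendsto_mult_left tendsto_prod assms) (auto simp: permutes_in_image)

definition in_linspan :: "('m \<Rightarrow> 'r \<Rightarrow> 'a :: comm_ring_1) \<Rightarrow> 'm set \<Rightarrow> ('r \<Rightarrow> 'a) \<Rightarrow> bool" where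
  "in_linspan w S v \<longleftrightarrow> (\<exists>c. \<forall>l. v l = (\<Sum>m\<in>S. c m * w m l))"

lemma in_linspan_zero: "in_linspan w S (\<lambda>l. 0)"
  unfolding in_linspan_def by (rule exI[of _ "\<lambda>_. 0"]) simp

lemma in_linspan_add:
  assumes "in_linspan w S u" "in_linspan w S v"
  shows "in_linspan w S (\<lambda>l. u l + v l)"
proof -
  obtain c d where "\<And>l. u l = (\<Sum>m\<in>S. c m * w m l)" "\<And>l. v l = (\<Sum>m\<in>S. d m * w m l)"
    using assms by (auto simp: in_linspan_def)
  then show ?thesis
    unfolding in_linspan_def
    by (intro exI[of _ "\<lambda>m. c m + d m"]) (simp add: sum.distrib distrib_right)
qed

lemma in_linspan_scale:
  assumes "in_linspan w S u"
  shows "in_linspan w S (\<lambda>l. a * u l)"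
proof -
  obtain c where "\<And>l. u l = (\<Sum>m\<in>S. c m * w m l)" using assms by (auto simp: in_linspan_def)
  then show ?thesis
    unfolding in_linspan_def
    by (intro exI[of _ "\<lambda>m. a * c m"]) (simp add: sum_distrib_left mult.assoc)
qed

lemma in_linspan_diff: "in_linspan w S u \<Longrightarrow> in_linspan w S v \<Longrightarrow> in_linspan w S (\<lambda>l. u l - v l)"
  using in_linspan_add[of w S u "\<lambda>l. (-1) * v l"] in_linspan_scale[of w S v "-1"] by simp

lemma in_linspan_base: "finite S \<Longrightarrow> m \<in> S \<Longrightarrow> in_linspan w S (w m)"
  unfolding in_linspan_def
  by (rule exI[of _ "\<lambda>m'. if m' = m then 1 else 0"])
     (simp add: if_distrib[of "\<lambda>x. x * _"] cong: if_cong)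

lemma in_linspan_mono:
  assumes "finite S'" "S \<subseteq> S'" "in_linspan w S u"
  shows "in_linspan w S' u"
proof -
  from assms(3) obtain c where c: "\<And>l. u l = (\<Sum>m\<in>S. c m * w m l)" by (auto simp: in_linspan_def)
  have "u l = (\<Sum>m\<in>S'. (if m \<in> S then c m else 0) * w m l)" for l
    unfolding c using assms(1,2) by (intro sum.mono_neutral_cong_left) auto
  then show ?thesis by (auto simp: in_linspan_def)
qed

lemma in_linspan_sum:
  "(\<And>i. i \<in> I \<Longrightarrow> in_linspan w S (v i)) \<Longrightarrow> in_linspan w S (\<lambda>l. \<Sum>i\<in>I. v i l)"
  by (induction I rule: infinite_finite_induct) (auto intro: in_linspan_zero in_linspan_add)

lemma in_linspan_sum_mset:
  "(\<And>i. i \<in># I \<Longrightarrow> in_linspan w S (v i)) \<Longrightarrow> in_linspan w S (\<lambda>l. \<Sum>i\<in>#I. v i l)"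
  by (induction I) (auto intro: in_linspan_zero in_linspan_add)

lemma in_linspan_comp: "in_linspan w S v \<Longrightarrow> in_linspan (\<lambda>m l. w m (f l)) S (\<lambda>l. v (f l))"
  unfolding in_linspan_def by blast

lemma det_on_triangular_transition:
  fixes rank :: "'i \<Rightarrow> nat" and v v' :: "'i \<Rightarrow> 'i \<Rightarrow> 'a :: {idom, ring_char_0}"
  assumes S: "finite S"
    and transition:
      "\<And>m. m \<in> S \<Longrightarrow> in_linspan v {m'\<in>S. rank m' < rank m} (\<lambda>l. v' m l - d m * v m l)"
  shows "det_on S (\<lambda>l m. v' m l) = (\<Prod>m\<in>S. d m) * det_on S (\<lambda>l m. v m l)"
proof -
  have "\<forall>m\<in>S. \<exists>c. \<forall>l. v' m l - d m * v m l = (\<Sum>m'\<in>{m'\<in>S. rank m' < rank m}. c m' * v m' l)"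
    using transition unfolding in_linspan_def by blast
  from bchoice[OF this] obtain c where c:
    "\<And>m l. m \<in> S \<Longrightarrow> v' m l - d m * v m l = (\<Sum>m'\<in>{m'\<in>S. rank m' < rank m}. c m m' * v m' l)"
    by blast
  define T where "T m' m = (if m' = m then d m else if rank m' < rank m then c m m' else 0)" for m' m
  have "v' m l = (\<Sum>m'\<in>S. v m' l * T m' m)" if "m \<in> S" for m l
  proof -
    have "(\<Sum>m'\<in>S. v m' l * T m' m) = v m l * T m m + (\<Sum>m'\<in>S - {m}. v m' l * T m' m)"
      using S that by (simp add: sum.remove)
    also have "(\<Sum>m'\<in>S - {m}. v m' l * T m' m) = (\<Sum>m'\<in>{m'\<in>S. rank m' < rank m}. c m m' * v m' l)"
      using S by (intro sum.mono_neutral_cong_right) (auto simp: T_def)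
    finally show ?thesis using c[OF that, of l] by (simp add: T_def algebra_simps)
  qed
  then have "det_on S (\<lambda>l m. v' m l) = det_on S (\<lambda>l m. \<Sum>m'\<in>S. v m' l * T m' m)"
    by (intro det_on_cong) auto
  also have "\<dots> = det_on S (\<lambda>l m. v m l) * det_on S T"
    using det_on_mult[OF S, of "\<lambda>l m. v m l" T] by simp
  also have "det_on S T = (\<Prod>m\<in>S. T m m)"
    using S by (rule det_on_triangular[where rank=rank]) (auto simp: T_def)
  finally show ?thesis by (simp add: T_def)
qed

lemma prod_fact_card_fibres_insert:
  assumes S: "finite S" "a \<notin> S" and V: "finite V" "f a \<in> V"
  shows "(\<Prod>v\<in>V. fact (card {x\<in>insert a S. f x = v}))
    = card {x\<in>insert a S. f x = f a} * (\<Prod>v\<in>V. fact (card {x\<in>S. f x = v}) :: nat)"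
proof -
  have "{x\<in>insert a S. f x = v} = {x\<in>S. f x = v}" if "v \<noteq> f a" for v using that by auto
  then have "(\<Prod>v\<in>V - {f a}. fact (card {x\<in>insert a S. f x = v}))
      = (\<Prod>v\<in>V - {f a}. fact (card {x\<in>S. f x = v}) :: nat)"
    by (intro prod.cong refl arg_cong[where f=fact] arg_cong[where f=card]) auto
  moreover have "{x\<in>insert a S. f x = f a} = insert a {x\<in>S. f x = f a}" by auto
  then have "fact (card {x\<in>insert a S. f x = f a})
      = card {x\<in>insert a S. f x = f a} * (fact (card {x\<in>S. f x = f a}) :: nat)"
    using S by simp
  ultimately show ?thesis
    using V by (simp add: prod.remove[of _ "f a"] mult.assoc del: insert_iff)
qed

lemma card_permutes_preserving:
  fixes f :: "'a \<Rightarrow> 'b"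
  assumes "finite A" "finite V" "f ` A \<subseteq> V"
  shows "card {\<sigma>. \<sigma> permutes A \<and> (\<forall>x\<in>A. f (\<sigma> x) = f x)} = (\<Prod>v\<in>V. fact (card {x\<in>A. f x = v}))"
  using assms(1,3)
proof (induction A rule: finite_induct)
  case empty
  have "{\<sigma>. \<sigma> permutes {} \<and> (\<forall>x\<in>{}. f (\<sigma> x) = f x)} = {id}" by auto
  then show ?case by simp
next
  case (insert a S)
  let ?pres = "\<lambda>A \<sigma>. \<forall>x\<in>A. f (\<sigma> x) = f x"
  let ?fibre = "{b \<in> insert a S. f b = f a}"
  have preserves: "?pres (insert a S) (Transposition.transpose a b \<circ> q) \<longleftrightarrow> f b = f a \<and> ?pres S q"
    if "b \<in> insert a S" "q permutes S" for b q
  proof -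
    have "q a = a" using that(2) insert.hyps(2) by (simp add: permutes_not_in)
    moreover have "q x \<noteq> a" if "x \<in> S" for x
      using permutes_in_image[OF \<open>q permutes S\<close>, of x] that insert.hyps(2) by auto
    ultimately show ?thesis by (auto simp: Transposition.transpose_def)
  qed
  have "card {\<sigma>. \<sigma> permutes insert a S \<and> ?pres (insert a S) \<sigma>}
      = (\<Sum>\<sigma> | \<sigma> permutes insert a S. of_bool (?pres (insert a S) \<sigma>))"
    using insert.hyps by (simp add: finite_permutations Int_def)
  also have "\<dots> = (\<Sum>b\<in>insert a S. \<Sum>q | q permutes S. of_bool (f b = f a) * of_bool (?pres S q))"
    unfolding sum_over_permutations_insert[OF insert.hyps]
    by (intro sum.cong refl, subst preserves) (auto simp: of_bool_conj)
  also have "\<dots> = card ?fibre * card {q. q permutes S \<and> ?pres S q}"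
    using insert.hyps unfolding sum_product[symmetric]
    by (simp add: finite_permutations Int_def del: sum.insert)
  also have "\<dots> = card ?fibre * (\<Prod>v\<in>V. fact (card {x\<in>S. f x = v}))"
    using insert by simp
  also have "\<dots> = (\<Prod>v\<in>V. fact (card {x\<in>insert a S. f x = v}))"
    using prod_fact_card_fibres_insert[OF insert.hyps assms(2), of f] insert.prems by simp
  finally show ?case .
qed

section \<open>Compositions\<close>

lemma Zset_le: "m \<in> Zset n q \<Longrightarrow> s \<in> {1..q} \<Longrightarrow> m s \<le> n"
  unfolding Zset_def using member_le_sum[of s "{1..q}" m] by auto

lemma Zset_eq_0: "m \<in> Zset n q \<Longrightarrow> s \<notin> {1..q} \<Longrightarrow> m s = 0"
  unfolding Zset_def by blast

lemma finite_Zset [simp]: "finite (Zset n q)"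
proof -
  have "Zset n q \<subseteq> {f. \<forall>x. (x \<in> {1..q} \<longrightarrow> f x \<in> {..n}) \<and> (x \<notin> {1..q} \<longrightarrow> f x = 0)}"
    using Zset_le by (auto simp: Zset_def)
  then show ?thesis
    using finite_set_of_finite_funs[of "{1..q}" "{..n}" "0::nat"]
    by (meson finite_subset finite_atLeastAtMost finite_atMost)
qed

lemma Zset_0: "Zset 0 q = {\<lambda>_. 0}"
proof -
  have "m = (\<lambda>_. 0)" if "m \<in> Zset 0 q" for m
    using Zset_le[OF that] Zset_eq_0[OF that] by (metis ext le_zero_eq)
  moreover have "(\<lambda>_. 0) \<in> Zset 0 q" by (simp add: Zset_def)
  ultimately show ?thesis by blast
qed

lemma Zset_Suc_0: "Zset (Suc n) 0 = {}"
  by (auto simp: Zset_def)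

lemma Zset_1: "Zset n 1 = {\<lambda>s. if s = 1 then n else 0}"
proof -
  have "m = (\<lambda>s. if s = 1 then n else 0)" if "m \<in> Zset n 1" for m
    using that by (auto simp: Zset_def fun_eq_iff)
  moreover have "(\<lambda>s. if s = 1 then n else 0) \<in> Zset n 1" by (simp add: Zset_def)
  ultimately show ?thesis by blast
qed

lemma bij_betw_Zset_greater:
  assumes s: "s \<in> {1..q}" and i: "i < n"
  shows "bij_betw (\<lambda>m. m(s := m s + Suc i)) (Zset (n - 1 - i) q) {m \<in> Zset n q. i < m s}"
proof (rule bij_betw_byWitness[where f'="\<lambda>m. m(s := m s - Suc i)"])
  have sum_upd: "(\<Sum>j=1..q. (m(s := x)) j) + m s = (\<Sum>j=1..q. m j) + x" for m :: "nat \<Rightarrow> nat" and x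
    using s by (simp add: sum.remove[of _ s])
  show "(\<lambda>m. m(s := m s + Suc i)) ` Zset (n - 1 - i) q \<subseteq> {m \<in> Zset n q. i < m s}"
  proof safe
    fix m assume m: "m \<in> Zset (n - 1 - i) q"
    then have "(\<Sum>j=1..q. (m(s := m s + Suc i)) j) = n"
      using sum_upd[of m "m s + Suc i"] i by (simp add: Zset_def)
    then show "m(s := m s + Suc i) \<in> Zset n q" using m s by (auto simp: Zset_def)
  qed simp
  show "(\<lambda>m. m(s := m s - Suc i)) ` {m \<in> Zset n q. i < m s} \<subseteq> Zset (n - 1 - i) q"
  proof safe
    fix m assume m: "m \<in> Zset n q" "i < m s"
    then have "(\<Sum>j=1..q. (m(s := m s - Suc i)) j) = n - 1 - i"
      using sum_upd[of m "m s - Suc i"] i by (simp add: Zset_def)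
    then show "m(s := m s - Suc i) \<in> Zset (n - 1 - i) q" using m s by (auto simp: Zset_def)
  qed
qed (auto simp: fun_eq_iff)

lemma sum_Zset_sum_lessThan:
  assumes s: "s \<in> {1..q}"
  shows "(\<Sum>m\<in>Zset n q. \<Sum>i<m s. F i m) = (\<Sum>i<n. \<Sum>m\<in>Zset (n - 1 - i) q. F i (m(s := m s + Suc i)))"
proof -
  have "(\<Sum>m\<in>Zset n q. \<Sum>i<m s. F i m) = (\<Sum>m\<in>Zset n q. \<Sum>i | i \<in> {..<n} \<and> i < m s. F i m)"
    using Zset_le[OF _ s, where n=n] by (intro sum.cong refl) (auto simp: order.strict_trans2)
  also have "\<dots> = (\<Sum>i<n. \<Sum>m | m \<in> Zset n q \<and> i < m s. F i m)" by (rule sum.swap_restrict) auto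
  also have "\<dots> = (\<Sum>i<n. \<Sum>m\<in>Zset (n - 1 - i) q. F i (m(s := m s + Suc i)))"
    by (intro sum.cong refl sum.reindex_bij_betw[symmetric] bij_betw_Zset_greater[OF s]) simp
  finally show ?thesis .
qed

lemma prod_Zset_prod_lessThan:
  fixes r :: "nat \<Rightarrow> 'a :: comm_monoid_mult"
  assumes s: "s \<in> {1..q}"
  shows "(\<Prod>m\<in>Zset n q. \<Prod>i<m s. r i) = (\<Prod>i<n. r i ^ card (Zset (n - 1 - i) q))"
proof -
  have "(\<Prod>m\<in>Zset n q. \<Prod>i<m s. r i) = (\<Prod>m\<in>Zset n q. \<Prod>i | i \<in> {..<n} \<and> i < m s. r i)"
    using Zset_le[OF _ s, where n=n] by (intro prod.cong refl) (auto simp: order.strict_trans2)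
  also have "\<dots> = (\<Prod>i<n. \<Prod>m | m \<in> Zset n q \<and> i < m s. r i)" by (rule prod.swap_restrict) auto
  also have "\<dots> = (\<Prod>i<n. r i ^ card (Zset (n - 1 - i) q))"
    using bij_betw_same_card[OF bij_betw_Zset_greater[OF s]] by (intro prod.cong refl) simp
  finally show ?thesis .
qed

lemma card_Zset_Suc_Suc: "card (Zset (Suc n) (Suc q)) = card (Zset (Suc n) q) + card (Zset n (Suc q))"
proof -
  let ?last_pos = "{m \<in> Zset (Suc n) (Suc q). 0 < m (Suc q)}"
  have "Zset (Suc n) (Suc q) = Zset (Suc n) q \<union> ?last_pos"
    by (auto simp: Zset_def not_less_eq_eq le_Suc_eq)
  moreover have "Zset (Suc n) q \<inter> ?last_pos = {}"
    by (auto simp: Zset_def)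
  ultimately have "card (Zset (Suc n) (Suc q)) = card (Zset (Suc n) q) + card ?last_pos"
    by (metis (no_types, lifting) card_Un_disjoint finite_Un finite_Zset)
  also have "card ?last_pos = card (Zset n (Suc q))"
    using bij_betw_same_card[OF bij_betw_Zset_greater[of "Suc q" "Suc q" 0 "Suc n"]] by simp
  finally show ?thesis .
qed

lemma card_Zset: "card (Zset n (Suc q)) = (n + q) choose q"
proof (induction q arbitrary: n)
  case 0
  show ?case by (induction n) (auto simp: card_Zset_Suc_Suc Zset_0 Zset_Suc_0)
next
  case (Suc q)
  show ?case by (induction n) (auto simp: card_Zset_Suc_Suc[of _ "Suc q"] Zset_0 Suc)
qed

lemma sum_choose_lessThan_offset:
  "(\<Sum>j<n. (j + a) choose b) + (a choose Suc b) = (n + a) choose Suc b"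
  by (induction n) auto

lemma sum_choose_lessThan_rev:
  assumes "a \<le> b"
  shows "(\<Sum>i<n. (n - 1 - i + a) choose b) = (n + a) choose Suc b"
  using sum_choose_lessThan_offset[of a b n] sum.nat_diff_reindex[of "\<lambda>j. (j + a) choose b" n] assms
  by (simp add: binomial_eq_0)

lemma sum_lessThan_eq_choose_2: "(\<Sum>i<k. k - Suc i) = k choose 2"
  using sum_choose_lessThan_rev[of 0 1 k] by (simp add: numeral_2_eq_2)

lemma sum_Zset_coord:
  assumes "s \<in> {1..Suc q}"
  shows "(\<Sum>m\<in>Zset n (Suc q). m s) = (n + q) choose Suc q"
proof -
  have "(\<Sum>m\<in>Zset n (Suc q). m s) = (\<Sum>m\<in>Zset n (Suc q). \<Sum>i<m s. 1)" by simp
  also have "\<dots> = (\<Sum>i<n. (n - 1 - i + q) choose q)"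
    unfolding sum_Zset_sum_lessThan[OF assms] by (simp add: card_Zset)
  also have "\<dots> = (n + q) choose Suc q" by (rule sum_choose_lessThan_rev) simp
  finally show ?thesis .
qed

lemma sum_Zset_coord_mult:
  assumes "s \<in> {1..Suc q}" "r \<in> {1..Suc q}" "r \<noteq> s"
  shows "(\<Sum>m\<in>Zset n (Suc q). m r * m s) = (n + q) choose Suc (Suc q)"
proof -
  have "(\<Sum>m\<in>Zset n (Suc q). m r * m s) = (\<Sum>m\<in>Zset n (Suc q). \<Sum>i<m r. m s)" by simp
  also have "\<dots> = (\<Sum>i<n. (n - 1 - i + q) choose Suc q)"
    unfolding sum_Zset_sum_lessThan[OF assms(2)] using assms(3)
    by (simp add: sum_Zset_coord[OF assms(1)])
  also have "\<dots> = (n + q) choose Suc (Suc q)" by (rule sum_choose_lessThan_rev) simp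
  finally show ?thesis .
qed

lemma sum_Zset_coord_choose_2:
  assumes "s \<in> {1..Suc q}"
  shows "(\<Sum>m\<in>Zset n (Suc q). m s choose 2) = (n + q) choose Suc (Suc q)"
proof -
  have "(\<Sum>m\<in>Zset n (Suc q). m s choose 2) = (\<Sum>m\<in>Zset n (Suc q). \<Sum>i<m s. m s - Suc i)"
    by (simp only: sum_lessThan_eq_choose_2)
  also have "\<dots> = (\<Sum>i<n. (n - 1 - i + q) choose Suc q)"
    unfolding sum_Zset_sum_lessThan[OF assms] by (simp add: sum_Zset_coord[OF assms])
  also have "\<dots> = (n + q) choose Suc (Suc q)" by (rule sum_choose_lessThan_rev) simp
  finally show ?thesis .
qed

lemma sum_card_Zset: "(\<Sum>i<n. card (Zset (n - 1 - i) (Suc q))) = (n + q) choose Suc q"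
  unfolding card_Zset by (rule sum_choose_lessThan_rev) simp

lemma sum_card_Zset_weighted:
  "(\<Sum>i<n. card (Zset (n - 1 - i) (Suc q)) * (n - 1 - i)) = Suc q * ((n + q) choose Suc (Suc q))"
proof -
  have absorb: "((j + q) choose q) * j = Suc q * ((j + q) choose Suc q)" for j
    using binomial_absorb_comp[of "j + q" q] binomial_absorption[of q "j + q"]
    by (metis add_diff_cancel_right' mult.commute)
  have "(\<Sum>i<n. card (Zset (n - 1 - i) (Suc q)) * (n - 1 - i))
      = Suc q * (\<Sum>i<n. (n - 1 - i + q) choose Suc q)"
    unfolding card_Zset absorb by (rule sum_distrib_left[symmetric])
  then show ?thesis using sum_choose_lessThan_rev[of q "Suc q" n] by simp
qed

lemma psum_0 [simp]: "psum l 0 = 0"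
  by (simp add: psum_def)

lemma psum_Suc: "psum l (Suc s) = psum l s + l (Suc s)"
  by (simp add: psum_def)

lemma psum_mono: "a \<le> b \<Longrightarrow> psum l a \<le> psum l b"
  by (rule lift_Suc_mono_le[of "psum l"]) (simp add: psum_Suc)

lemma psum_Zset: "l \<in> Zset n q \<Longrightarrow> psum l q = n"
  by (simp add: Zset_def psum_def)

definition site :: "(nat \<Rightarrow> nat) \<Rightarrow> nat \<Rightarrow> nat" where
  "site l i = (LEAST s. i \<le> psum l s)"

lemma site_eq_iff:
  assumes "i \<ge> 1" "i \<le> psum l q"
  shows "site l i = s \<longleftrightarrow> s \<ge> 1 \<and> i \<in> Gam l s"
proof -
  have site_ge: "i \<le> psum l (site l i)" unfolding site_def using assms(2) by (rule LeastI)
  have below: "\<not> i \<le> psum l s" if "s < site l i" for s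
    using that unfolding site_def by (rule not_less_Least)
  have site_pos: "site l i \<ge> 1" using site_ge assms(1) by (cases "site l i") auto
  have "s = site l i" if "s \<ge> 1" "i \<in> Gam l s"
  proof (rule antisym)
    show "s \<le> site l i"
    proof (rule ccontr)
      assume "\<not> s \<le> site l i"
      then have "psum l (site l i) \<le> psum l (s - 1)" by (intro psum_mono) auto
      then show False using site_ge that by (auto simp: Gam_def)
    qed
    show "site l i \<le> s" unfolding site_def using that by (intro Least_le) (auto simp: Gam_def)
  qed
  moreover have "i \<in> Gam l (site l i)"
    using site_ge below[of "site l i - 1"] site_pos by (auto simp: Gam_def)
  ultimately show ?thesis using site_pos by auto
qed

definition index_pairs :: "nat \<Rightarrow> (nat \<times> nat) set" where
  "index_pairs n = {(i, j). 1 \<le> i \<and> i < j \<and> j \<le> n}"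

lemma index_pairs_eq_Sigma: "index_pairs n = (SIGMA i:{1..n}. {i<..n})"
  by (auto simp: index_pairs_def)

lemma finite_index_pairs [simp]: "finite (index_pairs n)"
  by (simp add: index_pairs_eq_Sigma)

lemma prod_index_pairs: "(\<Prod>i=1..n. \<Prod>j\<in>{i<..n}. f i j) = (\<Prod>(i, j)\<in>index_pairs n. f i j)"
  unfolding index_pairs_eq_Sigma by (rule prod.Sigma) auto

lemma card_less_pairs:
  fixes A :: "'a :: linorder set"
  assumes "finite A"
  shows "card {(i, j). i \<in> A \<and> j \<in> A \<and> i < j} = card A choose 2"
  using assms
proof (induction A rule: finite_linorder_max_induct)
  case (insert b A)
  let ?pairs = "\<lambda>A. {(i, j). i \<in> A \<and> j \<in> A \<and> i < j}"
  have "?pairs (insert b A) = ?pairs A \<union> A \<times> {b}" "?pairs A \<inter> A \<times> {b} = {}"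
    using insert.hyps(2) by auto
  moreover have "finite (?pairs A)"
    by (rule finite_subset[of _ "A \<times> A"]) (use insert.hyps(1) in auto)
  ultimately have "card (?pairs (insert b A)) = card (?pairs A) + card A"
    using insert.hyps(1) by (simp add: card_Un_disjoint card_cartesian_product)
  moreover have "b \<notin> A" using insert.hyps(2) by auto
  ultimately show ?case using insert by (simp add: numeral_2_eq_2)
qed simp

context
  fixes l n q
  assumes l: "l \<in> Zset n q"
begin

lemma site_range: "i \<in> {1..n} \<Longrightarrow> site l i \<in> {1..q}"
proof -
  assume i: "i \<in> {1..n}"
  have "site l i \<ge> 1" using site_eq_iff[of i l q "site l i"] i psum_Zset[OF l] by auto
  moreover have "site l i \<le> q" unfolding site_def using i psum_Zset[OF l] by (intro Least_le) auto
  ultimately show ?thesis by auto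
qed

lemma Gam_eq_site: "s \<in> {1..q} \<Longrightarrow> Gam l s = {i \<in> {1..n}. site l i = s}"
proof -
  assume s: "s \<in> {1..q}"
  have "Gam l s \<subseteq> {1..n}" using psum_mono[of s q l] s psum_Zset[OF l] by (auto simp: Gam_def)
  then show ?thesis using site_eq_iff[of _ l q s] s psum_Zset[OF l] by auto
qed

lemma card_site_eq: "s \<in> {1..q} \<Longrightarrow> card {i \<in> {1..n}. site l i = s} = l s"
proof -
  assume s: "s \<in> {1..q}"
  have "psum l s = psum l (s - 1) + l s" using psum_Suc[of l "s - 1"] s by simp
  then have "card (Gam l s) = l s" by (simp add: Gam_def)
  then show ?thesis using Gam_eq_site[OF s] by simp
qed

lemma site_mono: "i \<le> j \<Longrightarrow> i \<in> {1..n} \<Longrightarrow> j \<in> {1..n} \<Longrightarrow> site l i \<le> site l j"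
  unfolding site_def using psum_Zset[OF l]
  by (intro Least_le) (auto intro: order_trans LeastI[of "\<lambda>s. j \<le> psum l s" q])

lemma prod_site:
  fixes g :: "nat \<Rightarrow> 'a :: comm_monoid_mult"
  shows "(\<Prod>i=1..n. g (site l i)) = (\<Prod>s=1..q. g s ^ l s)"
proof -
  have "(\<Prod>i=1..n. g (site l i)) = (\<Prod>s=1..q. \<Prod>i\<in>{i\<in>{1..n}. site l i = s}. g (site l i))"
    using site_range by (intro prod.group[symmetric]) auto
  also have "\<dots> = (\<Prod>s=1..q. g s ^ l s)"
    using card_site_eq by (intro prod.cong refl) simp
  finally show ?thesis .
qed

lemma card_site_pairs:
  assumes sr: "s \<in> {1..q}" "r \<in> {1..s}"
  shows "card {(i, j) \<in> index_pairs n. site l j = s \<and> site l i = r} = (if r = s then l s choose 2 else l r * l s)"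
    (is "card ?pairs = _")
proof (cases "r = s")
  case True
  let ?block = "{i \<in> {1..n}. site l i = s}"
  have "?pairs = {(i, j). i \<in> ?block \<and> j \<in> ?block \<and> i < j}"
    using True by (auto simp: index_pairs_def)
  then show ?thesis using True card_less_pairs[of ?block] card_site_eq[OF sr(1)] by simp
next
  case False
  have "i < j" if "site l i = r" "site l j = s" "i \<in> {1..n}" "j \<in> {1..n}" for i j
    using site_mono[of j i] that False sr(2) by (cases "i < j") auto
  then have "?pairs = {i \<in> {1..n}. site l i = r} \<times> {i \<in> {1..n}. site l i = s}"
    by (auto simp: index_pairs_def)
  then show ?thesis using False card_site_eq sr by (simp add: card_cartesian_product)
qed

lemma prod_site_pairs:
  fixes G :: "nat \<Rightarrow> nat \<Rightarrow> 'a :: comm_monoid_mult"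
  shows "(\<Prod>i=1..n. \<Prod>j\<in>{i<..n}. G (site l i) (site l j))
     = (\<Prod>s=1..q. G s s ^ (l s choose 2)) * (\<Prod>s=1..q. \<Prod>r=1..<s. G r s ^ (l r * l s))"
proof -
  let ?sites = "SIGMA s:{1..q}. {1..s}"
  let ?fibre = "\<lambda>y. {x \<in> index_pairs n. (case x of (i, j) \<Rightarrow> (site l j, site l i)) = y}"
  let ?power = "\<lambda>s r. G r s ^ (if r = s then l s choose 2 else l r * l s)"
  have "(\<Prod>i=1..n. \<Prod>j\<in>{i<..n}. G (site l i) (site l j)) = (\<Prod>(i, j)\<in>index_pairs n. G (site l i) (site l j))"
    by (rule prod_index_pairs)
  also have "\<dots> = (\<Prod>y\<in>?sites. \<Prod>(i, j)\<in>?fibre y. G (site l i) (site l j))"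
    using site_range site_mono by (intro prod.group[symmetric] finite_index_pairs) (auto simp: index_pairs_def)
  also have "\<dots> = (\<Prod>(s, r)\<in>?sites. ?power s r)"
  proof (intro prod.cong refl, clarify)
    fix s r assume sr: "s \<in> {1..q}" "r \<in> {1..s}"
    have "(\<Prod>(i, j)\<in>?fibre (s, r). G (site l i) (site l j)) = (\<Prod>x\<in>?fibre (s, r). G r s)"
      by (intro prod.cong refl) auto
    also have "\<dots> = G r s ^ card (?fibre (s, r))" by simp
    also have "card (?fibre (s, r)) = card {(i, j) \<in> index_pairs n. site l j = s \<and> site l i = r}"
      by (intro arg_cong[where f=card]) auto
    finally show "(\<Prod>(i, j)\<in>?fibre (s, r). G (site l i) (site l j)) = ?power s r"
      by (simp only: card_site_pairs[OF sr])
  qed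
  also have "\<dots> = (\<Prod>s=1..q. \<Prod>r=1..s. ?power s r)" by (rule prod.Sigma[symmetric]) auto
  also have "\<dots> = (\<Prod>s=1..q. G s s ^ (l s choose 2) * (\<Prod>r=1..<s. G r s ^ (l r * l s)))"
  proof (intro prod.cong refl)
    fix s assume "s \<in> {1..q}"
    then have "(\<Prod>r=1..s. ?power s r) = ?power s s * (\<Prod>r=1..<s. ?power s r)"
      by (intro prod.last_plus) simp
    then show "(\<Prod>r=1..s. ?power s r) = G s s ^ (l s choose 2) * (\<Prod>r=1..<s. G r s ^ (l r * l s))"
      by simp
  qed
  finally show ?thesis by (simp add: prod.distrib)
qed

end

section \<open>The recursion in the last exponent\<close>

text \<open>Letters name functions of one variable: \<open>LOne\<close> is the constant 1, and \<open>LF s\<close>, \<open>LG s\<close>, \<open>LH s\<close>, \<open>LU s\<close> are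
  \<open>f\<^sub>s\<close>, \<open>g\<^sub>s\<close>, \<open>h\<^sub>s\<close>, \<open>u\<^sub>s\<close>. A multiset of \<open>n\<close> letters stands for the symmetrised product, and
  \<open>pair_expansion b\<close> lists the triples \<open>(a, a', c)\<close> of the expansion \<open>\<Sum> c a(x) a'(y)\<close> of
  \<open>((x - z\<^sub>p) b(y) - (y - z\<^sub>p) b(x)) / (x - y)\<close>, the symmetrised interaction term of the integration by parts.\<close>

datatype letter = LOne | LF nat | LG nat | LH nat | LU nat

definition letters :: "nat \<Rightarrow> letter set" where
  "letters q = {LOne} \<union> LF ` {1..q} \<union> LG ` {1..q} \<union> LH ` {1..q} \<union> LU ` {1..q}"

definition ibp_letters :: "nat \<Rightarrow> letter set" where
  "ibp_letters q = {LOne} \<union> LG ` {1..q} \<union> LU ` {1..q}"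

lemma ibp_letters_subset: "ibp_letters q \<subseteq> letters q"
  by (auto simp: ibp_letters_def letters_def)

primrec pair_expansion :: "letter \<Rightarrow> (letter \<times> letter \<times> complex) list" where
  "pair_expansion LOne = [(LOne, LOne, 1)]"
| "pair_expansion (LG s) = [(LOne, LG s, 1), (LG s, LOne, 1), (LG s, LG s, -1)]"
| "pair_expansion (LU s) =
    [(LOne, LU s, 1), (LU s, LOne, 1), (LU s, LU s, -1), (LU s, LG 1, -1), (LG 1, LU s, -1)]"
| "pair_expansion (LF s) = []"
| "pair_expansion (LH s) = []"

definition pair_contribution ::
    "(letter multiset \<Rightarrow> 'r \<Rightarrow> complex) \<Rightarrow> letter multiset \<Rightarrow> 'r \<Rightarrow> letter \<Rightarrow> complex" where
  "pair_contribution V N l b = (\<Sum>(a, a', c)\<leftarrow>pair_expansion b. c * V (add_mset a (add_mset a' N)) l)"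

lemma pair_contribution_LOne: "pair_contribution V N l LOne = V (add_mset LOne (add_mset LOne N)) l"
  by (simp add: pair_contribution_def)

lemma pair_contribution_LG:
  "pair_contribution V N l (LG s)
   = 2 * V (add_mset LOne (add_mset (LG s) N)) l - V (add_mset (LG s) (add_mset (LG s) N)) l"
  by (simp add: pair_contribution_def add_mset_commute[of "LG _" LOne])

lemma pair_contribution_LU:
  "pair_contribution V N l (LU s)
   = 2 * V (add_mset LOne (add_mset (LU s) N)) l - V (add_mset (LU s) (add_mset (LU s) N)) l
     - 2 * V (add_mset (LG 1) (add_mset (LU s) N)) l"
  by (simp add: pair_contribution_def add_mset_commute[of "LU _" LOne] add_mset_commute[of "LU _" "LG _"])

definition LU_is_difference ::
    "(letter multiset \<Rightarrow> 'r \<Rightarrow> complex) \<Rightarrow> nat \<Rightarrow> nat \<Rightarrow> (nat \<Rightarrow> letter) \<Rightarrow> bool" where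
  "LU_is_difference V n q P \<longleftrightarrow> P ` {1..q} \<subseteq> letters q \<and>
     (\<forall>N s l. size N + 1 = n \<longrightarrow> set_mset N \<subseteq> letters q \<longrightarrow> s \<in> {1..q} \<longrightarrow>
        V (add_mset (LU s) N) l = V (add_mset (P s) N) l - V (add_mset (P 1) N) l)"

lemma count_Abs_multiset_Zset:
  assumes "m \<in> Zset n q"
  shows "count (Abs_multiset m) = m"
proof -
  have "{x. 0 < m x} \<subseteq> {1..q}" using assms by (force simp: Zset_def)
  then show ?thesis by (intro count_Abs_multiset) (auto intro: finite_subset)
qed

lemma count_in_Zset:
  assumes "size M = n" "set_mset M \<subseteq> {1..q}"
  shows "count M \<in> Zset n q"
proof -
  have "(\<Sum>i=1..q. count M i) = (\<Sum>i\<in>set_mset M. count M i)"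
    using assms(2) by (intro sum.mono_neutral_right) (auto simp: count_eq_zero_iff)
  then have "(\<Sum>i=1..q. count M i) = n" using assms(1) by (simp add: size_multiset_overloaded_eq)
  moreover have "count M i = 0" if "i \<notin> {1..q}" for i
    using that assms(2) by (auto simp: count_eq_zero_iff)
  ultimately show ?thesis by (simp add: Zset_def)
qed

lemma set_mset_Abs_multiset_Zset:
  assumes m: "m \<in> Zset n q"
  shows "set_mset (Abs_multiset m) \<subseteq> {1..q}"
  using Zset_eq_0[OF m] count_Abs_multiset_Zset[OF m] by (metis count_eq_zero_iff subsetI)

lemma size_Abs_multiset_Zset:
  assumes m: "m \<in> Zset n q"
  shows "size (Abs_multiset m) = n"
proof -
  have "size (Abs_multiset m) = (\<Sum>i\<in>set_mset (Abs_multiset m). m i)"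
    unfolding size_multiset_overloaded_eq count_Abs_multiset_Zset[OF m] ..
  also have "\<dots> = (\<Sum>i=1..q. m i)"
    using set_mset_Abs_multiset_Zset[OF m] count_Abs_multiset_Zset[OF m]
    by (intro sum.mono_neutral_left) (auto simp: set_mset_def)
  finally show ?thesis using m by (simp add: Zset_def)
qed

definition tail_mset :: "(nat \<Rightarrow> nat) \<Rightarrow> nat multiset" where
  "tail_mset m = Abs_multiset (m(1 := 0))"

definition adapted_word :: "(nat \<Rightarrow> letter) \<Rightarrow> (nat \<Rightarrow> nat) \<Rightarrow> letter multiset" where
  "adapted_word P m = replicate_mset (m 1) (P 1) + image_mset LU (tail_mset m)"

lemma
  assumes m: "m \<in> Zset n q" and q: "q \<ge> 1"
  shows Abs_multiset_eq_replicate_tail: "Abs_multiset m = replicate_mset (m 1) 1 + tail_mset m"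
    and size_tail_mset: "m 1 + size (tail_mset m) = n"
    and set_tail_mset: "set_mset (tail_mset m) \<subseteq> {2..q}"
proof -
  have "(\<Sum>j=1..q. (m(1 := 0)) j) + m 1 = (\<Sum>j=1..q. m j)"
    using q by (simp add: sum.remove[of _ 1])
  then have tail: "m(1 := 0) \<in> Zset (n - m 1) q" using m by (auto simp: Zset_def)
  note count_tail = count_Abs_multiset_Zset[OF tail]
  show "Abs_multiset m = replicate_mset (m 1) 1 + tail_mset m"
    unfolding tail_mset_def
    by (rule multiset_eqI)
       (simp only: count_union count_replicate_mset count_Abs_multiset_Zset[OF m] count_tail, simp)
  have "m 1 \<le> n" using Zset_le[OF m] q by simp
  then show "m 1 + size (tail_mset m) = n"
    unfolding tail_mset_def size_Abs_multiset_Zset[OF tail] by simp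
  have "1 \<notin># tail_mset m" unfolding tail_mset_def count_eq_zero_iff[symmetric] count_tail by simp
  moreover have "set_mset (tail_mset m) \<subseteq> {1..q}"
    unfolding tail_mset_def by (rule set_mset_Abs_multiset_Zset[OF tail])
  ultimately have "set_mset (tail_mset m) \<subseteq> {1..q} - {1}" by blast
  also have "{1..q} - {1} = {2..q}" by auto
  finally show "set_mset (tail_mset m) \<subseteq> {2..q}" .
qed

lemma LU_words_in_linspan:
  assumes P: "LU_is_difference V n q P" and q: "q \<ge> 1"
    and "size M + size B = n" "set_mset M \<subseteq> {1..q}" "set_mset B \<subseteq> {1..q}"
  shows "in_linspan (\<lambda>m. V (image_mset P (Abs_multiset m))) {m \<in> Zset n q. count M 1 < m 1}
      (\<lambda>l. V (image_mset P M + image_mset LU B) l - V (image_mset P (M + B)) l)"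
  using assms(3-5)
proof (induction B arbitrary: M)
  case empty
  show ?case by (simp add: in_linspan_zero)
next
  case (add s B)
  let ?span = "in_linspan (\<lambda>m. V (image_mset P (Abs_multiset m))) {m \<in> Zset n q. count M 1 < m 1}"
  let ?N = "image_mset P M + image_mset LU B"
  have s: "s \<in> {1..q}" and one: "1 \<in> {1..q}" using add.prems q by simp_all
  have "P ` set_mset M \<subseteq> letters q" using add.prems(2) P unfolding LU_is_difference_def by blast
  moreover have "LU ` set_mset B \<subseteq> letters q" using add.prems(3) by (auto simp: letters_def)
  ultimately have "set_mset ?N \<subseteq> letters q" by simp
  moreover have "size ?N + 1 = n" using add.prems by simp
  ultimately have expand: "V (image_mset P M + image_mset LU (add_mset s B)) l
      = V (image_mset P (add_mset s M) + image_mset LU B) l - V (image_mset P (add_mset 1 M) + image_mset LU B) l"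
    for l using P s unfolding LU_is_difference_def by simp
  have replaced: "?span (\<lambda>l. V (image_mset P (add_mset r M) + image_mset LU B) l
      - V (image_mset P (add_mset r M + B)) l)"
    if "r \<in> {1..q}" for r
    by (rule in_linspan_mono[OF _ _ add.IH]) (use add.prems that in auto)
  have "count (add_mset 1 M + B) \<in> Zset n q"
  proof (rule count_in_Zset)
    show "set_mset (add_mset 1 M + B) \<subseteq> {1..q}" using add.prems one by simp
  qed (use add.prems in simp)
  then have "?span (V (image_mset P (Abs_multiset (count (add_mset 1 M + B)))))"
    by (intro in_linspan_base[where w="\<lambda>m. V (image_mset P (Abs_multiset m))"]) auto
  then have first: "?span (V (image_mset P (add_mset 1 M + B)))" by (simp add: count_inverse)
  show ?case
    using in_linspan_diff[OF in_linspan_diff[OF replaced[OF s] replaced[OF one]] first]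
    unfolding expand by (simp add: algebra_simps)
qed

lemma det_on_adapted_word:
  assumes P: "LU_is_difference V n q P" and q: "q \<ge> 1"
  shows "det_on (Zset n q) (\<lambda>l m. V (adapted_word P m) (f l))
       = det_on (Zset n q) (\<lambda>l m. V (image_mset P (Abs_multiset m)) (f l))"
proof -
  let ?v = "\<lambda>m. V (image_mset P (Abs_multiset m))" and ?v' = "\<lambda>m. V (adapted_word P m)"
  have "det_on (Zset n q) (\<lambda>l m. ?v' m (f l)) = (\<Prod>m\<in>Zset n q. 1) * det_on (Zset n q) (\<lambda>l m. ?v m (f l))"
  proof (rule det_on_triangular_transition[where rank="\<lambda>m. n - m 1"
        and v="\<lambda>m l. ?v m (f l)" and v'="\<lambda>m l. ?v' m (f l)"])
    fix m assume m: "m \<in> Zset n q"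
    have tail: "set_mset (tail_mset m) \<subseteq> {1..q}" using set_tail_mset[OF m q] by auto
    have "in_linspan ?v {m' \<in> Zset n q. count (replicate_mset (m 1) (1 :: nat)) 1 < m' 1}
        (\<lambda>l. V (image_mset P (replicate_mset (m 1) 1) + image_mset LU (tail_mset m)) l
           - V (image_mset P (replicate_mset (m 1) 1 + tail_mset m)) l)"
      by (rule LU_words_in_linspan[OF P q _ _ tail]) (use size_tail_mset[OF m q] q in auto)
    then have "in_linspan ?v {m' \<in> Zset n q. m 1 < m' 1} (\<lambda>l. ?v' m l - ?v m l)"
      by (simp add: adapted_word_def Abs_multiset_eq_replicate_tail[OF m q])
    moreover have "{m' \<in> Zset n q. m 1 < m' 1} = {m' \<in> Zset n q. n - m' 1 < n - m 1}"
      using Zset_le[of _ n q 1] m q by (intro Collect_cong conj_cong refl) force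
    ultimately show "in_linspan (\<lambda>m l. ?v m (f l)) {m' \<in> Zset n q. n - m' 1 < n - m 1}
        (\<lambda>l. ?v' m (f l) - 1 * ?v m (f l))"
      using in_linspan_comp[of _ _ _ f] by simp
  qed simp
  then show ?thesis by simp
qed

locale symmetric_recursion =
  fixes V :: "letter multiset \<Rightarrow> 'r \<Rightarrow> complex" and n q :: nat and \<alpha> :: "nat \<Rightarrow> complex" and \<gamma> a A :: complex
  assumes q_ge_1: "q \<ge> 1"
    and A_eq: "A = a + (\<Sum>s=1..q. \<alpha> s)"
    and LU_LG: "LU_is_difference V n q LG"
    and LU_LH: "LU_is_difference V n q LH"
    and LH_LG: "\<And>N l. size N + 1 = n \<Longrightarrow> set_mset N \<subseteq> letters q \<Longrightarrow>
        V (add_mset (LH 1) N) l = V (add_mset (LG 1) N) l - V (add_mset LOne N) l"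
    and integration_by_parts: "\<And>N l. size N + 1 = n \<Longrightarrow> set_mset N \<subseteq> ibp_letters q \<Longrightarrow>
        A * V (add_mset LOne N) l - (\<Sum>s=1..q. \<alpha> s * V (add_mset (LG s) N) l)
        + \<gamma> * (\<Sum>b\<in>#N. pair_contribution V (N - {#b#}) l b) = 0"
    and A_plus_nonzero: "\<And>j::nat. A + of_nat j * \<gamma> \<noteq> 0"
begin

definition word :: "nat \<Rightarrow> nat \<Rightarrow> nat \<Rightarrow> nat multiset \<Rightarrow> letter multiset" where
  "word i j k B = replicate_mset i (LH 1) + replicate_mset j LOne + replicate_mset k (LG 1) + image_mset LU B"

lemma size_word: "size (word i j k B) = i + j + k + size B"
  by (simp add: word_def)

lemma adapted_word_LG: "adapted_word LG m = word 0 0 (m 1) (tail_mset m)"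
  by (simp add: adapted_word_def word_def)

lemma adapted_word_LH: "adapted_word LH m = word (m 1) 0 0 (tail_mset m)"
  by (simp add: adapted_word_def word_def)

lemma word_in_letters: "set_mset B \<subseteq> {2..q} \<Longrightarrow> set_mset (word i j k B) \<subseteq> letters q"
  using q_ge_1 by (force simp: word_def letters_def split: if_splits)

lemma word_in_ibp_letters: "set_mset B \<subseteq> {2..q} \<Longrightarrow> set_mset (word 0 j k B) \<subseteq> ibp_letters q"
  using q_ge_1 by (force simp: word_def ibp_letters_def split: if_splits)

lemma sum_LG_word:
  assumes n: "Suc (j + k + size B) = n" and B: "set_mset B \<subseteq> {2..q}"
  shows "(\<Sum>s=1..q. \<alpha> s * V (add_mset (LG s) (word 0 j k B)) l)
    = (\<Sum>s=2..q. \<alpha> s * V (word 0 j k (add_mset s B)) l) + (\<Sum>s=1..q. \<alpha> s) * V (word 0 j (Suc k) B) l"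
proof -
  have LG: "V (add_mset (LG s) (word 0 j k B)) l = V (word 0 j k (add_mset s B)) l + V (word 0 j (Suc k) B) l"
    if "s \<in> {1..q}" for s
  proof -
    have "V (add_mset (LU s) (word 0 j k B)) l
        = V (add_mset (LG s) (word 0 j k B)) l - V (add_mset (LG 1) (word 0 j k B)) l"
      using LU_LG word_in_letters[OF B] that n unfolding LU_is_difference_def by (simp add: size_word)
    then show ?thesis by (simp add: word_def)
  qed
  have "V (word 0 j k (add_mset 1 B)) l = 0" using LG[of 1] q_ge_1 by (simp add: word_def)
  then have "(\<Sum>s=1..q. \<alpha> s * V (word 0 j k (add_mset s B)) l) = (\<Sum>s=2..q. \<alpha> s * V (word 0 j k (add_mset s B)) l)"
    using sum.atLeast_Suc_atMost[of 1 q "\<lambda>s. \<alpha> s * V (word 0 j k (add_mset s B)) l"] q_ge_1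
    by (simp add: numeral_2_eq_2)
  moreover have "(\<Sum>s=1..q. \<alpha> s * V (add_mset (LG s) (word 0 j k B)) l)
      = (\<Sum>s=1..q. \<alpha> s * V (word 0 j k (add_mset s B)) l + \<alpha> s * V (word 0 j (Suc k) B) l)"
    by (intro sum.cong refl) (simp only: LG distrib_left)
  ultimately show ?thesis by (simp add: sum.distrib sum_distrib_right)
qed

lemma sum_pair_contribution_word:
  "(\<Sum>b\<in>#word 0 j k B. pair_contribution V (word 0 j k B - {#b#}) l b)
    = of_nat (j + 2 * k + 2 * size B) * V (word 0 (Suc j) k B) l
      - of_nat (k + 2 * size B) * V (word 0 j (Suc k) B) l - (\<Sum>s\<in>#B. V (word 0 j k (add_mset s B)) l)"
proof -
  let ?N = "word 0 j k B" and ?one = "V (word 0 (Suc j) k B) l" and ?g = "V (word 0 j (Suc k) B) l"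
  have "pair_contribution V (?N - {#LOne#}) l LOne = ?one" if "j > 0"
    using that by (cases j) (simp_all add: pair_contribution_LOne word_def)
  then have LOne: "(\<Sum>b\<in>#replicate_mset j LOne. pair_contribution V (?N - {#b#}) l b) = of_nat j * ?one"
    by (cases "j = 0") auto
  have "pair_contribution V (?N - {#LG 1#}) l (LG 1) = 2 * ?one - ?g" if "k > 0"
    using that by (cases k) (simp_all add: pair_contribution_LG word_def add_mset_commute)
  then have LG: "(\<Sum>b\<in>#replicate_mset k (LG 1). pair_contribution V (?N - {#b#}) l b) = of_nat k * (2 * ?one - ?g)"
    by (cases "k = 0") auto
  have "pair_contribution V (?N - {#LU s#}) l (LU s) = 2 * ?one - V (word 0 j k (add_mset s B)) l - 2 * ?g"
    if s: "s \<in># B" for s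
  proof -
    obtain B' where B': "B = add_mset s B'" using s by (metis multi_member_split)
    have "?N - {#LU s#} = word 0 j k B'"
      "add_mset LOne (add_mset (LU s) (word 0 j k B')) = word 0 (Suc j) k B"
      "add_mset (LU s) (add_mset (LU s) (word 0 j k B')) = word 0 j k (add_mset s B)"
      "add_mset (LG 1) (add_mset (LU s) (word 0 j k B')) = word 0 j (Suc k) B"
      by (simp_all add: B' word_def)
    then show ?thesis by (simp only: pair_contribution_LU)
  qed
  then have "(\<Sum>b\<in>#image_mset LU B. pair_contribution V (?N - {#b#}) l b)
      = (\<Sum>s\<in>#B. 2 * ?one - V (word 0 j k (add_mset s B)) l - 2 * ?g)"
    unfolding image_mset.compositionality o_def by (intro arg_cong[of _ _ sum_mset] image_mset_cong)
  also have "\<dots> = of_nat (size B) * (2 * ?one - 2 * ?g) - (\<Sum>s\<in>#B. V (word 0 j k (add_mset s B)) l)"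
  proof -
    have "(\<Sum>s\<in>#M. c - f s - d) = of_nat (size M) * (c - d) - (\<Sum>s\<in>#M. f s)"
      for M c d and f :: "nat \<Rightarrow> complex"
      by (induction M) (auto simp: algebra_simps)
    then show ?thesis .
  qed
  finally have LU: "(\<Sum>b\<in>#image_mset LU B. pair_contribution V (?N - {#b#}) l b)
      = of_nat (size B) * (2 * ?one - 2 * ?g) - (\<Sum>s\<in>#B. V (word 0 j k (add_mset s B)) l)" .
  have split: "(\<Sum>b\<in>#?N. f b) = (\<Sum>b\<in>#replicate_mset j LOne. f b)
      + (\<Sum>b\<in>#replicate_mset k (LG 1). f b) + (\<Sum>b\<in>#image_mset LU B. f b)" for f :: "letter \<Rightarrow> complex"
    by (simp add: word_def)
  show ?thesis unfolding split LOne LG LU by (simp add: algebra_simps)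
qed

definition denom :: "nat \<Rightarrow> complex" where
  "denom r = A + (2 * of_nat n - 1 - of_nat r) * \<gamma>"

definition numer :: "nat \<Rightarrow> nat \<Rightarrow> complex" where
  "numer \<kappa> r = (\<Sum>s=1..q. \<alpha> s) + (2 * of_nat n - of_nat \<kappa> - of_nat r) * \<gamma>"

lemma denom_nonzero: "r < 2 * n \<Longrightarrow> denom r \<noteq> 0"
  using A_plus_nonzero[of "2 * n - 1 - r"] by (simp add: denom_def of_nat_diff algebra_simps)

lemma denom_minus_numer: "denom (Suc j + i) - numer \<kappa> (Suc j) = a + (of_nat \<kappa> - 1 - of_nat i) * \<gamma>"
  unfolding denom_def numer_def by (simp add: A_eq algebra_simps)

lemma word_recursion:
  assumes n: "Suc j + k + size B = n" and B: "set_mset B \<subseteq> {2..q}"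
  shows "denom (Suc j) * V (word 0 (Suc j) k B) l
     = numer (Suc j + k) (Suc j) * V (word 0 j (Suc k) B) l
       + (\<Sum>s=2..q. \<alpha> s * V (word 0 j k (add_mset s B)) l) + \<gamma> * (\<Sum>s\<in>#B. V (word 0 j k (add_mset s B)) l)"
proof -
  have one: "add_mset LOne (word 0 j k B) = word 0 (Suc j) k B" by (simp add: word_def)
  have "size (word 0 j k B) + 1 = n" using n by (simp add: size_word)
  note ibp = integration_by_parts[OF this word_in_ibp_letters[OF B], of l]
  have "of_nat n = (1 + of_nat j + of_nat k + of_nat (size B) :: complex)"
    using n by (auto simp flip: of_nat_add)
  then have "denom (Suc j) = A + of_nat (j + 2 * k + 2 * size B) * \<gamma>"
    "numer (Suc j + k) (Suc j) = (\<Sum>s=1..q. \<alpha> s) + of_nat (k + 2 * size B) * \<gamma>"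
    by (simp_all add: denom_def numer_def algebra_simps)
  then show ?thesis
    using ibp n unfolding one sum_pair_contribution_word sum_LG_word[OF n[unfolded add_Suc] B]
    by (simp add: algebra_simps)
qed

definition one_coeff :: "nat \<Rightarrow> nat \<Rightarrow> complex" where
  "one_coeff j \<kappa> = (\<Prod>r=1..j. numer \<kappa> r / denom r)"

definition h_coeff :: "nat \<Rightarrow> nat \<Rightarrow> nat \<Rightarrow> complex" where
  "h_coeff i j \<kappa> = one_coeff j \<kappa> * (\<Prod>s<i. (a + (of_nat \<kappa> - 1 - of_nat s) * \<gamma>) / denom (Suc j + s))"

lemma h_coeff_Suc:
  assumes "i + j < 2 * n - 1"
  shows "h_coeff (Suc i) j \<kappa> = h_coeff i j \<kappa> - h_coeff i (Suc j) \<kappa>"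
proof -
  define N where "N = (\<Prod>s<i. a + (of_nat \<kappa> - 1 - of_nat s) * \<gamma>)"
  define D where "D = (\<Prod>s<Suc i. denom (Suc j + s))"
  have nonzero: "denom (Suc j + i) \<noteq> 0" "denom (Suc j) \<noteq> 0" using assms by (auto intro!: denom_nonzero)
  have "D = (\<Prod>s<i. denom (Suc j + s)) * denom (Suc j + i)" by (simp add: D_def)
  then have drop_last: "(\<Prod>s<i. denom (Suc j + s)) = D / denom (Suc j + i)" using nonzero by simp
  have "D = denom (Suc j) * (\<Prod>s<i. denom (Suc (Suc j) + s))"
    unfolding D_def by (simp only: prod.lessThan_Suc_shift) simp
  then have drop_first: "(\<Prod>s<i. denom (Suc (Suc j) + s)) = D / denom (Suc j)" using nonzero by simp
  have "h_coeff i j \<kappa> = one_coeff j \<kappa> * N * denom (Suc j + i) / D"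
    unfolding h_coeff_def prod_dividef drop_last N_def by simp
  moreover have "h_coeff i (Suc j) \<kappa> = one_coeff j \<kappa> * N * numer \<kappa> (Suc j) / D"
    unfolding h_coeff_def prod_dividef drop_first N_def using nonzero by (simp add: one_coeff_def)
  moreover have "h_coeff (Suc i) j \<kappa> = one_coeff j \<kappa> * N * (denom (Suc j + i) - numer \<kappa> (Suc j)) / D"
    unfolding h_coeff_def prod_dividef denom_minus_numer D_def[symmetric] by (simp add: N_def)
  ultimately show ?thesis by (simp add: right_diff_distrib diff_divide_distrib)
qed

abbreviation lower_span :: "nat \<Rightarrow> ('r \<Rightarrow> complex) \<Rightarrow> bool" where
  "lower_span \<kappa> \<equiv> in_linspan (\<lambda>m. V (adapted_word LG m)) {m \<in> Zset n q. m 1 < \<kappa>}"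

lemma LG_word_in_lower_span:
  assumes "k + size B = n" "set_mset B \<subseteq> {2..q}" "k < \<kappa>"
  shows "lower_span \<kappa> (V (word 0 0 k B))"
proof -
  let ?m = "count (replicate_mset k 1 + B)"
  have m: "?m \<in> Zset n q" using assms q_ge_1 by (intro count_in_Zset) (auto split: if_splits)
  have head: "?m 1 = k" using assms(2) by (auto simp: count_eq_zero_iff)
  have "?m(1 := 0) = count B" using assms(2) by (auto simp: fun_eq_iff count_eq_zero_iff)
  then have "V (adapted_word LG ?m) = V (word 0 0 k B)"
    unfolding adapted_word_LG tail_mset_def head by (simp add: count_inverse)
  then show ?thesis
    using in_linspan_base[of "{m \<in> Zset n q. m 1 < \<kappa>}" ?m "\<lambda>m. V (adapted_word LG m)"] m head assms(3) by simp
qed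

lemma LOne_word_in_lower_span:
  assumes "j + k + size B = n" "set_mset B \<subseteq> {2..q}"
  shows "lower_span (j + k) (\<lambda>l. V (word 0 j k B) l - one_coeff j (j + k) * V (word 0 0 (j + k) B) l)"
  using assms
proof (induction j arbitrary: k B)
  case 0
  then show ?case by (simp add: one_coeff_def in_linspan_zero)
next
  case (Suc j)
  let ?\<kappa> = "Suc j + k"
  let ?tail = "\<lambda>l. (\<Sum>s=2..q. \<alpha> s * V (word 0 j k (add_mset s B)) l) + \<gamma> * (\<Sum>s\<in>#B. V (word 0 j k (add_mset s B)) l)"
  let ?rest = "\<lambda>l. V (word 0 j (Suc k) B) l - one_coeff j ?\<kappa> * V (word 0 0 ?\<kappa> B) l"
  have nonzero: "denom (Suc j) \<noteq> 0" using Suc.prems(1) by (intro denom_nonzero) simp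
  have "lower_span ?\<kappa> ?rest" using Suc.IH[of "Suc k" B] Suc.prems by simp
  moreover have "lower_span ?\<kappa> (V (word 0 j k (add_mset s B)))" if "s \<in> {2..q}" for s
  proof -
    let ?lead = "\<lambda>l. one_coeff j (j + k) * V (word 0 0 (j + k) (add_mset s B)) l"
    have "lower_span ?\<kappa> (\<lambda>l. V (word 0 j k (add_mset s B)) l - ?lead l)"
      by (rule in_linspan_mono[OF _ _ Suc.IH]) (use Suc.prems that in auto)
    moreover have "lower_span ?\<kappa> ?lead"
      using Suc.prems that by (intro in_linspan_scale LG_word_in_lower_span) auto
    ultimately have "lower_span ?\<kappa> (\<lambda>l. (V (word 0 j k (add_mset s B)) l - ?lead l) + ?lead l)"
      by (rule in_linspan_add)
    then show ?thesis by simp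
  qed
  then have "lower_span ?\<kappa> ?tail"
    using Suc.prems(2) by (intro in_linspan_add in_linspan_scale in_linspan_sum in_linspan_sum_mset) auto
  ultimately have "lower_span ?\<kappa> (\<lambda>l. numer ?\<kappa> (Suc j) / denom (Suc j) * ?rest l + 1 / denom (Suc j) * ?tail l)"
    by (rule in_linspan_add[OF in_linspan_scale in_linspan_scale])
  moreover have "V (word 0 (Suc j) k B) l - one_coeff (Suc j) ?\<kappa> * V (word 0 0 ?\<kappa> B) l
      = numer ?\<kappa> (Suc j) / denom (Suc j) * ?rest l + 1 / denom (Suc j) * ?tail l" for l
  proof -
    have "one_coeff (Suc j) ?\<kappa> = one_coeff j ?\<kappa> * (numer ?\<kappa> (Suc j) / denom (Suc j))"
      by (simp add: one_coeff_def)
    moreover have "V (word 0 (Suc j) k B) l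
        = (numer ?\<kappa> (Suc j) * V (word 0 j (Suc k) B) l + ?tail l) / denom (Suc j)"
      using word_recursion[OF Suc.prems, of l] nonzero
      by (simp only: nonzero_eq_divide_eq[OF nonzero] mult.commute[of _ "denom (Suc j)"] add.assoc)
    ultimately show ?thesis using nonzero by (simp add: field_simps)
  qed
  ultimately show ?case by simp
qed

lemma LH_word_in_lower_span:
  assumes "i + j + k + size B = n" "set_mset B \<subseteq> {2..q}"
  shows "lower_span (i + j + k) (\<lambda>l. V (word i j k B) l - h_coeff i j (i + j + k) * V (word 0 0 (i + j + k) B) l)"
  using assms
proof (induction i arbitrary: j k)
  case 0
  then show ?case using LOne_word_in_lower_span[of j k B] by (simp add: h_coeff_def)
next
  case (Suc i)
  let ?\<kappa> = "Suc i + j + k"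
  let ?remainder = "\<lambda>j k l. V (word i j k B) l - h_coeff i j ?\<kappa> * V (word 0 0 ?\<kappa> B) l"
  have "V (add_mset (LH 1) (word i j k B)) l
      = V (add_mset (LG 1) (word i j k B)) l - V (add_mset LOne (word i j k B)) l" for l
    using Suc.prems by (intro LH_LG word_in_letters) (simp_all add: size_word)
  then have expand: "V (word (Suc i) j k B) l = V (word i j (Suc k) B) l - V (word i (Suc j) k B) l" for l
    by (simp add: word_def)
  have coeff: "h_coeff (Suc i) j ?\<kappa> = h_coeff i j ?\<kappa> - h_coeff i (Suc j) ?\<kappa>"
    using Suc.prems by (intro h_coeff_Suc) simp
  have "lower_span ?\<kappa> (?remainder j (Suc k))" "lower_span ?\<kappa> (?remainder (Suc j) k)"
    using Suc.IH[of j "Suc k"] Suc.IH[of "Suc j" k] Suc.prems by simp_all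
  then have "lower_span ?\<kappa> (\<lambda>l. ?remainder j (Suc k) l - ?remainder (Suc j) k l)"
    by (rule in_linspan_diff)
  then show ?case unfolding expand coeff by (simp add: algebra_simps)
qed

theorem det_LH_eq_det_LG:
  "det_on (Zset n q) (\<lambda>l m. V (image_mset LH (Abs_multiset m)) (f l))
   = (\<Prod>m\<in>Zset n q. \<Prod>s<m 1. (a + of_nat s * \<gamma>) / (A + (2 * of_nat n - 2 - of_nat s) * \<gamma>))
     * det_on (Zset n q) (\<lambda>l m. V (image_mset LG (Abs_multiset m)) (f l))"
proof -
  have "det_on (Zset n q) (\<lambda>l m. V (adapted_word LH m) (f l))
    = (\<Prod>m\<in>Zset n q. h_coeff (m 1) 0 (m 1)) * det_on (Zset n q) (\<lambda>l m. V (adapted_word LG m) (f l))"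
  proof (rule det_on_triangular_transition[where rank="\<lambda>m. m 1"
        and v="\<lambda>m l. V (adapted_word LG m) (f l)" and v'="\<lambda>m l. V (adapted_word LH m) (f l)"])
    fix m assume m: "m \<in> Zset n q"
    have "lower_span (m 1) (\<lambda>l. V (adapted_word LH m) l - h_coeff (m 1) 0 (m 1) * V (adapted_word LG m) l)"
      using LH_word_in_lower_span[of "m 1" 0 0 "tail_mset m"] size_tail_mset[OF m q_ge_1]
        set_tail_mset[OF m q_ge_1]
      by (simp add: adapted_word_LG adapted_word_LH)
    then show "in_linspan (\<lambda>m l. V (adapted_word LG m) (f l)) {m' \<in> Zset n q. m' 1 < m 1}
       (\<lambda>l. V (adapted_word LH m) (f l) - h_coeff (m 1) 0 (m 1) * V (adapted_word LG m) (f l))"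
      by (rule in_linspan_comp)
  qed simp
  moreover have "h_coeff k 0 k = (\<Prod>s<k. (a + of_nat s * \<gamma>) / (A + (2 * of_nat n - 2 - of_nat s) * \<gamma>))" for k
  proof -
    have "(\<Prod>s<k. a + (of_nat k - 1 - of_nat s) * \<gamma>) = (\<Prod>s<k. a + of_nat (k - Suc s) * \<gamma>)"
      by (intro prod.cong refl) (auto simp: of_nat_diff algebra_simps)
    also have "\<dots> = (\<Prod>s<k. a + of_nat s * \<gamma>)" by (rule prod.nat_diff_reindex)
    finally show ?thesis
      by (simp add: h_coeff_def one_coeff_def prod_dividef denom_def algebra_simps)
  qed
  ultimately show ?thesis
    by (simp only: det_on_adapted_word[OF LU_LG q_ge_1] det_on_adapted_word[OF LU_LH q_ge_1])
qed

end

section \<open>Integration tools\<close>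

interpretation lborel_product: product_sigma_finite "\<lambda>_ :: 'i. lborel :: real measure" by standard

lemma emeasure_lborel_affine_vimage:
  fixes c :: real
  assumes c: "c \<noteq> 0" and A: "A \<in> sets lborel"
  shows "ennreal \<bar>c\<bar> * emeasure lborel ((\<lambda>x. d + c * x) -` A) = emeasure lborel A"
proof -
  have "emeasure lborel A = emeasure (density (distr lborel borel (\<lambda>x. d + c * x)) (\<lambda>_. \<bar>c\<bar>)) A"
    using lborel_real_affine[OF c, of d] by simp
  also have "\<dots> = ennreal \<bar>c\<bar> * emeasure (distr lborel borel (\<lambda>x. d + c * x)) A"
    using A by (subst emeasure_density_const) auto
  also have "emeasure (distr lborel borel (\<lambda>x. d + c * x)) A = emeasure lborel ((\<lambda>x. d + c * x) -` A)"
    using A by (subst emeasure_distr) auto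
  finally show ?thesis by simp
qed

definition affine_reindex ::
    "'j set \<Rightarrow> ('j \<Rightarrow> 'i) \<Rightarrow> ('j \<Rightarrow> real) \<Rightarrow> ('j \<Rightarrow> real) \<Rightarrow> ('i \<Rightarrow> real) \<Rightarrow> 'j \<Rightarrow> real" where
  "affine_reindex J f c d y = (\<lambda>j\<in>J. d j + c j * y (f j))"

lemma affine_reindex_apply: "j \<in> J \<Longrightarrow> affine_reindex J f c d y j = d j + c j * y (f j)"
  by (simp add: affine_reindex_def)

lemma measurable_affine_reindex:
  assumes "bij_betw f J I"
  shows "affine_reindex J f c d \<in> measurable (PiM I (\<lambda>_. lborel)) (PiM J (\<lambda>_. lborel))"
  unfolding affine_reindex_def
proof (rule measurable_restrict)
  fix j assume "j \<in> J"
  then have "f j \<in> I" using assms by (auto simp: bij_betw_def)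
  then have "(\<lambda>y. y (f j)) \<in> borel_measurable (PiM I (\<lambda>_. lborel))"
    using measurable_component_singleton[of "f j" I "\<lambda>_. lborel :: real measure"] by simp
  then show "(\<lambda>y. d j + c j * y (f j)) \<in> measurable (PiM I (\<lambda>_. lborel)) lborel"
    by (auto intro!: borel_measurable_add borel_measurable_times)
qed

lemma affine_reindex_vimage_PiE:
  assumes f: "bij_betw f J I"
  shows "affine_reindex J f c d -` Pi\<^sub>E J A \<inter> space (PiM I (\<lambda>_. lborel))
    = (\<Pi>\<^sub>E i\<in>I. (\<lambda>x. d (inv_into J f i) + c (inv_into J f i) * x) -` A (inv_into J f i))" (is "_ = Pi\<^sub>E I ?B")
proof (intro set_eqI iffI)
  fix y assume "y \<in> affine_reindex J f c d -` Pi\<^sub>E J A \<inter> space (PiM I (\<lambda>_. lborel))"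
  then have y: "affine_reindex J f c d y \<in> Pi\<^sub>E J A" "y \<in> extensional I" by (auto simp: space_PiM PiE_def)
  have "y i \<in> ?B i" if i: "i \<in> I" for i
  proof -
    have inv: "inv_into J f i \<in> J" "f (inv_into J f i) = i"
      using f i by (auto simp: bij_betw_def inv_into_into f_inv_into_f)
    show ?thesis using PiE_mem[OF y(1) inv(1)] inv by (simp add: affine_reindex_apply)
  qed
  then show "y \<in> Pi\<^sub>E I ?B" using y(2) by (auto simp: PiE_def)
next
  fix y assume y: "y \<in> Pi\<^sub>E I ?B"
  have "affine_reindex J f c d y j \<in> A j" if j: "j \<in> J" for j
  proof -
    have "f j \<in> I" "inv_into J f (f j) = j" using f j by (auto simp: bij_betw_def inv_into_f_f)
    then show ?thesis using PiE_mem[OF y, of "f j"] j by (simp add: affine_reindex_apply)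
  qed
  then show "y \<in> affine_reindex J f c d -` Pi\<^sub>E J A \<inter> space (PiM I (\<lambda>_. lborel))"
    using y by (auto simp: space_PiM PiE_def affine_reindex_def)
qed

lemma PiM_lborel_affine:
  assumes f: "bij_betw f J I" and J: "finite J" and c: "\<And>j. j \<in> J \<Longrightarrow> c j \<noteq> 0"
  shows "density (distr (PiM I (\<lambda>_. lborel)) (PiM J (\<lambda>_. lborel)) (affine_reindex J f c d))
           (\<lambda>_. \<Prod>j\<in>J. ennreal \<bar>c j\<bar>) = PiM J (\<lambda>_. lborel)" (is "density (distr ?P ?Q ?T) _ = _")
proof (rule lborel_product.PiM_eqI[OF J])
  show "sets (density (distr ?P ?Q ?T) (\<lambda>_. \<Prod>j\<in>J. ennreal \<bar>c j\<bar>)) = sets ?Q" by simp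
  fix A :: "'a \<Rightarrow> real set" assume A: "\<And>i. i \<in> J \<Longrightarrow> A i \<in> sets lborel"
  let ?B = "\<lambda>i. (\<lambda>x. d (inv_into J f i) + c (inv_into J f i) * x) -` A (inv_into J f i)"
  have I: "finite I" using f J bij_betw_finite by blast
  have B: "?B i \<in> sets lborel" if "i \<in> I" for i
  proof -
    have "inv_into J f i \<in> J" using f that by (auto simp: bij_betw_def inv_into_into)
    moreover have "(\<lambda>x. d (inv_into J f i) + c (inv_into J f i) * x) \<in> borel_measurable borel" by measurable
    ultimately show ?thesis
      using A measurable_sets[of "\<lambda>x. d (inv_into J f i) + c (inv_into J f i) * x" borel borel] by simp
  qed
  have "Pi\<^sub>E J A \<in> sets ?Q" using A J by (intro sets_PiM_I_finite) auto
  then have "emeasure (density (distr ?P ?Q ?T) (\<lambda>_. \<Prod>j\<in>J. ennreal \<bar>c j\<bar>)) (Pi\<^sub>E J A)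
     = (\<Prod>j\<in>J. ennreal \<bar>c j\<bar>) * emeasure ?P (Pi\<^sub>E I ?B)"
    by (simp add: emeasure_density_const emeasure_distr measurable_affine_reindex[OF f]
      affine_reindex_vimage_PiE[OF f])
  also have "emeasure ?P (Pi\<^sub>E I ?B) = (\<Prod>i\<in>I. emeasure lborel (?B i))"
    by (rule lborel_product.emeasure_PiM[OF I B])
  also have "\<dots> = (\<Prod>j\<in>J. emeasure lborel ((\<lambda>x. d j + c j * x) -` A j))"
    using prod.reindex_bij_betw[OF f, of "\<lambda>i. emeasure lborel (?B i)"] f
    by (simp add: bij_betw_def inv_into_f_f)
  also have "(\<Prod>j\<in>J. ennreal \<bar>c j\<bar>) * \<dots> = (\<Prod>j\<in>J. emeasure lborel (A j))"
    unfolding prod.distrib[symmetric] by (intro prod.cong refl emeasure_lborel_affine_vimage c A)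
  finally show "emeasure (density (distr ?P ?Q ?T) (\<lambda>_. \<Prod>j\<in>J. ennreal \<bar>c j\<bar>)) (Pi\<^sub>E J A)
      = (\<Prod>j\<in>J. emeasure lborel (A j))" .
qed

lemma integral_PiM_affine:
  fixes g :: "('j \<Rightarrow> real) \<Rightarrow> 'b :: {banach, second_countable_topology}"
  assumes f: "bij_betw f J I" and J: "finite J" and c: "\<And>j. j \<in> J \<Longrightarrow> c j \<noteq> 0"
    and g: "g \<in> borel_measurable (PiM J (\<lambda>_. lborel))"
  shows "(\<integral>x. g x \<partial>PiM J (\<lambda>_. lborel))
    = (\<Prod>j\<in>J. \<bar>c j\<bar>) *\<^sub>R (\<integral>y. g (affine_reindex J f c d y) \<partial>PiM I (\<lambda>_. lborel))"
proof -
  let ?P = "PiM I (\<lambda>_. lborel :: real measure)" and ?Q = "PiM J (\<lambda>_. lborel :: real measure)"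
    and ?T = "affine_reindex J f c d"
  note T = measurable_affine_reindex[OF f]
  have "(\<Prod>j\<in>J. ennreal \<bar>c j\<bar>) = ennreal (\<Prod>j\<in>J. \<bar>c j\<bar>)" by (rule prod_ennreal) auto
  then have "(\<integral>x. g x \<partial>?Q) = (\<integral>x. g x \<partial>density (distr ?P ?Q ?T) (\<lambda>_. ennreal (\<Prod>j\<in>J. \<bar>c j\<bar>)))"
    using PiM_lborel_affine[OF f J, of c d] c by simp
  also have "\<dots> = (\<integral>x. (\<Prod>j\<in>J. \<bar>c j\<bar>) *\<^sub>R g x \<partial>distr ?P ?Q ?T)"
    using g by (subst integral_density) (auto intro!: prod_nonneg)
  also have "\<dots> = (\<Prod>j\<in>J. \<bar>c j\<bar>) *\<^sub>R (\<integral>y. g (?T y) \<partial>?P)"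
    using g T by (simp add: integral_distr)
  finally show ?thesis .
qed

lemma integrable_of_norm_le:
  fixes f :: "'a \<Rightarrow> 'b :: {banach, second_countable_topology}" and g :: "'a \<Rightarrow> real"
  assumes "integrable M g" "f \<in> borel_measurable M" "\<And>x. norm (f x) \<le> g x"
  shows "integrable M f"
  using assms(1,2)
  by (rule Bochner_Integration.integrable_bound) (auto intro!: AE_I2 order_trans[OF assms(3)])

lemma measurable_Rn_component: "i \<in> {1..n} \<Longrightarrow> (\<lambda>t. t i) \<in> borel_measurable (Rn n)"
  using measurable_component_singleton[of i "{1..n}" "\<lambda>_. lborel :: real measure"] by simp

lemma measurable_Rn_ball:
  assumes "\<And>i. i \<in> {1..n} \<Longrightarrow> Measurable.pred borel (P i)"
  shows "Measurable.pred (Rn n) (\<lambda>t. \<forall>i\<in>{1..n}. P i (t i))"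
  using measurable_compose[OF measurable_Rn_component assms] by (intro pred_intros_finite(3)) auto

lemma measurable_Rn_ball_le:
  "Measurable.pred (Rn n) (\<lambda>t. \<forall>i\<in>{1..n}. \<forall>j\<in>{1..n}. R i j \<longrightarrow> t i \<le> t j)"
proof (intro pred_intros_finite(3) finite_atLeastAtMost)
  fix i j assume "i \<in> {1..n}" "j \<in> {1..n}"
  then have "Measurable.pred (Rn n) (\<lambda>t. t i \<le> t j)"
    unfolding pred_def by (intro borel_measurable_le measurable_Rn_component)
  then show "Measurable.pred (Rn n) (\<lambda>t. R i j \<longrightarrow> t i \<le> t j)" by (cases "R i j") simp_all
qed

lemma measurable_Rn_mono_on: "Measurable.pred (Rn n) (\<lambda>t. mono_on {1..n} t)"
  unfolding monotone_on_def by (rule measurable_Rn_ball_le)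

lemma measurable_Rn_prod:
  fixes f :: "nat \<Rightarrow> real \<Rightarrow> complex"
  assumes "\<And>i. i \<in> A \<Longrightarrow> f i \<in> borel_measurable borel" "A \<subseteq> {1..n}"
  shows "(\<lambda>t. \<Prod>i\<in>A. f i (t i)) \<in> borel_measurable (Rn n)"
  using measurable_compose[OF measurable_Rn_component assms(1)] assms(2) by (intro borel_measurable_prod) auto

lemma integrable_Rn_by_section:
  fixes f :: "(nat \<Rightarrow> real) \<Rightarrow> complex"
  assumes i: "i \<in> {1..n}" and f: "f \<in> borel_measurable (Rn n)"
    and g: "integrable (PiM ({1..n} - {i}) (\<lambda>_. lborel)) g" "\<And>x. g x \<ge> 0"
    and section_le: "\<And>x. (\<integral>\<^sup>+y. ennreal (norm (f (x(i := y)))) \<partial>lborel) \<le> ennreal (g x)"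
  shows "integrable (Rn n) f"
proof (rule integrableI_bounded[OF f])
  note [measurable] = f
  have norm_f: "(\<lambda>t. ennreal (norm (f t))) \<in> borel_measurable (Rn n)" by measurable
  have insert: "insert i ({1..n} - {i}) = {1..n}" using i by auto
  have "(\<integral>\<^sup>+t. ennreal (norm (f t)) \<partial>Rn n)
      = (\<integral>\<^sup>+x. \<integral>\<^sup>+y. ennreal (norm (f (x(i := y)))) \<partial>lborel \<partial>PiM ({1..n} - {i}) (\<lambda>_. lborel))"
    by (rule lborel_product.product_nn_integral_insert[of "{1..n} - {i}" i "\<lambda>t. ennreal (norm (f t))",
          unfolded insert])
       (use norm_f in auto)
  also have "\<dots> \<le> (\<integral>\<^sup>+x. ennreal (g x) \<partial>PiM ({1..n} - {i}) (\<lambda>_. lborel))"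
    by (rule nn_integral_mono) (rule section_le)
  also have "\<dots> < \<infinity>" using g by (simp add: integrable_iff_bounded)
  finally show "(\<integral>\<^sup>+t. ennreal (norm (f t)) \<partial>Rn n) < \<infinity>" .
qed

lemma integral_indicator_vector_derivative_eq_0:
  fixes F :: "real \<Rightarrow> 'b :: euclidean_space"
  assumes F: "continuous_on {a..b} F" "F a = 0" "F b = 0"
    and deriv: "\<And>x. x \<in> {a<..<b} \<Longrightarrow> (F has_vector_derivative f x) (at x)"
  shows "(\<integral>y. indicator {a..b} y *\<^sub>R f y \<partial>lborel) = 0"
proof (cases "integrable lborel (\<lambda>y. indicator {a..b} y *\<^sub>R f y)")
  case False
  then show ?thesis by (rule not_integrable_integral_eq)
next
  case int: True
  show ?thesis
  proof (cases "a \<le> b")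
    case True
    have "(f has_integral (F b - F a)) {a..b}"
      by (rule fundamental_theorem_of_calculus_interior[OF True F(1) deriv])
    then have "integral {a..b} f = 0" using F(2,3) by (simp add: integral_unique)
    moreover have "(LINT y:{a..b}|lborel. f y) = integral {a..b} f"
      using int by (intro set_borel_integral_eq_integral) (simp add: set_integrable_def)
    ultimately show ?thesis by (simp add: set_lebesgue_integral_def)
  qed simp
qed

text \<open>This is \<open>br_pow\<close> without its phase, and likewise 0 at \<open>x = 0\<close>.\<close>

definition abs_pow :: "real \<Rightarrow> complex \<Rightarrow> complex" where
  "abs_pow x a = (if x = 0 then 0 else exp (a * of_real (ln \<bar>x\<bar>)))"

lemma abs_pow_0 [simp]: "abs_pow 0 a = 0"
  by (simp add: abs_pow_def)

lemma abs_pow_eq_0_iff [simp]: "abs_pow x a = 0 \<longleftrightarrow> x = 0"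
  by (simp add: abs_pow_def)

lemma abs_pow_1 [simp]: "abs_pow 1 a = 1"
  by (simp add: abs_pow_def)

lemma norm_abs_pow: "norm (abs_pow x a) = \<bar>x\<bar> powr Re a"
  by (simp add: abs_pow_def powr_def)

lemma abs_pow_minus [simp]: "abs_pow (- x) a = abs_pow x a"
  by (simp add: abs_pow_def)

lemma abs_pow_diff_commute: "abs_pow (x - y) a = abs_pow (y - x) a"
  using abs_pow_minus[of "x - y" a] by simp

lemma abs_pow_mult: "abs_pow (x * y) a = abs_pow x a * abs_pow y a"
  by (simp add: abs_pow_def abs_mult ln_mult distrib_left exp_add)

lemma abs_pow_add: "abs_pow x (a + b) = abs_pow x a * abs_pow x b"
  by (simp add: abs_pow_def distrib_right exp_add)

lemma abs_pow_exponent_0: "x \<noteq> 0 \<Longrightarrow> abs_pow x 0 = 1"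
  by (simp add: abs_pow_def)

lemma abs_pow_sum: "x \<noteq> 0 \<Longrightarrow> abs_pow x (\<Sum>i\<in>S. f i) = (\<Prod>i\<in>S. abs_pow x (f i))"
  by (induction S rule: infinite_finite_induct) (auto simp: abs_pow_add abs_pow_exponent_0)

lemma abs_pow_power: "x \<noteq> 0 \<Longrightarrow> abs_pow x a ^ k = abs_pow x (of_nat k * a)"
  by (simp add: abs_pow_def exp_of_nat_mult[symmetric] mult_ac)

lemma abs_pow_exponent_1: "abs_pow x 1 = of_real \<bar>x\<bar>"
  by (simp add: abs_pow_def exp_of_real)

lemma abs_pow_add_of_nat: "abs_pow x (a + of_nat k) = abs_pow x a * of_real (\<bar>x\<bar> ^ k)"
  using abs_pow_power[of x 1 k] by (cases "x = 0") (simp_all add: abs_pow_add abs_pow_exponent_1)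

lemma measurable_abs_pow [measurable]: "(\<lambda>x. abs_pow x a) \<in> borel_measurable borel"
  unfolding abs_pow_def by measurable

lemma isCont_abs_pow: "x \<noteq> 0 \<Longrightarrow> isCont (\<lambda>x. abs_pow x a) x"
proof -
  assume x: "x \<noteq> 0"
  have "isCont (\<lambda>x. exp (a * of_real (ln \<bar>x\<bar>))) x" using x by (intro continuous_intros) auto
  moreover have "\<forall>\<^sub>F y in nhds x. exp (a * of_real (ln \<bar>y\<bar>)) = abs_pow y a"
    using t1_space_nhds[OF x] by eventually_elim (simp add: abs_pow_def)
  ultimately show ?thesis by (subst isCont_cong[symmetric])
qed

lemma tendsto_abs_pow: "(f \<longlongrightarrow> x) F \<Longrightarrow> x \<noteq> 0 \<Longrightarrow> ((\<lambda>k. abs_pow (f k) a) \<longlongrightarrow> abs_pow x a) F"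
  using isCont_tendsto_compose[OF isCont_abs_pow] by blast

lemma continuous_on_abs_pow: "Re a > 0 \<Longrightarrow> continuous_on S (\<lambda>x. abs_pow x a)"
proof (rule continuous_at_imp_continuous_on, rule ballI)
  fix x assume a: "Re a > 0"
  show "isCont (\<lambda>x. abs_pow x a) x"
  proof (cases "x = 0")
    case True
    have "((\<lambda>x::real. \<bar>x\<bar> powr Re a) \<longlongrightarrow> 0 powr Re a) (at 0)"
      using a by (intro tendsto_powr2) (auto intro!: tendsto_eq_intros)
    then have "((\<lambda>x. norm (abs_pow x a)) \<longlongrightarrow> 0) (at 0)" by (simp add: norm_abs_pow)
    then have "((\<lambda>x. abs_pow x a) \<longlongrightarrow> 0) (at 0)" by (rule tendsto_norm_zero_cancel)
    then show ?thesis using True by (simp add: isCont_def)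
  qed (rule isCont_abs_pow)
qed

lemma abs_pow_has_vector_derivative:
  assumes "x \<noteq> c"
  shows "((\<lambda>x. abs_pow (x - c) a) has_vector_derivative a / of_real (x - c) * abs_pow (x - c) a) (at x)"
proof -
  let ?exp = "\<lambda>x. exp (a * of_real (ln \<bar>x - c\<bar>))"
  have ln_abs: "ln \<bar>x - c\<bar> = ln ((x - c)\<^sup>2) / 2" if "x \<noteq> c" for x
    using ln_realpow[of "\<bar>x - c\<bar>" 2] that by simp
  have "((\<lambda>x. ln ((x - c)\<^sup>2) / 2) has_real_derivative (2 * (x - c)) / (x - c)\<^sup>2 / 2) (at x)"
    using assms by (auto intro!: derivative_eq_intros) (simp add: divide_simps algebra_simps)
  also have "(2 * (x - c)) / (x - c)\<^sup>2 / 2 = 1 / (x - c)"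
    using assms by (simp add: power2_eq_square frac_eq_eq)
  finally have "((\<lambda>x. ln ((x - c)\<^sup>2) / 2) has_real_derivative 1 / (x - c)) (at x)" .
  then have "((\<lambda>x. ln \<bar>x - c\<bar>) has_vector_derivative 1 / (x - c)) (at x)"
    unfolding has_real_derivative_iff_has_vector_derivative
    by (rule has_vector_derivative_transform_within_open[of _ _ _ "- {c}"]) (use assms ln_abs in auto)
  then have "((\<lambda>x. a * of_real (ln \<bar>x - c\<bar>)) has_vector_derivative a * of_real (1 / (x - c))) (at x)"
    by (intro has_vector_derivative_mult_right has_vector_derivative_of_real)
       (simp add: has_real_derivative_iff_has_vector_derivative)
  from field_vector_diff_chain_at[OF this DERIV_exp]
  have "(?exp has_vector_derivative a / of_real (x - c) * ?exp x) (at x)" by (simp add: o_def)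
  then have "((\<lambda>x. abs_pow (x - c) a) has_vector_derivative a / of_real (x - c) * ?exp x) (at x)"
    by (rule has_vector_derivative_transform_within_open[of _ _ _ "- {c}"]) (use assms in \<open>auto simp: abs_pow_def\<close>)
  then show ?thesis using assms by (simp add: abs_pow_def)
qed

lemma has_vector_derivative_prod_log:
  fixes f :: "'k \<Rightarrow> real \<Rightarrow> 'b :: real_normed_field"
  assumes "finite S" "\<And>k. k \<in> S \<Longrightarrow> (f k has_vector_derivative g k * f k x) (at x)"
  shows "((\<lambda>x. \<Prod>k\<in>S. f k x) has_vector_derivative ((\<Prod>k\<in>S. f k x) * (\<Sum>k\<in>S. g k))) (at x)"
  using assms
proof (induction S rule: finite_induct)
  case (insert k S)
  have "((\<lambda>x. f k x * (\<Prod>k\<in>S. f k x)) has_vector_derivative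
      f k x * ((\<Prod>k\<in>S. f k x) * (\<Sum>k\<in>S. g k)) + g k * f k x * (\<Prod>k\<in>S. f k x)) (at x)"
    using insert by (intro has_vector_derivative_mult) auto
  then show ?case using insert.hyps by (simp add: algebra_simps)
qed simp

lemma integral_prod_abs_pow_log_derivative_eq_0:
  fixes c :: "'k \<Rightarrow> real" and \<beta> :: "'k \<Rightarrow> complex"
  assumes L: "finite L" "L \<noteq> {}" and R: "finite R" "R \<noteq> {}" and \<beta>: "\<And>k. k \<in> L \<union> R \<Longrightarrow> Re (\<beta> k) > 0"
  shows "(\<integral>y. indicator {y. (\<forall>k\<in>L. c k \<le> y) \<and> (\<forall>k\<in>R. y \<le> c k)} y *\<^sub>R
      ((\<Prod>k\<in>L\<union>R. abs_pow (y - c k) (\<beta> k)) * (\<Sum>k\<in>L\<union>R. \<beta> k / of_real (y - c k))) \<partial>lborel) = 0"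
proof -
  define lo hi where "lo = Max (c ` L)" and "hi = Min (c ` R)"
  define F where "F y = (\<Prod>k\<in>L\<union>R. abs_pow (y - c k) (\<beta> k))" for y
  have "lo \<le> y \<longleftrightarrow> (\<forall>k\<in>L. c k \<le> y)" "y \<le> hi \<longleftrightarrow> (\<forall>k\<in>R. y \<le> c k)" for y
    unfolding lo_def hi_def using L R by (simp_all)
  then have "{y. (\<forall>k\<in>L. c k \<le> y) \<and> (\<forall>k\<in>R. y \<le> c k)} = {lo..hi}" by auto
  moreover have "(\<integral>y. indicator {lo..hi} y *\<^sub>R (F y * (\<Sum>k\<in>L\<union>R. \<beta> k / of_real (y - c k))) \<partial>lborel) = 0"
  proof (rule integral_indicator_vector_derivative_eq_0)
    show "continuous_on {lo..hi} F" unfolding F_def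
      using \<beta> by (intro continuous_on_prod continuous_on_compose2[OF continuous_on_abs_pow[of _ UNIV]]
          continuous_intros) auto
    have "lo \<in> c ` L" "hi \<in> c ` R" unfolding lo_def hi_def using L R by (intro Max_in Min_in; simp)+
    then show "F lo = 0" "F hi = 0" unfolding F_def using L R by (auto intro!: prod_zero)
    fix x assume x: "x \<in> {lo<..<hi}"
    have "x \<noteq> c k" if "k \<in> L \<union> R" for k
    proof -
      have "c k \<le> lo \<or> hi \<le> c k" using that L R by (auto simp: lo_def hi_def)
      then show ?thesis using x by auto
    qed
    then show "(F has_vector_derivative F x * (\<Sum>k\<in>L\<union>R. \<beta> k / of_real (x - c k))) (at x)"
      unfolding F_def using L R by (intro has_vector_derivative_prod_log abs_pow_has_vector_derivative) auto
  qed
  ultimately show ?thesis by (simp only: F_def)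
qed

lemma nn_integral_abs_powr_symmetric_interval_le:
  assumes "a > 0" "L \<ge> 0"
  shows "(\<integral>\<^sup>+t. ennreal (indicator {-L..L} t * \<bar>t\<bar> powr (a - 1)) \<partial>lborel) \<le> ennreal (2 * (L powr a / a))"
proof -
  let ?g = "\<lambda>t. indicator {0..L} t * t powr (a - 1)"
  have "((\<lambda>t. if t \<in> {0..L} then t powr (a - 1) else 0) has_integral (L powr a / a)) UNIV"
    unfolding has_integral_restrict_UNIV using has_integral_powr_from_0[of "a - 1" L] assms by simp
  then have "(?g has_integral (L powr a / a)) UNIV"
    by (rule has_integral_eq[rotated]) (auto simp: indicator_def)
  then have right: "(\<integral>\<^sup>+t. ennreal (?g t) \<partial>lborel) = ennreal (L powr a / a)"
    by (intro nn_integral_has_integral_lborel) auto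
  then have left: "(\<integral>\<^sup>+t. ennreal (?g (- t)) \<partial>lborel) = ennreal (L powr a / a)"
    using nn_integral_real_affine[of "\<lambda>t. ennreal (?g t)" "-1" 0] by simp
  have "(\<integral>\<^sup>+t. ennreal (indicator {-L..L} t * \<bar>t\<bar> powr (a - 1)) \<partial>lborel)
      \<le> (\<integral>\<^sup>+t. ennreal (?g t) + ennreal (?g (- t)) \<partial>lborel)"
    by (rule nn_integral_mono) (auto simp: indicator_def abs_real_def)
  also have "\<dots> = ennreal (L powr a / a) + ennreal (L powr a / a)"
    by (subst nn_integral_add) (auto simp: left right)
  also have "\<dots> = ennreal (2 * (L powr a / a))" using assms by (simp flip: ennreal_plus)
  finally show ?thesis .
qed

lemma nn_integral_abs_diff_powr_le:
  assumes "a > 0" "c \<in> {A..B}"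
  shows "(\<integral>\<^sup>+t. ennreal (indicator {A..B} t * \<bar>t - c\<bar> powr (a - 1)) \<partial>lborel) \<le> ennreal (2 * ((B - A) powr a / a))"
proof -
  let ?g = "\<lambda>t. indicator {-(B - A)..B - A} t * \<bar>t\<bar> powr (a - 1)"
  have "(\<integral>\<^sup>+t. ennreal (indicator {A..B} t * \<bar>t - c\<bar> powr (a - 1)) \<partial>lborel) \<le> (\<integral>\<^sup>+t. ennreal (?g (t - c)) \<partial>lborel)"
    using assms by (intro nn_integral_mono) (auto simp: indicator_def)
  also have "\<dots> = (\<integral>\<^sup>+t. ennreal (?g t) \<partial>lborel)"
    using nn_integral_real_affine[of "\<lambda>t. ennreal (?g t)" 1 "- c"] by simp
  also have "\<dots> \<le> ennreal (2 * ((B - A) powr a / a))"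
    using assms by (intro nn_integral_abs_powr_symmetric_interval_le) auto
  finally show ?thesis .
qed

lemma nn_integral_norm_le_abs_diff_powr:
  fixes F :: "real \<Rightarrow> 'b :: real_normed_vector"
  assumes a: "a > 0" and g: "g \<ge> 0" "c \<notin> {A..B} \<Longrightarrow> g = 0"
    and F: "\<And>y. norm (F y) \<le> g * (indicator {A..B} y * \<bar>y - c\<bar> powr (a - 1))"
  shows "(\<integral>\<^sup>+y. ennreal (norm (F y)) \<partial>lborel) \<le> ennreal (g * (2 * ((B - A) powr a / a)))"
proof -
  let ?e = "\<lambda>y. indicator {A..B} y * \<bar>y - c\<bar> powr (a - 1)"
  have "(\<integral>\<^sup>+y. ennreal (norm (F y)) \<partial>lborel) \<le> (\<integral>\<^sup>+y. ennreal g * ennreal (?e y) \<partial>lborel)"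
    using F g(1) by (intro nn_integral_mono) (auto simp flip: ennreal_mult intro!: ennreal_leI)
  also have "\<dots> = ennreal g * (\<integral>\<^sup>+y. ennreal (?e y) \<partial>lborel)" by (intro nn_integral_cmult) simp
  also have "\<dots> \<le> ennreal g * ennreal (2 * ((B - A) powr a / a))"
    using nn_integral_abs_diff_powr_le[OF a, of c A B] g(2) by (cases "c \<in> {A..B}") (auto simp: mult_left_mono)
  also have "\<dots> = ennreal (g * (2 * ((B - A) powr a / a)))" using a g(1) by (simp add: ennreal_mult[symmetric])
  finally show ?thesis .
qed

lemma integrable_abs_diff_powr:
  assumes "a > 0" "c \<in> {A..B}"
  shows "integrable lborel (\<lambda>t. indicator {A..B} t * \<bar>t - c\<bar> powr (a - 1) :: real)"
proof (rule integrableI_bounded)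
  show "(\<integral>\<^sup>+t. ennreal (norm (indicator {A..B} t * \<bar>t - c\<bar> powr (a - 1))) \<partial>lborel) < \<infinity>"
    using nn_integral_abs_diff_powr_le[OF assms] by (simp add: order_le_less_trans)
qed simp

lemma integrable_Gamma_density:
  assumes "a > 0"
  shows "integrable lborel (\<lambda>t. indicator {0..} t * (t powr (a - 1) * exp (- t)) :: real)"
proof -
  have "((\<lambda>t. if t \<in> {0..} then t powr (a - 1) / exp t else 0) has_integral Gamma a) UNIV"
    unfolding has_integral_restrict_UNIV by (rule Gamma_integral_real[OF assms])
  then have "((\<lambda>t. indicator {0..} t * (t powr (a - 1) * exp (- t))) has_integral Gamma a) UNIV"
    by (rule has_integral_eq[rotated]) (auto simp: indicator_def exp_minus field_simps)
  then have "(\<integral>\<^sup>+t. ennreal (indicator {0..} t * (t powr (a - 1) * exp (- t))) \<partial>lborel) = ennreal (Gamma a)"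
    by (intro nn_integral_has_integral_lborel) auto
  then show ?thesis by (intro integrableI_bounded) auto
qed

lemma one_plus_powr_le:
  fixes t Q :: real
  assumes "t \<ge> 0" "Q \<ge> 0"
  shows "(1 + t) powr Q \<le> 2 powr Q * (1 + t powr Q)"
proof (cases "t \<le> 1")
  case True
  have "(1 + t) powr Q \<le> 2 powr Q" using assms True by (intro powr_mono2) auto
  then show ?thesis by (simp add: distrib_left add_increasing2)
next
  case False
  have "(1 + t) powr Q \<le> (2 * t) powr Q" using assms False by (intro powr_mono2) auto
  also have "\<dots> = 2 powr Q * t powr Q" using False by (simp add: powr_mult)
  also have "\<dots> \<le> 2 powr Q * (1 + t powr Q)" by (intro mult_left_mono) auto
  finally show ?thesis .
qed

text \<open>Dominates the Laguerre weight times the growth of the interaction.\<close>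

definition Gamma_majorant :: "real \<Rightarrow> real \<Rightarrow> real \<Rightarrow> real" where
  "Gamma_majorant a Q t = indicator {0..} t * (t powr (a - 1) * (1 + t) powr Q * exp (- t))"

lemma Gamma_majorant_nonneg: "Gamma_majorant a Q t \<ge> 0"
  by (simp add: Gamma_majorant_def)

lemma Gamma_majorant_mult_powr:
  "t \<ge> 0 \<Longrightarrow> Gamma_majorant a P t * (1 + t) powr Q = Gamma_majorant a (P + Q) t"
  by (simp add: Gamma_majorant_def powr_add mult_ac)

lemma integrable_Gamma_majorant:
  assumes "a > 0" "Q \<ge> 0"
  shows "integrable lborel (Gamma_majorant a Q)"
proof (rule integrable_of_norm_le)
  let ?gamma = "\<lambda>a t :: real. indicator {0..} t * (t powr (a - 1) * exp (- t))"
  show "integrable lborel (\<lambda>t. 2 powr Q * (?gamma a t + ?gamma (a + Q) t))"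
    using assms by (intro integrable_mult_right Bochner_Integration.integrable_add integrable_Gamma_density) auto
  fix t
  have "Gamma_majorant a Q t \<le> 2 powr Q * (?gamma a t + ?gamma (a + Q) t)"
  proof (cases "t \<ge> 0")
    case True
    have "t powr (a - 1) * (1 + t) powr Q * exp (- t) \<le> t powr (a - 1) * (2 powr Q * (1 + t powr Q)) * exp (- t)"
      using one_plus_powr_le[OF True assms(2)] by (intro mult_right_mono mult_left_mono) auto
    also have "\<dots> = 2 powr Q * (t powr (a - 1) * exp (- t) + t powr (a - 1) * t powr Q * exp (- t))"
      by (simp add: algebra_simps)
    also have "t powr (a - 1) * t powr Q = t powr (a + Q - 1)" by (simp add: powr_add[symmetric] algebra_simps)
    finally show ?thesis using True by (simp add: Gamma_majorant_def)
  qed (simp add: Gamma_majorant_def indicator_def)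
  then show "norm (Gamma_majorant a Q t) \<le> 2 powr Q * (?gamma a t + ?gamma (a + Q) t)"
    by (simp add: Gamma_majorant_nonneg)
qed (unfold Gamma_majorant_def, measurable)

section \<open>The weight and its integrability\<close>

definition vandermonde :: "nat \<Rightarrow> complex \<Rightarrow> (nat \<Rightarrow> real) \<Rightarrow> complex" where
  "vandermonde n \<gamma> t = (\<Prod>i=1..n. \<Prod>j\<in>{i<..n}. abs_pow (t j - t i) (2 * \<gamma>))"

definition Psi :: "nat \<Rightarrow> nat \<Rightarrow> (nat \<Rightarrow> real) \<Rightarrow> (nat \<Rightarrow> complex) \<Rightarrow> complex \<Rightarrow> (nat \<Rightarrow> real) \<Rightarrow> complex" where
  "Psi n p z \<alpha> \<gamma> t = (\<Prod>i=1..n. \<Prod>s=1..p. abs_pow (t i - z s) (\<alpha> s)) * vandermonde n \<gamma> t"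

definition pairs_avoiding :: "nat \<Rightarrow> nat \<Rightarrow> (nat \<times> nat) set" where
  "pairs_avoiding n i = {(a, b) \<in> index_pairs n. a \<noteq> i \<and> b \<noteq> i}"

lemma vandermonde_split:
  assumes i: "i \<in> {1..n}"
  shows "vandermonde n \<gamma> t = (\<Prod>j\<in>{1..n}-{i}. abs_pow (t i - t j) (2 * \<gamma>))
    * (\<Prod>(a, b)\<in>pairs_avoiding n i. abs_pow (t b - t a) (2 * \<gamma>))"
proof -
  let ?touching = "{x \<in> index_pairs n. fst x = i \<or> snd x = i}"
  let ?f = "\<lambda>(a, b). abs_pow (t b - t a) (2 * \<gamma>)"
  have "index_pairs n = ?touching \<union> pairs_avoiding n i" "?touching \<inter> pairs_avoiding n i = {}"
    by (auto simp: pairs_avoiding_def)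
  then have "vandermonde n \<gamma> t = prod ?f ?touching * prod ?f (pairs_avoiding n i)"
    unfolding vandermonde_def prod_index_pairs
    by (metis (no_types, lifting) finite_Un finite_index_pairs prod.union_disjoint)
  also have "prod ?f ?touching = (\<Prod>j\<in>{1..n}-{i}. abs_pow (t i - t j) (2 * \<gamma>))"
    by (rule prod.reindex_bij_witness[where i="\<lambda>j. (min i j, max i j)" and j="\<lambda>(a, b). if a = i then b else a"])
       (use i in \<open>auto simp: index_pairs_def min_def max_def abs_pow_diff_commute split: if_splits\<close>)
  finally show ?thesis .
qed

lemma measurable_vandermonde [measurable]: "vandermonde n \<gamma> \<in> borel_measurable (Rn n)"
  unfolding vandermonde_def by measurable

text \<open>The condition on \<open>\<alpha> p\<close> is weaker than in the theorem because Selberg's integral \<open>Selberg n a b\<close>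
  is the case \<open>\<alpha> 2 = b - 1\<close>.\<close>

locale configuration =
  fixes n p :: nat and z :: "nat \<Rightarrow> real" and \<alpha> :: "nat \<Rightarrow> complex" and \<gamma> :: complex
  assumes p_ge_2: "p \<ge> 2"
    and z_less_Suc: "\<And>s. s \<in> {1..<p} \<Longrightarrow> z s < z (s + 1)"
    and Re_alpha_pos: "\<And>s. s \<in> {1..<p} \<Longrightarrow> Re (\<alpha> s) > 0"
    and Re_alpha_last: "Re (\<alpha> p) > - 1"
    and Re_gamma_pos: "Re \<gamma> > 0"
begin

lemma z_less: "1 \<le> i \<Longrightarrow> i < j \<Longrightarrow> j \<le> p \<Longrightarrow> z i < z j"
proof (induction j)
  case (Suc j)
  then show ?case using z_less_Suc[of j] by (cases "i = j") force+
qed simp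

lemma z_le: "1 \<le> i \<Longrightarrow> i \<le> j \<Longrightarrow> j \<le> p \<Longrightarrow> z i \<le> z j"
  using z_less[of i j] by (cases "i = j") auto

lemma z_neq: "i \<in> {1..p} \<Longrightarrow> j \<in> {1..p} \<Longrightarrow> i \<noteq> j \<Longrightarrow> z i \<noteq> z j"
  using z_less[of i j] z_less[of j i] by (cases "i < j") auto

lemma z_first_less_last: "z 1 < z p"
  using z_less[of 1 p] p_ge_2 by auto

lemma z_in_range: "s \<in> {1..p} \<Longrightarrow> z s \<in> {z 1..z p}"
  by (auto intro!: z_le)

lemma abs_diff_z_le: "t \<in> {z 1..z p} \<Longrightarrow> s \<in> {1..p} \<Longrightarrow> \<bar>t - z s\<bar> \<le> z p - z 1"
  using z_in_range[of s] by auto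

lemma atLeastAtMost_p: "{1..p} = insert p {1..<p}"
  using p_ge_2 by auto

lemma prod_last: "(\<Prod>s=1..p. f s) = (\<Prod>s=1..p-1. f s) * f p" for f :: "nat \<Rightarrow> 'a :: comm_monoid_mult"
  using prod.nat_ivl_Suc'[of 1 "p - 1" f] p_ge_2 by (simp add: mult.commute)

lemma sum_last: "(\<Sum>s=1..p. f s) = (\<Sum>s=1..p-1. f s) + f p" for f :: "nat \<Rightarrow> 'a :: comm_monoid_add"
  using sum.nat_ivl_Suc'[of 1 "p - 1" f] p_ge_2 by (simp add: add.commute)

definition in_cell :: "(nat \<Rightarrow> nat) \<Rightarrow> (nat \<Rightarrow> real) \<Rightarrow> bool" where
  "in_cell l t \<longleftrightarrow> (\<forall>i\<in>{1..n}. z (site l i) \<le> t i \<and> t i \<le> z (site l i + 1)) \<and> mono_on {1..n} t"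

lemma in_cell_bounds: "in_cell l t \<Longrightarrow> i \<in> {1..n} \<Longrightarrow> z (site l i) \<le> t i \<and> t i \<le> z (site l i + 1)"
  by (simp add: in_cell_def)

lemma in_cell_mono: "in_cell l t \<Longrightarrow> i \<in> {1..n} \<Longrightarrow> j \<in> {1..n} \<Longrightarrow> i \<le> j \<Longrightarrow> t i \<le> t j"
  unfolding in_cell_def by (blast dest: mono_onD)

lemma in_cell_range:
  assumes l: "l \<in> Zset n (p - 1)" and t: "in_cell l t" and i: "i \<in> {1..n}"
  shows "t i \<in> {z 1..z p}"
proof -
  have "site l i \<in> {1..p-1}" by (rule site_range[OF l i])
  then have "z 1 \<le> z (site l i)" "z (site l i + 1) \<le> z p" using p_ge_2 by (auto intro!: z_le)
  then show ?thesis using in_cell_bounds[OF t i] by auto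
qed

lemma Uset_mono_on_Gam:
  assumes t: "t \<in> Uset n p z l" and s: "s \<in> {1..p-1}"
  shows "mono_on (Gam l s) t"
proof (rule mono_onI)
  fix i j assume "i \<in> Gam l s" "j \<in> Gam l s" "i \<le> j"
  from this(3,2) show "t i \<le> t j"
  proof (induction j rule: dec_induct)
    case (step m)
    have "m \<in> {psum l (s - 1) + 1..<psum l s}" using step \<open>i \<in> Gam l s\<close> by (auto simp: Gam_def)
    then have "t m \<le> t (m + 1)" using t s unfolding Uset_def by blast
    moreover have "m \<in> Gam l s" using step \<open>i \<in> Gam l s\<close> by (auto simp: Gam_def)
    ultimately show ?case using step.IH by simp
  qed simp
qed

lemma Uset_iff_in_cell:
  assumes l: "l \<in> Zset n (p - 1)"
  shows "t \<in> Uset n p z l \<longleftrightarrow> in_cell l t"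
proof
  assume t: "t \<in> Uset n p z l"
  have bounds: "z (site l i) \<le> t i" "t i \<le> z (site l i + 1)" if i: "i \<in> {1..n}" for i
    using t site_range[OF l i] Gam_eq_site[OF l site_range[OF l i]] i unfolding Uset_def by auto
  have "mono_on {1..n} t"
  proof (rule mono_onI)
    fix i j assume ij: "i \<in> {1..n}" "j \<in> {1..n}" "i \<le> j"
    show "t i \<le> t j"
    proof (cases "site l i = site l j")
      case True
      then show ?thesis
        using mono_onD[OF Uset_mono_on_Gam[OF t site_range[OF l ij(1)]]] ij
          Gam_eq_site[OF l site_range[OF l ij(1)]] by simp
    next
      case False
      then have "site l i < site l j" using site_mono[OF l, of i j] ij by simp
      then have "z (site l i + 1) \<le> z (site l j)" using site_range[OF l ij(2)] by (intro z_le) auto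
      then show ?thesis using bounds[OF ij(1)] bounds[OF ij(2)] by linarith
    qed
  qed
  then show "in_cell l t" using bounds by (simp add: in_cell_def)
next
  assume t: "in_cell l t"
  show "t \<in> Uset n p z l" unfolding Uset_def
  proof (intro CollectI ballI conjI)
    fix s j assume s: "s \<in> {1..p - 1}" and "j \<in> Gam l s"
    then have "j \<in> {1..n}" "site l j = s" using Gam_eq_site[OF l s] by auto
    then show "z s \<le> t j" "t j \<le> z (s + 1)" using in_cell_bounds[OF t] by auto
  next
    fix s j assume s: "s \<in> {1..p - 1}" and "j \<in> {psum l (s - 1) + 1..<psum l s}"
    then have "j \<in> Gam l s" "j + 1 \<in> Gam l s" by (auto simp: Gam_def)
    then show "t j \<le> t (j + 1)" using Gam_eq_site[OF l s] by (intro in_cell_mono[OF t]) auto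
  qed
qed

definition cell_weight :: "(nat \<Rightarrow> nat) \<Rightarrow> (nat \<Rightarrow> real) \<Rightarrow> complex" where
  "cell_weight l t = (if in_cell l t then Psi n p z \<alpha> \<gamma> t else 0)"

definition point_weight :: "real \<Rightarrow> complex" where
  "point_weight t = (\<Prod>s=1..p. abs_pow (t - z s) (\<alpha> s))"

lemma Psi_eq: "Psi n p z \<alpha> \<gamma> t = (\<Prod>i=1..n. point_weight (t i)) * vandermonde n \<gamma> t"
  by (simp add: Psi_def point_weight_def)

lemma measurable_in_cell [measurable]: "Measurable.pred (Rn n) (in_cell l)"
proof -
  have "Measurable.pred (Rn n) (\<lambda>t. \<forall>i\<in>{1..n}. z (site l i) \<le> t i \<and> t i \<le> z (site l i + 1))"
    by (rule measurable_Rn_ball) measurable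
  then show ?thesis unfolding in_cell_def by (intro pred_intros_logic(3) measurable_Rn_mono_on)
qed

lemma measurable_Psi [measurable]: "Psi n p z \<alpha> \<gamma> \<in> borel_measurable (Rn n)"
  unfolding Psi_def by measurable

lemma measurable_cell_weight [measurable]: "cell_weight l \<in> borel_measurable (Rn n)"
  unfolding cell_weight_def by measurable

lemma point_weight_z: "s \<in> {1..p} \<Longrightarrow> point_weight (z s) = 0"
  unfolding point_weight_def by (intro prod_zero) auto

lemma norm_point_weight: "norm (point_weight t) = (\<Prod>s=1..p. \<bar>t - z s\<bar> powr Re (\<alpha> s))"
  by (simp add: point_weight_def prod_norm[symmetric] norm_abs_pow)

lemma measurable_point_weight [measurable]: "point_weight \<in> borel_measurable borel"
  unfolding point_weight_def by measurable

definition pole_sum :: "real \<Rightarrow> real" where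
  "pole_sum t = 1 + (\<Sum>s=1..<p. 1 / \<bar>t - z s\<bar>)"

definition majorant :: "real \<Rightarrow> real" where
  "majorant t = indicator {z 1..z p} t * (norm (point_weight t) * pole_sum t)"

lemma pole_sum_ge_1: "pole_sum t \<ge> 1"
  unfolding pole_sum_def by (simp add: sum_nonneg)

lemma majorant_nonneg: "majorant t \<ge> 0"
  unfolding majorant_def using pole_sum_ge_1[of t] by (auto intro!: mult_nonneg_nonneg)

lemma measurable_majorant [measurable]: "majorant \<in> borel_measurable borel"
  unfolding majorant_def pole_sum_def by measurable

end

lemma powr_between_le:
  fixes x :: real
  assumes "0 < d" "d \<le> x" "x \<le> L"
  shows "x powr e \<le> d powr e + L powr e"
proof (cases "e \<ge> 0")
  case True
  then have "x powr e \<le> L powr e" using assms by (intro powr_mono2) auto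
  then show ?thesis by (simp add: add_increasing)
next
  case False
  then have "x powr e \<le> d powr e" using assms by (intro powr_mono2') auto
  then show ?thesis by (simp add: add_increasing2)
qed

lemma abs_diff_powr_mult_le:
  fixes a b t :: real
  assumes "a < b" "\<bar>t - a\<bar> \<le> L" "\<bar>t - b\<bar> \<le> L" and d: "d = (b - a) / 2"
  shows "\<bar>t - a\<bar> powr A * \<bar>t - b\<bar> powr B
    \<le> (d powr A + L powr A) * \<bar>t - b\<bar> powr B + (d powr B + L powr B) * \<bar>t - a\<bar> powr A"
proof (cases "d \<le> \<bar>t - a\<bar>")
  case True
  then have "\<bar>t - a\<bar> powr A \<le> d powr A + L powr A" using assms by (intro powr_between_le) auto
  then have "\<bar>t - a\<bar> powr A * \<bar>t - b\<bar> powr B \<le> (d powr A + L powr A) * \<bar>t - b\<bar> powr B"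
    by (intro mult_right_mono) auto
  then show ?thesis by (simp add: add_increasing2)
next
  case False
  then have "\<bar>t - a\<bar> < d" by simp
  moreover have "b - a = 2 * d" "b - t \<le> \<bar>t - b\<bar>" "t - a \<le> \<bar>t - a\<bar>" by (simp_all add: d)
  ultimately have "d \<le> \<bar>t - b\<bar>" by linarith
  then have "\<bar>t - b\<bar> powr B \<le> d powr B + L powr B" using assms by (intro powr_between_le) auto
  then have "\<bar>t - a\<bar> powr A * \<bar>t - b\<bar> powr B \<le> \<bar>t - a\<bar> powr A * (d powr B + L powr B)"
    by (intro mult_left_mono) auto
  then show ?thesis by (simp add: add_increasing mult.commute)
qed

lemma integrable_abs_diff_powr_mult:
  fixes a b c e :: real
  assumes ab: "a < b" "a \<in> {c..e}" "b \<in> {c..e}" and "A > -1" "B > -1"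
  shows "integrable lborel (\<lambda>t. indicator {c..e} t * (\<bar>t - a\<bar> powr A * \<bar>t - b\<bar> powr B))"
proof -
  define d L where "d = (b - a) / 2" and "L = e - c"
  let ?bound = "\<lambda>t. (d powr A + L powr A) * (indicator {c..e} t * \<bar>t - b\<bar> powr (B + 1 - 1))
       + (d powr B + L powr B) * (indicator {c..e} t * \<bar>t - a\<bar> powr (A + 1 - 1))"
  have "integrable lborel ?bound"
    using assms
    by (intro integrable_mult_right Bochner_Integration.integrable_add integrable_abs_diff_powr) auto
  then show ?thesis
  proof (rule integrable_of_norm_le)
    show "norm (indicator {c..e} t * (\<bar>t - a\<bar> powr A * \<bar>t - b\<bar> powr B)) \<le> ?bound t" for t
      using ab abs_diff_powr_mult_le[OF ab(1) _ _ d_def, of t L A B]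
      by (cases "t \<in> {c..e}") (auto simp: L_def)
  qed simp
qed

context configuration
begin

lemma norm_point_weight_div_le:
  assumes s: "s \<in> {1..<p}" and t: "t \<in> {z 1..z p}"
  shows "norm (point_weight t) * (1 / \<bar>t - z s\<bar>)
    \<le> (\<Prod>r\<in>{1..p}-{s,p}. (z p - z 1) powr Re (\<alpha> r)) * (\<bar>t - z s\<bar> powr (Re (\<alpha> s) - 1) * \<bar>t - z p\<bar> powr Re (\<alpha> p))"
proof (cases "t = z s")
  case True
  then show ?thesis by simp
next
  case False
  let ?f = "\<lambda>r. \<bar>t - z r\<bar> powr Re (\<alpha> r)"
  have "{1..p} = insert s (insert p ({1..p} - {s, p}))" using s by auto
  then have "norm (point_weight t) = prod ?f (insert s (insert p ({1..p} - {s, p})))"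
    unfolding norm_point_weight by (rule arg_cong)
  also have "\<dots> = ?f s * (?f p * prod ?f ({1..p} - {s, p}))" using s by simp
  finally have "norm (point_weight t) * (1 / \<bar>t - z s\<bar>)
      = prod ?f ({1..p} - {s, p}) * (\<bar>t - z s\<bar> powr (Re (\<alpha> s) - 1) * \<bar>t - z p\<bar> powr Re (\<alpha> p))"
    using False by (simp add: powr_diff)
  moreover have "prod ?f ({1..p} - {s, p}) \<le> (\<Prod>r\<in>{1..p}-{s,p}. (z p - z 1) powr Re (\<alpha> r))"
    using abs_diff_z_le[OF t] Re_alpha_pos
    by (intro prod_mono conjI powr_ge_zero powr_mono2) (force intro: less_imp_le)+
  ultimately show ?thesis by (simp add: mult_right_mono)
qed

lemma integrable_point_weight_div:
  assumes s: "s \<in> {1..<p}"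
  shows "integrable lborel (\<lambda>t. indicator {z 1..z p} t * (norm (point_weight t) * (1 / \<bar>t - z s\<bar>)))"
proof -
  let ?C = "\<Prod>r\<in>{1..p}-{s,p}. (z p - z 1) powr Re (\<alpha> r)"
  let ?g = "\<lambda>t. indicator {z 1..z p} t * (\<bar>t - z s\<bar> powr (Re (\<alpha> s) - 1) * \<bar>t - z p\<bar> powr Re (\<alpha> p))"
  have "integrable lborel (\<lambda>t. ?C * ?g t)"
    using z_less[of s p] z_in_range[of s] z_in_range[of p] s Re_alpha_pos[OF s] Re_alpha_last
    by (intro integrable_mult_right integrable_abs_diff_powr_mult) auto
  then show ?thesis
  proof (rule integrable_of_norm_le)
    show "norm (indicator {z 1..z p} t * (norm (point_weight t) * (1 / \<bar>t - z s\<bar>))) \<le> ?C * ?g t" for t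
      using norm_point_weight_div_le[OF s, of t] by (cases "t \<in> {z 1..z p}") auto
  qed simp
qed

lemma norm_point_weight_le_pole:
  assumes t: "t \<in> {z 1..z p}"
  shows "norm (point_weight t) \<le> (z p - z 1) * (norm (point_weight t) * (1 / \<bar>t - z 1\<bar>))"
proof (cases "t = z 1")
  case True
  then show ?thesis using point_weight_z[of 1] p_ge_2 by simp
next
  case False
  then have "norm (point_weight t) * 1 \<le> norm (point_weight t) * ((z p - z 1) / \<bar>t - z 1\<bar>)"
    using t by (intro mult_left_mono) auto
  then show ?thesis by (simp add: mult_ac)
qed

lemma integrable_majorant: "integrable lborel majorant"
proof -
  let ?g = "\<lambda>s t. indicator {z 1..z p} t * (norm (point_weight t) * (1 / \<bar>t - z s\<bar>))"
  have "1 \<in> {1..<p}" using p_ge_2 by simp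
  then have "integrable lborel (\<lambda>t. (z p - z 1) * ?g 1 t + (\<Sum>s=1..<p. ?g s t))"
    by (intro Bochner_Integration.integrable_add integrable_mult_right Bochner_Integration.integrable_sum
        integrable_point_weight_div)
  then show ?thesis
  proof (rule integrable_of_norm_le)
    have "majorant t \<le> (z p - z 1) * ?g 1 t + (\<Sum>s=1..<p. ?g s t)" for t
      using norm_point_weight_le_pole[of t]
      by (cases "t \<in> {z 1..z p}") (simp_all add: majorant_def pole_sum_def distrib_left sum_distrib_left)
    then show "norm (majorant t) \<le> (z p - z 1) * ?g 1 t + (\<Sum>s=1..<p. ?g s t)" for t
      using majorant_nonneg[of t] by simp
  qed simp
qed

definition admissible :: "(real \<Rightarrow> complex) \<Rightarrow> bool" where
  "admissible h \<longleftrightarrow> h \<in> borel_measurable borel \<and> (\<exists>C\<ge>0. \<forall>t\<in>{z 1..z p}. norm (h t) \<le> C * pole_sum t)"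

lemma admissibleE:
  assumes "admissible h"
  obtains C where "C \<ge> 0" "\<And>t. t \<in> {z 1..z p} \<Longrightarrow> norm (h t) \<le> C * pole_sum t"
  using assms by (auto simp: admissible_def)

lemma admissible_measurable: "admissible h \<Longrightarrow> h \<in> borel_measurable borel"
  by (simp add: admissible_def)

lemma admissible_const: "admissible (\<lambda>t. c)"
proof -
  have "norm c \<le> norm c * pole_sum t" for t
    using mult_left_mono[OF pole_sum_ge_1[of t], of "norm c"] by simp
  then show ?thesis unfolding admissible_def by (auto intro!: exI[of _ "norm c"])
qed

lemma admissible_add:
  assumes f: "admissible f" and g: "admissible g"
  shows "admissible (\<lambda>t. f t + g t)"
proof -
  obtain C where C: "C \<ge> 0" "\<And>t. t \<in> {z 1..z p} \<Longrightarrow> norm (f t) \<le> C * pole_sum t"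
    using admissibleE[OF f] by blast
  obtain D where D: "D \<ge> 0" "\<And>t. t \<in> {z 1..z p} \<Longrightarrow> norm (g t) \<le> D * pole_sum t"
    using admissibleE[OF g] by blast
  have "norm (f t + g t) \<le> (C + D) * pole_sum t" if "t \<in> {z 1..z p}" for t
    using norm_triangle_ineq[of "f t" "g t"] C(2)[OF that] D(2)[OF that] by (simp add: distrib_right)
  then show ?thesis using f g C(1) D(1) unfolding admissible_def by (auto intro!: exI[of _ "C + D"])
qed

lemma admissible_mult_bounded:
  assumes f: "admissible f" and g: "g \<in> borel_measurable borel" "\<And>t. t \<in> {z 1..z p} \<Longrightarrow> norm (g t) \<le> B"
  shows "admissible (\<lambda>t. f t * g t)"
proof -
  obtain C where C: "C \<ge> 0" "\<And>t. t \<in> {z 1..z p} \<Longrightarrow> norm (f t) \<le> C * pole_sum t"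
    using admissibleE[OF f] by blast
  have "norm (f t * g t) \<le> (C * \<bar>B\<bar>) * pole_sum t" if "t \<in> {z 1..z p}" for t
  proof -
    have "norm (f t * g t) \<le> (C * pole_sum t) * \<bar>B\<bar>"
      unfolding norm_mult using C(1) C(2)[OF that] g(2)[OF that] pole_sum_ge_1[of t]
      by (intro mult_mono) auto
    then show ?thesis by (simp add: mult_ac)
  qed
  then show ?thesis using f g(1) C(1) unfolding admissible_def by (auto intro!: exI[of _ "C * \<bar>B\<bar>"])
qed

lemma admissible_scale: "admissible f \<Longrightarrow> admissible (\<lambda>t. c * f t)"
  using admissible_mult_bounded[of f "\<lambda>_. c" "norm c"] by (simp add: mult.commute)

lemma admissible_sum: "(\<And>i. i \<in> I \<Longrightarrow> admissible (f i)) \<Longrightarrow> admissible (\<lambda>t. \<Sum>i\<in>I. f i t)"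
  by (induction I rule: infinite_finite_induct) (auto intro: admissible_add admissible_const)

lemma admissible_pole: "s \<in> {1..<p} \<Longrightarrow> admissible (\<lambda>t. 1 / of_real (t - z s))"
proof -
  assume s: "s \<in> {1..<p}"
  have "norm (1 / of_real (t - z s) :: complex) \<le> 1 * pole_sum t" for t
  proof -
    have "1 / \<bar>t - z s\<bar> \<le> (\<Sum>s=1..<p. 1 / \<bar>t - z s\<bar>)" using s by (intro member_le_sum) auto
    then show ?thesis by (simp add: pole_sum_def norm_divide del: of_real_diff)
  qed
  then show ?thesis unfolding admissible_def by (auto intro!: exI[of _ 1])
qed

lemma admissible_family_bound:
  assumes h: "\<And>i. i \<in> I \<Longrightarrow> admissible (h i)"
  obtains C where "\<And>i. i \<in> I \<Longrightarrow> C i \<ge> 0"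
    "\<And>i t. i \<in> I \<Longrightarrow> t \<in> {z 1..z p} \<Longrightarrow> norm (point_weight t) * norm (h i t) \<le> C i * majorant t"
proof -
  have "\<forall>i\<in>I. \<exists>C. C \<ge> 0 \<and> (\<forall>t\<in>{z 1..z p}. norm (h i t) \<le> C * pole_sum t)"
    using h unfolding admissible_def by blast
  from bchoice[OF this] obtain C
    where C: "\<forall>i\<in>I. C i \<ge> 0 \<and> (\<forall>t\<in>{z 1..z p}. norm (h i t) \<le> C i * pole_sum t)" ..
  have "norm (point_weight t) * norm (h i t) \<le> C i * majorant t" if "i \<in> I" "t \<in> {z 1..z p}" for i t
  proof -
    have "norm (point_weight t) * norm (h i t) \<le> norm (point_weight t) * (C i * pole_sum t)"
      using C that by (intro mult_left_mono) auto
    also have "\<dots> = C i * majorant t" using that by (simp add: majorant_def)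
    finally show ?thesis .
  qed
  then show ?thesis using C that by blast
qed

lemma norm_abs_pow_diff_le:
  assumes "x \<in> {z 1..z p}" "y \<in> {z 1..z p}"
  shows "norm (abs_pow (x - y) (2 * \<gamma>)) \<le> (z p - z 1) powr (2 * Re \<gamma>)"
  unfolding norm_abs_pow using assms Re_gamma_pos by (auto intro!: powr_mono2)

lemma norm_vandermonde_le:
  assumes "\<And>i. i \<in> {1..n} \<Longrightarrow> t i \<in> {z 1..z p}"
  shows "norm (vandermonde n \<gamma> t) \<le> (\<Prod>i=1..n. \<Prod>j\<in>{i<..n}. (z p - z 1) powr (2 * Re \<gamma>))"
  unfolding vandermonde_def prod_norm[symmetric]
  by (intro prod_mono conjI norm_abs_pow_diff_le prod_nonneg norm_ge_zero assms) auto

lemma integrable_cell_weight_prod: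
  assumes l: "l \<in> Zset n (p - 1)" and h: "\<And>i. i \<in> {1..n} \<Longrightarrow> admissible (h i)"
  shows "integrable (Rn n) (\<lambda>t. cell_weight l t * (\<Prod>i=1..n. h i (t i)))"
proof -
  obtain C where C: "\<And>i. i \<in> {1..n} \<Longrightarrow> C i \<ge> 0"
    "\<And>i t. i \<in> {1..n} \<Longrightarrow> t \<in> {z 1..z p} \<Longrightarrow> norm (point_weight t) * norm (h i t) \<le> C i * majorant t"
    using admissible_family_bound[of "{1..n}" h] h by blast
  let ?B = "\<Prod>i=1..n. \<Prod>j\<in>{i<..n}. (z p - z 1) powr (2 * Re \<gamma>)"
  have B: "?B \<ge> 0" by (intro prod_nonneg) auto
  have "integrable (Rn n) (\<lambda>t. ?B * (\<Prod>i=1..n. C i * majorant (t i)))"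
    by (intro integrable_mult_right lborel_product.product_integrable_prod integrable_majorant) auto
  then show ?thesis
  proof (rule integrable_of_norm_le)
    have "(\<lambda>t. \<Prod>i=1..n. h i (t i)) \<in> borel_measurable (Rn n)"
      by (intro measurable_Rn_prod admissible_measurable h) auto
    then show "(\<lambda>t. cell_weight l t * (\<Prod>i=1..n. h i (t i))) \<in> borel_measurable (Rn n)" by measurable
    fix t
    show "norm (cell_weight l t * (\<Prod>i=1..n. h i (t i))) \<le> ?B * (\<Prod>i=1..n. C i * majorant (t i))"
    proof (cases "in_cell l t")
      case True
      then have t: "t i \<in> {z 1..z p}" if "i \<in> {1..n}" for i using in_cell_range[OF l] that by auto
      have "norm (cell_weight l t * (\<Prod>i=1..n. h i (t i)))
          = norm (vandermonde n \<gamma> t) * (\<Prod>i=1..n. norm (point_weight (t i)) * norm (h i (t i)))"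
        using True by (simp add: cell_weight_def Psi_eq norm_mult prod_norm prod.distrib)
      also have "\<dots> \<le> ?B * (\<Prod>i=1..n. C i * majorant (t i))"
      proof (rule mult_mono)
        show "(\<Prod>i=1..n. norm (point_weight (t i)) * norm (h i (t i))) \<le> (\<Prod>i=1..n. C i * majorant (t i))"
          using t C(2) by (intro prod_mono conjI) auto
      qed (auto intro!: norm_vandermonde_le[OF t, simplified] t prod_nonneg)
      finally show ?thesis .
    next
      case False
      have "0 \<le> ?B * (\<Prod>i=1..n. C i * majorant (t i))"
        using C(1) majorant_nonneg B by (intro mult_nonneg_nonneg[OF B] prod_nonneg ballI mult_nonneg_nonneg)
      then show ?thesis using False by (simp add: cell_weight_def)
    qed
  qed
qed

lemma point_weight_mult_bounded:
  obtains B where "B \<ge> 0" "\<And>t. t \<in> {z 1..z p} \<Longrightarrow> norm (point_weight t * of_real (t - z p)) \<le> B"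
proof
  let ?L = "z p - z 1"
  let ?B = "?L powr (Re (\<alpha> p) + 1) * (\<Prod>s=1..<p. ?L powr Re (\<alpha> s))"
  show "?B \<ge> 0" by (intro mult_nonneg_nonneg prod_nonneg) auto
  fix t assume t: "t \<in> {z 1..z p}"
  have "norm (point_weight t * of_real (t - z p))
      = \<bar>t - z p\<bar> powr (Re (\<alpha> p) + 1) * (\<Prod>s=1..<p. \<bar>t - z s\<bar> powr Re (\<alpha> s))"
    unfolding norm_mult norm_point_weight norm_of_real atLeastAtMost_p by (simp add: powr_add mult_ac)
  also have "\<dots> \<le> ?B"
    using abs_diff_z_le[OF t] Re_alpha_pos Re_alpha_last p_ge_2
    by (intro mult_mono prod_mono conjI powr_mono2 powr_ge_zero prod_nonneg) (auto intro: less_imp_le)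
  finally show "norm (point_weight t * of_real (t - z p)) \<le> ?B" .
qed

lemma norm_cell_weight_pair_pole_le:
  assumes l: "l \<in> Zset n (p - 1)" and i: "i \<in> {1..n}" and j: "j \<in> {1..n} - {i}"
    and B: "B \<ge> 0" "\<And>t. t \<in> {z 1..z p} \<Longrightarrow> norm (point_weight t * of_real (t - z p)) \<le> B"
    and C: "\<And>k. k \<in> {1..n} - {i} \<Longrightarrow> C k \<ge> 0"
      "\<And>k t. k \<in> {1..n} - {i} \<Longrightarrow> t \<in> {z 1..z p} \<Longrightarrow> norm (point_weight t) * norm (h k t) \<le> C k * majorant t"
    and L: "L = (z p - z 1) powr (2 * Re \<gamma>)"
  shows "norm (cell_weight l t * (\<Prod>k\<in>{1..n}-{i}. h k (t k)) * (of_real (t i - z p) / of_real (t i - t j)))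
    \<le> B * (\<Prod>k\<in>{1..n}-{i}. C k * majorant (t k)) * (indicator {z 1..z p} (t i) * \<bar>t i - t j\<bar> powr (2 * Re \<gamma> - 1))
      * (\<Prod>k\<in>{1..n}-{i}-{j}. L) * (\<Prod>(a, b)\<in>pairs_avoiding n i. L)" (is "_ \<le> ?bound")
proof (cases "in_cell l t")
  case False
  have "?bound \<ge> 0" using B(1) C(1) majorant_nonneg L by (auto intro!: mult_nonneg_nonneg prod_nonneg)
  then show ?thesis using False by (simp add: cell_weight_def)
next
  case True
  let ?I = "{1..n} - {i}"
  let ?pow = "\<lambda>x. norm (abs_pow x (2 * \<gamma>))"
  from True have t: "t k \<in> {z 1..z p}" if "k \<in> {1..n}" for k using in_cell_range[OF l] that by auto
  have L0: "L \<ge> 0" by (simp add: L)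
  have "Psi n p z \<alpha> \<gamma> t = point_weight (t i) * (\<Prod>k\<in>?I. point_weight (t k)) *
      (abs_pow (t i - t j) (2 * \<gamma>) * (\<Prod>k\<in>?I-{j}. abs_pow (t i - t k) (2 * \<gamma>))
       * (\<Prod>(a, b)\<in>pairs_avoiding n i. abs_pow (t b - t a) (2 * \<gamma>)))"
    unfolding Psi_eq vandermonde_split[OF i] using i j by (simp add: prod.remove)
  then have "norm (cell_weight l t * (\<Prod>k\<in>?I. h k (t k)) * (of_real (t i - z p) / of_real (t i - t j)))
      = norm (point_weight (t i) * of_real (t i - z p)) * (\<Prod>k\<in>?I. norm (point_weight (t k)) * norm (h k (t k)))
        * (?pow (t i - t j) / \<bar>t i - t j\<bar>) * (\<Prod>k\<in>?I-{j}. ?pow (t i - t k))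
        * (\<Prod>(a, b)\<in>pairs_avoiding n i. ?pow (t b - t a))"
    using True
    by (simp add: cell_weight_def norm_mult norm_divide prod_norm[symmetric] prod.distrib case_prod_beta mult_ac
        del: of_real_diff)
  also have "?pow (t i - t j) / \<bar>t i - t j\<bar> = indicator {z 1..z p} (t i) * \<bar>t i - t j\<bar> powr (2 * Re \<gamma> - 1)"
    using t[OF i] by (cases "t i = t j") (auto simp: norm_abs_pow powr_diff)
  also have "norm (point_weight (t i) * of_real (t i - z p))
      * (\<Prod>k\<in>?I. norm (point_weight (t k)) * norm (h k (t k)))
        * (indicator {z 1..z p} (t i) * \<bar>t i - t j\<bar> powr (2 * Re \<gamma> - 1)) * (\<Prod>k\<in>?I-{j}. ?pow (t i - t k))
        * (\<Prod>(a, b)\<in>pairs_avoiding n i. ?pow (t b - t a)) \<le> ?bound"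
  proof (intro mult_mono)
    show "(\<Prod>k\<in>?I. norm (point_weight (t k)) * norm (h k (t k))) \<le> (\<Prod>k\<in>?I. C k * majorant (t k))"
      using C(2) t by (intro prod_mono conjI) auto
    show "(\<Prod>k\<in>?I-{j}. ?pow (t i - t k)) \<le> (\<Prod>k\<in>?I-{j}. L)"
      unfolding L using t i by (intro prod_mono conjI norm_abs_pow_diff_le) auto
    show "(\<Prod>(a, b)\<in>pairs_avoiding n i. ?pow (t b - t a)) \<le> (\<Prod>(a, b)\<in>pairs_avoiding n i. L)"
      unfolding case_prod_beta L
      by (intro prod_mono conjI norm_abs_pow_diff_le t) (auto simp: pairs_avoiding_def index_pairs_def)
  qed (use B C(1) t[OF i] L0 majorant_nonneg in \<open>auto intro!: mult_nonneg_nonneg prod_nonneg\<close>)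
  finally show ?thesis .
qed

lemma integrable_cell_weight_pair_pole:
  assumes l: "l \<in> Zset n (p - 1)" and i: "i \<in> {1..n}" and j: "j \<in> {1..n} - {i}"
    and h: "\<And>k. k \<in> {1..n} - {i} \<Longrightarrow> admissible (h k)"
  shows "integrable (Rn n) (\<lambda>t. cell_weight l t * (\<Prod>k\<in>{1..n}-{i}. h k (t k))
      * (of_real (t i - z p) / of_real (t i - t j)))" (is "integrable _ ?f")
proof -
  let ?I = "{1..n} - {i}"
  obtain B where B: "B \<ge> 0" "\<And>t. t \<in> {z 1..z p} \<Longrightarrow> norm (point_weight t * of_real (t - z p)) \<le> B"
    using point_weight_mult_bounded by blast
  obtain C where C: "\<And>k. k \<in> ?I \<Longrightarrow> C k \<ge> 0"
    "\<And>k t. k \<in> ?I \<Longrightarrow> t \<in> {z 1..z p} \<Longrightarrow> norm (point_weight t) * norm (h k t) \<le> C k * majorant t"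
    using admissible_family_bound[of ?I h] h by blast
  define L where "L = (z p - z 1) powr (2 * Re \<gamma>)"
  define S where "S = 2 * ((z p - z 1) powr (2 * Re \<gamma>) / (2 * Re \<gamma>))"
  define D where "D = B * (\<Prod>k\<in>?I-{j}. L) * (\<Prod>(a, b)\<in>pairs_avoiding n i. L)"
  define g where "g x = D * (\<Prod>k\<in>?I. C k * majorant (x k))" for x :: "nat \<Rightarrow> real"
  have D: "D \<ge> 0" unfolding D_def using B(1) by (auto intro!: mult_nonneg_nonneg prod_nonneg simp: L_def)
  have S: "S \<ge> 0" using Re_gamma_pos by (simp add: S_def)
  have g: "g x \<ge> 0" for x
    unfolding g_def using C(1) majorant_nonneg D by (intro mult_nonneg_nonneg prod_nonneg) auto
  show ?thesis
  proof (rule integrable_Rn_by_section[OF i])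
    have "(\<lambda>t. \<Prod>k\<in>?I. h k (t k)) \<in> borel_measurable (Rn n)"
      by (intro measurable_Rn_prod admissible_measurable h) auto
    moreover have "(\<lambda>t. t i) \<in> borel_measurable (Rn n)" "(\<lambda>t. t j) \<in> borel_measurable (Rn n)"
      using i j by (auto intro: measurable_Rn_component)
    ultimately show "?f \<in> borel_measurable (Rn n)" by measurable
    show "integrable (PiM ?I (\<lambda>_. lborel)) (\<lambda>x. g x * S)" unfolding g_def
      by (intro integrable_mult_left integrable_mult_right lborel_product.product_integrable_prod
          integrable_majorant) auto
    show "g x * S \<ge> 0" for x using g S by simp
    fix x :: "nat \<Rightarrow> real"
    show "(\<integral>\<^sup>+y. ennreal (norm (?f (x(i := y)))) \<partial>lborel) \<le> ennreal (g x * S)"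
      unfolding S_def
    proof (rule nn_integral_norm_le_abs_diff_powr)
      have "(\<Prod>k\<in>?I. C k * majorant ((x(i := y)) k)) = (\<Prod>k\<in>?I. C k * majorant (x k))" for y
        by (intro prod.cong refl) auto
      then show "norm (?f (x(i := y))) \<le> g x * (indicator {z 1..z p} y * \<bar>y - x j\<bar> powr (2 * Re \<gamma> - 1))" for y
        using norm_cell_weight_pair_pole_le[OF l i j B C L_def, where t="x(i := y)"] j
        by (simp add: g_def D_def mult_ac del: of_real_diff)
      assume "x j \<notin> {z 1..z p}"
      then have "(\<Prod>k\<in>?I. C k * majorant (x k)) = 0"
        using j by (intro prod_zero) (auto simp: majorant_def intro!: bexI[of _ j])
      then show "g x = 0" unfolding g_def by (simp only: mult_zero_right)
    qed (use Re_gamma_pos g in auto)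
  qed
qed

end

section \<open>Integration by parts\<close>

context configuration
begin

abbreviation shifted :: "nat \<Rightarrow> nat \<Rightarrow> complex" where
  "shifted K \<equiv> \<alpha>(p := \<alpha> p + of_nat K)"

lemma configuration_shifted: "configuration p z (shifted K) \<gamma>"
  by standard (use p_ge_2 z_less_Suc Re_alpha_pos Re_alpha_last Re_gamma_pos in auto)

lemma prod_abs_pow_shifted:
  assumes "t \<le> z p"
  shows "(\<Prod>s=1..p. abs_pow (t - z s) (shifted K s)) = point_weight t * of_real ((z p - t) ^ K)"
  using assms unfolding point_weight_def atLeastAtMost_p
  by (simp add: abs_pow_add_of_nat abs_if)

lemma Psi_shifted:
  assumes "\<And>i. i \<in> {1..n} \<Longrightarrow> t i \<le> z p"
  shows "Psi n p z (shifted K) \<gamma> t = Psi n p z \<alpha> \<gamma> t * (\<Prod>i=1..n. of_real ((z p - t i) ^ K))"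
proof -
  have "(\<Prod>i=1..n. \<Prod>s=1..p. abs_pow (t i - z s) (shifted K s))
      = (\<Prod>i=1..n. point_weight (t i) * of_real ((z p - t i) ^ K))"
    by (intro prod.cong refl prod_abs_pow_shifted assms)
  then show ?thesis unfolding Psi_eq Psi_def[of n p z "shifted K"] prod.distrib by (simp only: mult_ac)
qed

text \<open>\<open>ibp_factor t + 2 \<gamma> \<Sum> (t - z\<^sub>p) / (t - t\<^sub>j)\<close> is the logarithmic derivative of \<open>(t\<^sub>i - z\<^sub>p) Psi\<close> in \<open>t\<^sub>i\<close> at
  \<open>t\<^sub>i = t\<close>, multiplied by \<open>t - z\<^sub>p\<close>.\<close>

definition ibp_factor :: "real \<Rightarrow> complex" where
  "ibp_factor t = 1 + (\<Sum>s=1..p. \<alpha> s * of_real (t - z p) / of_real (t - z s))"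

lemma admissible_ibp_factor: "admissible ibp_factor"
proof -
  have "admissible (\<lambda>t. \<alpha> s * of_real (t - z p) / of_real (t - z s))" if s: "s \<in> {1..p}" for s
  proof (cases "s = p")
    case True
    have "norm (\<alpha> p * of_real (t - z p) / of_real (t - z p)) \<le> norm (\<alpha> p) * pole_sum t" for t
      using mult_left_mono[OF pole_sum_ge_1[of t], of "norm (\<alpha> p)"] pole_sum_ge_1[of t]
      by (cases "t = z p") (simp_all add: norm_divide norm_mult del: of_real_diff)
    then show ?thesis unfolding admissible_def True
      by (intro conjI exI[of _ "norm (\<alpha> p)"] ballI norm_ge_zero) measurable
  next
    case False
    have "norm (\<alpha> s * of_real (t - z p) :: complex) \<le> norm (\<alpha> s) * (z p - z 1)" if "t \<in> {z 1..z p}" for t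
      unfolding norm_mult norm_of_real using that by (intro mult_left_mono) auto
    from admissible_mult_bounded[OF admissible_pole _ this, of s] show ?thesis
      using s False by (simp add: mult.commute)
  qed
  then show ?thesis unfolding ibp_factor_def by (intro admissible_add admissible_const admissible_sum)
qed

text \<open>With all coordinates but the \<open>i\<close>-th one fixed, \<open>t\<^sub>i\<close> ranges over an interval whose ends are points
  \<open>z\<^sub>s\<close> (left summand) or coordinates \<open>t\<^sub>j\<close> (right summand).\<close>

definition lower_barriers :: "(nat \<Rightarrow> nat) \<Rightarrow> nat \<Rightarrow> (nat + nat) set" where
  "lower_barriers l i = {1..site l i} <+> {j \<in> {1..n} - {i}. j < i}"

definition upper_barriers :: "(nat \<Rightarrow> nat) \<Rightarrow> nat \<Rightarrow> (nat + nat) set" where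
  "upper_barriers l i = {site l i + 1..p} <+> {j \<in> {1..n} - {i}. i < j}"

definition barrier :: "(nat \<Rightarrow> real) \<Rightarrow> nat + nat \<Rightarrow> real" where
  "barrier x = case_sum z x"

definition barrier_exponent :: "nat + nat \<Rightarrow> complex" where
  "barrier_exponent = case_sum (shifted 1) (\<lambda>_. 2 * \<gamma>)"

definition in_section :: "(nat \<Rightarrow> nat) \<Rightarrow> nat \<Rightarrow> (nat \<Rightarrow> real) \<Rightarrow> real \<Rightarrow> bool" where
  "in_section l i x y \<longleftrightarrow> (\<forall>k\<in>lower_barriers l i. barrier x k \<le> y) \<and> (\<forall>k\<in>upper_barriers l i. y \<le> barrier x k)"

lemma in_section_iff:
  "in_section l i x y \<longleftrightarrow>
    (\<forall>s\<in>{1..site l i}. z s \<le> y) \<and> (\<forall>j\<in>{1..n} - {i}. j < i \<longrightarrow> x j \<le> y) \<and>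
    (\<forall>s\<in>{site l i + 1..p}. y \<le> z s) \<and> (\<forall>j\<in>{1..n} - {i}. i < j \<longrightarrow> y \<le> x j)"
  unfolding in_section_def lower_barriers_def upper_barriers_def barrier_def Plus_def ball_Un by auto

lemma in_cell_imp_in_section:
  assumes l: "l \<in> Zset n (p - 1)" and i: "i \<in> {1..n}" and u: "in_cell l (x(i := y))"
  shows "in_section l i x y"
proof -
  have s: "site l i \<in> {1..p-1}" by (rule site_range[OF l i])
  have y: "z (site l i) \<le> y" "y \<le> z (site l i + 1)" using in_cell_bounds[OF u i] by auto
  have "z r \<le> y" if "r \<in> {1..site l i}" for r using that s by (intro order_trans[OF _ y(1)] z_le) auto
  moreover have "y \<le> z r" if "r \<in> {site l i + 1..p}" for r
    using that s by (intro order_trans[OF y(2)] z_le) auto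
  moreover have "x j \<le> y" if "j \<in> {1..n} - {i}" "j < i" for j using in_cell_mono[OF u _ i, of j] that by auto
  moreover have "y \<le> x j" if "j \<in> {1..n} - {i}" "i < j" for j using in_cell_mono[OF u i, of j] that by auto
  ultimately show ?thesis by (simp add: in_section_iff)
qed

lemma in_section_imp_in_cell:
  assumes l: "l \<in> Zset n (p - 1)" and i: "i \<in> {1..n}" and u: "in_cell l (x(i := y0))" and y: "in_section l i x y"
  shows "in_cell l (x(i := y))"
  unfolding in_cell_def
proof (intro conjI ballI mono_onI)
  have s: "site l i \<in> {1..p-1}" by (rule site_range[OF l i])
  fix k assume k: "k \<in> {1..n}"
  have "z (site l i) \<le> y" "y \<le> z (site l i + 1)" using y s unfolding in_section_iff by auto
  then show "z (site l k) \<le> (x(i := y)) k" "(x(i := y)) k \<le> z (site l k + 1)"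
    using in_cell_bounds[OF u k] by (cases "k = i"; simp)+
next
  fix k j assume kj: "k \<in> {1..n}" "j \<in> {1..n}" "k \<le> j"
  have "(x(i := y0)) k \<le> (x(i := y0)) j" using in_cell_mono[OF u kj] .
  then show "(x(i := y)) k \<le> (x(i := y)) j"
    using kj y unfolding in_section_iff by (cases "k = i"; cases "j = i") auto
qed

lemma barriers_Un:
  assumes "l \<in> Zset n (p - 1)" "i \<in> {1..n}"
  shows "lower_barriers l i \<union> upper_barriers l i = {1..p} <+> ({1..n} - {i})"
  using site_range[OF assms] by (auto simp: lower_barriers_def upper_barriers_def)

lemma prod_barriers:
  assumes "y \<le> z p"
  shows "(\<Prod>k\<in>{1..p} <+> ({1..n} - {i}). abs_pow (y - barrier x k) (barrier_exponent k))
    = point_weight y * of_real (z p - y) * (\<Prod>j\<in>{1..n}-{i}. abs_pow (y - x j) (2 * \<gamma>))"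
  using prod_abs_pow_shifted[OF assms, of 1]
  by (subst prod.Plus) (simp_all add: barrier_def barrier_exponent_def)

lemma sum_barriers:
  "(\<Sum>k\<in>{1..p} <+> ({1..n} - {i}). barrier_exponent k / of_real (y - barrier x k))
    = 1 / of_real (y - z p) + (\<Sum>s=1..p. \<alpha> s / of_real (y - z s)) + (\<Sum>j\<in>{1..n}-{i}. 2 * \<gamma> / of_real (y - x j))"
proof -
  have "(\<Sum>s=1..p. shifted 1 s / of_real (y - z s)) = (\<Sum>s=1..p. \<alpha> s / of_real (y - z s)) + 1 / of_real (y - z p)"
    unfolding atLeastAtMost_p by (simp add: add_divide_distrib)
  then show ?thesis by (subst sum.Plus) (simp_all add: barrier_def barrier_exponent_def add.commute)
qed

lemma point_weight_mult_ibp_factor: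
  "point_weight y * (ibp_factor y + 2 * \<gamma> * (\<Sum>j\<in>J. of_real (y - z p) / of_real (y - x j)))
    = - (point_weight y * of_real (z p - y)
      * (1 / of_real (y - z p) + (\<Sum>s=1..p. \<alpha> s / of_real (y - z s)) + (\<Sum>j\<in>J. 2 * \<gamma> / of_real (y - x j))))"
proof (cases "y = z p")
  case True
  then show ?thesis using point_weight_z[of p] p_ge_2 by simp
next
  case False
  define w :: complex where "w = of_real (y - z p)"
  have w: "w \<noteq> 0" "of_real (z p - y) = - w" using False by (simp_all add: w_def)
  have "ibp_factor y = w * (1 / w + (\<Sum>s=1..p. \<alpha> s / of_real (y - z s)))"
    unfolding ibp_factor_def w_def[symmetric] using w(1)
    by (simp add: distrib_left sum_distrib_left mult_ac del: of_real_diff)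
  moreover have "2 * \<gamma> * (\<Sum>j\<in>J. w / of_real (y - x j)) = w * (\<Sum>j\<in>J. 2 * \<gamma> / of_real (y - x j))"
    by (simp add: sum_distrib_left mult_ac del: of_real_diff)
  ultimately show ?thesis unfolding w(2) w_def[symmetric] by (simp add: algebra_simps)
qed

lemma Psi_section:
  assumes i: "i \<in> {1..n}"
  shows "Psi n p z \<alpha> \<gamma> (x(i := y)) = point_weight y * (\<Prod>j\<in>{1..n}-{i}. abs_pow (y - x j) (2 * \<gamma>))
    * ((\<Prod>k\<in>{1..n}-{i}. point_weight (x k)) * (\<Prod>(a, b)\<in>pairs_avoiding n i. abs_pow (x b - x a) (2 * \<gamma>)))"
proof -
  have "(\<Prod>k=1..n. point_weight ((x(i := y)) k)) = point_weight y * (\<Prod>k\<in>{1..n}-{i}. point_weight ((x(i := y)) k))"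
    using i by (simp add: prod.remove)
  also have "(\<Prod>k\<in>{1..n}-{i}. point_weight ((x(i := y)) k)) = (\<Prod>k\<in>{1..n}-{i}. point_weight (x k))"
    by (intro prod.cong refl) auto
  moreover have "(\<Prod>j\<in>{1..n}-{i}. abs_pow ((x(i := y)) i - (x(i := y)) j) (2 * \<gamma>))
      = (\<Prod>j\<in>{1..n}-{i}. abs_pow (y - x j) (2 * \<gamma>))"
    by (intro prod.cong refl) auto
  moreover have "(\<Prod>(a, b)\<in>pairs_avoiding n i. abs_pow ((x(i := y)) b - (x(i := y)) a) (2 * \<gamma>))
      = (\<Prod>(a, b)\<in>pairs_avoiding n i. abs_pow (x b - x a) (2 * \<gamma>))"
    by (intro prod.cong refl) (auto simp: pairs_avoiding_def)
  ultimately show ?thesis unfolding Psi_eq vandermonde_split[OF i] by (simp only: mult_ac)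
qed

lemma integral_barriers_eq_0:
  assumes l: "l \<in> Zset n (p - 1)" and i: "i \<in> {1..n}"
  defines "barriers \<equiv> lower_barriers l i \<union> upper_barriers l i"
  shows "(\<integral>y. indicator {y. in_section l i x y} y *\<^sub>R
      ((\<Prod>k\<in>barriers. abs_pow (y - barrier x k) (barrier_exponent k))
        * (\<Sum>k\<in>barriers. barrier_exponent k / of_real (y - barrier x k))) \<partial>lborel) = 0"
  unfolding in_section_def barriers_def
proof (rule integral_prod_abs_pow_log_derivative_eq_0)
  have "site l i \<in> {1..p-1}" by (rule site_range[OF l i])
  then show "lower_barriers l i \<noteq> {}" "upper_barriers l i \<noteq> {}"
    by (auto simp: lower_barriers_def upper_barriers_def)
  fix k assume "k \<in> lower_barriers l i \<union> upper_barriers l i"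
  then show "Re (barrier_exponent k) > 0"
    unfolding barriers_Un[OF l i] barrier_exponent_def
    using Re_alpha_pos Re_alpha_last Re_gamma_pos by (auto simp: order_le_less)
qed (auto simp: lower_barriers_def upper_barriers_def)

lemma integral_section_eq_0:
  assumes l: "l \<in> Zset n (p - 1)" and i: "i \<in> {1..n}"
  shows "(\<integral>y. cell_weight l (x(i := y))
      * (ibp_factor y + 2 * \<gamma> * (\<Sum>j\<in>{1..n}-{i}. of_real (y - z p) / of_real (y - x j))) \<partial>lborel) = 0"
    (is "(\<integral>y. ?f y \<partial>lborel) = 0")
proof (cases "\<exists>y. in_cell l (x(i := y))")
  case False
  then show ?thesis by (simp add: cell_weight_def)
next
  case True
  let ?I = "{1..n} - {i}" and ?barriers = "lower_barriers l i \<union> upper_barriers l i"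
  let ?F = "\<lambda>y. (\<Prod>k\<in>?barriers. abs_pow (y - barrier x k) (barrier_exponent k))
      * (\<Sum>k\<in>?barriers. barrier_exponent k / of_real (y - barrier x k))"
  define Q where "Q = (\<Prod>k\<in>?I. point_weight (x k)) * (\<Prod>(a, b)\<in>pairs_avoiding n i. abs_pow (x b - x a) (2 * \<gamma>))"
  have in_section: "in_section l i x y \<longleftrightarrow> in_cell l (x(i := y))" for y
    using True in_cell_imp_in_section[OF l i] in_section_imp_in_cell[OF l i] by blast
  have "?f y = - Q * (indicator {y. in_section l i x y} y *\<^sub>R ?F y)" for y
  proof (cases "in_cell l (x(i := y))")
    case False
    then show ?thesis by (simp add: in_section cell_weight_def)
  next
    case True
    then have "y \<le> z p" using in_cell_range[OF l True i] by simp
    note F = prod_barriers[OF this, where i=i and x=x, folded barriers_Un[OF l i]]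
      sum_barriers[where i=i and x=x, folded barriers_Un[OF l i]]
    have "?f y = point_weight y * (ibp_factor y + 2 * \<gamma> * (\<Sum>j\<in>?I. of_real (y - z p) / of_real (y - x j)))
        * (\<Prod>j\<in>?I. abs_pow (y - x j) (2 * \<gamma>)) * Q"
      using True by (simp add: cell_weight_def Psi_section[OF i] Q_def mult_ac del: of_real_diff)
    also have "\<dots> = - Q * ?F y"
      unfolding point_weight_mult_ibp_factor F by (simp only: mult_ac mult_minus_left mult_minus_right)
    also have "?F y = indicator {y. in_section l i x y} y *\<^sub>R ?F y" using True by (simp add: in_section)
    finally show ?thesis .
  qed
  then have "(\<integral>y. ?f y \<partial>lborel) = - Q * (\<integral>y. indicator {y. in_section l i x y} y *\<^sub>R ?F y \<partial>lborel)"
    by (simp only: integral_mult_right_zero)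
  then show ?thesis by (simp only: integral_barriers_eq_0[OF l i] mult_zero_right)
qed

lemma integrable_ibp:
  assumes l: "l \<in> Zset n (p - 1)" and i: "i \<in> {1..n}"
    and h: "\<And>k. k \<in> {1..n} - {i} \<Longrightarrow> admissible (h k)"
  shows "integrable (Rn n) (\<lambda>t. cell_weight l t * (\<Prod>k\<in>{1..n}-{i}. h k (t k))
      * (ibp_factor (t i) + 2 * \<gamma> * (\<Sum>j\<in>{1..n}-{i}. of_real (t i - z p) / of_real (t i - t j))))"
proof -
  let ?I = "{1..n} - {i}" and ?g = "h(i := ibp_factor)"
  have "integrable (Rn n) (\<lambda>t. cell_weight l t * (\<Prod>k=1..n. ?g k (t k))
     + (\<Sum>j\<in>?I. (2 * \<gamma>) * (cell_weight l t * (\<Prod>k\<in>?I. h k (t k)) * (of_real (t i - z p) / of_real (t i - t j)))))"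
    by (intro Bochner_Integration.integrable_add Bochner_Integration.integrable_sum integrable_mult_right
        integrable_cell_weight_prod[OF l] integrable_cell_weight_pair_pole[OF l i])
       (auto simp: admissible_ibp_factor h)
  moreover have "(\<Prod>k=1..n. ?g k (t k)) = ibp_factor (t i) * (\<Prod>k\<in>?I. h k (t k))" for t
  proof -
    have "(\<Prod>k=1..n. ?g k (t k)) = ?g i (t i) * (\<Prod>k\<in>?I. ?g k (t k))"
      using i by (intro prod.remove) auto
    also have "(\<Prod>k\<in>?I. ?g k (t k)) = (\<Prod>k\<in>?I. h k (t k))" by (intro prod.cong refl) auto
    finally show ?thesis by simp
  qed
  ultimately show ?thesis
    by (simp add: algebra_simps sum_distrib_left del: of_real_diff)
qed

lemma integral_by_parts:
  assumes l: "l \<in> Zset n (p - 1)" and i: "i \<in> {1..n}"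
    and h: "\<And>k. k \<in> {1..n} - {i} \<Longrightarrow> admissible (h k)"
  shows "(\<integral>t. cell_weight l t * (\<Prod>k\<in>{1..n}-{i}. h k (t k))
      * (ibp_factor (t i) + 2 * \<gamma> * (\<Sum>j\<in>{1..n}-{i}. of_real (t i - z p) / of_real (t i - t j))) \<partial>Rn n) = 0"
    (is "(\<integral>t. ?f t \<partial>Rn n) = 0")
proof -
  let ?I = "{1..n} - {i}"
  have insert: "insert i ?I = {1..n}" using i by auto
  have section_0: "(\<integral>y. ?f (x(i := y)) \<partial>lborel) = 0" for x
  proof -
    have "(\<Prod>k\<in>?I. h k ((x(i := y)) k)) = (\<Prod>k\<in>?I. h k (x k))" for y by (intro prod.cong refl) auto
    moreover have "(\<Sum>j\<in>?I. of_real ((x(i := y)) i - z p) / of_real ((x(i := y)) i - (x(i := y)) j))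
        = (\<Sum>j\<in>?I. of_real (y - z p) / (of_real (y - x j) :: complex))" for y
      by (intro sum.cong refl) auto
    ultimately have "?f (x(i := y)) = (\<Prod>k\<in>?I. h k (x k)) * (cell_weight l (x(i := y))
        * (ibp_factor y + 2 * \<gamma> * (\<Sum>j\<in>?I. of_real (y - z p) / of_real (y - x j))))" for y
      by (simp only: fun_upd_same mult_ac)
    then show ?thesis by (simp only: integral_mult_right_zero integral_section_eq_0[OF l i] mult_zero_right)
  qed
  have "(\<integral>t. ?f t \<partial>Rn n) = (\<integral>x. (\<integral>y. ?f (x(i := y)) \<partial>lborel) \<partial>PiM ?I (\<lambda>_. lborel))"
    by (rule lborel_product.product_integral_insert[of ?I i ?f, unfolded insert])
       (use integrable_ibp[OF l i h] in auto)
  then show ?thesis by (simp only: section_0) simp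
qed

end

section \<open>Symmetrised products of letters\<close>

definition symmetrized :: "nat \<Rightarrow> (nat \<Rightarrow> real \<Rightarrow> complex) \<Rightarrow> (nat \<Rightarrow> real) \<Rightarrow> complex" where
  "symmetrized n h t = (\<Sum>\<sigma> | \<sigma> permutes {1..n}. \<Prod>j=1..n. h j (t (\<sigma> j)))"

lemma symmetrized_permute:
  assumes \<pi>: "\<pi> permutes {1..n}" and eq: "\<And>j. j \<in> {1..n} \<Longrightarrow> h j = h' (\<pi> j)"
  shows "symmetrized n h t = symmetrized n h' t"
proof -
  have "symmetrized n h' t = (\<Sum>\<sigma> | \<sigma> permutes {1..n}. \<Prod>j=1..n. h' j (t ((\<sigma> \<circ> inv \<pi>) j)))"
    unfolding symmetrized_def by (rule sum_permutations_compose_right[OF permutes_inv[OF \<pi>]])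
  also have "\<dots> = (\<Sum>\<sigma> | \<sigma> permutes {1..n}. \<Prod>j=1..n. h j (t (\<sigma> j)))"
  proof (rule sum.cong[OF refl])
    fix \<sigma>
    have "(\<Prod>j=1..n. h' j (t ((\<sigma> \<circ> inv \<pi>) j))) = (\<Prod>j=1..n. h' (\<pi> j) (t ((\<sigma> \<circ> inv \<pi>) (\<pi> j))))"
      using prod.permute[OF \<pi>, of "\<lambda>j. h' j (t ((\<sigma> \<circ> inv \<pi>) j))"] by (simp add: o_def)
    also have "\<dots> = (\<Prod>j=1..n. h j (t (\<sigma> j)))"
      using permutes_inverses[OF \<pi>] by (intro prod.cong refl) (simp add: eq)
    finally show "(\<Prod>j=1..n. h' j (t ((\<sigma> \<circ> inv \<pi>) j))) = (\<Prod>j=1..n. h j (t (\<sigma> j)))" .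
  qed
  finally show ?thesis by (simp add: symmetrized_def)
qed

lemma prod_permuted_eq_inv:
  assumes "\<sigma> permutes {1..n}"
  shows "(\<Prod>j=1..n. h j (t (\<sigma> j))) = (\<Prod>i=1..n. h (inv \<sigma> i) (t i))"
  using prod.permute[OF assms, of "\<lambda>i. h (inv \<sigma> i) (t i)"] permutes_inverses[OF assms] by (simp add: o_def)

lemma prod_upd_first:
  fixes h :: "nat \<Rightarrow> real \<Rightarrow> complex"
  assumes "n \<ge> 1"
  shows "(\<Prod>j=1..n. (h(1 := f)) j (t (\<sigma> j))) = f (t (\<sigma> 1)) * (\<Prod>j=2..n. h j (t (\<sigma> j)))"
proof -
  have "{1..n} = insert 1 {2..n}" using assms by auto
  then have "(\<Prod>j=1..n. (h(1 := f)) j (t (\<sigma> j))) = f (t (\<sigma> 1)) * (\<Prod>j=2..n. (h(1 := f)) j (t (\<sigma> j)))" by simp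
  also have "(\<Prod>j=2..n. (h(1 := f)) j (t (\<sigma> j))) = (\<Prod>j=2..n. h j (t (\<sigma> j)))" by (intro prod.cong refl) auto
  finally show ?thesis .
qed

lemma prod_upd_two:
  fixes h :: "nat \<Rightarrow> real \<Rightarrow> complex"
  assumes r: "r \<in> {2..n}"
  shows "(\<Prod>j=1..n. (h(1 := f, r := g)) j (t (\<sigma> j)))
    = f (t (\<sigma> 1)) * g (t (\<sigma> r)) * (\<Prod>j\<in>{2..n}-{r}. h j (t (\<sigma> j)))"
proof -
  have twist: "h(1 := f, r := g) = (h(r := g))(1 := f)" using r by (auto simp: fun_eq_iff)
  have "(\<Prod>j=2..n. (h(r := g)) j (t (\<sigma> j))) = (h(r := g)) r (t (\<sigma> r)) * (\<Prod>j\<in>{2..n}-{r}. (h(r := g)) j (t (\<sigma> j)))"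
    using r by (intro prod.remove) auto
  also have "(\<Prod>j\<in>{2..n}-{r}. (h(r := g)) j (t (\<sigma> j))) = (\<Prod>j\<in>{2..n}-{r}. h j (t (\<sigma> j)))"
    by (intro prod.cong refl) auto
  finally show ?thesis unfolding twist using r by (subst prod_upd_first) auto
qed

lemma ex_image_mset_mset_set:
  assumes "finite A" "card A = size N"
  shows "\<exists>w. image_mset w (mset_set A) = N"
  using assms
proof (induction A arbitrary: N rule: finite_induct)
  case (insert a A)
  then obtain b N' where N: "N = add_mset b N'" by (cases N) auto
  then obtain w where w: "image_mset w (mset_set A) = N'" using insert by auto
  have "image_mset (w(a := b)) (mset_set A) = N'"
    unfolding w[symmetric] using insert.hyps by (intro image_mset_cong) auto
  then show ?case
    by (intro exI[of _ "w(a := b)"]) (simp only: mset_set.insert[OF insert.hyps] image_mset_add_mset N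
      fun_upd_same)
qed auto

lemma image_mset_upd_first:
  fixes n :: nat
  assumes "image_mset w (mset_set {2..n}) = N" "n \<ge> 1"
  shows "image_mset (w(1 := a)) (mset_set {1..n}) = add_mset a N"
proof -
  have "{1..n} = insert 1 {2..n}" using assms(2) by auto
  moreover have "image_mset (w(1 := a)) (mset_set {2..n}) = N"
    unfolding assms(1)[symmetric] by (intro image_mset_cong) auto
  ultimately show ?thesis by (simp del: fun_upd_apply) simp
qed

lemma image_mset_upd_two:
  fixes n :: nat
  assumes w: "image_mset w (mset_set {2..n}) = N" and r: "r \<in> {2..n}"
  shows "image_mset (w(1 := a, r := b)) (mset_set {1..n}) = add_mset a (add_mset b (N - {#w r#}))"
proof -
  have split: "mset_set {2..n} = add_mset r (mset_set ({2..n} - {r}))"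
    using r mset_set.remove[of "{2..n}" r] by simp
  have "image_mset (w(r := b)) (mset_set ({2..n} - {r})) = image_mset w (mset_set ({2..n} - {r}))"
    by (intro image_mset_cong) auto
  also have "\<dots> = N - {#w r#}" using w unfolding split by auto
  finally have "image_mset (w(r := b)) (mset_set {2..n}) = add_mset b (N - {#w r#})"
    unfolding split by (simp del: fun_upd_apply) simp
  from image_mset_upd_first[OF this, of a] show ?thesis
    using r by (subst fun_upd_twist) auto
qed

lemma sum_sum_list_swap: "(\<Sum>s\<in>S. \<Sum>x\<leftarrow>xs. f s x) = (\<Sum>x\<leftarrow>xs. \<Sum>s\<in>S. f s x)"
  for f :: "'s \<Rightarrow> 'x \<Rightarrow> 'a :: comm_monoid_add"
  by (induction xs) (simp_all add: sum.distrib)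

lemma integral_sum_list:
  fixes f :: "'x \<Rightarrow> 'a \<Rightarrow> 'b :: {banach, second_countable_topology}"
  assumes "\<And>x. x \<in> set xs \<Longrightarrow> integrable M (f x)"
  shows "(\<integral>t. (\<Sum>x\<leftarrow>xs. f x t) \<partial>M) = (\<Sum>x\<leftarrow>xs. \<integral>t. f x t \<partial>M)"
proof -
  have "integrable M (\<lambda>t. \<Sum>x\<leftarrow>xs. f x t) \<and> (\<integral>t. (\<Sum>x\<leftarrow>xs. f x t) \<partial>M) = (\<Sum>x\<leftarrow>xs. \<integral>t. f x t \<partial>M)"
    using assms by (induction xs) auto
  then show ?thesis ..
qed

context configuration
begin

primrec eval_letter :: "letter \<Rightarrow> real \<Rightarrow> complex" where
  "eval_letter LOne = (\<lambda>t. 1)"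
| "eval_letter (LF s) = (\<lambda>t. 1 / of_real (t - z s))"
| "eval_letter (LG s) = (\<lambda>t. of_real (z p - z s) / of_real (t - z s))"
| "eval_letter (LH s) = (\<lambda>t. of_real (z p - t) / of_real (t - z s))"
| "eval_letter (LU s) = (\<lambda>t. of_real (z p - z s) / of_real (t - z s) - of_real (z p - z 1) / of_real (t - z 1))"

lemma eval_LU: "eval_letter (LU s) t = eval_letter (LG s) t - eval_letter (LG 1) t"
  by simp

lemma eval_LH: "t \<noteq> z s \<Longrightarrow> eval_letter (LH s) t = eval_letter (LG s) t - 1"
  by (simp add: field_simps)

lemma admissible_eval_letter: "b \<in> letters (p - 1) \<Longrightarrow> admissible (eval_letter b)"
proof -
  have G: "admissible (eval_letter (LG s))" if "s \<in> {1..<p}" for s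
    using admissible_scale[OF admissible_pole[OF that], of "of_real (z p - z s)"] by simp
  have H: "admissible (eval_letter (LH s))" if "s \<in> {1..<p}" for s
  proof -
    have "norm (of_real (z p - t) :: complex) \<le> z p - z 1" if "t \<in> {z 1..z p}" for t
      unfolding norm_of_real using that by auto
    from admissible_mult_bounded[OF admissible_pole[OF that] _ this] show ?thesis by simp
  qed
  have "1 \<in> {1..<p}" using p_ge_2 by simp
  then have U: "admissible (eval_letter (LU s))" if "s \<in> {1..<p}" for s
    using admissible_add[OF G[OF that] admissible_scale[OF G, of 1 "-1"]]
    unfolding eval_LU[abs_def] by (simp only: mult_minus1 add_uminus_conv_diff)
  assume "b \<in> letters (p - 1)"
  then show ?thesis
    unfolding letters_def using G H U admissible_pole admissible_const[of 1] p_ge_2 by auto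
qed

definition cell_integral :: "(nat \<Rightarrow> nat) \<Rightarrow> (nat \<Rightarrow> real \<Rightarrow> complex) \<Rightarrow> complex" where
  "cell_integral l h = (\<integral>t. cell_weight l t * symmetrized n h t \<partial>Rn n)"

text \<open>The multiset \<open>M\<close> determines its enumeration only up to a permutation, which \<open>symmetrized\<close> ignores.\<close>

definition word_integral :: "letter multiset \<Rightarrow> (nat \<Rightarrow> nat) \<Rightarrow> complex" where
  "word_integral M l = (if l \<in> Zset n (p - 1)
     then cell_integral l (\<lambda>j. eval_letter ((SOME w. image_mset w (mset_set {1..n}) = M) j)) else 0)"

lemma word_integral_image_mset:
  assumes "l \<in> Zset n (p - 1)"
  shows "word_integral (image_mset w (mset_set {1..n})) l = cell_integral l (\<lambda>j. eval_letter (w j))"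
proof -
  define w' where "w' = (SOME w'. image_mset w' (mset_set {1..n}) = image_mset w (mset_set {1..n}))"
  have "image_mset w' (mset_set {1..n}) = image_mset w (mset_set {1..n})"
    unfolding w'_def by (rule someI[of _ w]) simp
  then obtain \<pi> where \<pi>: "\<pi> permutes {1..n}" "\<forall>j\<in>{1..n}. w' j = w (\<pi> j)"
    using image_mset_eq_implies_permutes[of "{1..n}" w' w] by auto
  have "symmetrized n (\<lambda>j. eval_letter (w' j)) t = symmetrized n (\<lambda>j. eval_letter (w j)) t" for t
    using \<pi> by (intro symmetrized_permute[OF \<pi>(1)]) auto
  then show ?thesis
    unfolding word_integral_def w'_def[symmetric] if_P[OF assms] cell_integral_def by (simp only:)
qed

lemma word_integral_add_mset:
  assumes "image_mset w (mset_set {2..n}) = N" "l \<in> Zset n (p - 1)" "n \<ge> 1"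
  shows "word_integral (add_mset a N) l = cell_integral l ((\<lambda>j. eval_letter (w j))(1 := eval_letter a))"
proof -
  have "(\<lambda>j. eval_letter (w j))(1 := eval_letter a) = (\<lambda>j. eval_letter ((w(1 := a)) j))" by auto
  then show ?thesis
    unfolding image_mset_upd_first[OF assms(1,3), symmetric] word_integral_image_mset[OF assms(2)]
    by (rule arg_cong[symmetric])
qed

lemma obtain_word:
  assumes "size N + 1 = n"
  obtains w where "image_mset w (mset_set {2..n}) = N" "\<And>j. j \<in> {2..n} \<Longrightarrow> w j \<in># N"
proof -
  obtain w where "image_mset w (mset_set {2..n}) = N"
    using ex_image_mset_mset_set[of "{2..n}" N] assms by auto
  then show ?thesis by (intro that[of w]) auto
qed

lemma integrable_cell_weight_permuted_prod:
  assumes l: "l \<in> Zset n (p - 1)" and h: "\<And>j. j \<in> {1..n} \<Longrightarrow> admissible (h j)" and \<sigma>: "\<sigma> permutes {1..n}"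
  shows "integrable (Rn n) (\<lambda>t. cell_weight l t * (\<Prod>j=1..n. h j (t (\<sigma> j))))"
  unfolding prod_permuted_eq_inv[OF \<sigma>]
  using permutes_in_image[OF permutes_inv[OF \<sigma>]] by (intro integrable_cell_weight_prod[OF l] h) auto

lemma integrable_cell_weight_symmetrized:
  assumes "l \<in> Zset n (p - 1)" "\<And>j. j \<in> {1..n} \<Longrightarrow> admissible (h j)"
  shows "integrable (Rn n) (\<lambda>t. cell_weight l t * symmetrized n h t)"
  unfolding symmetrized_def sum_distrib_left
  using integrable_cell_weight_permuted_prod[OF assms] by (intro Bochner_Integration.integrable_sum) auto

lemma
  assumes "cell_weight l t \<noteq> 0"
  shows cell_weight_nonzero_imp_neq_z: "i \<in> {1..n} \<Longrightarrow> s \<in> {1..p} \<Longrightarrow> t i \<noteq> z s"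
    and cell_weight_nonzero_imp_neq: "i \<in> {1..n} \<Longrightarrow> j \<in> {1..n} \<Longrightarrow> i \<noteq> j \<Longrightarrow> t i \<noteq> t j"
proof -
  have Psi: "Psi n p z \<alpha> \<gamma> t \<noteq> 0" using assms by (auto simp: cell_weight_def split: if_splits)
  show "t i \<noteq> z s" if "i \<in> {1..n}" "s \<in> {1..p}" using Psi that unfolding Psi_def by auto
  assume i: "i \<in> {1..n}" and j: "j \<in> {1..n}" "i \<noteq> j"
  have "abs_pow (t i - t j) (2 * \<gamma>) \<noteq> 0" using Psi j unfolding Psi_def vandermonde_split[OF i] by auto
  then show "t i \<noteq> t j" by auto
qed

lemma cell_integral_upd_first_sum:
  assumes l: "l \<in> Zset n (p - 1)" and n: "n \<ge> 1" and h: "\<And>j. j \<in> {2..n} \<Longrightarrow> admissible (h j)"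
    and g: "\<And>i. i \<in> I \<Longrightarrow> admissible (g i)"
    and f: "\<And>t. (\<forall>s\<in>{1..p}. t \<noteq> z s) \<Longrightarrow> f t = (\<Sum>i\<in>I. c i * g i t)"
  shows "cell_integral l (h(1 := f)) = (\<Sum>i\<in>I. c i * cell_integral l (h(1 := g i)))"
proof -
  have "cell_weight l t * symmetrized n (h(1 := f)) t
      = (\<Sum>i\<in>I. c i * (cell_weight l t * symmetrized n (h(1 := g i)) t))" for t
  proof (cases "cell_weight l t = 0")
    case nonzero: False
    let ?rest = "\<lambda>\<sigma>. \<Prod>j=2..n. h j (t (\<sigma> j))"
    have "symmetrized n (h(1 := f)) t = (\<Sum>\<sigma> | \<sigma> permutes {1..n}. \<Sum>i\<in>I. c i * (g i (t (\<sigma> 1)) * ?rest \<sigma>))"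
      unfolding symmetrized_def prod_upd_first[OF n]
    proof (rule sum.cong[OF refl])
      fix \<sigma> assume "\<sigma> \<in> {\<sigma>. \<sigma> permutes {1..n}}"
      then have "\<sigma> 1 \<in> {1..n}" using n permutes_in_image[of \<sigma> "{1..n}" 1] by auto
      then have "f (t (\<sigma> 1)) = (\<Sum>i\<in>I. c i * g i (t (\<sigma> 1)))"
        using cell_weight_nonzero_imp_neq_z[OF nonzero] by (intro f) auto
      then show "f (t (\<sigma> 1)) * ?rest \<sigma> = (\<Sum>i\<in>I. c i * (g i (t (\<sigma> 1)) * ?rest \<sigma>))"
        by (simp add: sum_distrib_right mult.assoc)
    qed
    also have "\<dots> = (\<Sum>i\<in>I. c i * symmetrized n (h(1 := g i)) t)"
      unfolding symmetrized_def prod_upd_first[OF n] by (subst sum.swap) (simp add: sum_distrib_left)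
    finally show ?thesis by (simp add: sum_distrib_left mult_ac)
  qed simp
  then have "cell_integral l (h(1 := f))
      = (\<Sum>i\<in>I. \<integral>t. c i * (cell_weight l t * symmetrized n (h(1 := g i)) t) \<partial>Rn n)"
    unfolding cell_integral_def using h g
    by (simp only:) (intro Bochner_Integration.integral_sum integrable_mult_right
        integrable_cell_weight_symmetrized[OF l], auto)
  then show ?thesis unfolding cell_integral_def by (simp only: integral_mult_right_zero)
qed

lemma pair_identity_LG:
  fixes u u' zs zp :: complex
  assumes "u \<noteq> u'" "u \<noteq> zs" "u' \<noteq> zs"
  shows "((u - zp) * ((zp - zs) / (u' - zs)) - (u' - zp) * ((zp - zs) / (u - zs))) / (u - u')
    = (zp - zs) / (u' - zs) + (zp - zs) / (u - zs) - (zp - zs) / (u - zs) * ((zp - zs) / (u' - zs))"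
proof -
  have "u - u' \<noteq> 0" "u - zs \<noteq> 0" "u' - zs \<noteq> 0" using assms by auto
  then show ?thesis by (simp add: divide_simps) (simp add: algebra_simps)
qed

lemma pair_identity:
  assumes b: "b \<in> ibp_letters (p - 1)" and u: "u \<noteq> u'"
    and off: "\<And>s. s \<in> {1..p} \<Longrightarrow> u \<noteq> z s \<and> u' \<noteq> z s"
  shows "(of_real (u - z p) * eval_letter b u' - of_real (u' - z p) * eval_letter b u) / of_real (u - u')
     = (\<Sum>(a, a', c)\<leftarrow>pair_expansion b. c * (eval_letter a u * eval_letter a' u'))"
proof -
  let ?quot = "\<lambda>b. (of_real (u - z p) * eval_letter b u' - of_real (u' - z p) * eval_letter b u)
      / of_real (u - u')"
  have quot_LG: "?quot (LG s)
      = eval_letter (LG s) u' + eval_letter (LG s) u - eval_letter (LG s) u * eval_letter (LG s) u'"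
    if "s \<in> {1..p-1}" for s
  proof -
    have "s \<in> {1..p}" using that by auto
    then show ?thesis
      using off[of s] u pair_identity_LG[of "of_real u" "of_real u'" "of_real (z s)" "of_real (z p)"] by simp
  qed
  consider (LOne) "b = LOne" | (LG) s where "b = LG s" "s \<in> {1..p-1}" | (LU) s where "b = LU s" "s \<in> {1..p-1}"
    using b by (auto simp: ibp_letters_def)
  then show ?thesis
  proof cases
    case LOne
    then show ?thesis using u by (simp add: divide_simps)
  next
    case (LG s)
    then show ?thesis using quot_LG[of s] by (simp del: eval_letter.simps(3) add: algebra_simps)
  next
    case (LU s)
    have "1 \<in> {1..p-1}" using p_ge_2 by auto
    have "?quot (LU s) = ?quot (LG s) - ?quot (LG 1)"
      unfolding eval_LU diff_divide_distrib[symmetric] by (simp only: algebra_simps)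
    also have "\<dots> = (\<Sum>(a, a', c)\<leftarrow>pair_expansion (LU s). c * (eval_letter a u * eval_letter a' u'))"
      unfolding quot_LG[OF LU(2)] quot_LG[OF \<open>1 \<in> {1..p-1}\<close>]
      by (simp del: eval_letter.simps add: eval_LU eval_letter.simps(1) algebra_simps)
    finally show ?thesis unfolding LU(1) .
  qed
qed

definition pair_integrand ::
    "(nat \<Rightarrow> nat) \<Rightarrow> (nat \<Rightarrow> real \<Rightarrow> complex) \<Rightarrow> nat \<Rightarrow> (nat \<Rightarrow> nat) \<Rightarrow> (nat \<Rightarrow> real) \<Rightarrow> complex" where
  "pair_integrand l h r \<sigma> t = cell_weight l t * (\<Prod>j=2..n. h j (t (\<sigma> j)))
     * (of_real (t (\<sigma> 1) - z p) / of_real (t (\<sigma> 1) - t (\<sigma> r)))"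

lemma
  assumes l: "l \<in> Zset n (p - 1)" and n: "n \<ge> 1" and \<sigma>: "\<sigma> permutes {1..n}"
    and h: "\<And>j. j \<in> {2..n} \<Longrightarrow> admissible (h j)"
  shows integrable_pair_integrand: "r \<in> {2..n} \<Longrightarrow> integrable (Rn n) (pair_integrand l h r \<sigma>)"
    and integral_by_parts_permuted:
      "(\<integral>t. cell_weight l t * (\<Prod>j=1..n. (h(1 := ibp_factor)) j (t (\<sigma> j))) \<partial>Rn n)
        + 2 * \<gamma> * (\<Sum>r=2..n. \<integral>t. pair_integrand l h r \<sigma> t \<partial>Rn n) = 0"
proof -
  have first: "\<sigma> 1 \<in> {1..n}" using permutes_in_image[OF \<sigma>] n by auto
  have "bij_betw \<sigma> ({1..n} - {1}) ({1..n} - {\<sigma> 1})"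
    using permutes_imp_bij[OF \<sigma>] n first by (intro bij_betw_DiffI) auto
  moreover have "{1..n} - {1} = {2..n}" by auto
  ultimately have bij: "bij_betw \<sigma> {2..n} ({1..n} - {\<sigma> 1})" by simp
  have inv: "inv \<sigma> (\<sigma> j) = j" for j using permutes_inverses[OF \<sigma>] by simp
  have h_inv: "admissible (h (inv \<sigma> k))" if "k \<in> {1..n} - {\<sigma> 1}" for k
  proof -
    have "k \<in> \<sigma> ` {2..n}" using bij that unfolding bij_betw_def by simp
    then show ?thesis using inv h by auto
  qed
  have prod: "(\<Prod>k\<in>{1..n}-{\<sigma> 1}. h (inv \<sigma> k) (t k)) = (\<Prod>j=2..n. h j (t (\<sigma> j)))" for t
    using prod.reindex_bij_betw[OF bij, of "\<lambda>k. h (inv \<sigma> k) (t k)"] by (simp add: inv)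
  have sum: "(\<Sum>k\<in>{1..n}-{\<sigma> 1}. g k) = (\<Sum>r=2..n. g (\<sigma> r))" for g :: "nat \<Rightarrow> complex"
    using sum.reindex_bij_betw[OF bij, of g] by simp
  show int: "integrable (Rn n) (pair_integrand l h r \<sigma>)" if "r \<in> {2..n}" for r
  proof -
    have "\<sigma> r \<in> {1..n} - {\<sigma> 1}" using bij that unfolding bij_betw_def by blast
    then have "integrable (Rn n) (\<lambda>t. cell_weight l t * (\<Prod>k\<in>{1..n}-{\<sigma> 1}. h (inv \<sigma> k) (t k))
        * (of_real (t (\<sigma> 1) - z p) / of_real (t (\<sigma> 1) - t (\<sigma> r))))"
      by (rule integrable_cell_weight_pair_pole[OF l first]) (rule h_inv)
    then show ?thesis unfolding prod pair_integrand_def[abs_def] .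
  qed
  let ?main = "\<lambda>t. cell_weight l t * (\<Prod>j=1..n. (h(1 := ibp_factor)) j (t (\<sigma> j)))"
  have int_main: "integrable (Rn n) ?main"
    by (rule integrable_cell_weight_permuted_prod[OF l _ \<sigma>]) (auto simp: admissible_ibp_factor h)
  have "0 = (\<integral>t. ?main t + 2 * \<gamma> * (\<Sum>r=2..n. pair_integrand l h r \<sigma> t) \<partial>Rn n)"
    unfolding prod_upd_first[OF n] pair_integrand_def
    using integral_by_parts[OF l first, where h="\<lambda>k. h (inv \<sigma> k)", OF h_inv]
    unfolding prod sum by (simp only: ring_distribs sum_distrib_left mult_ac)
  also have "\<dots> = (\<integral>t. ?main t \<partial>Rn n) + (\<integral>t. 2 * \<gamma> * (\<Sum>r=2..n. pair_integrand l h r \<sigma> t) \<partial>Rn n)"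
    by (intro Bochner_Integration.integral_add int_main integrable_mult_right
      Bochner_Integration.integrable_sum int)
  also have "(\<integral>t. 2 * \<gamma> * (\<Sum>r=2..n. pair_integrand l h r \<sigma> t) \<partial>Rn n)
      = 2 * \<gamma> * (\<Sum>r=2..n. \<integral>t. pair_integrand l h r \<sigma> t \<partial>Rn n)"
    unfolding integral_mult_right_zero by (subst Bochner_Integration.integral_sum, erule int, rule refl)
  finally show "(\<integral>t. ?main t \<partial>Rn n) + 2 * \<gamma> * (\<Sum>r=2..n. \<integral>t. pair_integrand l h r \<sigma> t \<partial>Rn n) = 0" ..
qed

lemma pair_integrand_add_transposed:
  assumes \<sigma>: "\<sigma> permutes {1..n}" and r: "r \<in> {2..n}" and w: "w r \<in> ibp_letters (p - 1)"
  defines "h \<equiv> \<lambda>j. eval_letter (w j)"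
  shows "pair_integrand l h r \<sigma> t + pair_integrand l h r (\<sigma> \<circ> Transposition.transpose 1 r) t
    = (\<Sum>(a, a', c)\<leftarrow>pair_expansion (w r).
        c * (cell_weight l t * (\<Prod>j=1..n. (h(1 := eval_letter a, r := eval_letter a')) j (t (\<sigma> j)))))"
proof (cases "cell_weight l t = 0")
  case True
  have "(\<Sum>(a, a', c)\<leftarrow>xs. 0) = (0 :: complex)" for xs :: "(letter \<times> letter \<times> complex) list"
    by (induction xs) auto
  then show ?thesis using True by (simp add: pair_integrand_def)
next
  case nonzero: False
  let ?\<tau> = "Transposition.transpose 1 r"
  define u u' where "u = t (\<sigma> 1)" and "u' = t (\<sigma> r)"
  define R where "R = (\<Prod>j\<in>{2..n}-{r}. h j (t (\<sigma> j)))"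
  have mem: "\<sigma> 1 \<in> {1..n}" "\<sigma> r \<in> {1..n}" using permutes_in_image[OF \<sigma>] r by auto
  have "\<sigma> 1 \<noteq> \<sigma> r" using r inj_eq[OF permutes_inj[OF \<sigma>], of 1 r] by simp
  then have u: "u \<noteq> u'" unfolding u_def u'_def using cell_weight_nonzero_imp_neq[OF nonzero mem] by simp
  have off: "u \<noteq> z s \<and> u' \<noteq> z s" if "s \<in> {1..p}" for s
    unfolding u_def u'_def using cell_weight_nonzero_imp_neq_z[OF nonzero _ that] mem by auto
  have prod: "(\<Prod>j=2..n. h j (t (\<sigma> j))) = h r u' * R"
    unfolding R_def u'_def using r by (intro prod.remove) auto
  have "(\<Prod>j\<in>{2..n}-{r}. h j (t ((\<sigma> \<circ> ?\<tau>) j))) = R"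
    unfolding R_def by (intro prod.cong refl) (auto simp: Transposition.transpose_def)
  then have prod_transposed: "(\<Prod>j=2..n. h j (t ((\<sigma> \<circ> ?\<tau>) j))) = h r u * R"
    using r by (simp add: prod.remove[of _ r] u_def)
  have flip: "c * (b / - d) = - (c * b / d)" for b c d :: complex by simp
  have "of_real (u' - u) = - (of_real (u - u') :: complex)" by simp
  then have "pair_integrand l h r (\<sigma> \<circ> ?\<tau>) t
      = - (cell_weight l t * (h r u * R) * of_real (u' - z p) / of_real (u - u'))"
    unfolding pair_integrand_def prod_transposed
    unfolding o_apply transpose_apply_first transpose_apply_second u_def[symmetric] u'_def[symmetric]
    by (simp only: flip)
  then have "pair_integrand l h r \<sigma> t + pair_integrand l h r (\<sigma> \<circ> ?\<tau>) t
      = cell_weight l t * ((of_real (u - z p) * h r u' - of_real (u' - z p) * h r u) / of_real (u - u') * R)"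
    unfolding pair_integrand_def prod u_def[symmetric] u'_def[symmetric]
    by (simp add: diff_divide_distrib ring_distribs mult_ac del: of_real_diff)
  also have "\<dots> = (\<Sum>(a, a', c)\<leftarrow>pair_expansion (w r). c * (eval_letter a u * eval_letter a' u'))
      * (cell_weight l t * R)"
    using pair_identity[OF w u off] unfolding h_def by (simp only: mult_ac)
  also have "\<dots> = (\<Sum>(a, a', c)\<leftarrow>pair_expansion (w r).
      c * (cell_weight l t * (\<Prod>j=1..n. (h(1 := eval_letter a, r := eval_letter a')) j (t (\<sigma> j)))))"
    unfolding prod_upd_two[OF r] u_def[symmetric] u'_def[symmetric] R_def[symmetric] sum_list_mult_const[symmetric]
      case_prod_unfold
    by (simp only: mult_ac)
  finally show ?thesis .
qed

lemma sum_pair_integrand: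
  assumes r: "r \<in> {2..n}" and w: "w r \<in> ibp_letters (p - 1)"
  defines "h \<equiv> \<lambda>j. eval_letter (w j)"
  shows "2 * (\<Sum>\<sigma> | \<sigma> permutes {1..n}. pair_integrand l h r \<sigma> t)
    = (\<Sum>(a, a', c)\<leftarrow>pair_expansion (w r).
        c * (cell_weight l t * symmetrized n (h(1 := eval_letter a, r := eval_letter a')) t))"
proof -
  let ?S = "{\<sigma>. \<sigma> permutes {1..n}}" and ?\<tau> = "Transposition.transpose 1 r"
  have "?\<tau> permutes {1..n}" using r by (intro permutes_swap_id) auto
  then have "2 * (\<Sum>\<sigma>\<in>?S. pair_integrand l h r \<sigma> t)
      = (\<Sum>\<sigma>\<in>?S. pair_integrand l h r \<sigma> t + pair_integrand l h r (\<sigma> \<circ> ?\<tau>) t)"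
    using sum_permutations_compose_right[of ?\<tau> "{1..n}" "\<lambda>\<sigma>. pair_integrand l h r \<sigma> t"]
    by (simp add: sum.distrib)
  also have "\<dots> = (\<Sum>\<sigma>\<in>?S. \<Sum>(a, a', c)\<leftarrow>pair_expansion (w r).
      c * (cell_weight l t * (\<Prod>j=1..n. (h(1 := eval_letter a, r := eval_letter a')) j (t (\<sigma> j)))))"
    unfolding h_def using pair_integrand_add_transposed[of _ r w, OF _ r w] by (intro sum.cong refl) simp
  also have "\<dots> = (\<Sum>(a, a', c)\<leftarrow>pair_expansion (w r).
      c * (cell_weight l t * symmetrized n (h(1 := eval_letter a, r := eval_letter a')) t))"
    unfolding sum_sum_list_swap symmetrized_def case_prod_beta sum_distrib_left ..
  finally show ?thesis .
qed

lemma integral_sum_pair_integrand: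
  assumes l: "l \<in> Zset n (p - 1)" and N: "image_mset w (mset_set {2..n}) = N"
    and w: "\<And>j. j \<in> {2..n} \<Longrightarrow> w j \<in> ibp_letters (p - 1)" and r: "r \<in> {2..n}"
  defines "h \<equiv> \<lambda>j. eval_letter (w j)"
  shows "2 * (\<integral>t. (\<Sum>\<sigma> | \<sigma> permutes {1..n}. pair_integrand l h r \<sigma> t) \<partial>Rn n)
    = pair_contribution word_integral (N - {#w r#}) l (w r)"
proof -
  let ?upd = "\<lambda>a a'. h(1 := eval_letter a, r := eval_letter a')"
  have "pair_expansion b \<in> lists (letters (p - 1) \<times> letters (p - 1) \<times> UNIV)" if "b \<in> ibp_letters (p - 1)" for b
    using that p_ge_2 by (auto simp: ibp_letters_def letters_def)
  then have letters: "a \<in> letters (p - 1)" "a' \<in> letters (p - 1)"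
    if "(a, a', c) \<in> set (pair_expansion (w r))" for a a' c
    using w[OF r] that by (auto dest: in_listsD)
  have "integrable (Rn n) (\<lambda>t. cell_weight l t * symmetrized n (?upd a a') t)"
    if "(a, a', c) \<in> set (pair_expansion (w r))" for a a' c
  proof (rule integrable_cell_weight_symmetrized[OF l])
    fix j assume "j \<in> {1..n}"
    then show "admissible (?upd a a' j)"
      using letters[OF that] w[of j] ibp_letters_subset[of "p - 1"]
      by (auto simp: h_def intro!: admissible_eval_letter)
  qed
  then have "(\<integral>t. (\<Sum>(a, a', c)\<leftarrow>pair_expansion (w r). c * (cell_weight l t * symmetrized n (?upd a a') t)) \<partial>Rn n)
      = (\<Sum>(a, a', c)\<leftarrow>pair_expansion (w r). c * cell_integral l (?upd a a'))"
    unfolding case_prod_beta cell_integral_def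
    by (subst integral_sum_list) (auto intro!: integrable_mult_right)
  moreover have "cell_integral l (?upd a a') = word_integral (add_mset a (add_mset a' (N - {#w r#}))) l" for a a'
  proof -
    have "?upd a a' = (\<lambda>j. eval_letter ((w(1 := a, r := a')) j))" by (auto simp: h_def)
    then show ?thesis
      unfolding image_mset_upd_two[OF N r, symmetric] word_integral_image_mset[OF l] by (rule arg_cong)
  qed
  ultimately show ?thesis
    unfolding integral_mult_right_zero[symmetric] h_def sum_pair_integrand[of r w, OF r w[OF r]]
    by (simp add: pair_contribution_def)
qed

lemma cell_integral_ibp_factor:
  assumes l: "l \<in> Zset n (p - 1)" and n: "n \<ge> 1" and N: "image_mset w (mset_set {2..n}) = N"
    and w: "\<And>j. j \<in> {2..n} \<Longrightarrow> w j \<in> ibp_letters (p - 1)"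
  shows "cell_integral l ((\<lambda>j. eval_letter (w j))(1 := ibp_factor))
    + \<gamma> * (\<Sum>b\<in>#N. pair_contribution word_integral (N - {#b#}) l b) = 0"
proof -
  let ?h = "\<lambda>j. eval_letter (w j)" and ?S = "{\<sigma>. \<sigma> permutes {1..n}}"
  let ?main = "\<lambda>\<sigma> t. cell_weight l t * (\<Prod>j=1..n. (?h(1 := ibp_factor)) j (t (\<sigma> j)))"
  have h: "admissible (?h j)" if "j \<in> {2..n}" for j
    using w[OF that] ibp_letters_subset by (intro admissible_eval_letter) auto
  have "cell_integral l (?h(1 := ibp_factor)) = (\<Sum>\<sigma>\<in>?S. \<integral>t. ?main \<sigma> t \<partial>Rn n)"
    unfolding cell_integral_def symmetrized_def sum_distrib_left
    by (rule Bochner_Integration.integral_sum, rule integrable_cell_weight_permuted_prod[OF l])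
       (auto simp: admissible_ibp_factor h)
  moreover have "pair_contribution word_integral (N - {#w r#}) l (w r)
      = 2 * (\<Sum>\<sigma>\<in>?S. \<integral>t. pair_integrand l ?h r \<sigma> t \<partial>Rn n)" if r: "r \<in> {2..n}" for r
  proof -
    have "(\<integral>t. (\<Sum>\<sigma>\<in>?S. pair_integrand l ?h r \<sigma> t) \<partial>Rn n) = (\<Sum>\<sigma>\<in>?S. \<integral>t. pair_integrand l ?h r \<sigma> t \<partial>Rn n)"
      using integrable_pair_integrand[OF l n, where h="?h" and r=r] h r
      by (intro Bochner_Integration.integral_sum) auto
    then show ?thesis using integral_sum_pair_integrand[OF l N w r] by simp
  qed
  then have "(\<Sum>r=2..n. pair_contribution word_integral (N - {#w r#}) l (w r))
      = 2 * (\<Sum>\<sigma>\<in>?S. \<Sum>r=2..n. \<integral>t. pair_integrand l ?h r \<sigma> t \<partial>Rn n)"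
    by (subst sum.swap) (simp add: sum_distrib_left)
  moreover have "(\<Sum>b\<in>#N. pair_contribution word_integral (N - {#b#}) l b)
      = (\<Sum>r=2..n. pair_contribution word_integral (N - {#w r#}) l (w r))"
  proof -
    have "image_mset (\<lambda>b. pair_contribution word_integral (N - {#b#}) l b) N
        = image_mset (\<lambda>r. pair_contribution word_integral (N - {#w r#}) l (w r)) (mset_set {2..n})"
      using N[symmetric] by (metis (no_types, lifting) comp_apply image_mset.comp image_mset_cong)
    then show ?thesis by (simp only: sum_unfold_sum_mset)
  qed
  ultimately have "cell_integral l (?h(1 := ibp_factor))
      + \<gamma> * (\<Sum>b\<in>#N. pair_contribution word_integral (N - {#b#}) l b)
      = (\<Sum>\<sigma>\<in>?S. (\<integral>t. ?main \<sigma> t \<partial>Rn n) + 2 * \<gamma> * (\<Sum>r=2..n. \<integral>t. pair_integrand l ?h r \<sigma> t \<partial>Rn n))"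
    by (simp add: sum.distrib sum_distrib_left mult_ac)
  also have "\<dots> = 0" using integral_by_parts_permuted[OF l n, where h="?h"] h by (intro sum.neutral) auto
  finally show ?thesis .
qed

lemma ibp_factor_eq_letters:
  assumes t: "\<forall>s\<in>{1..p}. t \<noteq> z s"
  shows "ibp_factor t = (1 + (\<Sum>s=1..p. \<alpha> s)) * eval_letter LOne t - (\<Sum>s=1..p-1. \<alpha> s * eval_letter (LG s) t)"
proof -
  have "ibp_factor t = 1 + (\<Sum>s=1..p. \<alpha> s - \<alpha> s * eval_letter (LG s) t)"
    unfolding ibp_factor_def
  proof (intro arg_cong2[of _ _ _ _ "(+)"] refl sum.cong)
    fix s assume "s \<in> {1..p}"
    then have "of_real (t - z s) \<noteq> (0::complex)" using t by auto
    then show "\<alpha> s * of_real (t - z p) / of_real (t - z s) = \<alpha> s - \<alpha> s * eval_letter (LG s) t"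
      by (simp add: field_simps)
  qed
  moreover have "(\<Sum>s=1..p. \<alpha> s * eval_letter (LG s) t) = (\<Sum>s=1..p-1. \<alpha> s * eval_letter (LG s) t)"
    unfolding sum_last by simp
  ultimately show ?thesis by (simp add: sum_subtractf del: eval_letter.simps(3))
qed

lemma word_integral_by_parts:
  assumes N: "size N + 1 = n" "set_mset N \<subseteq> ibp_letters (p - 1)"
  shows "(1 + (\<Sum>s=1..p. \<alpha> s)) * word_integral (add_mset LOne N) l
      - (\<Sum>s=1..p-1. \<alpha> s * word_integral (add_mset (LG s) N) l)
      + \<gamma> * (\<Sum>b\<in>#N. pair_contribution word_integral (N - {#b#}) l b) = 0"
proof (cases "l \<in> Zset n (p - 1)")
  case False
  then have "word_integral M l = 0" for M by (simp add: word_integral_def)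
  moreover from this have "pair_contribution word_integral M l b = 0" for M b
    by (cases b) (simp_all add: pair_contribution_def)
  ultimately show ?thesis by simp
next
  case l: True
  obtain w where w: "image_mset w (mset_set {2..n}) = N" "\<And>j. j \<in> {2..n} \<Longrightarrow> w j \<in># N"
    using obtain_word[OF N(1)] by blast
  have n: "n \<ge> 1" using N by auto
  have w_ibp: "w j \<in> ibp_letters (p - 1)" if "j \<in> {2..n}" for j using w(2)[OF that] N(2) by auto
  define I where "I = insert LOne (LG ` {1..p-1})"
  define c where "c b = (case b of LG s \<Rightarrow> - \<alpha> s | _ \<Rightarrow> 1 + (\<Sum>s=1..p. \<alpha> s))" for b
  have sum_I: "(\<Sum>b\<in>I. c b * f b) = (1 + (\<Sum>s=1..p. \<alpha> s)) * f LOne - (\<Sum>s=1..p-1. \<alpha> s * f (LG s))"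
    for f :: "letter \<Rightarrow> complex"
  proof -
    have "(\<Sum>b\<in>LG ` {1..p-1}. c b * f b) = (\<Sum>s=1..p-1. - \<alpha> s * f (LG s))"
      by (subst sum.reindex) (auto simp: c_def inj_on_def)
    moreover have "(\<Sum>b\<in>I. c b * f b) = c LOne * f LOne + (\<Sum>b\<in>LG ` {1..p-1}. c b * f b)"
      unfolding I_def by (rule sum.insert) auto
    ultimately show ?thesis by (simp add: c_def sum_negf)
  qed
  have "cell_integral l ((\<lambda>j. eval_letter (w j))(1 := ibp_factor))
      = (\<Sum>b\<in>I. c b * cell_integral l ((\<lambda>j. eval_letter (w j))(1 := eval_letter b)))"
  proof (rule cell_integral_upd_first_sum[OF l n])
    show "admissible (eval_letter (w j))" if "j \<in> {2..n}" for j
      using w_ibp[OF that] ibp_letters_subset by (intro admissible_eval_letter) auto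
    show "admissible (eval_letter b)" if "b \<in> I" for b
      using that by (intro admissible_eval_letter) (auto simp: letters_def I_def)
  qed (simp only: ibp_factor_eq_letters sum_I)
  also have "\<dots> = (\<Sum>b\<in>I. c b * word_integral (add_mset b N) l)"
    unfolding word_integral_add_mset[OF w(1) l n] ..
  finally show ?thesis using cell_integral_ibp_factor[OF l n w(1) w_ibp] unfolding sum_I by simp
qed

lemma word_integral_add_mset_diff:
  assumes N: "size N + 1 = n" "set_mset N \<subseteq> letters (p - 1)"
    and ab: "a \<in> letters (p - 1)" "b \<in> letters (p - 1)"
    and diff: "\<And>t. (\<forall>s\<in>{1..p}. t \<noteq> z s) \<Longrightarrow> eval_letter c t = eval_letter a t - eval_letter b t"
  shows "word_integral (add_mset c N) l = word_integral (add_mset a N) l - word_integral (add_mset b N) l"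
proof (cases "l \<in> Zset n (p - 1)")
  case False
  then show ?thesis by (simp add: word_integral_def)
next
  case l: True
  obtain w where w: "image_mset w (mset_set {2..n}) = N" "\<And>j. j \<in> {2..n} \<Longrightarrow> w j \<in># N"
    using obtain_word[OF N(1)] by blast
  have n: "n \<ge> 1" using N by auto
  let ?sel = "\<lambda>i. if i then eval_letter a else eval_letter b"
  have "cell_integral l ((\<lambda>j. eval_letter (w j))(1 := eval_letter c))
      = (\<Sum>i\<in>{True, False}. (if i then 1 else -1) * cell_integral l ((\<lambda>j. eval_letter (w j))(1 := ?sel i)))"
  proof (rule cell_integral_upd_first_sum[OF l n])
    show "admissible (eval_letter (w j))" if "j \<in> {2..n}" for j
      using w(2)[OF that] N(2) by (intro admissible_eval_letter) auto
    show "admissible (?sel i)" for i using ab by (auto intro: admissible_eval_letter)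
  qed (simp add: diff)
  then show ?thesis unfolding word_integral_add_mset[OF w(1) l n] by simp
qed

lemma Re_one_plus_sum_alpha_pos: "x \<ge> 0 \<Longrightarrow> Re (1 + (\<Sum>s=1..p. \<alpha> s) + of_real x * \<gamma>) > 0"
proof -
  assume "x \<ge> 0"
  then have "x * Re \<gamma> \<ge> 0" using Re_gamma_pos by simp
  moreover have "(\<Sum>s=1..<p. Re (\<alpha> s)) \<ge> 0" using Re_alpha_pos by (intro sum_nonneg) (auto intro: less_imp_le)
  ultimately show ?thesis using Re_alpha_last unfolding atLeastAtMost_p by simp
qed

lemma symmetric_recursion_word_integral:
  "symmetric_recursion word_integral n (p - 1) \<alpha> \<gamma> (1 + \<alpha> p) (1 + (\<Sum>s=1..p. \<alpha> s))"
proof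
  show "1 \<le> p - 1" using p_ge_2 by simp
  show "1 + (\<Sum>s=1..p. \<alpha> s) = 1 + \<alpha> p + (\<Sum>s=1..p-1. \<alpha> s)" unfolding sum_last by simp
  have one: "1 \<in> {1..p-1}" using p_ge_2 by simp
  have mem: "LG s \<in> letters (p - 1)" "LH s \<in> letters (p - 1)" "LOne \<in> letters (p - 1)" if "s \<in> {1..p-1}" for s
    using that by (auto simp: letters_def)
  have off: "t \<noteq> z s" if "\<forall>s\<in>{1..p}. t \<noteq> z s" "s \<in> {1..p-1}" for s t using that by auto
  have LU: "LU_is_difference word_integral n (p - 1) P"
    if "P ` {1..p-1} \<subseteq> letters (p - 1)"
      and "\<And>s t. s \<in> {1..p-1} \<Longrightarrow> (\<forall>s\<in>{1..p}. t \<noteq> z s) \<Longrightarrow>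
          eval_letter (LU s) t = eval_letter (P s) t - eval_letter (P 1) t" for P
    unfolding LU_is_difference_def
    using that one by (intro conjI allI impI word_integral_add_mset_diff) auto
  show "LU_is_difference word_integral n (p - 1) LG" using mem(1) by (intro LU) (auto simp: eval_LU)
  show "LU_is_difference word_integral n (p - 1) LH"
  proof (rule LU)
    fix s t assume s: "s \<in> {1..p-1}" and t: "\<forall>s\<in>{1..p}. t \<noteq> z s"
    show "eval_letter (LU s) t = eval_letter (LH s) t - eval_letter (LH 1) t"
      unfolding eval_LU eval_LH[OF off[OF t s]] eval_LH[OF off[OF t one]] by simp
  qed (use mem(2) in auto)
  show "word_integral (add_mset (LH 1) N) l
      = word_integral (add_mset (LG 1) N) l - word_integral (add_mset LOne N) l"
    if "size N + 1 = n" "set_mset N \<subseteq> letters (p - 1)" for N l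
    using eval_LH[OF off[OF _ one]] by (intro word_integral_add_mset_diff[OF that mem(1,3)[OF one]]) auto
  show "1 + (\<Sum>s=1..p. \<alpha> s) + of_nat j * \<gamma> \<noteq> 0" for j
    using Re_one_plus_sum_alpha_pos[of "real j"]
    by (metis less_irrefl of_nat_0_le_iff of_real_of_nat_eq zero_complex.sel(1))
qed (rule word_integral_by_parts)

definition reduced_entry :: "(nat \<Rightarrow> nat) \<Rightarrow> (nat \<Rightarrow> nat) \<Rightarrow> complex" where
  "reduced_entry l m = (\<integral>t. cell_weight l t * omega n p z m t \<partial>Rn n)"

definition inverse_facts :: "(nat \<Rightarrow> nat) \<Rightarrow> complex" where
  "inverse_facts m = (\<Prod>s=1..p. 1 / of_nat (fact (m s)))"

lemma omega_eq_symmetrized: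
  assumes m: "m \<in> Zset n (p - 1)"
  shows "omega n p z m t = inverse_facts m * symmetrized n (\<lambda>j. eval_letter (LF (site m j))) t"
proof -
  have "psum m p = psum m (p - 1)" using psum_Suc[of m "p - 1"] Zset_eq_0[OF m, of p] p_ge_2 by simp
  then have Gam_p: "Gam m p = {}" by (simp add: Gam_def)
  have "(\<Prod>s=1..p. \<Prod>j\<in>Gam m s. 1 / complex_of_real (t (\<sigma> j) - z s))
      = (\<Prod>j=1..n. eval_letter (LF (site m j)) (t (\<sigma> j)))" for \<sigma>
  proof -
    have "(\<Prod>s=1..p. \<Prod>j\<in>Gam m s. 1 / complex_of_real (t (\<sigma> j) - z s))
        = (\<Prod>s=1..p-1. \<Prod>j\<in>{j\<in>{1..n}. site m j = s}. eval_letter (LF (site m j)) (t (\<sigma> j)))"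
      unfolding prod_last Gam_p by (simp add: Gam_eq_site[OF m])
    also have "\<dots> = (\<Prod>j=1..n. eval_letter (LF (site m j)) (t (\<sigma> j)))"
      using site_range[OF m] by (intro prod.group) auto
    finally show ?thesis .
  qed
  then show ?thesis
    unfolding omega_def symmetrized_def inverse_facts_def prod.distrib by (simp only: sum_distrib_left)
qed

lemma image_mset_site:
  assumes m: "m \<in> Zset n (p - 1)"
  shows "image_mset (site m) (mset_set {1..n}) = Abs_multiset m"
proof (rule multiset_eqI)
  fix s
  have "count (image_mset (site m) (mset_set {1..n})) s = card {i\<in>{1..n}. site m i = s}"
    by (simp add: count_image_mset vimage_def Int_def conj_commute)
  also have "\<dots> = m s"
  proof (cases "s \<in> {1..p-1}")
    case True
    then show ?thesis by (rule card_site_eq[OF m])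
  next
    case False
    then have "{i\<in>{1..n}. site m i = s} = {}" using site_range[OF m] by auto
    then show ?thesis using Zset_eq_0[OF m False] by simp
  qed
  finally show "count (image_mset (site m) (mset_set {1..n})) s = count (Abs_multiset m) s"
    unfolding count_Abs_multiset_Zset[OF m] .
qed

lemma word_integral_site:
  assumes "m \<in> Zset n (p - 1)" "l \<in> Zset n (p - 1)"
  shows "word_integral (image_mset P (Abs_multiset m)) l = cell_integral l (\<lambda>j. eval_letter (P (site m j)))"
  unfolding image_mset_site[OF assms(1), symmetric] image_mset.compositionality
    word_integral_image_mset[OF assms(2)] o_def ..

lemma reduced_entry_eq_LF:
  assumes "l \<in> Zset n (p - 1)" "m \<in> Zset n (p - 1)"
  shows "reduced_entry l m = inverse_facts m * word_integral (image_mset LF (Abs_multiset m)) l"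
  unfolding reduced_entry_def omega_eq_symmetrized[OF assms(2)] word_integral_site[OF assms(2,1)] cell_integral_def
  by (subst integral_mult_right_zero[symmetric]) (simp only: mult_ac)

lemma word_integral_LG:
  assumes l: "l \<in> Zset n (p - 1)" and m: "m \<in> Zset n (p - 1)"
  shows "word_integral (image_mset LG (Abs_multiset m)) l
    = (\<Prod>s=1..p-1. of_real (z p - z s) ^ m s) * word_integral (image_mset LF (Abs_multiset m)) l"
proof -
  have prod_LG: "(\<Prod>j=1..n. eval_letter (LG (site m j)) (t (\<sigma> j)))
      = (\<Prod>s=1..p-1. of_real (z p - z s) ^ m s) * (\<Prod>j=1..n. eval_letter (LF (site m j)) (t (\<sigma> j)))" for \<sigma> t
    unfolding prod_site[OF m, symmetric] prod.distrib[symmetric] by (intro prod.cong refl) simp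
  have "symmetrized n (\<lambda>j. eval_letter (LG (site m j))) t
      = (\<Prod>s=1..p-1. of_real (z p - z s) ^ m s) * symmetrized n (\<lambda>j. eval_letter (LF (site m j))) t" for t
    unfolding symmetrized_def prod_LG sum_distrib_left ..
  then show ?thesis
    unfolding word_integral_site[OF m l] cell_integral_def
    by (subst integral_mult_right_zero[symmetric]) (simp only: mult_ac)
qed

lemma cell_weight_shifted:
  assumes "l \<in> Zset n (p - 1)"
  shows "configuration.cell_weight n p z (shifted K) \<gamma> l t
      = cell_weight l t * (\<Prod>i=1..n. of_real ((z p - t i) ^ K))"
proof -
  interpret shifted: configuration n p z "shifted K" \<gamma> by (rule configuration_shifted)
  show ?thesis
  proof (cases "in_cell l t")
    case True
    then have "t i \<le> z p" if "i \<in> {1..n}" for i using in_cell_range[OF assms True that] by simp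
    from Psi_shifted[OF this] show ?thesis unfolding shifted.cell_weight_def cell_weight_def if_P[OF True] .
  qed (simp add: shifted.cell_weight_def cell_weight_def)
qed

lemma reduced_entry_shifted_1:
  assumes l: "l \<in> Zset n (p - 1)" and m: "m \<in> Zset n (p - 1)"
  shows "configuration.reduced_entry n p z (shifted 1) \<gamma> l m
    = inverse_facts m * word_integral (image_mset LH (Abs_multiset m)) l"
proof -
  interpret shifted: configuration n p z "shifted 1" \<gamma> by (rule configuration_shifted)
  have LH: "symmetrized n (\<lambda>j. eval_letter (LH (site m j))) t
      = (\<Prod>i=1..n. of_real (z p - t i)) * symmetrized n (\<lambda>j. eval_letter (LF (site m j))) t" for t
    unfolding symmetrized_def sum_distrib_left
  proof (rule sum.cong[OF refl])
    fix \<sigma> assume "\<sigma> \<in> {\<sigma>. \<sigma> permutes {1..n}}"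
    then have "(\<Prod>i=1..n. of_real (z p - t i)) = (\<Prod>j=1..n. of_real (z p - t (\<sigma> j)) :: complex)"
      using prod.permute[of \<sigma> "{1..n}" "\<lambda>i. of_real (z p - t i) :: complex"] by (simp add: o_def)
    then show "(\<Prod>j=1..n. eval_letter (LH (site m j)) (t (\<sigma> j)))
        = (\<Prod>i=1..n. of_real (z p - t i)) * (\<Prod>j=1..n. eval_letter (LF (site m j)) (t (\<sigma> j)))"
      by (simp add: prod.distrib[symmetric])
  qed
  have "shifted.cell_weight l t * omega n p z m t
      = inverse_facts m * (cell_weight l t * symmetrized n (\<lambda>j. eval_letter (LH (site m j))) t)" for t
    unfolding cell_weight_shifted[OF l] omega_eq_symmetrized[OF m] power_one_right LH
    by (simp only: mult_ac)
  then show ?thesis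
    unfolding shifted.reduced_entry_def word_integral_site[OF m l] cell_integral_def
    by (simp only: integral_mult_right_zero)
qed

theorem det_reduced_entry_shifted_1:
  "det_on (Zset n (p - 1)) (configuration.reduced_entry n p z (shifted 1) \<gamma>)
    = (\<Prod>m\<in>Zset n (p - 1). \<Prod>s<m 1.
        (1 + \<alpha> p + of_nat s * \<gamma>) / (1 + (\<Sum>s=1..p. \<alpha> s) + (2 * of_nat n - 2 - of_nat s) * \<gamma>))
      * (\<Prod>m\<in>Zset n (p - 1). \<Prod>s=1..p-1. of_real (z p - z s) ^ m s) * det_on (Zset n (p - 1)) reduced_entry"
proof -
  let ?Z = "Zset n (p - 1)"
  let ?det = "\<lambda>P. det_on ?Z (\<lambda>l m. word_integral (image_mset P (Abs_multiset m)) l)"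
  interpret symmetric_recursion word_integral n "p - 1" \<alpha> \<gamma> "1 + \<alpha> p" "1 + (\<Sum>s=1..p. \<alpha> s)"
    by (rule symmetric_recursion_word_integral)
  have scale: "det_on ?Z (\<lambda>l m. c m * M l m) = (\<Prod>m\<in>?Z. c m) * det_on ?Z M" for c M :: "_ \<Rightarrow> _"
    using det_on_scale[of ?Z "\<lambda>_. 1" M c] by (simp add: mult.commute)
  have "det_on ?Z (configuration.reduced_entry n p z (shifted 1) \<gamma>) = (\<Prod>m\<in>?Z. inverse_facts m) * ?det LH"
    unfolding scale[symmetric] by (intro det_on_cong reduced_entry_shifted_1)
  moreover have "det_on ?Z reduced_entry = (\<Prod>m\<in>?Z. inverse_facts m) * ?det LF"
    unfolding scale[symmetric] by (intro det_on_cong reduced_entry_eq_LF)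
  moreover have "?det LG = (\<Prod>m\<in>?Z. \<Prod>s=1..p-1. of_real (z p - z s) ^ m s) * ?det LF"
    unfolding scale[symmetric] by (intro det_on_cong word_integral_LG)
  ultimately show ?thesis using det_LH_eq_det_LG[of "\<lambda>l. l"] by (simp only: mult_ac)
qed

end

section \<open>Laguerre--Selberg integrals\<close>

definition concat_vec :: "nat \<Rightarrow> nat \<Rightarrow> (nat \<Rightarrow> 'a) \<Rightarrow> (nat \<Rightarrow> 'a) \<Rightarrow> nat \<Rightarrow> 'a" where
  "concat_vec m k x y = (\<lambda>i\<in>{1..m + k}. if i \<le> m then x i else y (i - m))"

lemma concat_vec_left: "i \<in> {1..m} \<Longrightarrow> concat_vec m k x y i = x i"
  and concat_vec_right: "j \<in> {1..k} \<Longrightarrow> concat_vec m k x y (m + j) = y j"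
  by (auto simp: concat_vec_def)

lemma measurable_concat_vec:
  assumes "x \<in> space (Rn m)"
  shows "concat_vec m k x \<in> measurable (Rn k) (Rn (m + k))"
  unfolding concat_vec_def
proof (rule measurable_restrict)
  fix i assume "i \<in> {1..m + k}"
  then have "i \<le> m \<or> i - m \<in> {1..k}" by auto
  then show "(\<lambda>y. if i \<le> m then x i else y (i - m)) \<in> measurable (Rn k) lborel"
    using measurable_Rn_component[of "i - m" k] by auto
qed

lemma integral_Rn_add:
  fixes f :: "(nat \<Rightarrow> real) \<Rightarrow> 'b :: {banach, second_countable_topology}"
  assumes f: "integrable (Rn (m + k)) f"
  shows "(\<integral>t. f t \<partial>Rn (m + k)) = (\<integral>x. (\<integral>y. f (concat_vec m k x y) \<partial>Rn k) \<partial>Rn m)"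
proof -
  let ?I = "{1..m}" and ?J = "{m+1..m+k}"
  have split: "{1..m + k} = ?I \<union> ?J" by auto
  have shift: "bij_betw (\<lambda>j. j - m) ?J {1..k}"
    by (rule bij_betw_byWitness[where f'="\<lambda>j. m + j"]) auto
  have "(\<integral>t. f t \<partial>Rn (m + k)) = (\<integral>x. (\<integral>y. f (merge ?I ?J (x, y)) \<partial>PiM ?J (\<lambda>_. lborel)) \<partial>Rn m)"
    unfolding split by (rule lborel_product.product_integral_fold[OF _ _ _ f[unfolded split]]) auto
  also have "\<dots> = (\<integral>x. (\<integral>y. f (concat_vec m k x y) \<partial>Rn k) \<partial>Rn m)"
  proof (rule Bochner_Integration.integral_cong[OF refl])
    fix x assume "x \<in> space (Rn m)"
    moreover have "f \<in> borel_measurable (PiM (?I \<union> ?J) (\<lambda>_. lborel))"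
      using f unfolding split by (rule borel_measurable_integrable)
    ultimately have "(\<lambda>y. f (merge ?I ?J (x, y))) \<in> borel_measurable (PiM ?J (\<lambda>_. lborel))"
      by (intro measurable_compose[OF measurable_compose[OF measurable_Pair1' measurable_merge]])
    from integral_PiM_affine[OF shift _ _ this, of "\<lambda>_. 1" "\<lambda>_. 0"]
    have affine: "(\<integral>y. f (merge ?I ?J (x, y)) \<partial>PiM ?J (\<lambda>_. lborel))
        = (\<integral>y. f (merge ?I ?J (x, affine_reindex ?J (\<lambda>j. j - m) (\<lambda>_. 1) (\<lambda>_. 0) y)) \<partial>Rn k)" by simp
    have "merge ?I ?J (x, affine_reindex ?J (\<lambda>j. j - m) (\<lambda>_. 1) (\<lambda>_. 0) y) = concat_vec m k x y" for y
      by (auto simp: fun_eq_iff merge_def affine_reindex_def concat_vec_def)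
    then show "(\<integral>y. f (merge ?I ?J (x, y)) \<partial>PiM ?J (\<lambda>_. lborel)) = (\<integral>y. f (concat_vec m k x y) \<partial>Rn k)"
      unfolding affine by (simp only:)
  qed
  finally show ?thesis .
qed

lemma prod_atLeastAtMost_add:
  fixes f :: "nat \<Rightarrow> 'a :: comm_monoid_mult"
  shows "(\<Prod>i=1..m + k. f i) = (\<Prod>i=1..m. f i) * (\<Prod>j=1..k. f (m + j))"
  using prod.ub_add_nat[of 1 m f k] prod.shift_bounds_cl_nat_ivl[of f 1 m k] by (simp add: add.commute)

definition in_block_chamber :: "nat \<Rightarrow> (nat \<Rightarrow> nat) \<Rightarrow> (nat \<Rightarrow> real) \<Rightarrow> bool" where
  "in_block_chamber n \<sigma> y \<longleftrightarrow> (\<forall>i\<in>{1..n}. 0 \<le> y i) \<and> (\<forall>i\<in>{1..n}. \<forall>j\<in>{1..n}. i \<le> j \<and> \<sigma> i = \<sigma> j \<longrightarrow> y i \<le> y j)"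

definition block_vandermonde :: "nat \<Rightarrow> (nat \<Rightarrow> nat) \<Rightarrow> complex \<Rightarrow> (nat \<Rightarrow> real) \<Rightarrow> complex" where
  "block_vandermonde n \<sigma> \<gamma> y = (\<Prod>i=1..n. \<Prod>j\<in>{i<..n}. if \<sigma> i = \<sigma> j then abs_pow (y j - y i) (2 * \<gamma>) else 1)"

definition Laguerre_weight :: "complex \<Rightarrow> real \<Rightarrow> complex" where
  "Laguerre_weight a y = abs_pow y a / of_real y * of_real (exp (- y))"

definition block_integrand ::
    "nat \<Rightarrow> (nat \<Rightarrow> nat) \<Rightarrow> (nat \<Rightarrow> complex) \<Rightarrow> complex \<Rightarrow> (nat \<Rightarrow> real) \<Rightarrow> complex" where
  "block_integrand n \<sigma> \<alpha> \<gamma> y = (if in_block_chamber n \<sigma> y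
     then (\<Prod>i=1..n. Laguerre_weight (\<alpha> (\<sigma> i)) (y i)) * block_vandermonde n \<sigma> \<gamma> y else 0)"

definition Laguerre_integrand :: "nat \<Rightarrow> complex \<Rightarrow> complex \<Rightarrow> (nat \<Rightarrow> real) \<Rightarrow> complex" where
  "Laguerre_integrand n a \<gamma> y = (if (\<forall>i\<in>{1..n}. 0 \<le> y i) \<and> mono_on {1..n} y
     then (\<Prod>i=1..n. Laguerre_weight a (y i)) * vandermonde n \<gamma> y else 0)"

definition Laguerre :: "nat \<Rightarrow> complex \<Rightarrow> complex \<Rightarrow> complex" where
  "Laguerre n a \<gamma> = (\<integral>y. Laguerre_integrand n a \<gamma> y \<partial>Rn n)"

lemma Laguerre_integrand_eq_block_integrand: "Laguerre_integrand n (\<alpha> s) \<gamma> = block_integrand n (\<lambda>_. s) \<alpha> \<gamma>"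
  by (rule ext) (simp only: Laguerre_integrand_def block_integrand_def in_block_chamber_def vandermonde_def
      block_vandermonde_def monotone_on_def simp_thms if_True)

lemma measurable_Laguerre_weight [measurable]: "Laguerre_weight a \<in> borel_measurable borel"
  unfolding Laguerre_weight_def[abs_def] by measurable

lemma norm_Laguerre_weight: "y \<ge> 0 \<Longrightarrow> norm (Laguerre_weight a y) = y powr (Re a - 1) * exp (- y)"
  by (cases "y = 0") (simp_all add: Laguerre_weight_def norm_mult norm_divide norm_abs_pow powr_diff)

lemma measurable_in_block_chamber [measurable]: "Measurable.pred (Rn n) (in_block_chamber n \<sigma>)"
proof -
  have "Measurable.pred (Rn n) (\<lambda>y. \<forall>i\<in>{1..n}. 0 \<le> y i)" by (rule measurable_Rn_ball) measurable
  then show ?thesis unfolding in_block_chamber_def by (intro pred_intros_logic(3) measurable_Rn_ball_le)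
qed

lemma measurable_block_integrand [measurable]: "block_integrand n \<sigma> \<alpha> \<gamma> \<in> borel_measurable (Rn n)"
proof -
  have "(\<lambda>y. if \<sigma> i = \<sigma> j then abs_pow (y j - y i) (2 * \<gamma>) else 1) \<in> borel_measurable (Rn n)"
    if "i \<in> {1..n}" "j \<in> {i<..n}" for i j
  proof -
    have "j \<in> {1..n}" using that by auto
    with that have [measurable]: "(\<lambda>y. y i) \<in> borel_measurable (Rn n)" "(\<lambda>y. y j) \<in> borel_measurable (Rn n)"
      by (auto intro: measurable_Rn_component)
    show ?thesis by measurable
  qed
  then have [measurable]: "block_vandermonde n \<sigma> \<gamma> \<in> borel_measurable (Rn n)"
    unfolding block_vandermonde_def by (intro borel_measurable_prod)
  have [measurable]: "(\<lambda>y. \<Prod>i=1..n. Laguerre_weight (\<alpha> (\<sigma> i)) (y i)) \<in> borel_measurable (Rn n)"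
    by (rule measurable_Rn_prod) auto
  show ?thesis unfolding block_integrand_def by measurable
qed

lemma measurable_Laguerre_integrand [measurable]: "Laguerre_integrand n a \<gamma> \<in> borel_measurable (Rn n)"
  using measurable_block_integrand[of n "\<lambda>_. 0" "\<lambda>_. a" \<gamma>]
  unfolding Laguerre_integrand_eq_block_integrand[of n "\<lambda>_. a" 0 \<gamma>, symmetric] .

lemma one_plus_mult_one_plus_powr_ge_1:
  fixes x y g :: real
  assumes "x \<ge> 0" "y \<ge> 0" "g \<ge> 0"
  shows "1 \<le> ((1 + x) * (1 + y)) powr g"
  using assms mult_mono[of 1 "1 + x" 1 "1 + y"] by (intro ge_one_powr_ge_zero) auto

lemma norm_abs_pow_diff_le_one_plus:
  assumes "x \<ge> 0" "y \<ge> 0" "Re a \<ge> 0"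
  shows "norm (abs_pow (y - x) a) \<le> ((1 + x) * (1 + y)) powr Re a"
proof -
  have "\<bar>y - x\<bar> \<le> x + y" using assms by auto
  also have "\<dots> \<le> (1 + x) * (1 + y)" using assms by (simp add: algebra_simps)
  finally show ?thesis unfolding norm_abs_pow using assms by (intro powr_mono2) auto
qed

lemma norm_prod_pairs_le:
  fixes b :: "nat \<Rightarrow> nat \<Rightarrow> complex" and y :: "nat \<Rightarrow> real"
  assumes y: "\<And>i. i \<in> {1..n} \<Longrightarrow> y i \<ge> 0" and g: "g \<ge> 0" and B: "B \<ge> 0"
    and b: "\<And>i j. i \<in> {1..n} \<Longrightarrow> j \<in> {i<..n} \<Longrightarrow> norm (b i j) \<le> B * ((1 + y i) * (1 + y j)) powr g"
  shows "norm (\<Prod>i=1..n. \<Prod>j\<in>{i<..n}. b i j)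
     \<le> B ^ card (index_pairs n) * (\<Prod>k=1..n. (1 + y k) powr (g * card (index_pairs n)))"
proof -
  define P where "P = (\<Prod>k=1..n. 1 + y k)"
  have P: "P \<ge> 1" unfolding P_def using y by (intro prod_ge_1) auto
  have "norm (b i j) \<le> B * P powr g" if ij: "(i, j) \<in> index_pairs n" for i j
  proof -
    have mem: "i \<in> {1..n}" "j \<in> {1..n}" "j \<in> {i<..n}" "i \<noteq> j" using ij by (auto simp: index_pairs_def)
    then have "(1 + y i) * (1 + y j) = (\<Prod>k\<in>{i, j}. 1 + y k)" by simp
    also have "\<dots> \<le> P" unfolding P_def using mem y by (intro prod_mono2) auto
    finally have "((1 + y i) * (1 + y j)) powr g \<le> P powr g" using y mem g by (intro powr_mono2) auto
    then show ?thesis using b[OF mem(1,3)] B by (meson mult_left_mono order_trans)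
  qed
  then have "norm (\<Prod>i=1..n. \<Prod>j\<in>{i<..n}. b i j) \<le> (\<Prod>(i, j)\<in>index_pairs n. B * P powr g)"
    unfolding prod_index_pairs prod_norm[symmetric] by (intro prod_mono) auto
  also have "\<dots> = B ^ card (index_pairs n) * P powr (g * card (index_pairs n))"
    using P by (simp add: case_prod_unfold power_mult_distrib powr_realpow[symmetric] powr_powr)
  finally show ?thesis unfolding P_def prod_powr_distrib .
qed

lemma integrable_prod_Gamma_majorant:
  assumes "\<And>i. i \<in> {1..n} \<Longrightarrow> a i > 0" "Q \<ge> 0"
  shows "integrable (Rn n) (\<lambda>y. C * (\<Prod>i=1..n. Gamma_majorant (a i) Q (y i)))"
  using assms
  by (intro integrable_mult_right lborel_product.product_integrable_prod integrable_Gamma_majorant) auto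

lemma norm_block_integrand_le:
  assumes \<gamma>: "Re \<gamma> > 0"
  shows "norm (block_integrand n \<sigma> \<alpha> \<gamma> y)
    \<le> (\<Prod>i=1..n. Gamma_majorant (Re (\<alpha> (\<sigma> i))) (2 * Re \<gamma> * card (index_pairs n)) (y i))"
proof (cases "in_block_chamber n \<sigma> y")
  case False
  then show ?thesis by (simp add: block_integrand_def prod_nonneg Gamma_majorant_nonneg)
next
  case True
  let ?Q = "2 * Re \<gamma> * card (index_pairs n)"
  have y: "y i \<ge> 0" if "i \<in> {1..n}" for i using True that by (simp add: in_block_chamber_def)
  have pairs: "norm (block_vandermonde n \<sigma> \<gamma> y) \<le> 1 ^ card (index_pairs n) * (\<Prod>k=1..n. (1 + y k) powr ?Q)"
    unfolding block_vandermonde_def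
  proof (rule norm_prod_pairs_le)
    fix i j assume "i \<in> {1..n}" "j \<in> {i<..n}"
    then have "y i \<ge> 0" "y j \<ge> 0" using y by auto
    then show "norm (if \<sigma> i = \<sigma> j then abs_pow (y j - y i) (2 * \<gamma>) else 1)
        \<le> 1 * ((1 + y i) * (1 + y j)) powr (2 * Re \<gamma>)"
      using norm_abs_pow_diff_le_one_plus[of "y i" "y j" "2 * \<gamma>"]
        one_plus_mult_one_plus_powr_ge_1[of "y i" "y j" "2 * Re \<gamma>"] \<gamma> by simp
  qed (use y \<gamma> in auto)
  have "norm (block_integrand n \<sigma> \<alpha> \<gamma> y)
      = (\<Prod>i=1..n. y i powr (Re (\<alpha> (\<sigma> i)) - 1) * exp (- y i)) * norm (block_vandermonde n \<sigma> \<gamma> y)"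
    unfolding block_integrand_def if_P[OF True] norm_mult prod_norm[symmetric]
    by (intro arg_cong2[of _ _ _ _ "(*)"] prod.cong refl norm_Laguerre_weight y)
  also have "\<dots> \<le> (\<Prod>i=1..n. y i powr (Re (\<alpha> (\<sigma> i)) - 1) * exp (- y i)) * (\<Prod>k=1..n. (1 + y k) powr ?Q)"
    using pairs by (intro mult_left_mono prod_nonneg) auto
  also have "\<dots> = (\<Prod>i=1..n. Gamma_majorant (Re (\<alpha> (\<sigma> i))) ?Q (y i))"
    unfolding prod.distrib[symmetric] Gamma_majorant_def using y by (intro prod.cong refl) (simp add: mult_ac)
  finally show ?thesis .
qed

lemma integrable_block_integrand:
  assumes "\<And>i. i \<in> {1..n} \<Longrightarrow> Re (\<alpha> (\<sigma> i)) > 0" "Re \<gamma> > 0"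
  shows "integrable (Rn n) (block_integrand n \<sigma> \<alpha> \<gamma>)"
proof (rule integrable_of_norm_le)
  let ?Q = "2 * Re \<gamma> * card (index_pairs n)"
  show "integrable (Rn n) (\<lambda>y. 1 * (\<Prod>i=1..n. Gamma_majorant (Re (\<alpha> (\<sigma> i))) ?Q (y i)))"
    using assms by (intro integrable_prod_Gamma_majorant) auto
  show "norm (block_integrand n \<sigma> \<alpha> \<gamma> y) \<le> 1 * (\<Prod>i=1..n. Gamma_majorant (Re (\<alpha> (\<sigma> i))) ?Q (y i))" for y
    using norm_block_integrand_le[OF assms(2)] by simp
qed (rule measurable_block_integrand)

lemma integrable_Laguerre_integrand:
  assumes "Re a > 0" "Re \<gamma> > 0"
  shows "integrable (Rn n) (Laguerre_integrand n a \<gamma>)"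
  unfolding Laguerre_integrand_eq_block_integrand[of n "\<lambda>_. a" 0 \<gamma>] using assms
  by (intro integrable_block_integrand) auto

lemma block_integrand_cong:
  assumes "\<And>i. i \<in> {1..n} \<Longrightarrow> \<sigma> i = \<sigma>' i" and "\<And>i. i \<in> {1..n} \<Longrightarrow> y i = y' i"
  shows "block_integrand n \<sigma> \<alpha> \<gamma> y = block_integrand n \<sigma>' \<alpha> \<gamma> y'"
proof -
  have "in_block_chamber n \<sigma> y = in_block_chamber n \<sigma>' y'" unfolding in_block_chamber_def using assms by simp
  moreover have "block_vandermonde n \<sigma> \<gamma> y = block_vandermonde n \<sigma>' \<gamma> y'"
    unfolding block_vandermonde_def using assms by (intro prod.cong refl) auto
  moreover have "(\<Prod>i=1..n. Laguerre_weight (\<alpha> (\<sigma> i)) (y i)) = (\<Prod>i=1..n. Laguerre_weight (\<alpha> (\<sigma>' i)) (y' i))"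
    using assms by (intro prod.cong refl) simp
  ultimately show ?thesis by (simp add: block_integrand_def)
qed

lemma in_block_chamber_add:
  assumes sep: "\<forall>i\<in>{1..m}. \<forall>j\<in>{1..k}. \<sigma> i \<noteq> \<sigma> (m + j)"
  shows "in_block_chamber (m + k) \<sigma> y
    \<longleftrightarrow> in_block_chamber m \<sigma> y \<and> in_block_chamber k (\<lambda>j. \<sigma> (m + j)) (\<lambda>j. y (m + j))"
proof -
  have split: "(\<forall>i\<in>{1..m + k}. P i) \<longleftrightarrow> (\<forall>i\<in>{1..m}. P i) \<and> (\<forall>j\<in>{1..k}. P (m + j))" for P
  proof -
    have "{1..m + k} = {1..m} \<union> (+) m ` {1..k}" by auto
    then show ?thesis by (simp only: ball_Un ball_simps)
  qed
  have "\<forall>i\<in>{1..m}. \<forall>j\<in>{1..k}. i \<le> m + j \<and> \<sigma> i = \<sigma> (m + j) \<longrightarrow> y i \<le> y (m + j)" using sep by blast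
  moreover have "\<forall>j\<in>{1..k}. \<forall>i\<in>{1..m}. m + j \<le> i \<and> \<sigma> (m + j) = \<sigma> i \<longrightarrow> y (m + j) \<le> y i" by auto
  ultimately show ?thesis unfolding in_block_chamber_def split ball_conj_distrib add_le_cancel_left by blast
qed

lemma block_vandermonde_add:
  assumes sep: "\<forall>i\<in>{1..m}. \<forall>j\<in>{1..k}. \<sigma> i \<noteq> \<sigma> (m + j)"
  shows "block_vandermonde (m + k) \<sigma> \<gamma> y
    = block_vandermonde m \<sigma> \<gamma> y * block_vandermonde k (\<lambda>j. \<sigma> (m + j)) \<gamma> (\<lambda>j. y (m + j))"
proof -
  define b where "b i j = (if \<sigma> i = \<sigma> j then abs_pow (y j - y i) (2 * \<gamma>) else 1)" for i j
  have "(\<Prod>j\<in>{i<..m + k}. b i j) = (\<Prod>j\<in>{i<..m}. b i j)" if i: "i \<in> {1..m}" for i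
  proof (rule prod.mono_neutral_right)
    show "\<forall>j\<in>{i<..m + k} - {i<..m}. b i j = 1"
    proof
      fix j assume "j \<in> {i<..m + k} - {i<..m}"
      then have "j - m \<in> {1..k}" "m + (j - m) = j" by auto
      then have "\<sigma> i \<noteq> \<sigma> j" using sep i by metis
      then show "b i j = 1" by (simp add: b_def)
    qed
  qed auto
  moreover have "(\<Prod>j\<in>{m + i<..m + k}. b (m + i) j) = (\<Prod>j\<in>{i<..k}. b (m + i) (m + j))" for i
    unfolding image_add_greaterThanAtMost[symmetric] by (subst prod.reindex) auto
  ultimately show ?thesis
    unfolding block_vandermonde_def prod_atLeastAtMost_add b_def[symmetric] by simp
qed

lemma block_integrand_add:
  assumes "\<forall>i\<in>{1..m}. \<forall>j\<in>{1..k}. \<sigma> i \<noteq> \<sigma> (m + j)"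
  shows "block_integrand (m + k) \<sigma> \<alpha> \<gamma> y
    = block_integrand m \<sigma> \<alpha> \<gamma> y * block_integrand k (\<lambda>j. \<sigma> (m + j)) \<alpha> \<gamma> (\<lambda>j. y (m + j))"
  unfolding block_integrand_def in_block_chamber_add[OF assms]
    block_vandermonde_add[OF assms] prod_atLeastAtMost_add by simp

lemma integral_block_integrand_add:
  assumes sep: "\<forall>i\<in>{1..m}. \<forall>j\<in>{1..k}. \<sigma> i \<noteq> \<sigma> (m + j)"
    and pos: "\<And>i. i \<in> {1..m + k} \<Longrightarrow> Re (\<alpha> (\<sigma> i)) > 0" "Re \<gamma> > 0"
  shows "(\<integral>y. block_integrand (m + k) \<sigma> \<alpha> \<gamma> y \<partial>Rn (m + k))
    = (\<integral>y. block_integrand m \<sigma> \<alpha> \<gamma> y \<partial>Rn m) * (\<integral>y. block_integrand k (\<lambda>j. \<sigma> (m + j)) \<alpha> \<gamma> y \<partial>Rn k)"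
proof -
  have product: "block_integrand (m + k) \<sigma> \<alpha> \<gamma> (concat_vec m k x y)
      = block_integrand m \<sigma> \<alpha> \<gamma> x * block_integrand k (\<lambda>j. \<sigma> (m + j)) \<alpha> \<gamma> y" for x y
    unfolding block_integrand_add[OF sep]
    by (intro arg_cong2[of _ _ _ _ "(*)"] block_integrand_cong refl concat_vec_left concat_vec_right)
  have "integrable (Rn (m + k)) (block_integrand (m + k) \<sigma> \<alpha> \<gamma>)"
    using pos by (intro integrable_block_integrand) auto
  from integral_Rn_add[OF this] show ?thesis unfolding product by simp
qed

lemma integral_block_integrand_0: "(\<integral>y. block_integrand 0 \<sigma> \<alpha> \<gamma> y \<partial>Rn 0) = 1"
proof -
  have "block_integrand 0 \<sigma> \<alpha> \<gamma> = (\<lambda>x. \<Prod>i\<in>({}::nat set). 1)"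
    by (simp add: block_integrand_def in_block_chamber_def block_vandermonde_def fun_eq_iff)
  then show ?thesis using lborel_product.product_integral_prod[of "{}" "\<lambda>_ _. 1 :: complex"] by simp
qed

lemma Zset_drop_last:
  assumes l: "l \<in> Zset n (Suc q)"
  defines "l' \<equiv> l(Suc q := 0)"
  shows "n = psum l q + l (Suc q)" and "l' \<in> Zset (psum l q) q"
    and "i \<in> {1..psum l q} \<Longrightarrow> site l i = site l' i" and "j \<in> {1..l (Suc q)} \<Longrightarrow> site l (psum l q + j) = Suc q"
proof -
  have psum_last: "psum l (Suc q) = n" by (rule psum_Zset[OF l])
  show n: "n = psum l q + l (Suc q)" using psum_last psum_Suc[of l q] by simp
  have psum_l': "psum l' s = psum l s" if "s \<le> q" for s
    unfolding psum_def l'_def using that by (intro sum.cong) auto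
  show l': "l' \<in> Zset (psum l q) q"
    using psum_l'[of q] Zset_eq_0[OF l] by (auto simp: Zset_def l'_def psum_def)
  show "site l i = site l' i" if i: "i \<in> {1..psum l q}"
  proof -
    have "site l' i \<in> {1..q}" by (rule site_range[OF l' i])
    moreover from this have "i \<in> Gam l' (site l' i)" using Gam_eq_site[OF l'] i by auto
    ultimately have "i \<in> Gam l (site l' i)" "site l' i \<ge> 1" using psum_l' by (auto simp: Gam_def)
    then show ?thesis using site_eq_iff[of i l "Suc q"] i psum_last n by auto
  qed
  show "site l (psum l q + j) = Suc q" if "j \<in> {1..l (Suc q)}"
    using site_eq_iff[of "psum l q + j" l "Suc q" "Suc q"] that psum_last n by (auto simp: Gam_def)
qed

theorem integral_block_integrand_site:
  assumes "l \<in> Zset n q" "\<And>s. s \<in> {1..q} \<Longrightarrow> Re (\<alpha> s) > 0" "Re \<gamma> > 0"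
  shows "(\<integral>y. block_integrand n (site l) \<alpha> \<gamma> y \<partial>Rn n) = (\<Prod>s=1..q. Laguerre (l s) (\<alpha> s) \<gamma>)"
  using assms(1,2)
proof (induction q arbitrary: l n)
  case 0
  then have "n = 0" by (simp add: Zset_def)
  then show ?case using integral_block_integrand_0[of "site l" \<alpha> \<gamma>] by simp
next
  case (Suc q)
  define k l' where "k = l (Suc q)" and "l' = l(Suc q := 0)"
  note l = Suc.prems(1) and split = Zset_drop_last[OF Suc.prems(1), folded k_def l'_def]
  have first: "site l i \<in> {1..q}" if "i \<in> {1..psum l q}" for i
    using split(3)[OF that] site_range[OF split(2) that] by simp
  have sep: "\<forall>i\<in>{1..psum l q}. \<forall>j\<in>{1..k}. site l i \<noteq> site l (psum l q + j)" using first split(4) by fastforce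
  have "(\<integral>y. block_integrand n (site l) \<alpha> \<gamma> y \<partial>Rn n)
      = (\<integral>y. block_integrand (psum l q) (site l) \<alpha> \<gamma> y \<partial>Rn (psum l q))
        * (\<integral>y. block_integrand k (\<lambda>j. site l (psum l q + j)) \<alpha> \<gamma> y \<partial>Rn k)"
    using integral_block_integrand_add[OF sep, of \<alpha> \<gamma>]
      Suc.prems(2) site_range[OF l] assms(3) unfolding split(1)[symmetric] by blast
  also have "block_integrand (psum l q) (site l) \<alpha> \<gamma> = block_integrand (psum l q) (site l') \<alpha> \<gamma>"
    by (intro ext block_integrand_cong split(3) refl)
  also have "block_integrand k (\<lambda>j. site l (psum l q + j)) \<alpha> \<gamma> = Laguerre_integrand k (\<alpha> (Suc q)) \<gamma>"
    unfolding Laguerre_integrand_eq_block_integrand by (intro ext block_integrand_cong split(4) refl)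
  also have "(\<integral>y. block_integrand (psum l q) (site l') \<alpha> \<gamma> y \<partial>Rn (psum l q)) = (\<Prod>s=1..q. Laguerre (l' s) (\<alpha> s) \<gamma>)"
    using Suc.prems(2) by (intro Suc.IH[OF split(2)]) auto
  also have "\<dots> = (\<Prod>s=1..q. Laguerre (l s) (\<alpha> s) \<gamma>)" by (intro prod.cong refl) (simp add: l'_def)
  finally show ?case by (simp add: k_def Laguerre_def)
qed

section \<open>Letting the last exponent tend to infinity\<close>

lemma powr_times_power_tendsto_0:
  fixes a x :: real
  assumes "0 < x" "x < 1"
  shows "(\<lambda>k. real (Suc k) powr a * x ^ Suc k) \<longlonglongrightarrow> 0"
proof -
  define b where "b = - ln x"
  have b: "b > 0" using assms by (simp add: b_def)
  have "(\<lambda>k. real (Suc k) powr a * exp (- b * real (Suc k))) \<longlonglongrightarrow> 0" using b by real_asymp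
  moreover have "exp (- b * real (Suc k)) = x ^ Suc k" for k
    using assms exp_of_nat_mult[of "Suc k" "ln x"] by (simp add: b_def mult.commute del: of_nat_Suc)
  ultimately show ?thesis by simp
qed

lemma power_tendsto_exp_minus: "(\<lambda>k. (1 - y / real (Suc k)) ^ Suc k) \<longlonglongrightarrow> exp (- y)"
  using LIMSEQ_Suc[OF tendsto_exp_limit_sequentially[of "- y"]] by simp

context configuration
begin

definition dist_last :: "nat \<Rightarrow> real" where
  "dist_last s = z p - z s"

lemma dist_last_pos: "s \<in> {1..p-1} \<Longrightarrow> dist_last s > 0"
  using z_less[of s p] by (auto simp: dist_last_def)

lemma dist_last_le: "s \<in> {1..p-1} \<Longrightarrow> dist_last s \<le> z p - z 1"
  using z_le[of 1 s] by (auto simp: dist_last_def)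

lemma Re_alpha_pos': "s \<in> {1..p-1} \<Longrightarrow> Re (\<alpha> s) > 0"
  using p_ge_2 by (intro Re_alpha_pos) auto

definition gap :: real where
  "gap = Min ((\<lambda>s. (z (s + 1) - z s) / 2) ` {1..<p})"

lemma gap_pos: "gap > 0"
proof -
  have "gap \<in> (\<lambda>s. (z (s + 1) - z s) / 2) ` {1..<p}" unfolding gap_def using p_ge_2 by (intro Min_in) auto
  then obtain s where s: "s \<in> {1..<p}" and gap: "gap = (z (s + 1) - z s) / 2" by blast
  show ?thesis unfolding gap using z_less_Suc[OF s] by simp
qed

lemma gap_le_diff:
  assumes "1 \<le> r" "r < s" "s \<le> p"
  shows "2 * gap \<le> z s - z r"
proof -
  have "gap \<le> (z (r + 1) - z r) / 2" unfolding gap_def using assms by (intro Min_le) auto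
  moreover have "z (r + 1) \<le> z s" using assms by (intro z_le) auto
  ultimately show ?thesis by simp
qed

definition near_ratio :: real where
  "near_ratio = gap / (z p - z 1)"

lemma near_ratio_pos: "near_ratio > 0"
  and near_ratio_le: "near_ratio \<le> 1 / 2"
  and near_ratio_mult_dist_last_le: "s \<in> {1..p-1} \<Longrightarrow> near_ratio * dist_last s \<le> gap"
proof -
  have range: "z p - z 1 > 0" using z_first_less_last by simp
  then show "near_ratio > 0" using gap_pos by (simp add: near_ratio_def)
  show "near_ratio \<le> 1 / 2" using range gap_le_diff[of 1 p] p_ge_2 by (simp add: near_ratio_def field_simps)
  assume "s \<in> {1..p-1}"
  then have "gap * dist_last s \<le> gap * (z p - z 1)" using gap_pos dist_last_le by (intro mult_left_mono) auto
  then show "near_ratio * dist_last s \<le> gap" using range by (simp add: near_ratio_def field_simps)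
qed

lemma
  assumes s: "s \<in> {1..p-1}" and t: "z s \<le> t" "t \<le> z s + near_ratio * dist_last s" and r: "r \<in> {1..p}" "r \<noteq> s"
  shows near_imp_gap_le: "gap \<le> \<bar>t - z r\<bar>"
    and near_imp_le_range: "\<bar>t - z r\<bar> \<le> z p - z 1"
proof -
  have t_le: "t \<le> z s + gap" using t near_ratio_mult_dist_last_le[OF s] by linarith
  consider (less) "r < s" | (greater) "s < r" using r by linarith
  then show "gap \<le> \<bar>t - z r\<bar>"
  proof cases
    case less
    then have "2 * gap \<le> z s - z r" using r s by (intro gap_le_diff) auto
    then show ?thesis using t gap_pos by linarith
  next
    case greater
    then have "2 * gap \<le> z r - z s" using r s by (intro gap_le_diff) auto
    then show ?thesis using t_le gap_pos by linarith
  qed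
  have "s \<in> {1..p}" "2 * gap \<le> z p - z s" using s p_ge_2 by (auto intro!: gap_le_diff)
  then have "t \<in> {z 1..z p}" using z_in_range[of s] t t_le gap_pos by auto
  then show "\<bar>t - z r\<bar> \<le> z p - z 1" using r by (intro abs_diff_z_le)
qed

definition scaling_exponent :: "(nat \<Rightarrow> nat) \<Rightarrow> complex" where
  "scaling_exponent l = (\<Sum>i=1..n. \<alpha> (site l i))
     + (\<Sum>i=1..n. \<Sum>j\<in>{i<..n}. if site l i = site l j then 2 * \<gamma> else 0)"

definition site_constant :: "nat \<Rightarrow> complex" where
  "site_constant s = abs_pow (dist_last s) (\<alpha> s) * (\<Prod>r\<in>{1..p}-{s}. abs_pow (z s - z r) (\<alpha> r))"

definition pair_constant :: "nat \<Rightarrow> nat \<Rightarrow> complex" where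
  "pair_constant r s = (if r = s then abs_pow (dist_last s) (2 * \<gamma>) else abs_pow (z s - z r) (2 * \<gamma>))"

definition cell_constant :: "(nat \<Rightarrow> nat) \<Rightarrow> complex" where
  "cell_constant l = (\<Prod>i=1..n. site_constant (site l i))
     * (\<Prod>i=1..n. \<Prod>j\<in>{i<..n}. pair_constant (site l i) (site l j))"

lemma abs_pow_scaling_exponent:
  assumes "x \<noteq> 0"
  shows "abs_pow x (scaling_exponent l) = (\<Prod>i=1..n. abs_pow x (\<alpha> (site l i)))
    * (\<Prod>i=1..n. \<Prod>j\<in>{i<..n}. if site l i = site l j then abs_pow x (2 * \<gamma>) else 1)"
  unfolding scaling_exponent_def abs_pow_add abs_pow_sum[OF assms] using abs_pow_exponent_0[OF assms]
  by (intro arg_cong2[of _ _ _ _ "(*)"] prod.cong refl) auto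

definition decay :: "(nat \<Rightarrow> nat) \<Rightarrow> (nat \<Rightarrow> real) \<Rightarrow> real" where
  "decay l t = (\<Prod>i=1..n. (z p - t i) / dist_last (site l i))"

definition pole_integrand :: "(nat \<Rightarrow> nat) \<Rightarrow> (nat \<Rightarrow> nat) \<Rightarrow> (nat \<Rightarrow> real) \<Rightarrow> complex" where
  "pole_integrand l \<tau> t = cell_weight l t * (\<Prod>i=1..n. 1 / of_real (t i - z (\<tau> i)))"

definition scaled_integrand :: "(nat \<Rightarrow> nat) \<Rightarrow> (nat \<Rightarrow> nat) \<Rightarrow> nat \<Rightarrow> (nat \<Rightarrow> real) \<Rightarrow> complex" where
  "scaled_integrand l \<tau> K t
      = abs_pow (real K) (scaling_exponent l) * of_real (decay l t ^ K) * pole_integrand l \<tau> t"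

text \<open>The part of the cell on which the substitution \<open>t\<^sub>i = z\<^sub>s + c\<^sub>s y\<^sub>i / K\<close>, \<open>c\<^sub>s = z\<^sub>p - z\<^sub>s\<close>, is made;
  outside it the integral decays geometrically in \<open>K\<close>.\<close>

definition near :: "(nat \<Rightarrow> nat) \<Rightarrow> (nat \<Rightarrow> real) \<Rightarrow> bool" where
  "near l t \<longleftrightarrow> (\<forall>i\<in>{1..n}. t i \<le> z (site l i) + near_ratio * dist_last (site l i))"

lemma measurable_near [measurable]: "Measurable.pred (Rn n) (near l)"
  unfolding near_def by (rule measurable_Rn_ball) measurable

context
  fixes l \<tau> :: "nat \<Rightarrow> nat"
  assumes l: "l \<in> Zset n (p - 1)" and \<tau>: "\<And>i. i \<in> {1..n} \<Longrightarrow> \<tau> i \<in> {1..p-1}"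
begin

lemma integrable_pole_integrand: "integrable (Rn n) (pole_integrand l \<tau>)"
proof -
  have "admissible (\<lambda>t. 1 / of_real (t - z (\<tau> i)))" if "i \<in> {1..n}" for i
    using \<tau>[OF that] p_ge_2 by (intro admissible_pole) auto
  then show ?thesis unfolding pole_integrand_def[abs_def] by (intro integrable_cell_weight_prod[OF l])
qed

lemma measurable_decay: "decay l \<in> borel_measurable (Rn n)"
  unfolding decay_def[abs_def] by measurable

lemma measurable_scaled_integrand: "scaled_integrand l \<tau> K \<in> borel_measurable (Rn n)"
proof -
  note [measurable] = measurable_decay borel_measurable_integrable[OF integrable_pole_integrand]
  show ?thesis unfolding scaled_integrand_def[abs_def] by measurable
qed

lemma decay_factor_bounds:
  assumes "in_cell l t" "i \<in> {1..n}"
  shows "0 \<le> (z p - t i) / dist_last (site l i) \<and> (z p - t i) / dist_last (site l i) \<le> 1"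
proof -
  have "dist_last (site l i) > 0" using assms by (intro dist_last_pos site_range[OF l])
  then show ?thesis using in_cell_range[OF l assms] in_cell_bounds[OF assms] by (auto simp: dist_last_def)
qed

lemma decay_nonneg: "in_cell l t \<Longrightarrow> 0 \<le> decay l t"
  unfolding decay_def by (intro prod_nonneg) (simp add: decay_factor_bounds)

lemma decay_le_1: "in_cell l t \<Longrightarrow> decay l t \<le> 1"
  unfolding decay_def by (intro prod_le_1) (simp add: decay_factor_bounds)

lemma decay_le_far:
  assumes t: "in_cell l t" and far: "\<not> near l t"
  shows "decay l t \<le> 1 - near_ratio"
proof -
  obtain k where k: "k \<in> {1..n}" "t k > z (site l k) + near_ratio * dist_last (site l k)"
    using far by (auto simp: near_def not_le)
  let ?f = "\<lambda>i. (z p - t i) / dist_last (site l i)"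
  have "z p - t k \<le> (1 - near_ratio) * dist_last (site l k)" using k(2) by (simp add: dist_last_def algebra_simps)
  then have "?f k \<le> 1 - near_ratio" using dist_last_pos[OF site_range[OF l k(1)]] by (simp add: divide_le_eq)
  moreover have "decay l t = ?f k * (\<Prod>i\<in>{1..n}-{k}. ?f i)" unfolding decay_def using k by (intro prod.remove) auto
  moreover have "(\<Prod>i\<in>{1..n}-{k}. ?f i) \<le> 1" using t by (intro prod_le_1) (simp add: decay_factor_bounds)
  ultimately show ?thesis
    using mult_left_mono[of "\<Prod>i\<in>{1..n}-{k}. ?f i" 1 "?f k"] decay_factor_bounds[OF t k(1)] by simp
qed

lemma norm_scaled_integrand:
  assumes "in_cell l t"
  shows "norm (scaled_integrand l \<tau> K t)
      = real K powr Re (scaling_exponent l) * decay l t ^ K * norm (pole_integrand l \<tau> t)"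
  using decay_nonneg[OF assms] by (simp add: scaled_integrand_def norm_mult norm_abs_pow norm_power)

lemma norm_scaled_integrand_le:
  assumes "in_cell l t \<Longrightarrow> decay l t \<le> d"
  shows "norm (scaled_integrand l \<tau> K t)
      \<le> real K powr Re (scaling_exponent l) * d ^ K * norm (pole_integrand l \<tau> t)"
proof (cases "in_cell l t")
  case True
  then show ?thesis
    unfolding norm_scaled_integrand[OF True] using assms decay_nonneg
    by (intro mult_right_mono mult_left_mono power_mono) auto
qed (simp add: scaled_integrand_def pole_integrand_def cell_weight_def)

lemma integrable_scaled_integrand: "integrable (Rn n) (scaled_integrand l \<tau> K)"
proof (rule integrable_of_norm_le)
  show "integrable (Rn n) (\<lambda>t. real K powr Re (scaling_exponent l) * 1 ^ K * norm (pole_integrand l \<tau> t))"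
    by (intro integrable_mult_right integrable_norm integrable_pole_integrand)
  show "norm (scaled_integrand l \<tau> K t)
      \<le> real K powr Re (scaling_exponent l) * 1 ^ K * norm (pole_integrand l \<tau> t)" for t
    by (intro norm_scaled_integrand_le decay_le_1)
qed (rule measurable_scaled_integrand)

lemma integral_far_tendsto_0:
  "(\<lambda>k. \<integral>t. (if near l t then 0 else scaled_integrand l \<tau> (Suc k) t) \<partial>Rn n) \<longlonglongrightarrow> 0"
proof -
  define C where "C k = real (Suc k) powr Re (scaling_exponent l) * (1 - near_ratio) ^ Suc k" for k
  define J where "J = (\<integral>t. norm (pole_integrand l \<tau> t) \<partial>Rn n)"
  have C_nonneg: "C k \<ge> 0" for k using near_ratio_le by (simp add: C_def)
  have bound: "norm (\<integral>t. (if near l t then 0 else scaled_integrand l \<tau> (Suc k) t) \<partial>Rn n) \<le> C k * J" for k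
  proof -
    have "norm (if near l t then 0 else scaled_integrand l \<tau> (Suc k) t) \<le> C k * norm (pole_integrand l \<tau> t)" for t
      using norm_scaled_integrand_le[OF decay_le_far, of t "Suc k"] C_nonneg[of k]
      by (simp add: C_def del: power_Suc)
    then have "norm (\<integral>t. (if near l t then 0 else scaled_integrand l \<tau> (Suc k) t) \<partial>Rn n)
        \<le> (\<integral>t. C k * norm (pole_integrand l \<tau> t) \<partial>Rn n)"
      using C_nonneg integrable_norm[OF integrable_pole_integrand]
      by (intro order_trans[OF integral_norm_bound integral_mono']) auto
    then show ?thesis by (simp add: J_def)
  qed
  have "(\<lambda>k. C k * J) \<longlonglongrightarrow> 0"
    unfolding C_def using near_ratio_pos near_ratio_le
    by (intro tendsto_mult_left_zero powr_times_power_tendsto_0) auto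
  then show ?thesis by (rule Lim_null_comparison[OF always_eventually, rotated]) (rule allI, rule bound)
qed

definition rescaled_coord :: "nat \<Rightarrow> nat \<Rightarrow> real \<Rightarrow> real" where
  "rescaled_coord K i u = z (site l i) + dist_last (site l i) / real K * u"

definition rescale :: "nat \<Rightarrow> (nat \<Rightarrow> real) \<Rightarrow> nat \<Rightarrow> real" where
  "rescale K = affine_reindex {1..n} (\<lambda>i. i) (\<lambda>i. dist_last (site l i) / real K) (\<lambda>i. z (site l i))"

definition in_rescaled_cell :: "nat \<Rightarrow> (nat \<Rightarrow> real) \<Rightarrow> bool" where
  "in_rescaled_cell K y \<longleftrightarrow> in_block_chamber n (site l) y \<and> (\<forall>i\<in>{1..n}. y i \<le> near_ratio * real K)"

definition site_factor :: "nat \<Rightarrow> nat \<Rightarrow> real \<Rightarrow> complex" where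
  "site_factor K i u = abs_pow (dist_last (site l i) * u) (\<alpha> (site l i))
     * (\<Prod>r\<in>{1..p}-{site l i}. abs_pow (rescaled_coord K i u - z r) (\<alpha> r)) * of_real ((1 - u / real K) ^ K)
     * of_real (dist_last (site l i) / (real K * (rescaled_coord K i u - z (\<tau> i))))"

definition pair_factor :: "nat \<Rightarrow> (nat \<Rightarrow> real) \<Rightarrow> nat \<Rightarrow> nat \<Rightarrow> complex" where
  "pair_factor K y i j = (if site l i = site l j then abs_pow (dist_last (site l i) * (y j - y i)) (2 * \<gamma>)
     else abs_pow (rescaled_coord K j (y j) - rescaled_coord K i (y i)) (2 * \<gamma>))"

definition rescaled_integrand :: "nat \<Rightarrow> (nat \<Rightarrow> real) \<Rightarrow> complex" where
  "rescaled_integrand K y = (if in_rescaled_cell K y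
     then (\<Prod>i=1..n. site_factor K i (y i)) * (\<Prod>i=1..n. \<Prod>j\<in>{i<..n}. pair_factor K y i j) else 0)"

lemma rescale_apply: "i \<in> {1..n} \<Longrightarrow> rescale K y i = rescaled_coord K i (y i)"
  unfolding rescale_def rescaled_coord_def by (rule affine_reindex_apply)

lemma site_in: "i \<in> {1..n} \<Longrightarrow> site l i \<in> {1..p}"
  using site_range[OF l, of i] by auto

lemma dist_last_site_pos: "i \<in> {1..n} \<Longrightarrow> dist_last (site l i) > 0"
  by (intro dist_last_pos site_range[OF l])

lemma
  assumes "K > 0" "i \<in> {1..n}"
  shows rescaled_coord_ge_iff: "z (site l i) \<le> rescaled_coord K i u \<longleftrightarrow> 0 \<le> u"
    and rescaled_coord_near_iff:
      "rescaled_coord K i u \<le> z (site l i) + near_ratio * dist_last (site l i) \<longleftrightarrow> u \<le> near_ratio * real K"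
    and rescaled_coord_le_iff:
      "site l j = site l i \<Longrightarrow> rescaled_coord K j v \<le> rescaled_coord K i u \<longleftrightarrow> v \<le> u"
proof -
  define d where "d = dist_last (site l i) / real K"
  have d: "d > 0" and dist: "dist_last (site l i) = d * real K"
    using dist_last_site_pos[OF assms(2)] assms(1) by (auto simp: d_def)
  have cancel: "d * x \<le> d * y \<longleftrightarrow> x \<le> y" for x y using d by (rule mult_le_cancel_left_pos)
  show "z (site l i) \<le> rescaled_coord K i u \<longleftrightarrow> 0 \<le> u"
    using cancel[of 0 u] by (simp add: rescaled_coord_def d_def[symmetric])
  show "rescaled_coord K i u \<le> z (site l i) + near_ratio * dist_last (site l i) \<longleftrightarrow> u \<le> near_ratio * real K"
    unfolding rescaled_coord_def d_def[symmetric] add_le_cancel_left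
    unfolding dist mult.left_commute[of near_ratio d] by (rule cancel)
  show "rescaled_coord K j v \<le> rescaled_coord K i u \<longleftrightarrow> v \<le> u" if "site l j = site l i"
    unfolding rescaled_coord_def that d_def[symmetric] using cancel by simp
qed

lemma in_rescaled_cellD:
  assumes "in_rescaled_cell K y" "i \<in> {1..n}"
  shows "0 \<le> y i" "y i \<le> near_ratio * real K"
  using assms by (auto simp: in_rescaled_cell_def in_block_chamber_def)

lemma in_cell_rescale:
  assumes K: "K > 0" and y: "in_rescaled_cell K y"
  shows "in_cell l (rescale K y)"
proof -
  have lower: "z (site l i) \<le> rescale K y i" if i: "i \<in> {1..n}" for i
    using rescaled_coord_ge_iff[OF K i] in_rescaled_cellD[OF y i] by (simp add: rescale_apply[OF i])
  have upper: "rescale K y i \<le> z s" if i: "i \<in> {1..n}" and s: "site l i < s" "s \<le> p" for i s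
  proof -
    have site: "site l i \<in> {1..p-1}" by (rule site_range[OF l i])
    have "rescale K y i \<le> z (site l i) + near_ratio * dist_last (site l i)"
      using rescaled_coord_near_iff[OF K i] in_rescaled_cellD[OF y i] by (simp add: rescale_apply[OF i])
    moreover have "2 * gap \<le> z s - z (site l i)" using site s by (intro gap_le_diff) auto
    ultimately show ?thesis using near_ratio_mult_dist_last_le[OF site] gap_pos by linarith
  qed
  show ?thesis
    unfolding in_cell_def
  proof (intro conjI ballI mono_onI)
    fix i assume i: "i \<in> {1..n}"
    show "z (site l i) \<le> rescale K y i" by (rule lower[OF i])
    have "site l i < site l i + 1" "site l i + 1 \<le> p" using site_range[OF l i] p_ge_2 by auto
    then show "rescale K y i \<le> z (site l i + 1)" by (rule upper[OF i])
  next
    fix i j assume i: "i \<in> {1..n}" and j: "j \<in> {1..n}" and "i \<le> j"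
    show "rescale K y i \<le> rescale K y j"
    proof (cases "site l i = site l j")
      case True
      then have "y i \<le> y j" using y i j \<open>i \<le> j\<close> unfolding in_rescaled_cell_def in_block_chamber_def by blast
      then show ?thesis unfolding rescale_apply[OF i] rescale_apply[OF j] rescaled_coord_le_iff[OF K j True] .
    next
      case False
      then have "site l i < site l j" using site_mono[OF l \<open>i \<le> j\<close> i j] by simp
      moreover have "site l j \<le> p" using site_range[OF l j] by auto
      ultimately show ?thesis using upper[OF i, of "site l j"] lower[OF j] by linarith
    qed
  qed
qed

lemma in_rescaled_cell_iff:
  assumes K: "K > 0"
  shows "in_rescaled_cell K y \<longleftrightarrow> in_cell l (rescale K y) \<and> near l (rescale K y)"
proof
  assume y: "in_rescaled_cell K y"
  then have "near l (rescale K y)"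
    unfolding near_def using in_rescaled_cellD[OF y] by (simp add: rescale_apply rescaled_coord_near_iff[OF K])
  then show "in_cell l (rescale K y) \<and> near l (rescale K y)" using in_cell_rescale[OF K y] by simp
next
  assume t: "in_cell l (rescale K y) \<and> near l (rescale K y)"
  have nonneg: "0 \<le> y i" if i: "i \<in> {1..n}" for i
    using in_cell_bounds[OF conjunct1[OF t] i] rescaled_coord_ge_iff[OF K i] by (simp add: rescale_apply[OF i])
  have bounded: "y i \<le> near_ratio * real K" if i: "i \<in> {1..n}" for i
    using t i unfolding near_def rescaled_coord_near_iff[OF K i, symmetric] rescale_apply[OF i, symmetric] by blast
  have "y i \<le> y j" if i: "i \<in> {1..n}" and j: "j \<in> {1..n}" and "i \<le> j" "site l i = site l j" for i j
    using in_cell_mono[OF conjunct1[OF t] i j \<open>i \<le> j\<close>] rescaled_coord_le_iff[OF K j \<open>site l i = site l j\<close>]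
    by (simp add: rescale_apply[OF i] rescale_apply[OF j])
  then show "in_rescaled_cell K y"
    unfolding in_rescaled_cell_def in_block_chamber_def using nonneg bounded by blast
qed

lemma decay_rescale:
  assumes K: "K > 0"
  shows "decay l (rescale K y) = (\<Prod>i=1..n. 1 - y i / real K)"
  unfolding decay_def
proof (rule prod.cong[OF refl])
  fix i assume i: "i \<in> {1..n}"
  show "(z p - rescale K y i) / dist_last (site l i) = 1 - y i / real K"
    unfolding rescale_apply[OF i] rescaled_coord_def using dist_last_site_pos[OF i] K
    by (simp add: dist_last_def field_simps)
qed

lemma point_weight_rescaled_coord:
  assumes K: "K > 0" and i: "i \<in> {1..n}"
  shows "abs_pow (real K) (\<alpha> (site l i)) * point_weight (rescaled_coord K i u)
    = abs_pow (dist_last (site l i) * u) (\<alpha> (site l i))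
      * (\<Prod>r\<in>{1..p}-{site l i}. abs_pow (rescaled_coord K i u - z r) (\<alpha> r))"
proof -
  have "point_weight (rescaled_coord K i u) = abs_pow (rescaled_coord K i u - z (site l i)) (\<alpha> (site l i))
      * (\<Prod>r\<in>{1..p}-{site l i}. abs_pow (rescaled_coord K i u - z r) (\<alpha> r))"
    unfolding point_weight_def using site_in[OF i] by (intro prod.remove) auto
  moreover have "real K * (rescaled_coord K i u - z (site l i)) = dist_last (site l i) * u"
    using K by (simp add: rescaled_coord_def)
  ultimately show ?thesis by (simp add: mult.assoc[symmetric] abs_pow_mult[symmetric])
qed

lemma vandermonde_rescale:
  assumes K: "K > 0"
  shows "(\<Prod>i=1..n. \<Prod>j\<in>{i<..n}. if site l i = site l j then abs_pow (real K) (2 * \<gamma>) else 1)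
      * vandermonde n \<gamma> (rescale K y) = (\<Prod>i=1..n. \<Prod>j\<in>{i<..n}. pair_factor K y i j)"
  unfolding vandermonde_def prod.distrib[symmetric]
proof (intro prod.cong refl)
  fix i j assume i: "i \<in> {1..n}" and "j \<in> {i<..n}"
  then have j: "j \<in> {1..n}" by auto
  have "real K * (rescaled_coord K j (y j) - rescaled_coord K i (y i)) = dist_last (site l i) * (y j - y i)"
    if "site l i = site l j"
    using K by (simp add: rescaled_coord_def that algebra_simps)
  then show "(if site l i = site l j then abs_pow (real K) (2 * \<gamma>) else 1)
      * abs_pow (rescale K y j - rescale K y i) (2 * \<gamma>) = pair_factor K y i j"
    unfolding rescale_apply[OF i] rescale_apply[OF j] by (simp add: pair_factor_def abs_pow_mult[symmetric])
qed

lemma scaled_integrand_rescale: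
  assumes K: "K > 0" and y: "in_rescaled_cell K y"
  shows "of_real (\<Prod>i=1..n. dist_last (site l i) / real K) * scaled_integrand l \<tau> K (rescale K y)
    = (\<Prod>i=1..n. site_factor K i (y i)) * (\<Prod>i=1..n. \<Prod>j\<in>{i<..n}. pair_factor K y i j)"
proof -
  have K0: "real K \<noteq> 0" using K by simp
  let ?c = "\<lambda>i. of_real (dist_last (site l i) / real K) :: complex"
  let ?pole = "\<lambda>i. 1 / of_real (rescale K y i - z (\<tau> i)) :: complex"
  have site: "?c i * (abs_pow (real K) (\<alpha> (site l i)) * point_weight (rescale K y i))
      * of_real ((1 - y i / real K) ^ K) * ?pole i = site_factor K i (y i)" if i: "i \<in> {1..n}" for i
    unfolding rescale_apply[OF i] point_weight_rescaled_coord[OF K i] site_factor_def by (simp add: mult_ac)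
  have "of_real (\<Prod>i=1..n. dist_last (site l i) / real K) * scaled_integrand l \<tau> K (rescale K y)
      = (\<Prod>i=1..n. ?c i * (abs_pow (real K) (\<alpha> (site l i)) * point_weight (rescale K y i))
          * of_real ((1 - y i / real K) ^ K) * ?pole i)
        * ((\<Prod>i=1..n. \<Prod>j\<in>{i<..n}. if site l i = site l j then abs_pow (real K) (2 * \<gamma>) else 1)
          * vandermonde n \<gamma> (rescale K y))"
    unfolding scaled_integrand_def pole_integrand_def cell_weight_def if_P[OF in_cell_rescale[OF K y]] Psi_eq
      abs_pow_scaling_exponent[OF K0] decay_rescale[OF K] prod.distrib of_real_prod of_real_power
        prod_power_distrib
    by (simp only: mult_ac)
  also have "\<dots> = (\<Prod>i=1..n. site_factor K i (y i)) * (\<Prod>i=1..n. \<Prod>j\<in>{i<..n}. pair_factor K y i j)"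
    unfolding vandermonde_rescale[OF K] using site by (intro arg_cong2[of _ _ _ _ "(*)"] prod.cong refl)
  finally show ?thesis .
qed

lemma rescaled_integrand_eq:
  assumes K: "K > 0"
  shows "rescaled_integrand K y = (\<Prod>i=1..n. \<bar>dist_last (site l i) / real K\<bar>)
    *\<^sub>R (if near l (rescale K y) then scaled_integrand l \<tau> K (rescale K y) else 0)"
proof (cases "in_rescaled_cell K y")
  case True
  have "(\<Prod>i=1..n. \<bar>dist_last (site l i) / real K\<bar>) = (\<Prod>i=1..n. dist_last (site l i) / real K)"
    using dist_last_site_pos by (intro prod.cong refl abs_of_nonneg divide_nonneg_nonneg) (auto intro: less_imp_le)
  then show ?thesis
    using True scaled_integrand_rescale[OF K True] unfolding in_rescaled_cell_iff[OF K]
    by (simp add: rescaled_integrand_def in_rescaled_cell_iff[OF K] scaleR_conv_of_real)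
next
  case False
  then have "near l (rescale K y) \<Longrightarrow> scaled_integrand l \<tau> K (rescale K y) = 0"
    unfolding in_rescaled_cell_iff[OF K] by (simp add: scaled_integrand_def pole_integrand_def cell_weight_def)
  then show ?thesis using False by (simp add: rescaled_integrand_def)
qed

lemma measurable_near_scaled_integrand:
  "(\<lambda>t. if near l t then scaled_integrand l \<tau> K t else 0) \<in> borel_measurable (Rn n)"
proof -
  note [measurable] = measurable_scaled_integrand
  show ?thesis by measurable
qed

lemma measurable_rescaled_integrand:
  assumes "K > 0"
  shows "rescaled_integrand K \<in> borel_measurable (Rn n)"
proof -
  have "rescale K \<in> measurable (Rn n) (Rn n)"
    unfolding rescale_def by (rule measurable_affine_reindex) (simp add: bij_betw_def)
  note [measurable] = measurable_compose[OF this measurable_near_scaled_integrand]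
  show ?thesis unfolding rescaled_integrand_eq[OF assms, abs_def] by measurable
qed

lemma integral_near_eq:
  assumes K: "K > 0"
  shows "(\<integral>t. (if near l t then scaled_integrand l \<tau> K t else 0) \<partial>Rn n) = (\<integral>y. rescaled_integrand K y \<partial>Rn n)"
proof -
  have "dist_last (site l i) / real K \<noteq> 0" if "i \<in> {1..n}" for i using dist_last_site_pos[OF that] K by simp
  then show ?thesis
    unfolding rescaled_integrand_eq[OF K] rescale_def integral_scaleR_right
    by (intro integral_PiM_affine measurable_near_scaled_integrand) (auto simp: bij_betw_def)
qed

lemma rescaled_coord_tendsto: "(\<lambda>k. rescaled_coord (Suc k) i u) \<longlonglongrightarrow> z (site l i)"
proof -
  have "(\<lambda>k. z (site l i) + dist_last (site l i) * (1 / real (Suc k)) * u)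
      \<longlonglongrightarrow> z (site l i) + dist_last (site l i) * 0 * u"
    by (intro tendsto_intros LIMSEQ_Suc[OF lim_1_over_n])
  then show ?thesis by (simp add: rescaled_coord_def)
qed

lemma pole_factor_site:
  assumes "K > 0" "i \<in> {1..n}" "\<tau> i = site l i"
  shows "dist_last (site l i) / (real K * (rescaled_coord K i u - z (\<tau> i))) = 1 / u"
proof -
  have "real K * (rescaled_coord K i u - z (\<tau> i)) = dist_last (site l i) * u"
    using assms(1) by (simp add: rescaled_coord_def assms(3))
  then show ?thesis using dist_last_site_pos[OF assms(2)] by simp
qed

lemma pole_factor_tendsto:
  assumes i: "i \<in> {1..n}"
  shows "(\<lambda>k. dist_last (site l i) / (real (Suc k) * (rescaled_coord (Suc k) i u - z (\<tau> i))))
    \<longlonglongrightarrow> (if \<tau> i = site l i then 1 / u else 0)"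
proof (cases "\<tau> i = site l i")
  case True
  then show ?thesis using pole_factor_site[OF zero_less_Suc i True] by (simp del: of_nat_Suc)
next
  case False
  moreover have "\<tau> i \<in> {1..p}" using \<tau>[OF i] by auto
  ultimately have "z (site l i) - z (\<tau> i) \<noteq> 0" using z_neq[of "site l i" "\<tau> i"] site_in[OF i] by auto
  then have "(\<lambda>k. dist_last (site l i) * (1 / real (Suc k)) / (rescaled_coord (Suc k) i u - z (\<tau> i)))
      \<longlonglongrightarrow> dist_last (site l i) * 0 / (z (site l i) - z (\<tau> i))"
    by (intro tendsto_intros LIMSEQ_Suc[OF lim_1_over_n] rescaled_coord_tendsto)
  then show ?thesis using False by simp
qed

lemma site_factor_tendsto:
  assumes i: "i \<in> {1..n}"
  shows "(\<lambda>k. site_factor (Suc k) i u)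
    \<longlonglongrightarrow> site_constant (site l i) * (if \<tau> i = site l i then Laguerre_weight (\<alpha> (site l i)) u else 0)"
proof -
  let ?s = "site l i"
  have "(\<lambda>k. \<Prod>r\<in>{1..p}-{?s}. abs_pow (rescaled_coord (Suc k) i u - z r) (\<alpha> r))
      \<longlonglongrightarrow> (\<Prod>r\<in>{1..p}-{?s}. abs_pow (z ?s - z r) (\<alpha> r))"
  proof (intro tendsto_prod tendsto_abs_pow tendsto_intros rescaled_coord_tendsto)
    fix r assume "r \<in> {1..p} - {?s}"
    then show "z ?s - z r \<noteq> 0" using z_neq[of ?s r] site_in[OF i] by auto
  qed
  then have "(\<lambda>k. site_factor (Suc k) i u) \<longlonglongrightarrow> abs_pow (dist_last ?s * u) (\<alpha> ?s)
      * (\<Prod>r\<in>{1..p}-{?s}. abs_pow (z ?s - z r) (\<alpha> r)) * of_real (exp (- u))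
      * of_real (if \<tau> i = ?s then 1 / u else 0)"
    unfolding site_factor_def
    by (intro tendsto_mult tendsto_const tendsto_of_real power_tendsto_exp_minus pole_factor_tendsto[OF i])
  also have "abs_pow (dist_last ?s * u) (\<alpha> ?s) * (\<Prod>r\<in>{1..p}-{?s}. abs_pow (z ?s - z r) (\<alpha> r))
        * of_real (exp (- u)) * of_real (if \<tau> i = ?s then 1 / u else 0)
      = site_constant ?s * (if \<tau> i = ?s then Laguerre_weight (\<alpha> ?s) u else 0)"
    by (simp add: abs_pow_mult site_constant_def Laguerre_weight_def)
  finally show ?thesis .
qed

lemma pair_factor_tendsto:
  assumes "i \<in> {1..n}" "j \<in> {1..n}"
  shows "(\<lambda>k. pair_factor (Suc k) y i j)
    \<longlonglongrightarrow> pair_constant (site l i) (site l j) * (if site l i = site l j then abs_pow (y j - y i) (2 * \<gamma>) else 1)"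
proof (cases "site l i = site l j")
  case True
  then show ?thesis by (simp add: pair_factor_def pair_constant_def abs_pow_mult)
next
  case False
  then have "z (site l j) - z (site l i) \<noteq> 0"
    using z_neq[of "site l j" "site l i"] site_in[OF assms(1)] site_in[OF assms(2)] by auto
  then have "(\<lambda>k. abs_pow (rescaled_coord (Suc k) j (y j) - rescaled_coord (Suc k) i (y i)) (2 * \<gamma>))
      \<longlonglongrightarrow> abs_pow (z (site l j) - z (site l i)) (2 * \<gamma>)"
    by (intro tendsto_abs_pow tendsto_intros rescaled_coord_tendsto)
  then show ?thesis using False by (simp add: pair_factor_def pair_constant_def)
qed

definition limit_integrand :: "(nat \<Rightarrow> real) \<Rightarrow> complex" where
  "limit_integrand y
      = (if \<forall>i\<in>{1..n}. \<tau> i = site l i then cell_constant l * block_integrand n (site l) \<alpha> \<gamma> y else 0)"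

lemma rescaled_integrand_tendsto: "(\<lambda>k. rescaled_integrand (Suc k) y) \<longlonglongrightarrow> limit_integrand y"
proof (cases "in_block_chamber n (site l) y")
  case False
  then show ?thesis
    by (simp add: rescaled_integrand_def in_rescaled_cell_def limit_integrand_def block_integrand_def)
next
  case chamber: True
  let ?weight = "\<lambda>i. if \<tau> i = site l i then Laguerre_weight (\<alpha> (site l i)) (y i) else 0"
  let ?pair = "\<lambda>i j. if site l i = site l j then abs_pow (y j - y i) (2 * \<gamma>) else 1"
  have "filterlim (\<lambda>k. near_ratio * real (Suc k)) at_top sequentially"
    by (intro filterlim_tendsto_pos_mult_at_top[OF tendsto_const near_ratio_pos]
        filterlim_compose[OF filterlim_real_sequentially filterlim_Suc])
  then have "\<forall>\<^sub>F k in sequentially. \<forall>i\<in>{1..n}. y i \<le> near_ratio * real (Suc k)"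
    unfolding filterlim_at_top by (intro eventually_ball_finite) auto
  then have "\<forall>\<^sub>F k in sequentially. (\<Prod>i=1..n. site_factor (Suc k) i (y i))
      * (\<Prod>i=1..n. \<Prod>j\<in>{i<..n}. pair_factor (Suc k) y i j) = rescaled_integrand (Suc k) y"
    by eventually_elim (use chamber in \<open>simp add: rescaled_integrand_def in_rescaled_cell_def\<close>)
  moreover have "(\<lambda>k. (\<Prod>i=1..n. site_factor (Suc k) i (y i)) * (\<Prod>i=1..n. \<Prod>j\<in>{i<..n}. pair_factor (Suc k) y i j))
      \<longlonglongrightarrow> (\<Prod>i=1..n. site_constant (site l i) * ?weight i)
        * (\<Prod>i=1..n. \<Prod>j\<in>{i<..n}. pair_constant (site l i) (site l j) * ?pair i j)"
    by (intro tendsto_mult tendsto_prod site_factor_tendsto pair_factor_tendsto) auto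
  ultimately have "(\<lambda>k. rescaled_integrand (Suc k) y)
      \<longlonglongrightarrow> (\<Prod>i=1..n. site_constant (site l i) * ?weight i)
        * (\<Prod>i=1..n. \<Prod>j\<in>{i<..n}. pair_constant (site l i) (site l j) * ?pair i j)"
    by (rule Lim_transform_eventually[rotated])
  also have "(\<Prod>i=1..n. site_constant (site l i) * ?weight i)
        * (\<Prod>i=1..n. \<Prod>j\<in>{i<..n}. pair_constant (site l i) (site l j) * ?pair i j)
      = cell_constant l * ((\<Prod>i=1..n. ?weight i) * block_vandermonde n (site l) \<gamma> y)"
    unfolding cell_constant_def block_vandermonde_def prod.distrib by (simp only: mult_ac)
  also have "\<dots> = limit_integrand y"
  proof (cases "\<forall>i\<in>{1..n}. \<tau> i = site l i")
    case True
    then have "(\<Prod>i=1..n. ?weight i) = (\<Prod>i=1..n. Laguerre_weight (\<alpha> (site l i)) (y i))" by (intro prod.cong) auto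
    then show ?thesis unfolding limit_integrand_def block_integrand_def if_P[OF True] if_P[OF chamber]
      by (simp only:)
  next
    case False
    then have "(\<Prod>i=1..n. ?weight i) = 0" by (intro prod_zero) auto
    then show ?thesis unfolding limit_integrand_def if_not_P[OF False] by simp
  qed
  finally show ?thesis .
qed

definition site_bound :: "nat \<Rightarrow> real" where
  "site_bound s = dist_last s powr Re (\<alpha> s)
     * (\<Prod>r\<in>{1..p}-{s}. gap powr Re (\<alpha> r) + (z p - z 1) powr Re (\<alpha> r)) * (1 + dist_last s / gap)"

lemma site_bound_nonneg: "i \<in> {1..n} \<Longrightarrow> site_bound (site l i) \<ge> 0"
  unfolding site_bound_def using dist_last_site_pos[of i] gap_pos
  by (intro mult_nonneg_nonneg prod_nonneg add_nonneg_nonneg) auto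

lemma
  assumes K: "K > 0" and i: "i \<in> {1..n}" and u: "0 \<le> u" "u \<le> near_ratio * real K"
    and r: "r \<in> {1..p}" "r \<noteq> site l i"
  shows gap_le_rescaled_coord: "gap \<le> \<bar>rescaled_coord K i u - z r\<bar>"
    and rescaled_coord_le_range: "\<bar>rescaled_coord K i u - z r\<bar> \<le> z p - z 1"
  using near_imp_gap_le[OF site_range[OF l i] _ _ r] near_imp_le_range[OF site_range[OF l i] _ _ r]
    rescaled_coord_ge_iff[OF K i] rescaled_coord_near_iff[OF K i] u by auto

lemma pole_factor_le:
  assumes K: "K > 0" and i: "i \<in> {1..n}" and u: "0 < u" "u \<le> near_ratio * real K"
  shows "\<bar>dist_last (site l i) / (real K * (rescaled_coord K i u - z (\<tau> i)))\<bar>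
    \<le> (1 + dist_last (site l i) / gap) * ((1 + u) / u)"
proof -
  let ?c = "dist_last (site l i)"
  have c: "?c > 0" by (rule dist_last_site_pos[OF i])
  have "\<bar>?c / (real K * (rescaled_coord K i u - z (\<tau> i)))\<bar> \<le> 1 / u + ?c / gap"
  proof (cases "\<tau> i = site l i")
    case True
    then show ?thesis unfolding pole_factor_site[OF K i True] using u c gap_pos by simp
  next
    case False
    have "\<tau> i \<in> {1..p}" using \<tau>[OF i] by auto
    then have "gap \<le> \<bar>rescaled_coord K i u - z (\<tau> i)\<bar>" using gap_le_rescaled_coord[OF K i _ u(2)] u False by simp
    then have "1 * gap \<le> real K * \<bar>rescaled_coord K i u - z (\<tau> i)\<bar>" using K gap_pos by (intro mult_mono) auto
    then have "?c / (real K * \<bar>rescaled_coord K i u - z (\<tau> i)\<bar>) \<le> ?c / gap"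
      using c gap_pos by (intro divide_left_mono) auto
    then show ?thesis using c u by (simp add: abs_mult add_increasing)
  qed
  also have "\<dots> \<le> (1 + ?c / gap) * ((1 + u) / u)"
    using c u gap_pos by (simp add: field_simps)
  finally show ?thesis .
qed

lemma norm_site_factor_le:
  assumes K: "K > 0" and i: "i \<in> {1..n}" and u: "0 \<le> u" "u \<le> near_ratio * real K"
  shows "norm (site_factor K i u) \<le> site_bound (site l i) * Gamma_majorant (Re (\<alpha> (site l i))) 1 u"
proof (cases "u = 0")
  case True
  then show ?thesis using site_bound_nonneg[OF i] by (simp add: site_factor_def Gamma_majorant_def)
next
  case False
  then have u0: "u > 0" using u by simp
  let ?s = "site l i" and ?t = "rescaled_coord K i u"
  let ?B = "\<Prod>r\<in>{1..p}-{?s}. gap powr Re (\<alpha> r) + (z p - z 1) powr Re (\<alpha> r)"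
  have c: "dist_last ?s > 0" by (rule dist_last_site_pos[OF i])
  have "near_ratio * real K \<le> 1 * real K" using near_ratio_le by (intro mult_right_mono) auto
  then have uK: "u \<le> real K" using u(2) by simp
  have own_site: "norm (abs_pow (dist_last ?s * u) (\<alpha> ?s)) = dist_last ?s powr Re (\<alpha> ?s) * u powr Re (\<alpha> ?s)"
    using c u0 by (simp add: norm_abs_pow powr_mult)
  have other_sites: "norm (\<Prod>r\<in>{1..p}-{?s}. abs_pow (?t - z r) (\<alpha> r)) \<le> ?B"
    unfolding prod_norm[symmetric] norm_abs_pow
    using gap_le_rescaled_coord[OF K i u] rescaled_coord_le_range[OF K i u] gap_pos
    by (intro prod_mono conjI powr_between_le) auto
  have "0 \<le> 1 - u / real K" using uK K by simp
  then have exponential: "norm (of_real ((1 - u / real K) ^ K) :: complex) \<le> exp (- u)"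
    using exp_ge_one_minus_x_over_n_power_n[OF uK K] unfolding norm_of_real by simp
  have pole: "norm (of_real (dist_last ?s / (real K * (?t - z (\<tau> i)))) :: complex)
      \<le> (1 + dist_last ?s / gap) * ((1 + u) / u)"
    unfolding norm_of_real by (rule pole_factor_le[OF K i u0 u(2)])
  have "norm (site_factor K i u) \<le> (dist_last ?s powr Re (\<alpha> ?s) * u powr Re (\<alpha> ?s)) * ?B * exp (- u)
      * ((1 + dist_last ?s / gap) * ((1 + u) / u))"
    unfolding site_factor_def norm_mult own_site
    by (intro mult_mono other_sites exponential pole mult_nonneg_nonneg norm_ge_zero prod_nonneg) auto
  also have "\<dots> = site_bound ?s * Gamma_majorant (Re (\<alpha> ?s)) 1 u"
    using u0 by (simp add: site_bound_def Gamma_majorant_def powr_diff)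
  finally show ?thesis .
qed

lemma norm_pair_factor_le:
  assumes K: "K > 0" and y: "in_rescaled_cell K y" and i: "i \<in> {1..n}" and j: "j \<in> {1..n}"
  shows "norm (pair_factor K y i j) \<le> (z p - z 1) powr (2 * Re \<gamma>) * ((1 + y i) * (1 + y j)) powr (2 * Re \<gamma>)"
proof (cases "site l i = site l j")
  case True
  have nonneg: "0 \<le> y i" "0 \<le> y j" using in_rescaled_cellD[OF y] i j by auto
  have "dist_last (site l i) powr (2 * Re \<gamma>) \<le> (z p - z 1) powr (2 * Re \<gamma>)"
    using dist_last_site_pos[OF i] dist_last_le[OF site_range[OF l i]] Re_gamma_pos by (intro powr_mono2) auto
  moreover have "norm (abs_pow (y j - y i) (2 * \<gamma>)) \<le> ((1 + y i) * (1 + y j)) powr (2 * Re \<gamma>)"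
    using norm_abs_pow_diff_le_one_plus[OF nonneg, of "2 * \<gamma>"] Re_gamma_pos by simp
  moreover have "norm (pair_factor K y i j)
      = dist_last (site l i) powr (2 * Re \<gamma>) * norm (abs_pow (y j - y i) (2 * \<gamma>))"
    using True dist_last_site_pos[OF i]
    by (simp add: pair_factor_def abs_pow_mult norm_mult norm_abs_pow[of "dist_last _"])
  ultimately show ?thesis by (simp add: mult_mono)
next
  case False
  have range: "rescaled_coord K k (y k) \<in> {z 1..z p}" if "k \<in> {1..n}" for k
    using in_cell_range[OF l in_cell_rescale[OF K y] that] unfolding rescale_apply[OF that] .
  then have "norm (pair_factor K y i j) \<le> (z p - z 1) powr (2 * Re \<gamma>) * 1"
    unfolding pair_factor_def if_not_P[OF False] mult_1_right by (intro norm_abs_pow_diff_le range i j)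
  also have "\<dots> \<le> (z p - z 1) powr (2 * Re \<gamma>) * ((1 + y i) * (1 + y j)) powr (2 * Re \<gamma>)"
    using in_rescaled_cellD[OF y] i j Re_gamma_pos
    by (intro mult_left_mono one_plus_mult_one_plus_powr_ge_1) auto
  finally show ?thesis .
qed

definition rescaled_majorant :: "(nat \<Rightarrow> real) \<Rightarrow> real" where
  "rescaled_majorant y = ((\<Prod>i=1..n. site_bound (site l i)) * ((z p - z 1) powr (2 * Re \<gamma>)) ^ card (index_pairs n))
     * (\<Prod>i=1..n. Gamma_majorant (Re (\<alpha> (site l i))) (1 + 2 * Re \<gamma> * card (index_pairs n)) (y i))"

lemma norm_rescaled_integrand_le:
  assumes K: "K > 0"
  shows "norm (rescaled_integrand K y) \<le> rescaled_majorant y"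
proof (cases "in_rescaled_cell K y")
  case False
  then show ?thesis
    unfolding rescaled_integrand_def rescaled_majorant_def if_not_P[OF False] norm_zero
    using site_bound_nonneg by (intro mult_nonneg_nonneg prod_nonneg) (auto simp: Gamma_majorant_nonneg)
next
  case True
  let ?Q = "2 * Re \<gamma> * card (index_pairs n)" and ?L = "(z p - z 1) powr (2 * Re \<gamma>)"
  let ?G = "\<lambda>Q i. Gamma_majorant (Re (\<alpha> (site l i))) Q (y i)"
  note y = in_rescaled_cellD[OF True]
  have sites: "norm (\<Prod>i=1..n. site_factor K i (y i)) \<le> (\<Prod>i=1..n. site_bound (site l i) * ?G 1 i)"
    unfolding prod_norm[symmetric] by (intro prod_mono conjI norm_ge_zero norm_site_factor_le[OF K] y)
  have pairs: "norm (\<Prod>i=1..n. \<Prod>j\<in>{i<..n}. pair_factor K y i j)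
      \<le> ?L ^ card (index_pairs n) * (\<Prod>k=1..n. (1 + y k) powr ?Q)"
    using y(1) Re_gamma_pos by (intro norm_prod_pairs_le norm_pair_factor_le[OF K True]) auto
  have "norm (rescaled_integrand K y) \<le> (\<Prod>i=1..n. site_bound (site l i) * ?G 1 i)
      * (?L ^ card (index_pairs n) * (\<Prod>k=1..n. (1 + y k) powr ?Q))"
    unfolding rescaled_integrand_def if_P[OF True] norm_mult using sites pairs site_bound_nonneg
    by (intro mult_mono prod_nonneg norm_ge_zero) (auto intro!: mult_nonneg_nonneg Gamma_majorant_nonneg)
  also have "\<dots> = (\<Prod>i=1..n. site_bound (site l i)) * ?L ^ card (index_pairs n)
      * (\<Prod>i=1..n. ?G 1 i * (1 + y i) powr ?Q)"
    unfolding prod.distrib by (simp only: mult_ac)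
  also have "(\<Prod>i=1..n. ?G 1 i * (1 + y i) powr ?Q) = (\<Prod>i=1..n. ?G (1 + ?Q) i)"
    by (intro prod.cong refl Gamma_majorant_mult_powr y(1))
  finally show ?thesis unfolding rescaled_majorant_def .
qed

lemma integral_rescaled_tendsto:
  "(\<lambda>k. \<integral>y. rescaled_integrand (Suc k) y \<partial>Rn n) \<longlonglongrightarrow> (\<integral>y. limit_integrand y \<partial>Rn n)"
proof (rule integral_dominated_convergence)
  have measurable: "rescaled_integrand (Suc k) \<in> borel_measurable (Rn n)" for k
    by (rule measurable_rescaled_integrand) simp
  then show "rescaled_integrand (Suc k) \<in> borel_measurable (Rn n)" for k .
  show "limit_integrand \<in> borel_measurable (Rn n)"
    by (rule borel_measurable_LIMSEQ_metric[OF measurable]) (rule rescaled_integrand_tendsto)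
  show "integrable (Rn n) rescaled_majorant"
    unfolding rescaled_majorant_def[abs_def] using Re_alpha_pos'[OF site_range[OF l]] Re_gamma_pos
    by (intro integrable_prod_Gamma_majorant) auto
qed (auto intro: rescaled_integrand_tendsto norm_rescaled_integrand_le)

theorem integral_scaled_integrand_tendsto:
  "(\<lambda>k. \<integral>t. scaled_integrand l \<tau> (Suc k) t \<partial>Rn n)
    \<longlonglongrightarrow> (if \<forall>i\<in>{1..n}. \<tau> i = site l i then cell_constant l * (\<Prod>s=1..p-1. Laguerre (l s) (\<alpha> s) \<gamma>) else 0)"
proof -
  let ?near = "\<lambda>K t. if near l t then scaled_integrand l \<tau> K t else 0"
  let ?far = "\<lambda>K t. if near l t then 0 else scaled_integrand l \<tau> K t"
  have split: "(\<integral>t. scaled_integrand l \<tau> K t \<partial>Rn n) = (\<integral>t. ?near K t \<partial>Rn n) + (\<integral>t. ?far K t \<partial>Rn n)" for K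
  proof -
    have near: "integrable (Rn n) (?near K)"
      by (rule integrable_of_norm_le[OF integrable_norm[OF integrable_scaled_integrand[of K]]
            measurable_near_scaled_integrand]) simp
    have "?far K t = scaled_integrand l \<tau> K t - ?near K t" for t by simp
    then show ?thesis using Bochner_Integration.integral_diff[OF integrable_scaled_integrand near]
      by (simp only:) simp
  qed
  have "(\<lambda>k. \<integral>t. ?near (Suc k) t \<partial>Rn n) \<longlonglongrightarrow> (\<integral>y. limit_integrand y \<partial>Rn n)"
    using integral_rescaled_tendsto unfolding integral_near_eq[OF zero_less_Suc] .
  then have "(\<lambda>k. \<integral>t. scaled_integrand l \<tau> (Suc k) t \<partial>Rn n) \<longlonglongrightarrow> (\<integral>y. limit_integrand y \<partial>Rn n) + 0"
    unfolding split by (rule tendsto_add[OF _ integral_far_tendsto_0])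
  also have "(\<integral>y. limit_integrand y \<partial>Rn n) + 0
      = (if \<forall>i\<in>{1..n}. \<tau> i = site l i then cell_constant l * (\<Prod>s=1..p-1. Laguerre (l s) (\<alpha> s) \<gamma>) else 0)"
  proof (cases "\<forall>i\<in>{1..n}. \<tau> i = site l i")
    case True
    have "(\<integral>y. block_integrand n (site l) \<alpha> \<gamma> y \<partial>Rn n) = (\<Prod>s=1..p-1. Laguerre (l s) (\<alpha> s) \<gamma>)"
      by (rule integral_block_integrand_site[OF l Re_alpha_pos' Re_gamma_pos])
    then show ?thesis unfolding limit_integrand_def if_P[OF True] integral_mult_right_zero by simp
  next
    case False
    show ?thesis unfolding limit_integrand_def if_not_P[OF False] by simp
  qed
  finally show ?thesis .
qed

end

end

lemma pochhammer_ratio_tendsto: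
  fixes x y :: complex
  assumes x: "Re x > 0" and y: "Re y > 0"
  shows "(\<lambda>k. pochhammer x (Suc k) / pochhammer y (Suc k) * abs_pow (real (Suc k)) (y - x)) \<longlonglongrightarrow> Gamma y / Gamma x"
proof -
  have no_pole: "x \<notin> \<int>\<^sub>\<le>\<^sub>0" "y \<notin> \<int>\<^sub>\<le>\<^sub>0" using x y by (auto elim!: nonpos_Ints_cases)
  have "(\<lambda>k. Gamma_series' y (Suc k) / Gamma_series' x (Suc k)) \<longlonglongrightarrow> Gamma y / Gamma x"
    using no_pole by (intro tendsto_divide LIMSEQ_Suc[OF Gamma_series'_LIMSEQ]) (auto simp: Gamma_eq_zero_iff)
  moreover have "Gamma_series' y (Suc k) / Gamma_series' x (Suc k)
      = pochhammer x (Suc k) / pochhammer y (Suc k) * abs_pow (real (Suc k)) (y - x)" for k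
  proof -
    have "pochhammer x (Suc k) \<noteq> 0" "pochhammer y (Suc k) \<noteq> 0" using x y by (auto simp: pochhammer_eq_0_iff)
    moreover have "exp (y * of_real (ln (real (Suc k)))) / exp (x * of_real (ln (real (Suc k))))
        = abs_pow (real (Suc k)) (y - x)"
      by (simp add: abs_pow_def exp_diff[symmetric] left_diff_distrib del: of_nat_Suc)
    ultimately show ?thesis unfolding Gamma_series'_def
      by (simp add: divide_simps mult_ac del: of_nat_Suc pochhammer_Suc)
  qed
  ultimately show ?thesis by simp
qed

lemma Gamma_neq_0: "Re x > 0 \<Longrightarrow> Gamma x \<noteq> 0"
  by (auto simp: Gamma_eq_zero_iff elim!: nonpos_Ints_cases)

lemma permuted_site_eq_imp_eq:
  assumes m: "m \<in> Zset n q" and l: "l \<in> Zset n q" and \<sigma>: "\<sigma> permutes {1..n}"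
    and eq: "\<And>i. i \<in> {1..n} \<Longrightarrow> site m (\<sigma> i) = site l i"
  shows "m = l"
proof -
  have "card {i \<in> {1..n}. site l i = s} = card {i \<in> {1..n}. site m i = s}" for s
  proof (rule bij_betw_same_card)
    have "bij_betw \<sigma> {1..n} {1..n}" by (rule permutes_imp_bij[OF \<sigma>])
    then show "bij_betw \<sigma> {i \<in> {1..n}. site l i = s} {i \<in> {1..n}. site m i = s}"
      by (rule bij_betw_Collect) (simp only: eq)
  qed
  then have "m s = l s" if "s \<in> {1..q}" for s using card_site_eq[OF m that] card_site_eq[OF l that] by simp
  moreover have "m s = l s" if "s \<notin> {1..q}" for s using Zset_eq_0[OF m that] Zset_eq_0[OF l that] by simp
  ultimately show ?thesis by blast
qed

lemma site_inv_range:
  assumes "m \<in> Zset n q" "\<sigma> permutes {1..n}" "i \<in> {1..n}"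
  shows "site m (inv \<sigma> i) \<in> {1..q}"
  using assms permutes_in_image[OF permutes_inv[OF assms(2)]] by (intro site_range) auto

lemma sum_permutations_site:
  fixes X :: "'a :: comm_ring_1"
  assumes m: "m \<in> Zset n q" and l: "l \<in> Zset n q"
  shows "(\<Sum>\<sigma> | \<sigma> permutes {1..n}. if \<forall>i\<in>{1..n}. site m (inv \<sigma> i) = site l i then X else 0)
    = (if m = l then of_nat (\<Prod>s=1..q. fact (l s)) * X else 0)"
proof -
  let ?S = "{\<sigma>. \<sigma> permutes {1..n}}"
  have "(\<Sum>\<sigma>\<in>?S. if \<forall>i\<in>{1..n}. site m (inv \<sigma> i) = site l i then X else 0)
      = (\<Sum>\<sigma>\<in>?S. if \<forall>i\<in>{1..n}. site m (\<sigma> i) = site l i then X else 0)"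
    by (rule sum_permutations_inverse[symmetric])
  also have "\<dots> = of_nat (card {\<sigma>\<in>?S. \<forall>i\<in>{1..n}. site m (\<sigma> i) = site l i}) * X"
    by (simp add: sum.If_cases finite_permutations Int_def)
  also have "\<dots> = (if m = l then of_nat (\<Prod>s=1..q. fact (l s)) * X else 0)"
  proof (cases "m = l")
    case True
    have "card {\<sigma>\<in>?S. \<forall>i\<in>{1..n}. site l (\<sigma> i) = site l i} = (\<Prod>s=1..q. fact (card {i\<in>{1..n}. site l i = s}))"
      using card_permutes_preserving[of "{1..n}" "{1..q}" "site l"] site_range[OF l]
      by (simp add: image_subset_iff)
    also have "\<dots> = (\<Prod>s=1..q. fact (l s))" by (intro prod.cong refl) (simp only: card_site_eq[OF l])
    finally show ?thesis using True by simp
  next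
    case False
    then have none: "{\<sigma>\<in>?S. \<forall>i\<in>{1..n}. site m (\<sigma> i) = site l i} = {}"
      using permuted_site_eq_imp_eq[OF m l] by blast
    show ?thesis unfolding none using False by simp
  qed
  finally show ?thesis .
qed

context configuration
begin

definition limit_entry :: "(nat \<Rightarrow> nat) \<Rightarrow> complex" where
  "limit_entry l = cell_constant l * (\<Prod>s=1..p-1. Laguerre (l s) (\<alpha> s) \<gamma>)"

definition row_scale :: "nat \<Rightarrow> (nat \<Rightarrow> nat) \<Rightarrow> complex" where
  "row_scale K l = abs_pow (real K) (scaling_exponent l) * (\<Prod>i=1..n. 1 / of_real (dist_last (site l i) ^ K))"

lemma inverse_facts_mult:
  assumes "l \<in> Zset n (p - 1)"
  shows "inverse_facts l * of_nat (\<Prod>s=1..p-1. fact (l s)) = 1"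
proof -
  have "l p = 0" using Zset_eq_0[OF assms, of p] p_ge_2 by simp
  then show ?thesis unfolding inverse_facts_def prod_last of_nat_prod by (simp add: prod.distrib[symmetric])
qed

lemma scaled_integrand_eq_shifted:
  assumes l: "l \<in> Zset n (p - 1)"
  shows "scaled_integrand l \<tau> K t
    = row_scale K l * (configuration.cell_weight n p z (shifted K) \<gamma> l t * (\<Prod>i=1..n. 1 / of_real (t i - z (\<tau> i))))"
proof -
  have "of_real (decay l t ^ K)
      = (\<Prod>i=1..n. of_real ((z p - t i) ^ K))
        * (\<Prod>i=1..n. 1 / of_real (dist_last (site l i) ^ K) :: complex)"
    by (simp add: decay_def prod_power_distrib[symmetric] power_divide prod_dividef)
  then show ?thesis
    unfolding scaled_integrand_def pole_integrand_def row_scale_def cell_weight_shifted[OF l]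
    by (simp only: mult_ac)
qed

lemma reduced_entry_scaled:
  assumes l: "l \<in> Zset n (p - 1)" and m: "m \<in> Zset n (p - 1)"
  shows "row_scale K l * configuration.reduced_entry n p z (shifted K) \<gamma> l m
    = inverse_facts m * (\<Sum>\<sigma> | \<sigma> permutes {1..n}. \<integral>t. scaled_integrand l (\<lambda>i. site m (inv \<sigma> i)) K t \<partial>Rn n)"
proof -
  interpret shifted: configuration n p z "shifted K" \<gamma> by (rule configuration_shifted)
  let ?S = "{\<sigma>. \<sigma> permutes {1..n}}"
  have poles: "symmetrized n (\<lambda>j. eval_letter (LF (site m j))) t
      = (\<Sum>\<sigma>\<in>?S. \<Prod>i=1..n. 1 / of_real (t i - z (site m (inv \<sigma> i))))" for t
    unfolding symmetrized_def
  proof (rule sum.cong[OF refl])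
    fix \<sigma> assume "\<sigma> \<in> ?S"
    then show "(\<Prod>j=1..n. eval_letter (LF (site m j)) (t (\<sigma> j)))
        = (\<Prod>i=1..n. 1 / of_real (t i - z (site m (inv \<sigma> i))))"
      using prod_permuted_eq_inv[of \<sigma> n "\<lambda>j. eval_letter (LF (site m j))" t] by simp
  qed
  have "row_scale K l * (shifted.cell_weight l t * omega n p z m t)
      = inverse_facts m * (\<Sum>\<sigma>\<in>?S. scaled_integrand l (\<lambda>i. site m (inv \<sigma> i)) K t)" for t
    unfolding omega_eq_symmetrized[OF m] scaled_integrand_eq_shifted[OF l] poles sum_distrib_left
    by (simp only: mult_ac)
  then have "row_scale K l * shifted.reduced_entry l m
      = inverse_facts m * (\<integral>t. (\<Sum>\<sigma>\<in>?S. scaled_integrand l (\<lambda>i. site m (inv \<sigma> i)) K t) \<partial>Rn n)"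
    unfolding shifted.reduced_entry_def by (simp only: integral_mult_right_zero[symmetric])
  also have "(\<integral>t. (\<Sum>\<sigma>\<in>?S. scaled_integrand l (\<lambda>i. site m (inv \<sigma> i)) K t) \<partial>Rn n)
      = (\<Sum>\<sigma>\<in>?S. \<integral>t. scaled_integrand l (\<lambda>i. site m (inv \<sigma> i)) K t \<partial>Rn n)"
    by (intro Bochner_Integration.integral_sum integrable_scaled_integrand[OF l] site_inv_range[OF m]) auto
  finally show ?thesis .
qed

lemma reduced_entry_tendsto:
  assumes l: "l \<in> Zset n (p - 1)" and m: "m \<in> Zset n (p - 1)"
  shows "(\<lambda>k. row_scale (Suc k) l * configuration.reduced_entry n p z (shifted (Suc k)) \<gamma> l m)
    \<longlonglongrightarrow> (if m = l then limit_entry l else 0)"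
proof -
  let ?S = "{\<sigma>. \<sigma> permutes {1..n}}"
  have "(\<lambda>k. inverse_facts m * (\<Sum>\<sigma>\<in>?S. \<integral>t. scaled_integrand l (\<lambda>i. site m (inv \<sigma> i)) (Suc k) t \<partial>Rn n))
      \<longlonglongrightarrow> inverse_facts m * (\<Sum>\<sigma>\<in>?S. if \<forall>i\<in>{1..n}. site m (inv \<sigma> i) = site l i then limit_entry l else 0)"
    unfolding limit_entry_def
    by (intro tendsto_mult tendsto_const tendsto_sum integral_scaled_integrand_tendsto[OF l]
      site_inv_range[OF m]) auto
  also have "inverse_facts m * (\<Sum>\<sigma>\<in>?S. if \<forall>i\<in>{1..n}. site m (inv \<sigma> i) = site l i then limit_entry l else 0)
      = (if m = l then limit_entry l else 0)"
    unfolding sum_permutations_site[OF m l] using inverse_facts_mult[OF l] by (simp add: mult.assoc[symmetric])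
  finally show ?thesis unfolding reduced_entry_scaled[OF l m] .
qed

lemma det_reduced_entry_tendsto:
  "(\<lambda>k. (\<Prod>l\<in>Zset n (p - 1). row_scale (Suc k) l)
      * det_on (Zset n (p - 1)) (configuration.reduced_entry n p z (shifted (Suc k)) \<gamma>))
    \<longlonglongrightarrow> (\<Prod>l\<in>Zset n (p - 1). limit_entry l)"
proof -
  let ?Z = "Zset n (p - 1)"
  have scale: "(\<Prod>l\<in>?Z. row_scale K l) * det_on ?Z M = det_on ?Z (\<lambda>l m. row_scale K l * M l m)" for K M
    using det_on_scale[of ?Z "row_scale K" M "\<lambda>_. 1"] by simp
  have "det_on ?Z (\<lambda>l m. if m = l then limit_entry l else 0) = (\<Prod>l\<in>?Z. limit_entry l)"
    by (subst det_on_triangular[where rank="\<lambda>_. 0"]) auto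
  moreover have "(\<lambda>k. det_on ?Z
        (\<lambda>l m. row_scale (Suc k) l * configuration.reduced_entry n p z (shifted (Suc k)) \<gamma> l m))
      \<longlonglongrightarrow> det_on ?Z (\<lambda>l m. if m = l then limit_entry l else 0)"
    by (intro tendsto_det_on reduced_entry_tendsto)
  ultimately show ?thesis unfolding scale by (simp only:)
qed

definition Gamma_num :: "nat \<Rightarrow> complex" where
  "Gamma_num s = 1 + \<alpha> p + of_nat s * \<gamma>"

definition Gamma_den :: "nat \<Rightarrow> complex" where
  "Gamma_den s = 1 + (\<Sum>s=1..p. \<alpha> s) + (2 * of_nat n - 2 - of_nat s) * \<gamma>"

definition dist_product :: complex where
  "dist_product = (\<Prod>m\<in>Zset n (p - 1). \<Prod>s=1..p-1. of_real (dist_last s) ^ m s)"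

lemma dist_product_neq_0: "dist_product \<noteq> 0"
proof -
  have "of_real (dist_last s) ^ k \<noteq> (0 :: complex)" if "s \<in> {1..p-1}" for s k using dist_last_pos[OF that] by simp
  then show ?thesis unfolding dist_product_def by (simp only: prod_zero_iff finite_Zset finite_atLeastAtMost) blast
qed

lemma det_reduced_entry_shifted:
  "det_on (Zset n (p - 1)) (configuration.reduced_entry n p z (shifted K) \<gamma>)
    = (\<Prod>m\<in>Zset n (p - 1). \<Prod>s<m 1. pochhammer (Gamma_num s) K / pochhammer (Gamma_den s) K)
      * dist_product ^ K * det_on (Zset n (p - 1)) reduced_entry"
proof (induction K)
  case (Suc K)
  interpret shifted: configuration n p z "shifted K" \<gamma> by (rule configuration_shifted)
  have twice: "shifted.shifted 1 = shifted (Suc K)" by (auto simp: fun_eq_iff)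
  have "(\<Sum>s=1..p. shifted K s) = (\<Sum>s=1..p. \<alpha> s) + of_nat K" unfolding atLeastAtMost_p by simp
  then have den: "1 + (\<Sum>s=1..p. shifted K s) + (2 * of_nat n - 2 - of_nat s) * \<gamma> = Gamma_den s + of_nat K" for s
    by (simp add: Gamma_den_def algebra_simps)
  have num: "1 + shifted K p + of_nat s * \<gamma> = Gamma_num s + of_nat K" for s by (simp add: Gamma_num_def)
  show ?case
    using shifted.det_reduced_entry_shifted_1
    unfolding twice den num Suc.IH pochhammer_Suc times_divide_times_eq[symmetric] prod.distrib power_Suc
      dist_product_def dist_last_def
    by (simp only: mult_ac)
qed simp

abbreviation site_total :: nat where
  "site_total \<equiv> (p + n - 2) choose (p - 1)"

abbreviation pair_total :: nat where
  "pair_total \<equiv> (p + n - 2) choose p"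

lemma
  shows sum_Zset_coord_site_total: "s \<in> {1..p-1} \<Longrightarrow> (\<Sum>m\<in>Zset n (p - 1). m s) = site_total"
    and sum_Zset_coord_choose_2_pair_total: "s \<in> {1..p-1} \<Longrightarrow> (\<Sum>m\<in>Zset n (p - 1). m s choose 2) = pair_total"
    and sum_Zset_coord_mult_pair_total:
      "s \<in> {1..p-1} \<Longrightarrow> r \<in> {1..p-1} \<Longrightarrow> r \<noteq> s \<Longrightarrow> (\<Sum>m\<in>Zset n (p - 1). m r * m s) = pair_total"
    and sum_card_Zset_site_total: "(\<Sum>i<n. card (Zset (n - 1 - i) (p - 1))) = site_total"
    and sum_card_Zset_weighted_pair_total:
      "(\<Sum>i<n. card (Zset (n - 1 - i) (p - 1)) * (n - 1 - i)) = (p - 1) * pair_total"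
proof -
  obtain q where p: "p = Suc (Suc q)" using p_ge_2 by (metis add_2_eq_Suc le_Suc_ex)
  show "(\<Sum>m\<in>Zset n (p - 1). m s) = site_total" if "s \<in> {1..p-1}"
    using sum_Zset_coord[of s q n] that by (simp add: p add.commute)
  show "(\<Sum>m\<in>Zset n (p - 1). m s choose 2) = pair_total" if "s \<in> {1..p-1}"
    using sum_Zset_coord_choose_2[of s q n] that by (simp add: p add.commute)
  show "(\<Sum>m\<in>Zset n (p - 1). m r * m s) = pair_total" if "s \<in> {1..p-1}" "r \<in> {1..p-1}" "r \<noteq> s"
    using sum_Zset_coord_mult[of s q r n] that by (simp add: p add.commute)
  show "(\<Sum>i<n. card (Zset (n - 1 - i) (p - 1))) = site_total"
    using sum_card_Zset[of n q] by (simp add: p add.commute)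
  show "(\<Sum>i<n. card (Zset (n - 1 - i) (p - 1)) * (n - 1 - i)) = (p - 1) * pair_total"
    using sum_card_Zset_weighted[of n q] by (simp add: p add.commute)
qed

lemma prod_Zset_site:
  fixes g :: "nat \<Rightarrow> 'a :: comm_semiring_1"
  shows "(\<Prod>l\<in>Zset n (p - 1). \<Prod>i=1..n. g (site l i)) = (\<Prod>s=1..p-1. g s) ^ site_total"
proof -
  have "(\<Prod>l\<in>Zset n (p - 1). \<Prod>i=1..n. g (site l i)) = (\<Prod>l\<in>Zset n (p - 1). \<Prod>s=1..p-1. g s ^ l s)"
    by (intro prod.cong refl prod_site)
  also have "\<dots> = (\<Prod>s=1..p-1. \<Prod>l\<in>Zset n (p - 1). g s ^ l s)" by (rule prod.swap)
  also have "\<dots> = (\<Prod>s=1..p-1. g s ^ site_total)"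
    by (intro prod.cong refl) (simp only: power_sum[symmetric] sum_Zset_coord_site_total)
  finally show ?thesis by (simp only: prod_power_distrib)
qed

lemma prod_Zset_site_pairs:
  fixes G :: "nat \<Rightarrow> nat \<Rightarrow> 'a :: comm_semiring_1"
  shows "(\<Prod>l\<in>Zset n (p - 1). \<Prod>i=1..n. \<Prod>j\<in>{i<..n}. G (site l i) (site l j))
    = ((\<Prod>s=1..p-1. G s s) * (\<Prod>s=1..p-1. \<Prod>r=1..<s. G r s)) ^ pair_total"
proof -
  let ?Z = "Zset n (p - 1)"
  have "(\<Prod>l\<in>?Z. \<Prod>i=1..n. \<Prod>j\<in>{i<..n}. G (site l i) (site l j))
      = (\<Prod>l\<in>?Z. (\<Prod>s=1..p-1. G s s ^ (l s choose 2)) * (\<Prod>s=1..p-1. \<Prod>r=1..<s. G r s ^ (l r * l s)))"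
    by (intro prod.cong refl prod_site_pairs)
  also have "\<dots> = (\<Prod>l\<in>?Z. \<Prod>s=1..p-1. G s s ^ (l s choose 2)) * (\<Prod>l\<in>?Z. \<Prod>s=1..p-1. \<Prod>r=1..<s. G r s ^ (l r * l s))"
    by (rule prod.distrib)
  also have "(\<Prod>l\<in>?Z. \<Prod>s=1..p-1. G s s ^ (l s choose 2)) = (\<Prod>s=1..p-1. G s s ^ pair_total)"
    by (subst prod.swap, intro prod.cong refl) (simp only: power_sum[symmetric] sum_Zset_coord_choose_2_pair_total)
  also have "(\<Prod>l\<in>?Z. \<Prod>s=1..p-1. \<Prod>r=1..<s. G r s ^ (l r * l s)) = (\<Prod>s=1..p-1. \<Prod>r=1..<s. G r s ^ pair_total)"
  proof (subst prod.swap, rule prod.cong[OF refl], subst prod.swap, rule prod.cong[OF refl])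
    fix s r assume "s \<in> {1..p-1}" "r \<in> {1..<s}"
    then have "(\<Sum>l\<in>?Z. l r * l s) = pair_total" by (intro sum_Zset_coord_mult_pair_total) auto
    then show "(\<Prod>l\<in>?Z. G r s ^ (l r * l s)) = G r s ^ pair_total" by (simp only: power_sum[symmetric])
  qed
  finally show ?thesis by (simp only: prod_power_distrib power_mult_distrib)
qed

definition scaling_total :: complex where
  "scaling_total = of_nat site_total * (\<Sum>s=1..p-1. \<alpha> s) + of_nat ((p - 1) * pair_total) * (2 * \<gamma>)"

lemma prod_abs_pow_scaling_exponent:
  assumes "x \<noteq> 0"
  shows "(\<Prod>l\<in>Zset n (p - 1). abs_pow x (scaling_exponent l)) = abs_pow x scaling_total"
proof -
  have "(\<Prod>s=1..p-1. abs_pow x (\<alpha> s)) ^ site_total = abs_pow x (of_nat site_total * (\<Sum>s=1..p-1. \<alpha> s))"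
    unfolding abs_pow_sum[OF assms, symmetric] by (rule abs_pow_power[OF assms])
  moreover have "(\<Prod>s=1..p-1. \<Prod>r=1..<s. if r = s then abs_pow x (2 * \<gamma>) else 1) = 1"
    by (intro prod.neutral ballI) auto
  moreover have "(\<Prod>s=1..p-1. abs_pow x (2 * \<gamma>)) ^ pair_total = abs_pow x (of_nat ((p - 1) * pair_total) * (2 * \<gamma>))"
    unfolding prod_constant power_mult[symmetric] by (simp add: abs_pow_power[OF assms])
  ultimately show ?thesis
    unfolding abs_pow_scaling_exponent[OF assms] prod.distrib prod_Zset_site[of "\<lambda>s. abs_pow x (\<alpha> s)"]
      prod_Zset_site_pairs[of "\<lambda>r s. if r = s then abs_pow x (2 * \<gamma>) else 1"]
    by (simp add: scaling_total_def abs_pow_add)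
qed

lemma prod_row_scale:
  assumes "K > 0"
  shows "(\<Prod>l\<in>Zset n (p - 1). row_scale K l) = abs_pow (real K) scaling_total / dist_product ^ K"
proof -
  have "real K \<noteq> 0" using assms by simp
  note scaling = prod_abs_pow_scaling_exponent[OF this]
  have "(\<Prod>i=1..n. 1 / of_real (dist_last (site l i) ^ K))
      = 1 / (\<Prod>s=1..p-1. of_real (dist_last s) ^ l s :: complex) ^ K"
    if "l \<in> Zset n (p - 1)" for l
    unfolding prod_site[OF that, symmetric] by (simp add: prod_dividef prod_power_distrib)
  then have "(\<Prod>l\<in>Zset n (p - 1). \<Prod>i=1..n. 1 / of_real (dist_last (site l i) ^ K)) = 1 / dist_product ^ K"
    unfolding dist_product_def by (simp add: prod_dividef prod_power_distrib)
  then show ?thesis unfolding row_scale_def prod.distrib scaling by simp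
qed

lemma Re_Gamma_num_pos: "Re (Gamma_num s) > 0"
  using Re_alpha_last Re_gamma_pos by (simp add: Gamma_num_def add_pos_nonneg)

lemma Re_Gamma_den_pos: "s < n \<Longrightarrow> Re (Gamma_den s) > 0"
  using Re_one_plus_sum_alpha_pos[of "2 * real n - 2 - real s"] by (simp add: Gamma_den_def)

lemma Gamma_den_minus_Gamma_num:
  assumes "i < n"
  shows "Gamma_den i - Gamma_num i = (\<Sum>s=1..p-1. \<alpha> s) + of_nat (n - 1 - i) * (2 * \<gamma>)"
proof -
  have diff: "of_nat (n - 1 - i) = (of_nat n - 1 - of_nat i :: complex)" using assms by (simp add: of_nat_diff)
  show ?thesis unfolding diff Gamma_num_def Gamma_den_def sum_last by (simp add: algebra_simps)
qed

lemma sum_Gamma_den_minus_Gamma_num: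
  "(\<Sum>m\<in>Zset n (p - 1). \<Sum>i<m 1. Gamma_den i - Gamma_num i) = scaling_total"
proof -
  let ?c = "\<lambda>i. card (Zset (n - 1 - i) (p - 1))"
  have "1 \<in> {1..p-1}" using p_ge_2 by simp
  then have "(\<Sum>m\<in>Zset n (p - 1). \<Sum>i<m 1. Gamma_den i - Gamma_num i)
      = (\<Sum>i<n. of_nat (?c i) * (Gamma_den i - Gamma_num i))"
    by (subst sum_Zset_sum_lessThan) simp_all
  also have "\<dots> = (\<Sum>i<n. of_nat (?c i) * (\<Sum>s=1..p-1. \<alpha> s) + of_nat (?c i * (n - 1 - i)) * (2 * \<gamma>))"
    by (intro sum.cong refl) (simp only: lessThan_iff Gamma_den_minus_Gamma_num of_nat_mult distrib_left
      mult.assoc)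
  also have "\<dots> = scaling_total"
    unfolding sum.distrib sum_distrib_right[symmetric] of_nat_sum[symmetric] scaling_total_def
      sum_card_Zset_site_total sum_card_Zset_weighted_pair_total ..
  finally show ?thesis .
qed

theorem det_reduced_entry:
  "det_on (Zset n (p - 1)) reduced_entry = (\<Prod>l\<in>Zset n (p - 1). limit_entry l)
    * (\<Prod>i<n. (Gamma (Gamma_num i) / Gamma (Gamma_den i)) ^ card (Zset (n - 1 - i) (p - 1)))"
proof -
  let ?Z = "Zset n (p - 1)"
  let ?ratio = "\<lambda>k s. pochhammer (Gamma_num s) (Suc k) / pochhammer (Gamma_den s) (Suc k)
    * abs_pow (real (Suc k)) (Gamma_den s - Gamma_num s)"
  have first: "1 \<in> {1..p-1}" using p_ge_2 by simp
  have less: "s < n" if "m \<in> ?Z" "s \<in> {..<m 1}" for m s using Zset_le[OF that(1) first] that(2) by simp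
  have "(\<Prod>l\<in>?Z. row_scale (Suc k) l) * det_on ?Z (configuration.reduced_entry n p z (shifted (Suc k)) \<gamma>)
      = (\<Prod>m\<in>?Z. \<Prod>s<m 1. ?ratio k s) * det_on ?Z reduced_entry" for k
    unfolding det_reduced_entry_shifted prod_row_scale[OF zero_less_Suc] prod.distrib
      abs_pow_sum[OF of_nat_neq_0, symmetric] sum_Gamma_den_minus_Gamma_num
    using dist_product_neq_0 by (simp add: mult_ac del: of_nat_Suc pochhammer_Suc)
  moreover have "(\<lambda>k. (\<Prod>m\<in>?Z. \<Prod>s<m 1. ?ratio k s) * det_on ?Z reduced_entry)
      \<longlonglongrightarrow> (\<Prod>m\<in>?Z. \<Prod>s<m 1. Gamma (Gamma_den s) / Gamma (Gamma_num s)) * det_on ?Z reduced_entry"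
    by (intro tendsto_mult tendsto_prod tendsto_const pochhammer_ratio_tendsto Re_Gamma_num_pos
      Re_Gamma_den_pos less)
  ultimately have limit: "(\<Prod>m\<in>?Z. \<Prod>s<m 1. Gamma (Gamma_den s) / Gamma (Gamma_num s)) * det_on ?Z reduced_entry
      = (\<Prod>l\<in>?Z. limit_entry l)"
    using det_reduced_entry_tendsto LIMSEQ_unique by (simp only:)
  have "Gamma (Gamma_num s) / Gamma (Gamma_den s) * (Gamma (Gamma_den s) / Gamma (Gamma_num s)) = 1"
    if "s < n" for s
    using Gamma_neq_0[OF Re_Gamma_num_pos] Gamma_neq_0[OF Re_Gamma_den_pos[OF that]] by simp
  then have "(\<Prod>m\<in>?Z. \<Prod>s<m 1. Gamma (Gamma_num s) / Gamma (Gamma_den s))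
      * (\<Prod>m\<in>?Z. \<Prod>s<m 1. Gamma (Gamma_den s) / Gamma (Gamma_num s)) = 1"
    unfolding prod.distrib[symmetric] using less by (intro prod.neutral ballI) blast
  then have "det_on ?Z reduced_entry
      = (\<Prod>m\<in>?Z. \<Prod>s<m 1. Gamma (Gamma_num s) / Gamma (Gamma_den s)) * (\<Prod>l\<in>?Z. limit_entry l)"
    unfolding limit[symmetric] by (simp add: mult.assoc[symmetric])
  then show ?thesis unfolding prod_Zset_prod_lessThan[OF first] by (simp only: mult.commute)
qed

end

section \<open>Evaluation of the Laguerre--Selberg integrals\<close>

definition Selberg_integrand :: "nat \<Rightarrow> complex \<Rightarrow> complex \<Rightarrow> complex \<Rightarrow> (nat \<Rightarrow> real) \<Rightarrow> complex" where
  "Selberg_integrand n a b \<gamma> t = (if (\<forall>i\<in>{1..n}. t i \<in> {0..1}) \<and> mono_on {1..n} t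
     then (\<Prod>i=1..n. abs_pow (t i) (a - 1) * abs_pow (t i - 1) (b - 1)) * vandermonde n \<gamma> t else 0)"

definition Selberg :: "nat \<Rightarrow> complex \<Rightarrow> complex \<Rightarrow> complex \<Rightarrow> complex" where
  "Selberg n a b \<gamma> = (\<integral>t. Selberg_integrand n a b \<gamma> t \<partial>Rn n)"

lemma measurable_Selberg_integrand: "Selberg_integrand n a b \<gamma> \<in> borel_measurable (Rn n)"
proof -
  have [measurable]: "Measurable.pred (Rn n) (\<lambda>t. \<forall>i\<in>{1..n}. t i \<in> {0..1})"
    by (rule measurable_Rn_ball) measurable
  have [measurable]: "(\<lambda>t. \<Prod>i=1..n. abs_pow (t i) (a - 1) * abs_pow (t i - 1) (b - 1)) \<in> borel_measurable (Rn n)"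
    by (rule measurable_Rn_prod) auto
  note [measurable] = measurable_Rn_mono_on
  show ?thesis unfolding Selberg_integrand_def[abs_def] by measurable
qed

definition unit_points :: "nat \<Rightarrow> real" where
  "unit_points s = (if s = 1 then 0 else 1)"

definition unit_exponents :: "complex \<Rightarrow> complex \<Rightarrow> nat \<Rightarrow> complex" where
  "unit_exponents a b s = (if s = 1 then a else b - 1)"

text \<open>For two points there is a single cell, and the determinant of reduced integrals is Selberg's integral.\<close>

locale unit_configuration =
  fixes n :: nat and a b \<gamma> :: complex
  assumes Re_a_pos: "Re a > 0" and Re_b_pos: "Re b > 0" and Re_\<gamma>_pos: "Re \<gamma> > 0"
begin

sublocale configuration n 2 unit_points "unit_exponents a b" \<gamma>
  by unfold_locales (use Re_a_pos Re_b_pos Re_\<gamma>_pos in \<open>auto simp: unit_points_def unit_exponents_def\<close>)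

definition all_first :: "nat \<Rightarrow> nat" where
  "all_first = (\<lambda>s. if s = 1 then n else 0)"

lemma Zset_2: "Zset n (2 - 1) = {all_first}"
  using Zset_1[of n] by (simp add: all_first_def)

lemma all_first_in_Zset: "all_first \<in> Zset n (2 - 1)"
  unfolding Zset_2 by simp

lemma site_all_first: "i \<in> {1..n} \<Longrightarrow> site all_first i = 1"
  using site_range[OF all_first_in_Zset] by simp

lemma in_cell_all_first: "in_cell all_first t \<longleftrightarrow> (\<forall>i\<in>{1..n}. t i \<in> {0..1}) \<and> mono_on {1..n} t"
proof -
  have "(\<forall>i\<in>{1..n}. unit_points (site all_first i) \<le> t i \<and> t i \<le> unit_points (site all_first i + 1))
      \<longleftrightarrow> (\<forall>i\<in>{1..n}. t i \<in> {0..1})"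
    by (intro ball_cong refl) (simp only: site_all_first, simp add: unit_points_def)
  then show ?thesis unfolding in_cell_def by (simp only:)
qed

lemma omega_all_first: "omega n 2 unit_points all_first t = (\<Prod>i=1..n. 1 / of_real (t i))"
proof -
  have "(\<Prod>j=1..n. eval_letter (LF (site all_first j)) (t (\<sigma> j))) = (\<Prod>i=1..n. 1 / of_real (t i))"
    if \<sigma>: "\<sigma> permutes {1..n}" for \<sigma>
  proof -
    have "(\<Prod>j=1..n. eval_letter (LF (site all_first j)) (t (\<sigma> j))) = (\<Prod>j=1..n. 1 / of_real (t (\<sigma> j)))"
      by (intro prod.cong refl) (simp only: site_all_first, simp add: unit_points_def)
    also have "\<dots> = (\<Prod>i=1..n. 1 / of_real (t i))"
      using prod.permute[OF \<sigma>, of "\<lambda>i. 1 / of_real (t i) :: complex"] by (simp add: o_def)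
    finally show ?thesis .
  qed
  then have "symmetrized n (\<lambda>j. eval_letter (LF (site all_first j))) t
      = of_nat (fact n) * (\<Prod>i=1..n. 1 / of_real (t i))"
    unfolding symmetrized_def using card_permutations[of "{1..n}" n] by simp
  moreover have "{1..2::nat} = {1, 2}" by auto
  then have "inverse_facts all_first = 1 / of_nat (fact n)" by (simp add: inverse_facts_def all_first_def)
  ultimately show ?thesis unfolding omega_eq_symmetrized[OF all_first_in_Zset] by simp
qed

lemma cell_weight_mult_omega_all_first:
  "cell_weight all_first t * omega n 2 unit_points all_first t = Selberg_integrand n a b \<gamma> t"
proof (cases "in_cell all_first t")
  case False
  then show ?thesis
    unfolding Selberg_integrand_def in_cell_all_first[symmetric] cell_weight_def if_not_P[OF False] by simp
next
  case True
  have "{1..2::nat} = {1, 2}" by auto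
  then have point_weight: "point_weight u = abs_pow u a * abs_pow (u - 1) (b - 1)" for u
    by (simp add: point_weight_def unit_points_def unit_exponents_def)
  have "(\<Prod>i=1..n. point_weight (t i)) * (\<Prod>i=1..n. 1 / of_real (t i))
      = (\<Prod>i=1..n. abs_pow (t i) (a - 1) * abs_pow (t i - 1) (b - 1))"
    unfolding prod.distrib[symmetric]
  proof (rule prod.cong[OF refl])
    fix i assume "i \<in> {1..n}"
    then have "abs_pow (t i) a = abs_pow (t i) (a - 1) * of_real (t i)"
      using True abs_pow_add_of_nat[of "t i" "a - 1" 1] unfolding in_cell_all_first by simp
    then show "point_weight (t i) * (1 / of_real (t i)) = abs_pow (t i) (a - 1) * abs_pow (t i - 1) (b - 1)"
      by (cases "t i = 0") (simp_all add: point_weight)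
  qed
  then show ?thesis
    unfolding Selberg_integrand_def in_cell_all_first[symmetric] cell_weight_def if_P[OF True] Psi_eq
      omega_all_first
    by (simp only: mult_ac)
qed

lemma limit_entry_all_first: "limit_entry all_first = Laguerre n a \<gamma>"
proof -
  have "{1..2::nat} - {1} = {2}" by auto
  then have "site_constant 1 = 1" "pair_constant 1 1 = 1"
    using abs_pow_minus[of 1 "b - 1"]
    by (simp_all add: site_constant_def pair_constant_def dist_last_def unit_points_def unit_exponents_def)
  then have "cell_constant all_first = (\<Prod>i=1..n. 1) * (\<Prod>i=1..n. \<Prod>j\<in>{i<..n}. 1)"
    unfolding cell_constant_def
    by (intro arg_cong2[of _ _ _ _ "(*)"] prod.cong refl) (simp_all add: site_all_first)
  then show ?thesis by (simp add: limit_entry_def unit_exponents_def all_first_def)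
qed

lemma Selberg_eq_Laguerre:
  "Selberg n a b \<gamma> = Laguerre n a \<gamma>
    * (\<Prod>i<n. Gamma (b + of_nat i * \<gamma>) / Gamma (a + b + (2 * of_nat n - 2 - of_nat i) * \<gamma>))"
proof -
  have "det_on (Zset n (2 - 1)) reduced_entry = reduced_entry all_first all_first"
    unfolding Zset_2 by (subst det_on_triangular[where rank="\<lambda>_. 0"]) auto
  also have "\<dots> = Selberg n a b \<gamma>" unfolding reduced_entry_def cell_weight_mult_omega_all_first Selberg_def ..
  finally have "Selberg n a b \<gamma> = limit_entry all_first
      * (\<Prod>i<n. (Gamma (Gamma_num i) / Gamma (Gamma_den i)) ^ card (Zset (n - 1 - i) (2 - 1)))"
    unfolding det_reduced_entry unfolding Zset_2 by simp
  moreover have "card (Zset k (2 - 1)) = 1" for k using card_Zset[of k 0] by simp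
  moreover have "Gamma_num i = b + of_nat i * \<gamma>" for i by (simp add: Gamma_num_def unit_exponents_def)
  moreover have "{1..2::nat} = {1, 2}" by auto
  then have "Gamma_den i = a + b + (2 * of_nat n - 2 - of_nat i) * \<gamma>" for i
    by (simp add: Gamma_den_def unit_exponents_def)
  ultimately show ?thesis unfolding limit_entry_all_first by simp
qed

end

context
  fixes n :: nat and t y :: "nat \<Rightarrow> real"
  assumes reflected: "\<And>i. i \<in> {1..n} \<Longrightarrow> t i = 1 - y (n + 1 - i)"
begin

lemma unit_chamber_reflect:
  assumes y: "(\<forall>i\<in>{1..n}. y i \<in> {0..1}) \<and> mono_on {1..n} y"
  shows "(\<forall>i\<in>{1..n}. t i \<in> {0..1}) \<and> mono_on {1..n} t"
proof (intro conjI ballI mono_onI)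
  fix i assume i: "i \<in> {1..n}"
  then have "n + 1 - i \<in> {1..n}" by auto
  then show "t i \<in> {0..1}" using y reflected[OF i] by auto
next
  fix i j assume i: "i \<in> {1..n}" and j: "j \<in> {1..n}" and "i \<le> j"
  then have "n + 1 - j \<in> {1..n}" "n + 1 - i \<in> {1..n}" "n + 1 - j \<le> n + 1 - i" by auto
  then have "y (n + 1 - j) \<le> y (n + 1 - i)" using y by (blast dest: mono_onD)
  then show "t i \<le> t j" using reflected[OF i] reflected[OF j] by simp
qed

lemma vandermonde_reflect: "vandermonde n \<gamma> t = vandermonde n \<gamma> y"
  unfolding vandermonde_def prod_index_pairs
proof (rule prod.reindex_bij_witness[where i="\<lambda>(i, j). (n + 1 - j, n + 1 - i)"
      and j="\<lambda>(i, j). (n + 1 - j, n + 1 - i)"])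
  fix x assume "x \<in> index_pairs n"
  then obtain i j where x: "x = (i, j)" "i \<in> {1..n}" "j \<in> {1..n}" by (auto simp: index_pairs_def)
  show "(case case x of (i, j) \<Rightarrow> (n + 1 - j, n + 1 - i) of (i, j) \<Rightarrow> abs_pow (y j - y i) (2 * \<gamma>))
      = (case x of (i, j) \<Rightarrow> abs_pow (t j - t i) (2 * \<gamma>))"
    using reflected[OF x(2)] reflected[OF x(3)] by (simp add: x(1))
qed (auto simp: index_pairs_def)

lemma prod_weights_reflect:
  "(\<Prod>i=1..n. abs_pow (t i) c * abs_pow (t i - 1) d) = (\<Prod>i=1..n. abs_pow (y i) d * abs_pow (y i - 1) c)"
proof (rule prod.reindex_bij_witness[where i="\<lambda>i. n + 1 - i" and j="\<lambda>i. n + 1 - i"])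
  fix i assume i: "i \<in> {1..n}"
  show "abs_pow (y (n + 1 - i)) d * abs_pow (y (n + 1 - i) - 1) c = abs_pow (t i) c * abs_pow (t i - 1) d"
    unfolding reflected[OF i] using abs_pow_diff_commute[of "y (n + 1 - i)" 1 c] by simp
qed auto

end

lemma Selberg_commute: "Selberg n a b \<gamma> = Selberg n b a \<gamma>"
proof -
  let ?reflect = "affine_reindex {1..n} (\<lambda>j. n + 1 - j) (\<lambda>_. -1) (\<lambda>_. 1)"
  have "Selberg_integrand n a b \<gamma> (?reflect y) = Selberg_integrand n b a \<gamma> y" for y
  proof -
    let ?chamber = "\<lambda>t. (\<forall>i\<in>{1..n}. t i \<in> {0..1}) \<and> mono_on {1..n} t"
    have reflected: "?reflect y i = 1 - y (n + 1 - i)" if "i \<in> {1..n}" for i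
      using that by (simp add: affine_reindex_apply)
    have reflected': "y i = 1 - ?reflect y (n + 1 - i)" if "i \<in> {1..n}" for i
    proof -
      have "n + 1 - i \<in> {1..n}" "n + 1 - (n + 1 - i) = i" using that by auto
      then show ?thesis by (simp only: reflected)
    qed
    have "?chamber (?reflect y) \<longleftrightarrow> ?chamber y"
      using unit_chamber_reflect[of n "?reflect y" y, OF reflected]
        unit_chamber_reflect[of n y "?reflect y", OF reflected'] by blast
    moreover have "vandermonde n \<gamma> (?reflect y) = vandermonde n \<gamma> y"
      by (rule vandermonde_reflect) (rule reflected)
    moreover have "(\<Prod>i=1..n. abs_pow (?reflect y i) (a - 1) * abs_pow (?reflect y i - 1) (b - 1))
        = (\<Prod>i=1..n. abs_pow (y i) (b - 1) * abs_pow (y i - 1) (a - 1))"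
      by (rule prod_weights_reflect) (rule reflected)
    ultimately show ?thesis unfolding Selberg_integrand_def by (simp only:)
  qed
  moreover have "bij_betw (\<lambda>j. n + 1 - j) {1..n} {1..n}"
    by (rule bij_betw_byWitness[where f'="\<lambda>j. n + 1 - j"]) auto
  then have "Selberg n a b \<gamma> = (\<Prod>j\<in>{1..n}. \<bar>-1\<bar>) *\<^sub>R (\<integral>y. Selberg_integrand n a b \<gamma> (?reflect y) \<partial>Rn n)"
    unfolding Selberg_def by (rule integral_PiM_affine[OF _ _ _ measurable_Selberg_integrand]) auto
  ultimately show ?thesis by (simp add: Selberg_def)
qed

lemma integral_exp_half_line:
  assumes c: "c > 0"
  shows "(\<integral>u. (if u > 0 then of_real (exp (- c * u)) else 0) \<partial>lborel) = (of_real (1 / c) :: complex)"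
proof -
  let ?f = "\<lambda>u :: real. if u \<in> {0..} then exp (- c * u) else 0"
  have "(?f has_integral exp (- c * 0) / c) UNIV"
    unfolding has_integral_restrict_UNIV using has_integral_exp_minus_to_infinity[OF c, of 0] by simp
  then have "(\<integral>\<^sup>+u. ennreal (?f u) \<partial>lborel) = ennreal (1 / c)"
    by (intro nn_integral_has_integral_lborel) auto
  then have "(\<integral>u. ?f u \<partial>lborel) = 1 / c" using c by (subst integral_eq_nn_integral) auto
  then have "(\<integral>u. (of_real (?f u) :: complex) \<partial>lborel) = of_real (1 / c)" by (simp only: integral_complex_of_real)
  moreover have "(\<integral>u. (if u > 0 then of_real (exp (- c * u)) else 0) \<partial>lborel)
      = (\<integral>u. (of_real (?f u) :: complex) \<partial>lborel)"
  proof (rule integral_cong_AE)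
    show "AE u in lborel. (if u > 0 then of_real (exp (- c * u)) else 0) = (of_real (?f u) :: complex)"
      using AE_lborel_singleton[of 0] by eventually_elim auto
  qed measurable
  ultimately show ?thesis by simp
qed

lemma Laguerre_weight_1: "y > 0 \<Longrightarrow> Laguerre_weight 1 y = of_real (exp (- y))"
  by (simp add: Laguerre_weight_def abs_pow_exponent_1)

lemma Laguerre_weight_1_add: "y \<ge> 0 \<Longrightarrow> Laguerre_weight (1 + a) y = abs_pow y a * of_real (exp (- y))"
  using abs_pow_add_of_nat[of y a 1] by (cases "y = 0") (simp_all add: Laguerre_weight_def add.commute)

context
  fixes k :: nat and t w :: "nat \<Rightarrow> real" and u :: real
  assumes first: "t 1 = u" and rest: "\<And>j. j \<in> {1..k} \<Longrightarrow> t (1 + j) = u + w j"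
begin

lemma nonneg_chamber_shift:
  assumes u: "u > 0"
  shows "(\<forall>i\<in>{1..1+k}. 0 \<le> t i) \<and> mono_on {1..1+k} t \<longleftrightarrow> (\<forall>i\<in>{1..k}. 0 \<le> w i) \<and> mono_on {1..k} w"
proof (intro iffI conjI ballI mono_onI)
  assume t: "(\<forall>i\<in>{1..1+k}. 0 \<le> t i) \<and> mono_on {1..1+k} t"
  show "0 \<le> w j" if "j \<in> {1..k}" for j
  proof -
    have "t 1 \<le> t (1 + j)" using t that by (intro mono_onD[of "{1..1+k}" t]) auto
    then show ?thesis using first rest[OF that] by simp
  qed
  show "w i \<le> w j" if "i \<in> {1..k}" "j \<in> {1..k}" "i \<le> j" for i j
  proof -
    have "t (1 + i) \<le> t (1 + j)" using t that by (intro mono_onD[of "{1..1+k}" t]) auto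
    then show ?thesis using rest[OF that(1)] rest[OF that(2)] by simp
  qed
next
  assume w: "(\<forall>i\<in>{1..k}. 0 \<le> w i) \<and> mono_on {1..k} w"
  have cases: "i = 1 \<or> (\<exists>j\<in>{1..k}. i = 1 + j)" if "i \<in> {1..1+k}" for i
    using that by (cases "i = 1") (auto intro!: bexI[of _ "i - 1"])
  show "0 \<le> t i" if "i \<in> {1..1+k}" for i
    using cases[OF that] w u first rest by (auto simp del: One_nat_def intro: add_nonneg_nonneg)
  show "t i \<le> t j" if "i \<in> {1..1+k}" "j \<in> {1..1+k}" "i \<le> j" for i j
    using cases[OF that(1)] cases[OF that(2)] that(3) w first rest
    by (auto simp del: One_nat_def dest: mono_onD)
qed

lemma vandermonde_shift:
  "vandermonde (1 + k) \<gamma> t = (\<Prod>j=1..k. abs_pow (w j) (2 * \<gamma>)) * vandermonde k \<gamma> w"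
proof -
  have shift: "(\<Prod>j\<in>{1 + i<..1 + k}. f j) = (\<Prod>j\<in>{i<..k}. f (1 + j))" for i and f :: "nat \<Rightarrow> complex"
    unfolding image_add_greaterThanAtMost[symmetric] by (subst prod.reindex) auto
  have "(\<Prod>j\<in>{1<..1+k}. abs_pow (t j - t 1) (2 * \<gamma>)) = (\<Prod>j\<in>{0<..k}. abs_pow (t (1 + j) - t 1) (2 * \<gamma>))"
    using shift[where i=0] by simp
  also have "\<dots> = (\<Prod>j=1..k. abs_pow (w j) (2 * \<gamma>))"
    by (rule prod.cong) (auto simp only: first rest add_diff_cancel_left' atLeastAtMost_iff greaterThanAtMost_iff)
  finally have "(\<Prod>j\<in>{1<..1+k}. abs_pow (t j - t 1) (2 * \<gamma>)) = (\<Prod>j=1..k. abs_pow (w j) (2 * \<gamma>))" .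
  moreover have "(\<Prod>i=1..k. \<Prod>j\<in>{i<..k}. abs_pow (t (1 + j) - t (1 + i)) (2 * \<gamma>)) = vandermonde k \<gamma> w"
    unfolding vandermonde_def
  proof (intro prod.cong refl)
    fix i j assume "i \<in> {1..k}" "j \<in> {i<..k}"
    then have i: "i \<in> {1..k}" and j: "j \<in> {1..k}" by auto
    show "abs_pow (t (1 + j) - t (1 + i)) (2 * \<gamma>) = abs_pow (w j - w i) (2 * \<gamma>)"
      unfolding rest[OF i] rest[OF j] by simp
  qed
  ultimately show ?thesis unfolding vandermonde_def prod_atLeastAtMost_add shift by simp
qed

lemma Laguerre_integrand_shift:
  "Laguerre_integrand (1 + k) 1 \<gamma> t
    = (if u > 0 then of_real (exp (- real (1 + k) * u)) else 0) * Laguerre_integrand k (1 + 2 * \<gamma>) \<gamma> w"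
proof (cases "u > 0")
  case False
  then have "\<not> 0 \<le> t 1 \<or> Laguerre_weight 1 (t 1) = 0" unfolding first by (auto simp: Laguerre_weight_def)
  moreover have "1 \<in> {1..1 + k}" by simp
  ultimately have "\<not> (\<forall>i\<in>{1..1+k}. 0 \<le> t i) \<or> (\<Prod>i=1..1+k. Laguerre_weight 1 (t i)) = 0"
    by (metis finite_atLeastAtMost prod_zero)
  then show ?thesis using False unfolding Laguerre_integrand_def by auto
next
  case u: True
  show ?thesis
  proof (cases "(\<forall>i\<in>{1..k}. 0 \<le> w i) \<and> mono_on {1..k} w")
    case chamber: False
    show ?thesis unfolding Laguerre_integrand_def nonneg_chamber_shift[OF u] if_not_P[OF chamber] by simp
  next
    case chamber: True
    then have w: "w j \<ge> 0" if "j \<in> {1..k}" for j using that by simp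
    have "Laguerre_weight 1 (t (1 + j)) = of_real (exp (- u)) * of_real (exp (- w j))" if "j \<in> {1..k}" for j
      using u w[OF that] unfolding rest[OF that]
      by (subst Laguerre_weight_1) (auto simp: exp_diff exp_minus field_simps)
    then have "(\<Prod>i=1..1+k. Laguerre_weight 1 (t i))
        = of_real (exp (- u)) * (\<Prod>j=1..k. of_real (exp (- u)) * of_real (exp (- w j)))"
      unfolding prod_atLeastAtMost_add using first Laguerre_weight_1[OF u] by simp
    also have "\<dots> = of_real (exp (- u) ^ (1 + k)) * (\<Prod>j=1..k. of_real (exp (- w j)))"
      by (simp add: prod.distrib)
    also have "exp (- u) ^ (1 + k) = exp (- real (1 + k) * u)" using exp_of_nat_mult[of "1 + k" "- u"]
      by (simp only: mult_minus_right mult_minus_left)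
    finally have weights: "(\<Prod>i=1..1+k. Laguerre_weight 1 (t i))
        = of_real (exp (- real (1 + k) * u)) * (\<Prod>j=1..k. of_real (exp (- w j)))" .
    have "(\<Prod>j=1..k. Laguerre_weight (1 + 2 * \<gamma>) (w j))
        = (\<Prod>j=1..k. abs_pow (w j) (2 * \<gamma>)) * (\<Prod>j=1..k. of_real (exp (- w j)))"
      unfolding prod.distrib[symmetric] by (intro prod.cong refl Laguerre_weight_1_add w)
    then show ?thesis
      unfolding Laguerre_integrand_def nonneg_chamber_shift[OF u] if_P[OF chamber] if_P[OF u] weights
        vandermonde_shift
      by (simp only: mult_ac)
  qed
qed

end

lemma Laguerre_Suc_1:
  assumes \<gamma>: "Re \<gamma> > 0"
  shows "Laguerre (1 + k) 1 \<gamma> = Laguerre k (1 + 2 * \<gamma>) \<gamma> / of_nat (1 + k)"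
proof -
  let ?E = "\<lambda>u :: real. if u > 0 then of_real (exp (- real (1 + k) * u)) else 0 :: complex"
  let ?f = "Laguerre_integrand (1 + k) 1 \<gamma>"
  have "Laguerre (1 + k) 1 \<gamma> = (\<integral>x. (\<integral>y. ?f (concat_vec 1 k x y) \<partial>Rn k) \<partial>Rn 1)"
    unfolding Laguerre_def by (rule integral_Rn_add) (rule integrable_Laguerre_integrand, simp_all add: \<gamma>)
  also have "\<dots> = (\<integral>x. ?E (x 1) * Laguerre k (1 + 2 * \<gamma>) \<gamma> \<partial>Rn 1)"
  proof (rule Bochner_Integration.integral_cong[OF refl])
    fix x :: "nat \<Rightarrow> real" assume x: "x \<in> space (Rn 1)"
    let ?shift = "affine_reindex {1..k} (\<lambda>j. j) (\<lambda>_. 1) (\<lambda>_. x 1)"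
    have "(\<integral>y. ?f (concat_vec 1 k x y) \<partial>Rn k) = (\<Prod>j\<in>{1..k}. \<bar>1\<bar>) *\<^sub>R (\<integral>w. ?f (concat_vec 1 k x (?shift w)) \<partial>Rn k)"
      using measurable_compose[OF measurable_concat_vec[OF x] measurable_Laguerre_integrand]
      by (intro integral_PiM_affine) (auto simp: bij_betw_def)
    also have "\<dots> = (\<integral>w. ?E (x 1) * Laguerre_integrand k (1 + 2 * \<gamma>) \<gamma> w \<partial>Rn k)"
    proof -
      have "?f (concat_vec 1 k x (?shift w)) = ?E (x 1) * Laguerre_integrand k (1 + 2 * \<gamma>) \<gamma> w" for w
      proof (rule Laguerre_integrand_shift)
        show "concat_vec 1 k x (?shift w) 1 = x 1" by (rule concat_vec_left) simp
        show "concat_vec 1 k x (?shift w) (1 + j) = x 1 + w j" if "j \<in> {1..k}" for j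
          unfolding concat_vec_right[OF that] affine_reindex_apply[OF that] by simp
      qed
      then show ?thesis by simp
    qed
    finally show "(\<integral>y. ?f (concat_vec 1 k x y) \<partial>Rn k) = ?E (x 1) * Laguerre k (1 + 2 * \<gamma>) \<gamma>"
      by (simp only: integral_mult_right_zero Laguerre_def)
  qed
  also have "\<dots> = (\<integral>x. ?E (x 1) \<partial>Rn 1) * Laguerre k (1 + 2 * \<gamma>) \<gamma>" by (rule integral_mult_left_zero)
  also have "(\<integral>x. ?E (x 1) \<partial>Rn 1) = (\<integral>u. ?E u \<partial>lborel)"
  proof -
    have singleton: "{1..1} = {1 :: nat}" by simp
    show ?thesis unfolding singleton by (rule lborel_product.product_integral_singleton) measurable
  qed
  also have "\<dots> = of_real (1 / real (1 + k))" by (rule integral_exp_half_line) simp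
  finally show ?thesis by simp
qed

lemma Laguerre_0: "Laguerre 0 a \<gamma> = 1"
  unfolding Laguerre_def Laguerre_integrand_eq_block_integrand[where \<alpha>="\<lambda>_. a" and s=0]
  by (rule integral_block_integrand_0)

lemma Re_add_of_nat_mult_pos: "Re a > 0 \<Longrightarrow> Re \<gamma> > 0 \<Longrightarrow> Re (a + of_nat s * \<gamma>) > 0"
  by (simp add: add_pos_nonneg)

lemma Laguerre_Gamma_symmetry:
  assumes a: "Re a > 0" and \<gamma>: "Re \<gamma> > 0"
  shows "Laguerre n a \<gamma> * (\<Prod>s<n. Gamma (1 + of_nat s * \<gamma>)) = Laguerre n 1 \<gamma> * (\<Prod>s<n. Gamma (a + of_nat s * \<gamma>))"
proof -
  let ?D = "\<Prod>i<n. Gamma (a + 1 + (2 * of_nat n - 2 - of_nat i) * \<gamma>)"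
  interpret a_1: unit_configuration n a 1 \<gamma> by standard (use a \<gamma> in auto)
  interpret one_a: unit_configuration n 1 a \<gamma> by standard (use a \<gamma> in auto)
  have "Gamma (a + 1 + (2 * of_nat n - 2 - of_nat i) * \<gamma>) \<noteq> 0" if "i < n" for i
  proof -
    have "2 * of_nat n - 2 - of_nat i = (of_nat (2 * n - 2 - i) :: complex)" using that by (simp add: of_nat_diff)
    then show ?thesis using Gamma_neq_0[OF Re_add_of_nat_mult_pos[of "a + 1" \<gamma> "2 * n - 2 - i"]] a \<gamma> by simp
  qed
  then have "?D \<noteq> 0" by simp
  moreover have "Laguerre n a \<gamma> * ((\<Prod>s<n. Gamma (1 + of_nat s * \<gamma>)) / ?D)
      = Laguerre n 1 \<gamma> * ((\<Prod>s<n. Gamma (a + of_nat s * \<gamma>)) / ?D)"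
  proof -
    have "Laguerre n a \<gamma> * ((\<Prod>s<n. Gamma (1 + of_nat s * \<gamma>)) / ?D) = Selberg n a 1 \<gamma>"
      unfolding a_1.Selberg_eq_Laguerre prod_dividef ..
    also have "\<dots> = Selberg n 1 a \<gamma>" by (rule Selberg_commute)
    also have "\<dots> = Laguerre n 1 \<gamma> * ((\<Prod>s<n. Gamma (a + of_nat s * \<gamma>)) / ?D)"
      unfolding one_a.Selberg_eq_Laguerre prod_dividef add.commute[of 1 a] ..
    finally show ?thesis .
  qed
  ultimately show ?thesis by simp
qed

lemma prod_Gamma_shift_2:
  assumes \<gamma>: "Re \<gamma> > 0"
  shows "(\<Prod>s<n. Gamma (1 + 2 * \<gamma> + of_nat s * \<gamma>))
    = (\<Prod>s<Suc n. Gamma (1 + of_nat s * \<gamma>)) * (of_nat (Suc n) * Gamma (of_nat (Suc n) * \<gamma>) / Gamma \<gamma>)"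
proof -
  have Gamma_plus_1: "Gamma (1 + x) = x * Gamma x" if "Re x > 0" for x :: complex
  proof -
    have "x \<notin> \<int>\<^sub>\<le>\<^sub>0" using that by (auto elim!: nonpos_Ints_cases)
    from Gamma_plus1[OF this] show ?thesis by (simp add: add.commute)
  qed
  let ?P = "\<Prod>s<Suc n. Gamma (1 + of_nat s * \<gamma>)"
  have "?P * Gamma (1 + of_nat (Suc n) * \<gamma>) = (\<Prod>s<Suc (Suc n). Gamma (1 + of_nat s * \<gamma>))" by simp
  also have "\<dots> = Gamma (1 + \<gamma>) * (\<Prod>s<n. Gamma (1 + of_nat (Suc (Suc s)) * \<gamma>))"
    by (simp only: prod.lessThan_Suc_shift) simp
  also have "(\<Prod>s<n. Gamma (1 + of_nat (Suc (Suc s)) * \<gamma>)) = (\<Prod>s<n. Gamma (1 + 2 * \<gamma> + of_nat s * \<gamma>))"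
    by (intro prod.cong refl arg_cong[of _ _ Gamma]) (simp add: algebra_simps)
  finally have shift: "?P * Gamma (1 + of_nat (Suc n) * \<gamma>)
      = Gamma (1 + \<gamma>) * (\<Prod>s<n. Gamma (1 + 2 * \<gamma> + of_nat s * \<gamma>))" .
  have "Re (of_nat (Suc n) * \<gamma>) > 0" using \<gamma> by (simp del: of_nat_Suc)
  from shift have "\<gamma> * (Gamma \<gamma> * (\<Prod>s<n. Gamma (1 + 2 * \<gamma> + of_nat s * \<gamma>)))
      = \<gamma> * (?P * (of_nat (Suc n) * Gamma (of_nat (Suc n) * \<gamma>)))"
    unfolding Gamma_plus_1[OF \<gamma>] Gamma_plus_1[OF \<open>Re (of_nat (Suc n) * \<gamma>) > 0\<close>] by (simp only: mult_ac)
  moreover have "\<gamma> \<noteq> 0" using \<gamma> by auto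
  ultimately have "Gamma \<gamma> * (\<Prod>s<n. Gamma (1 + 2 * \<gamma> + of_nat s * \<gamma>))
      = ?P * (of_nat (Suc n) * Gamma (of_nat (Suc n) * \<gamma>))"
    using mult_left_cancel by blast
  then show ?thesis unfolding times_divide_eq_right using Gamma_neq_0[OF \<gamma>]
    by (simp only: eq_divide_eq mult.commute) simp
qed

theorem Laguerre_eq:
  assumes "Re a > 0" and \<gamma>: "Re \<gamma> > 0"
  shows "Laguerre n a \<gamma> = (\<Prod>s<n. Gamma (a + of_nat s * \<gamma>) * (Gamma (of_nat (s + 1) * \<gamma>) / Gamma \<gamma>))"
  using assms(1)
proof (induction n arbitrary: a)
  case 0
  show ?case by (simp add: Laguerre_0)
next
  case (Suc n)
  let ?P = "\<lambda>x. \<Prod>s<Suc n. Gamma (x + of_nat s * \<gamma>)" and ?R = "\<lambda>n. \<Prod>s<n. Gamma (of_nat (s + 1) * \<gamma>) / Gamma \<gamma>"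
  have "Re (1 + 2 * \<gamma>) > 0" using \<gamma> by simp
  from Suc.IH[OF this] have "Laguerre (Suc n) 1 \<gamma>
      = (\<Prod>s<n. Gamma (1 + 2 * \<gamma> + of_nat s * \<gamma>)) * ?R n / of_nat (Suc n)"
    using Laguerre_Suc_1[OF \<gamma>, of n] unfolding prod.distrib by simp
  also have "\<dots> = ?P 1 * ?R (Suc n)"
    unfolding prod_Gamma_shift_2[OF \<gamma>]
    by (simp del: of_nat_Suc add: prod.lessThan_Suc[of "\<lambda>s. Gamma (of_nat (s + 1) * \<gamma>) / Gamma \<gamma>"])
  finally have "Laguerre (Suc n) a \<gamma> * ?P 1 = ?P a * ?R (Suc n) * ?P 1"
    using Laguerre_Gamma_symmetry[OF Suc.prems \<gamma>, of "Suc n"] by (simp only: mult_ac)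
  moreover have "?P 1 \<noteq> 0" using Gamma_neq_0[OF Re_add_of_nat_mult_pos[of 1 \<gamma>]] \<gamma> by simp
  ultimately show ?case unfolding prod.distrib by (simp only: mult_cancel_right) simp
qed

section \<open>Phases and evaluation of the determinant\<close>

lemma br_log_of_real: "x \<noteq> 0 \<Longrightarrow> br_log (of_real x) = of_real (ln \<bar>x\<bar>) + (if x < 0 then \<i> * pi else 0)"
proof -
  have "- (pi / 2) < pi" using pi_gt_zero by linarith
  moreover assume "x \<noteq> 0"
  ultimately show ?thesis by (simp add: br_log_def Ln_of_real' mult.commute not_le)
qed

lemma br_pow_of_real: "br_pow (of_real x) a = abs_pow x a * (if x < 0 then exp (\<i> * pi * a) else 1)"
  by (cases "x = 0") (simp_all add: br_pow_def br_log_of_real abs_pow_def distrib_left exp_add mult_ac)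

lemma prod_off_diagonal:
  fixes F :: "nat \<Rightarrow> nat \<Rightarrow> 'a :: comm_monoid_mult"
  shows "(\<Prod>s=1..p. \<Prod>r\<in>{1..p}-{s}. F s r) = (\<Prod>b=1..p. \<Prod>a=1..<b. F b a * F a b)"
proof (induction p)
  case (Suc p)
  have last: "(\<Prod>s=1..Suc p. f s) = (\<Prod>s=1..p. f s) * f (Suc p)" for f :: "nat \<Rightarrow> 'a" by simp
  have "(\<Prod>s=1..p. \<Prod>r\<in>{1..Suc p}-{s}. F s r) = (\<Prod>s=1..p. F s (Suc p) * (\<Prod>r\<in>{1..p}-{s}. F s r))"
  proof (rule prod.cong[OF refl])
    fix s assume "s \<in> {1..p}"
    then have "{1..Suc p} - {s} = insert (Suc p) ({1..p} - {s})" by auto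
    then show "(\<Prod>r\<in>{1..Suc p}-{s}. F s r) = F s (Suc p) * (\<Prod>r\<in>{1..p}-{s}. F s r)" by simp
  qed
  moreover have "{1..Suc p} - {Suc p} = {1..p}" "{1..<Suc p} = {1..p}" by auto
  ultimately show ?case unfolding last prod.distrib by (simp only: Suc.IH prod.distrib mult_ac)
qed simp

context configuration
begin

definition phase :: "nat \<Rightarrow> complex" where
  "phase r = (\<Prod>s=1..p. if r < s then exp (\<i> * pi * \<alpha> s) else 1)"

lemma br_pow_in_cell:
  assumes l: "l \<in> Zset n (p - 1)" and t: "in_cell l t" and i: "i \<in> {1..n}" and s: "s \<in> {1..p}"
  shows "br_pow (of_real (t i - z s)) (\<alpha> s)
    = (if site l i < s then exp (\<i> * pi * \<alpha> s) else 1) * abs_pow (t i - z s) (\<alpha> s)"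
proof (cases "t i = z s")
  case False
  have "t i - z s < 0 \<longleftrightarrow> site l i < s"
  proof (cases "site l i < s")
    case True
    then have "z (site l i + 1) \<le> z s" using s by (intro z_le) auto
    then show ?thesis using True False in_cell_bounds[OF t i] by auto
  next
    case not_less: False
    then have "z s \<le> z (site l i)" using s site_range[OF l i] by (intro z_le) auto
    then show ?thesis using not_less in_cell_bounds[OF t i] by auto
  qed
  then show ?thesis unfolding br_pow_of_real by (simp only: mult.commute)
qed (simp add: br_pow_def)

lemma Phi_in_cell:
  assumes l: "l \<in> Zset n (p - 1)" and t: "in_cell l t"
  shows "Phi n p z \<alpha> \<gamma> t = (\<Prod>i=1..n. phase (site l i)) * Psi n p z \<alpha> \<gamma> t"
proof -
  have "(\<Prod>s=1..p. \<Prod>i=1..n. br_pow (of_real (t i - z s)) (\<alpha> s))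
      = (\<Prod>i=1..n. \<Prod>s=1..p. br_pow (of_real (t i - z s)) (\<alpha> s))"
    by (rule prod.swap)
  also have "\<dots> = (\<Prod>i=1..n. \<Prod>s=1..p. (if site l i < s then exp (\<i> * pi * \<alpha> s) else 1) * abs_pow (t i - z s) (\<alpha> s))"
    by (intro prod.cong refl br_pow_in_cell[OF l t])
  finally have points: "(\<Prod>s=1..p. \<Prod>i=1..n. br_pow (of_real (t i - z s)) (\<alpha> s))
      = (\<Prod>i=1..n. phase (site l i)) * (\<Prod>i=1..n. \<Prod>s=1..p. abs_pow (t i - z s) (\<alpha> s))"
    unfolding phase_def prod.distrib .
  have pairs: "(\<Prod>i=1..n. \<Prod>j\<in>{i<..n}. br_pow (of_real (t j - t i)) (2 * \<gamma>)) = vandermonde n \<gamma> t"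
    unfolding vandermonde_def
  proof (intro prod.cong refl)
    fix i j assume "i \<in> {1..n}" "j \<in> {i<..n}"
    then have "t i \<le> t j" by (intro in_cell_mono[OF t]) auto
    then show "br_pow (of_real (t j - t i)) (2 * \<gamma>) = abs_pow (t j - t i) (2 * \<gamma>)"
      unfolding br_pow_of_real by simp
  qed
  show ?thesis unfolding Phi_def Psi_def points pairs by (simp only: mult.assoc)
qed

lemma integral_Phi_omega:
  assumes l: "l \<in> Zset n (p - 1)"
  shows "set_lebesgue_integral (Rn n) (Uset n p z l) (\<lambda>t. Phi n p z \<alpha> \<gamma> t * omega n p z m t)
    = (\<Prod>i=1..n. phase (site l i)) * reduced_entry l m"
proof -
  have "indicator (Uset n p z l) t *\<^sub>R (Phi n p z \<alpha> \<gamma> t * omega n p z m t)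
      = (\<Prod>i=1..n. phase (site l i)) * (cell_weight l t * omega n p z m t)" for t
    by (cases "in_cell l t") (simp_all add: Uset_iff_in_cell[OF l] Phi_in_cell[OF l] cell_weight_def
      indicator_def mult_ac)
  then show ?thesis unfolding set_lebesgue_integral_def reduced_entry_def by (simp only: integral_mult_right_zero)
qed

lemma prod_phase: "(\<Prod>r=1..p-1. phase r) = exp (\<i> * pi * (\<Sum>s=1..p. of_nat (s - 1) * \<alpha> s))"
proof -
  have "(\<Prod>r=1..p-1. phase r) = (\<Prod>s=1..p. \<Prod>r=1..p-1. if r < s then exp (\<i> * pi * \<alpha> s) else 1)"
    unfolding phase_def by (rule prod.swap)
  also have "\<dots> = (\<Prod>s=1..p. exp (\<i> * pi * (of_nat (s - 1) * \<alpha> s)))"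
  proof (rule prod.cong[OF refl])
    fix s assume "s \<in> {1..p}"
    then have less: "{r \<in> {1..p-1}. r < s} = {1..<s}" by auto
    have "(\<Prod>r=1..p-1. if r < s then exp (\<i> * pi * \<alpha> s) else 1) = exp (\<i> * pi * \<alpha> s) ^ (s - 1)"
      unfolding prod.inter_filter[OF finite_atLeastAtMost, symmetric] less by simp
    also have "\<dots> = exp (of_nat (s - 1) * (\<i> * pi * \<alpha> s))" by (rule exp_of_nat_mult[symmetric])
    finally show "(\<Prod>r=1..p-1. if r < s then exp (\<i> * pi * \<alpha> s) else 1) = exp (\<i> * pi * (of_nat (s - 1) * \<alpha> s))"
      by (simp only: mult_ac)
  qed
  also have "\<dots> = exp (\<i> * pi * (\<Sum>s=1..p. of_nat (s - 1) * \<alpha> s))"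
    by (simp only: exp_sum[OF finite_atLeastAtMost] sum_distrib_left)
  finally show ?thesis .
qed

lemma det_integral_Phi_omega:
  "det_on (Zset n (p - 1))
      (\<lambda>l m. set_lebesgue_integral (Rn n) (Uset n p z l) (\<lambda>t. Phi n p z \<alpha> \<gamma> t * omega n p z m t))
    = exp (\<i> * pi * of_nat site_total * (\<Sum>s=1..p. of_nat (s - 1) * \<alpha> s)) * det_on (Zset n (p - 1)) reduced_entry"
    (is "?lhs = _")
proof -
  have "?lhs = det_on (Zset n (p - 1)) (\<lambda>l m. (\<Prod>i=1..n. phase (site l i)) * reduced_entry l m * 1)"
    by (rule det_on_cong) (simp only: integral_Phi_omega mult_1_right)
  also have "\<dots> = (\<Prod>r=1..p-1. phase r) ^ site_total * det_on (Zset n (p - 1)) reduced_entry"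
    unfolding det_on_scale prod_Zset_site by simp
  also have "(\<Prod>r=1..p-1. phase r) ^ site_total
      = exp (\<i> * pi * of_nat site_total * (\<Sum>s=1..p. of_nat (s - 1) * \<alpha> s))"
    unfolding prod_phase exp_of_nat_mult[symmetric] by (simp only: mult_ac)
  finally show ?thesis .
qed

lemma prod_site_constant:
  "(\<Prod>s=1..p-1. site_constant s) = (\<Prod>b=1..p. \<Prod>a=1..<b. abs_pow (z b - z a) (\<alpha> a + \<alpha> b))"
proof -
  have "{1..p} - {p} = {1..p-1}" by auto
  then have "(\<Prod>s=1..p-1. site_constant s) = (\<Prod>s=1..p. \<Prod>r\<in>{1..p}-{s}. abs_pow (z s - z r) (\<alpha> r))"
    unfolding prod_last[of "\<lambda>s. \<Prod>r\<in>{1..p}-{s}. abs_pow (z s - z r) (\<alpha> r)"]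
    by (simp add: site_constant_def dist_last_def prod.distrib)
  also have "\<dots> = (\<Prod>b=1..p. \<Prod>a=1..<b. abs_pow (z b - z a) (\<alpha> a) * abs_pow (z a - z b) (\<alpha> b))"
    by (rule prod_off_diagonal)
  also have "\<dots> = (\<Prod>b=1..p. \<Prod>a=1..<b. abs_pow (z b - z a) (\<alpha> a + \<alpha> b))"
    by (intro prod.cong refl) (simp only: abs_pow_add abs_pow_diff_commute[of "z _" "z _" "\<alpha> _"])
  finally show ?thesis .
qed

lemma prod_pair_constant:
  "(\<Prod>s=1..p-1. pair_constant s s) * (\<Prod>s=1..p-1. \<Prod>r=1..<s. pair_constant r s)
    = (\<Prod>b=1..p. \<Prod>a=1..<b. abs_pow (z b - z a) (2 * \<gamma>))"
proof -
  have "{1..<p} = {1..p-1}" by auto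
  moreover have "(\<Prod>s=1..p-1. \<Prod>r=1..<s. pair_constant r s) = (\<Prod>s=1..p-1. \<Prod>r=1..<s. abs_pow (z s - z r) (2 * \<gamma>))"
    by (intro prod.cong refl) (simp add: pair_constant_def)
  ultimately show ?thesis unfolding prod_last by (simp add: pair_constant_def dist_last_def)
qed

lemma prod_cell_constant:
  "(\<Prod>l\<in>Zset n (p - 1). cell_constant l) = (\<Prod>b=1..p. \<Prod>a=1..<b.
    br_pow (of_real (z b - z a)) ((\<alpha> a + \<alpha> b) * of_nat site_total + 2 * \<gamma> * of_nat pair_total))"
proof -
  have "(\<Prod>l\<in>Zset n (p - 1). cell_constant l) = (\<Prod>b=1..p. \<Prod>a=1..<b.
      abs_pow (z b - z a) (\<alpha> a + \<alpha> b) ^ site_total * abs_pow (z b - z a) (2 * \<gamma>) ^ pair_total)"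
    unfolding cell_constant_def prod.distrib prod_Zset_site prod_Zset_site_pairs prod_site_constant
      prod_pair_constant
    by (simp only: prod_power_distrib)
  also have "\<dots> = (\<Prod>b=1..p. \<Prod>a=1..<b.
      br_pow (of_real (z b - z a)) ((\<alpha> a + \<alpha> b) * of_nat site_total + 2 * \<gamma> * of_nat pair_total))"
  proof (intro prod.cong refl)
    fix b a assume "b \<in> {1..p}" "a \<in> {1..<b}"
    then have pos: "z b - z a > 0" using z_less[of a b] by simp
    then have "z b - z a \<noteq> 0" by simp
    with pos show "abs_pow (z b - z a) (\<alpha> a + \<alpha> b) ^ site_total * abs_pow (z b - z a) (2 * \<gamma>) ^ pair_total
        = br_pow (of_real (z b - z a)) ((\<alpha> a + \<alpha> b) * of_nat site_total + 2 * \<gamma> * of_nat pair_total)"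
      unfolding br_pow_of_real abs_pow_power[OF \<open>z b - z a \<noteq> 0\<close>] abs_pow_add[symmetric] by (simp add: mult.commute)
  qed
  finally show ?thesis .
qed

lemma prod_Laguerre:
  "(\<Prod>l\<in>Zset n (p - 1). \<Prod>s=1..p-1. Laguerre (l s) (\<alpha> s) \<gamma>)
    = (\<Prod>i<n. ((Gamma (of_nat (i + 1) * \<gamma>) ^ (p - 1) / Gamma \<gamma> ^ (p - 1)) * (\<Prod>j=1..p-1. Gamma (\<alpha> j + of_nat i * \<gamma>)))
        ^ card (Zset (n - 1 - i) (p - 1)))"
proof -
  define R where "R s i = Gamma (\<alpha> s + of_nat i * \<gamma>) * (Gamma (of_nat (i + 1) * \<gamma>) / Gamma \<gamma>)" for s i
  have "(\<Prod>l\<in>Zset n (p - 1). \<Prod>s=1..p-1. Laguerre (l s) (\<alpha> s) \<gamma>) = (\<Prod>l\<in>Zset n (p - 1). \<Prod>s=1..p-1. \<Prod>i<l s. R s i)"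
    unfolding R_def by (intro prod.cong refl Laguerre_eq Re_alpha_pos' Re_gamma_pos)
  also have "\<dots> = (\<Prod>s=1..p-1. \<Prod>l\<in>Zset n (p - 1). \<Prod>i<l s. R s i)" by (rule prod.swap)
  also have "\<dots> = (\<Prod>s=1..p-1. \<Prod>i<n. R s i ^ card (Zset (n - 1 - i) (p - 1)))"
    by (intro prod.cong refl prod_Zset_prod_lessThan)
  also have "\<dots> = (\<Prod>i<n. \<Prod>s=1..p-1. R s i ^ card (Zset (n - 1 - i) (p - 1)))" by (rule prod.swap)
  also have "\<dots> = (\<Prod>i<n. (\<Prod>s=1..p-1. R s i) ^ card (Zset (n - 1 - i) (p - 1)))" by (simp only: prod_power_distrib)
  finally show ?thesis unfolding R_def prod.distrib by (simp add: power_divide mult.commute)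
qed

lemma prod_Laguerre_mult_Gamma_ratio:
  "(\<Prod>l\<in>Zset n (p - 1). \<Prod>s=1..p-1. Laguerre (l s) (\<alpha> s) \<gamma>)
      * (\<Prod>i<n. (Gamma (Gamma_num i) / Gamma (Gamma_den i)) ^ card (Zset (n - 1 - i) (p - 1)))
    = (\<Prod>s=0..<n.
         ((Gamma (of_nat (s + 1) * \<gamma>) ^ (p - 1) / Gamma \<gamma> ^ (p - 1)) *
          (Gamma (1 + \<alpha> p + of_nat s * \<gamma>) * (\<Prod>j=1..p-1. Gamma (\<alpha> j + of_nat s * \<gamma>)) /
           Gamma (1 + (\<Sum>j=1..p. \<alpha> j) + (2 * of_nat n - 2 - of_nat s) * \<gamma>)))
         ^ ((p + n - s - 3) choose (p - 2)))"
  unfolding prod_Laguerre prod.distrib[symmetric] atLeast0LessThan power_mult_distrib[symmetric]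
proof (rule prod.cong[OF refl])
  fix i assume "i \<in> {..<n}"
  then have "p - 1 = Suc (p - 2)" "n - 1 - i + (p - 2) = p + n - i - 3" using p_ge_2 by auto
  then have card: "card (Zset (n - 1 - i) (p - 1)) = (p + n - i - 3) choose (p - 2)"
    using card_Zset[of "n - 1 - i" "p - 2"] by simp
  show "((Gamma (of_nat (i + 1) * \<gamma>) ^ (p - 1) / Gamma \<gamma> ^ (p - 1)) * (\<Prod>j=1..p-1. Gamma (\<alpha> j + of_nat i * \<gamma>))
        * (Gamma (Gamma_num i) / Gamma (Gamma_den i))) ^ card (Zset (n - 1 - i) (p - 1))
      = ((Gamma (of_nat (i + 1) * \<gamma>) ^ (p - 1) / Gamma \<gamma> ^ (p - 1)) *
          (Gamma (1 + \<alpha> p + of_nat i * \<gamma>) * (\<Prod>j=1..p-1. Gamma (\<alpha> j + of_nat i * \<gamma>)) /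
           Gamma (1 + (\<Sum>j=1..p. \<alpha> j) + (2 * of_nat n - 2 - of_nat i) * \<gamma>)))
         ^ ((p + n - i - 3) choose (p - 2))"
    unfolding card Gamma_num_def Gamma_den_def by (simp only: divide_inverse mult_ac)
qed

end

theorem theorem4:
  fixes n p :: nat and z :: "nat \<Rightarrow> real" and \<alpha> :: "nat \<Rightarrow> complex" and \<gamma> :: complex
  assumes "p \<ge> 2"
    and "\<And>s. s \<in> {1..<p} \<Longrightarrow> z s < z (s + 1)"
    and "\<And>s. s \<in> {1..p} \<Longrightarrow> Re (\<alpha> s) > 0"
    and "Re \<gamma> > 0"
  shows "det_on (Zset n (p - 1))
           (\<lambda>l m. set_lebesgue_integral (Rn n) (Uset n p z l)
                    (\<lambda>t. Phi n p z \<alpha> \<gamma> t * omega n p z m t))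
    = (\<Prod>s=0..<n.
         ((Gamma (of_nat (s + 1) * \<gamma>) ^ (p - 1) / Gamma \<gamma> ^ (p - 1)) *
          (Gamma (1 + \<alpha> p + of_nat s * \<gamma>) * (\<Prod>j=1..p-1. Gamma (\<alpha> j + of_nat s * \<gamma>)) /
           Gamma (1 + (\<Sum>j=1..p. \<alpha> j) + (2 * of_nat n - 2 - of_nat s) * \<gamma>)))
         ^ ((p + n - s - 3) choose (p - 2)))
      * exp (\<i> * pi * of_nat ((p + n - 2) choose (p - 1)) * (\<Sum>s=1..p. of_nat (s - 1) * \<alpha> s))
      * (\<Prod>b=1..p. \<Prod>a=1..<b.
           br_pow (complex_of_real (z b - z a))
             ((\<alpha> a + \<alpha> b) * of_nat ((p + n - 2) choose (p - 1))
              + 2 * \<gamma> * of_nat ((p + n - 2) choose p)))"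
proof -
  have "Re (\<alpha> p) > 0" using assms(1) by (intro assms(3)) simp
  then interpret configuration n p z \<alpha> \<gamma>
    by unfold_locales (use assms in \<open>auto intro: less_trans[of "- 1" 0]\<close>)
  have "det_on (Zset n (p - 1)) reduced_entry = (\<Prod>l\<in>Zset n (p - 1). cell_constant l)
      * ((\<Prod>l\<in>Zset n (p - 1). \<Prod>s=1..p-1. Laguerre (l s) (\<alpha> s) \<gamma>)
        * (\<Prod>i<n. (Gamma (Gamma_num i) / Gamma (Gamma_den i)) ^ card (Zset (n - 1 - i) (p - 1))))"
    unfolding det_reduced_entry limit_entry_def prod.distrib by (simp only: mult.assoc)
  then show ?thesis
    unfolding det_integral_Phi_omega prod_cell_constant prod_Laguerre_mult_Gamma_ratio by (simp only: mult_ac)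
qed

end
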